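(* Let $f\in\mathcal{P}_n$ and $p\ge 0$. If $C$ is an origin-symmetric convex body in $\mathbb{R}^m$, $m\ge1$, then $$|Z^\diamondsuit_{p,C}(f)|\le |Z^\diamondsuit_{p,C}(f^* )|.$$ Moreover, let $N>n$, let $\mathcal{C}=(C_1,\dots,C_N)$ where each $C_i$ is an origin-symmetric convex body in $\mathbb{R}^{m_i}$, $m_i\ge1$, and let $\mathcal{F}=(f_{ij})_{i\in[N],j\in[m_i]}\subseteq\mathcal{P}_n$. Then $$\mathbb{E}\,|\mathcal{Z}^\diamondsuit_{p,\mathcal{C}}(\mathcal{F})|\le \mathbb{E}\,|\mathcal{Z}^\diamondsuit_{p,\mathcal{C}}(\mathcal{F}^{\#})|.$$
   Context: $\mathcal{P}_n$ is the set of measurable $f:\mathbb{R}^n\to[0,\infty)$ with $\int f=1$ and $\|f\|_\infty<\infty$. For measurable $A\subseteq\mathbb{R}^n$ of finite volume, $A^*$ is the open centered Euclidean ball with $|A^*|=|A|$; $f^*(x)=\int_0^\infty\chi_{\{f>t\}^*}(x)\,dt$ is the symmetric decreasing rearrangement. Star-shaped sets ($0\in K$, $\lambda K\subseteq K$ for $\lambda\in[0,1]$) are given by radial functions $\rho(K,u)=\sup\{\lambda\ge0:\lambda u\in K\}\in[0,\infty]$ on $S^{n-1}$, with volume $|K|=\omega_n\int_{S^{n-1}}\rho(K,u)^n\,d\sigma(u)\in[0,\infty]$ ($\sigma$ normalized surface measure, $\omega_n=|B_2^n|$). $h(C,y)=\sup_{c\in C}\langle c,y\rangle$ is the support function. Conventions: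 $0^{q}=+\infty$ for $q<0$. For $f\in\mathcal{P}_n$, an origin-symmetric convex body $C\subseteq\mathbb{R}^m$, and $\overline{x}=(x_1,\dots,x_m)\in(\mathbb{R}^n)^m$, write $h(C,(\langle x_i,u\rangle)_{i=1}^m)$ for the support function of $C$ at the vector $(\langle x_1,u\rangle,\dots,\langle x_m,u\rangle)\in\mathbb{R}^m$. For $p\ne0$, $Z^\diamondsuit_{p,C}(f)$ is the star-shaped set with $\rho^{-p}(Z^\diamondsuit_{p,C}(f),u)=\int_{(\mathbb{R}^n)^m}h^p(C,(\langle x_i,u\rangle)_{i=1}^m)\prod_{i=1}^mf(x_i)\,d\overline{x}$; for $p=0$, $\log\rho(Z^\diamondsuit_{0,C}(f),u)=-\int_{(\mathbb{R}^n)^m}\log h(C,(\langle x_i,u\rangle)_{i=1}^m)\prod_{i=1}^m f(x_i)\,d\overline{x}$. Empirical version: given $\mathcal{C}=(C_1,\dots,C_N)$ with $C_i$ an origin-symmetric convex body in $\mathbb{R}^{m_i}$ and $\mathcal{F}=(f_{ij})_{i\in[N],j\in[m_i]}\subseteq\mathcal{P}_n$, let $X_{ij}$ be independent random vectors in $\mathbb{R}^n$ with densities $f_{ij}$, ${\bf X}_i=[X_{i1}\cdots X_{im_i}]$ and ${\bf X}_i^Tu=(\langle X_{ij},u\rangle)_{j=1}^{m_i}$. For $p\ne0$, $\mathcal{Z}^\diamondsuit_{p,\mathcal{C}}(\mathcal{F})$ is the random star-shaped set with $\rho^{-p}(\mathcal{Z}^\diamondsuit_{p,\mathcal{C}}(\mathcal{F}),u)=\frac1N\sum_{i=1}^Nh^p(C_i,{\bf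 X}_i^Tu)$; for $p=0$, $\rho^{-N}(\mathcal{Z}^\diamondsuit_{0,\mathcal{C}}(\mathcal{F}),u)=\prod_{i=1}^Nh(C_i,{\bf X}_i^Tu)$. $\mathcal{F}^\#=(f_{ij}^* )$. *)

theory Defs
  imports "HOL-Analysis.Analysis"
begin

definition Pn :: "('a::euclidean_space \<Rightarrow> real) \<Rightarrow> bool" where
  "Pn f \<longleftrightarrow> f \<in> borel_measurable lebesgue \<and> (\<forall>x. 0 \<le> f x)
     \<and> (\<integral>\<^sup>+ x. ennreal (f x) \<partial>lebesgue) = 1
     \<and> (\<exists>M. AE x in lebesgue. \<bar>f x\<bar> \<le> M)"

definition sym_set :: "'a::euclidean_space set \<Rightarrow> 'a set" where
  "sym_set A = ball 0 (THE r. 0 \<le> r \<and> emeasure lebesgue (ball (0::'a) r) = emeasure lebesgue A)"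

definition sym_rearr :: "('a::euclidean_space \<Rightarrow> real) \<Rightarrow> 'a \<Rightarrow> real" where
  "sym_rearr f x = enn2real (\<integral>\<^sup>+ t. indicator {0<..} t * indicator (sym_set {y. t < f y}) x \<partial>lborel)"

definition Rm :: "nat \<Rightarrow> (nat \<Rightarrow> real) set" where
  "Rm m = {x. \<forall>j\<ge>m. x j = 0}"

definition eucl_norm_m :: "nat \<Rightarrow> (nat \<Rightarrow> real) \<Rightarrow> real" where
  "eucl_norm_m m x = sqrt (\<Sum>j<m. (x j)\<^sup>2)"

text \<open>Origin-symmetric convex body in R^m: compact convex subset of R^m with nonempty interior
  (relative to R^m), symmetric under x \<mapsto> -x.  On R^m the product topology of nat => real
  coincides with the Euclidean topology, so compact is the usual notion.\<close>
definition os_convex_body :: "nat \<Rightarrow> (nat \<Rightarrow> real) set \<Rightarrow> bool" where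
  "os_convex_body m C \<longleftrightarrow>
     C \<subseteq> Rm m
   \<and> (\<forall>x\<in>C. \<forall>y\<in>C. \<forall>t::real. 0 \<le> t \<and> t \<le> 1 \<longrightarrow> (\<lambda>j. t * x j + (1 - t) * y j) \<in> C)
   \<and> compact C
   \<and> (\<exists>c\<in>C. \<exists>e>0. \<forall>y\<in>Rm m. eucl_norm_m m (\<lambda>j. y j - c j) < e \<longrightarrow> y \<in> C)
   \<and> (\<forall>x\<in>C. (\<lambda>j. - x j) \<in> C)"

definition supp_fun :: "nat \<Rightarrow> (nat \<Rightarrow> real) set \<Rightarrow> (nat \<Rightarrow> real) \<Rightarrow> real" where
  "supp_fun m C y = (SUP c\<in>C. \<Sum>j<m. c j * y j)"

definition epow :: "ennreal \<Rightarrow> real \<Rightarrow> ennreal" where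
  "epow x q = (if q = 0 then 1
     else if x = 0 then (if q < 0 then \<infinity> else 0)
     else if x = \<infinity> then (if q < 0 then 0 else \<infinity>)
     else ennreal (enn2real x powr q))"

definition star_set :: "('a::euclidean_space \<Rightarrow> ennreal) \<Rightarrow> 'a set" where
  "star_set \<rho> = {x. x = 0 \<or> ennreal (norm x) < \<rho> (sgn x)}"

definition star_vol :: "('a::euclidean_space \<Rightarrow> ennreal) \<Rightarrow> ennreal" where
  "star_vol \<rho> = emeasure lebesgue (star_set \<rho>)"

definition prod_integral ::
  "nat \<Rightarrow> ('a::euclidean_space \<Rightarrow> real) \<Rightarrow> ((nat \<Rightarrow> 'a) \<Rightarrow> ennreal) \<Rightarrow> ennreal" where
  "prod_integral m f g =
     (\<integral>\<^sup>+ x. g x * ennreal (\<Prod>i<m. f (x i)) \<partial>(PiM {..<m} (\<lambda>_. lebesgue)))"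

text \<open>Radial function of Z^diamond_{p,C}(f).  For p \<noteq> 0:
  rho^{-p}(u) = integral of h^p;  for p = 0: log rho(u) = - integral of log h
  (the latter integral taken as integral of log^+ minus integral of log^-, in extended reals).\<close>
definition Zrho :: "real \<Rightarrow> nat \<Rightarrow> (nat \<Rightarrow> real) set \<Rightarrow> ('a::euclidean_space \<Rightarrow> real) \<Rightarrow> 'a \<Rightarrow> ennreal" where
  "Zrho p m C f u =
    (if p \<noteq> 0 then
       epow (prod_integral m f (\<lambda>x. epow (ennreal (supp_fun m C (\<lambda>i. x i \<bullet> u))) p)) (- 1 / p)
     else
       (let Ipos = prod_integral m f (\<lambda>x. let h = supp_fun m C (\<lambda>i. x i \<bullet> u) in
                      if h = 0 then 0 else ennreal (max 0 (ln h)));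
            Ineg = prod_integral m f (\<lambda>x. let h = supp_fun m C (\<lambda>i. x i \<bullet> u) in
                      if h = 0 then \<infinity> else ennreal (max 0 (- ln h)));
            L = enn2ereal Ipos - enn2ereal Ineg
        in if L = \<infinity> then 0 else if L = - \<infinity> then \<infinity> else ennreal (exp (- real_of_ereal L))))"

definition Zvol :: "real \<Rightarrow> nat \<Rightarrow> (nat \<Rightarrow> real) set \<Rightarrow> ('a::euclidean_space \<Rightarrow> real) \<Rightarrow> ennreal" where
  "Zvol p m C f = star_vol (Zrho p m C f)"

definition ZNrho :: "real \<Rightarrow> nat \<Rightarrow> (nat \<Rightarrow> nat) \<Rightarrow> (nat \<Rightarrow> (nat \<Rightarrow> real) set)
    \<Rightarrow> (nat \<times> nat \<Rightarrow> 'a::euclidean_space) \<Rightarrow> 'a \<Rightarrow> ennreal" where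
  "ZNrho p N m C X u =
    (if p \<noteq> 0 then
       epow ((\<Sum>i<N. epow (ennreal (supp_fun (m i) (C i) (\<lambda>j. X (i, j) \<bullet> u))) p) / of_nat N) (- 1 / p)
     else
       epow (ennreal (\<Prod>i<N. supp_fun (m i) (C i) (\<lambda>j. X (i, j) \<bullet> u))) (- 1 / real N))"

text \<open>Expected volume: X_{ij} independent with densities f_{ij}.\<close>
definition EZNvol :: "real \<Rightarrow> nat \<Rightarrow> (nat \<Rightarrow> nat) \<Rightarrow> (nat \<Rightarrow> (nat \<Rightarrow> real) set)
    \<Rightarrow> (nat \<Rightarrow> nat \<Rightarrow> 'a::euclidean_space \<Rightarrow> real) \<Rightarrow> ennreal" where
  "EZNvol p N m C F =
     (\<integral>\<^sup>+ X. star_vol (ZNrho p N m C X) * ennreal (\<Prod>ij\<in>(SIGMA i:{..<N}. {..<m i}). F (fst ij) (snd ij) (X ij))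
       \<partial>(PiM (SIGMA i:{..<N}. {..<m i}) (\<lambda>_. lebesgue)))"

end

theory Submission
  imports Defs
begin

text \<open>
  The core is a rearrangement inequality for the functional
  \<open>\<integral>\<^bsub>|x|<1\<^esub> \<integral> \<Prod>\<^sub>i q\<^sub>i(\<langle>X\<^sub>j,x\<rangle>)\<^sub>j \<Prod>\<^sub>j f\<^sub>j(X\<^sub>j) dX dx\<close> with \<open>q\<^sub>i\<close> even and quasiconcave.
  By layer cake all functions become indicators of sets. Along lines of a fixed direction, Prekopa's
  inequality gives an Anderson-type inequality: contracting the centres of a box of intervals increases
  the integral. Sliding and merging intervals as in the Rogers--Brascamp--Lieb--Luttinger inequality then
  shows that simultaneous Steiner symmetrization increases the functional. Averaging over directions,
  some Steiner symmetrization decreases the total distance of the sets to the centred balls of the same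
  volume by a definite amount, which yields the inequality for balls.

  For an origin-symmetric convex body, a decreasing function of its support function is even and
  quasiconcave, and a Gamma integral (or a product, for \<open>p = 0\<close>) expresses negative powers of the
  empirical mean through such functions. This compares \<open>\<integral>\<^bsub>|x|<1\<^esub> \<rho>(x)\<^sup>a dx\<close> for every \<open>a > 0\<close>, where
  \<open>\<rho>\<close> is extended to be homogeneous of degree \<open>-1\<close>; as \<open>a\<close> increases to \<open>n\<close>, the suitably normalized
  integrals tend to the volume. In the non-empirical case the expectation lies inside a nonlinear
  function, and is reached through products over \<open>N\<close> independent copies with \<open>N\<close> tending to infinity.
\<close>

section \<open>Midpoint Prekopa inequality\<close>

text \<open>Splitting off a direction \<open>\<theta>\<close> turns it into
  \<open>proj \<theta> X \<bullet> proj \<theta> x + t * s\<close>. Once the coordinate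
  \<open>s\<close> of \<open>x\<close> and the projections of the points are frozen, this is linear
  in the projection of \<open>x\<close> together with the coordinates \<open>t\<close> of the
  points. Reflecting exactly these variables keeps \<open>s\<close> and preserves the unit ball, and
  this is the symmetry on which the Anderson-type argument rests. The unit ball as domain of
  \<open>x\<close> keeps the resulting kernels bounded, but it also forces the limit at the end: for
  \<open>\<rho>\<close> of degree -1 the integrand of order \<open>n\<close> behaves like
  \<open>|x|^(-n)\<close> near the origin and its integral diverges. For \<open>a < n\<close> the
  divergence is the finite factor \<open>powr_tail (n / a)\<close>, which is the same on both sides
  and is cancelled before \<open>a\<close> tends to \<open>n\<close>. Prekopa's inequality is needed
  for midpoints only: the superlevel sets of the slid measure are closed, and closed midpoint convex
  sets of reals have no gaps.\<close>

lemma emeasure_less_ennreal: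
  "emeasure lborel {t::real. 0 < t \<and> ennreal t < c} = c"
proof (cases c)
  case (real r)
  then have "{t::real. 0 < t \<and> ennreal t < c} = {0<..<r}"
    by (auto simp: ennreal_less_iff)
  then show ?thesis using real by simp
next
  case top
  then have "{t::real. 0 < t \<and> ennreal t < c} = {0<..}" by auto
  moreover have "emeasure lborel {0::real<..} = top"
  proof -
    have "ennreal (real n) \<le> emeasure lborel {0::real<..}" for n
      using emeasure_mono[of "{0<..<real n}" "{0::real<..}" lborel] by (simp add: subset_iff)
    then show ?thesis
      by (metis ennreal_Ex_less_of_nat ennreal_of_nat_eq_real_of_nat infinity_ennreal_def leD less_top)
  qed
  ultimately show ?thesis using top by simp
qed

text \<open>The condition \<open>0 < t\<close> matters: for negative \<open>t\<close> the value
  \<open>ennreal t\<close> is 0, so the level condition alone would count the whole negative axis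
  wherever \<open>f\<close> is positive.\<close>

lemma layer_cake:
  assumes [measurable]: "f \<in> borel_measurable M" and "sigma_finite_measure M"
  shows "(\<integral>\<^sup>+x. f x \<partial>M) = (\<integral>\<^sup>+t. emeasure M {x\<in>space M. 0 < t \<and> ennreal t < f x} \<partial>lborel)"
proof -
  interpret sigma_finite_measure M by fact
  interpret pair_sigma_finite lborel M by standard
  have "(\<integral>\<^sup>+x. f x \<partial>M) = (\<integral>\<^sup>+x. (\<integral>\<^sup>+t. indicator {t::real. 0 < t \<and> ennreal t < f x} t \<partial>lborel) \<partial>M)"
    by (subst nn_integral_indicator) (auto simp: emeasure_less_ennreal)
  also have "\<dots> = (\<integral>\<^sup>+x. (\<integral>\<^sup>+t. indicator {p\<in>space (lborel \<Otimes>\<^sub>M M). 0 < fst p \<and> ennreal (fst p) < f (snd p)} (t,x) \<partial>lborel) \<partial>M)"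
    by (intro nn_integral_cong) (auto simp: indicator_def space_pair_measure)
  also have "\<dots> = (\<integral>\<^sup>+t. (\<integral>\<^sup>+x. indicator {p\<in>space (lborel \<Otimes>\<^sub>M M). 0 < fst p \<and> ennreal (fst p) < f (snd p)} (t,x) \<partial>M) \<partial>lborel)"
    by (intro Fubini') measurable
  also have "\<dots> = (\<integral>\<^sup>+t. (\<integral>\<^sup>+x. indicator {x\<in>space M. 0 < t \<and> ennreal t < f x} x \<partial>M) \<partial>lborel)"
    by (intro nn_integral_cong) (auto simp: indicator_def space_pair_measure)
  also have "\<dots> = (\<integral>\<^sup>+t. emeasure M {x\<in>space M. 0 < t \<and> ennreal t < f x} \<partial>lborel)"
    by simp
  finally show ?thesis .
qed

lemma emeasure_half_affine:
  assumes [measurable]: "A \<in> sets borel"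
  shows "emeasure lborel A = 2 * emeasure lborel {y::real. 2 * y - b \<in> A}"
proof -
  have "emeasure lborel A = (\<integral>\<^sup>+x. indicator A x \<partial>lborel)" by simp
  also have "\<dots> = ennreal \<bar>2\<bar> * (\<integral>\<^sup>+y. indicator A (- b + 2 * y) \<partial>lborel)"
    by (rule nn_integral_real_affine) auto
  also have "(\<integral>\<^sup>+y. indicator A (- b + 2 * y) \<partial>lborel) = (\<integral>\<^sup>+y. indicator {y. 2 * y - b \<in> A} y \<partial>lborel)"
    by (intro nn_integral_cong) (auto simp: indicator_def)
  finally show ?thesis by simp
qed

text \<open>One-dimensional Brunn-Minkowski by translated copies: \<open>(A + b) / 2\<close> and
  \<open>(a + B) / 2\<close> both lie in \<open>C\<close>, and if \<open>a\<close> is nearly maximal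
  in \<open>A\<close> and \<open>b\<close> nearly minimal in \<open>B\<close>, they overlap only in
  a short interval. A measurable \<open>C\<close> containing the midpoints avoids the question
  whether the sum set is measurable.\<close>

lemma midpoint_measure_bounded:
  fixes A B C :: "real set"
  assumes [measurable]: "A \<in> sets borel" "B \<in> sets borel" "C \<in> sets borel"
    and AB: "A \<subseteq> {-k..k}" "B \<subseteq> {-k..k}" "A \<noteq> {}" "B \<noteq> {}"
    and C: "\<And>a b. a \<in> A \<Longrightarrow> b \<in> B \<Longrightarrow> (a + b) / 2 \<in> C"
  shows "emeasure lborel A + emeasure lborel B \<le> 2 * emeasure lborel C"
proof (rule ennreal_le_epsilon)
  fix e :: real assume "0 < e"
  have bd: "bdd_above A" "bdd_below B"
    using AB(1,2) by (meson bdd_above_Icc bdd_below_Icc bdd_above_mono bdd_below_mono)+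
  obtain a where a: "a \<in> A" "Sup A - e/2 < a"
    using less_cSupE[of "Sup A - e/2" A] \<open>0 < e\<close> AB by auto
  obtain b where b: "b \<in> B" "b < Inf B + e/2"
    using cInf_lessD[of B "Inf B + e/2"] \<open>0 < e\<close> AB by auto
  let ?A = "{y. 2 * y - b \<in> A}" and ?B = "{y. 2 * y - a \<in> B}"
  have sub: "?A \<union> ?B \<subseteq> C"
  proof
    fix y assume "y \<in> ?A \<union> ?B"
    then show "y \<in> C"
      using C[of "2*y-b" b] C[of a "2*y-a"] a b by auto
  qed
  \<comment> \<open>The length of this interval is half of \<open>(Sup A - a) + (b - Inf B)\<close>,
    hence below \<open>e / 2\<close>; the factor 2 in the claim turns this into
    \<open>e\<close>.\<close>
  have int: "?A \<inter> ?B \<subseteq> {(a + Inf B)/2..(Sup A + b)/2}"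
  proof
    fix y assume y: "y \<in> ?A \<inter> ?B"
    then have "2*y-b \<le> Sup A" "Inf B \<le> 2*y-a"
      using bd by (auto intro: cSup_upper cInf_lower)
    then show "y \<in> {(a + Inf B)/2..(Sup A + b)/2}" by auto
  qed
  have "emeasure lborel (?A \<inter> ?B) \<le> emeasure lborel {(a + Inf B)/2..(Sup A + b)/2}"
    by (intro emeasure_mono int) auto
  also have "\<dots> \<le> ennreal (e/2)"
    using a b \<open>0 < e\<close> by (auto simp: emeasure_lborel_Icc_eq field_simps intro!: ennreal_leI)
  finally have i: "emeasure lborel (?A \<inter> ?B) \<le> ennreal (e/2)" .
  have "emeasure lborel ?A + emeasure lborel ?B = emeasure lborel (?A \<union> ?B) + emeasure lborel (?A \<inter> ?B)"
    by (intro emeasure_Un_Int) auto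
  also have "\<dots> \<le> emeasure lborel C + ennreal (e/2)"
    by (intro add_mono i emeasure_mono sub) auto
  finally have "2 * (emeasure lborel ?A + emeasure lborel ?B) \<le> 2 * (emeasure lborel C + ennreal (e/2))"
    by (intro mult_left_mono) auto
  also have "\<dots> = 2 * emeasure lborel C + ennreal e"
    using \<open>0 < e\<close> by (simp add: distrib_left ennreal_mult'[symmetric] flip: ennreal_numeral)
  finally show "emeasure lborel A + emeasure lborel B \<le> 2 * emeasure lborel C + ennreal e"
    using emeasure_half_affine[of A b] emeasure_half_affine[of B a] by (simp add: distrib_left)
qed

lemma midpoint_measure:
  fixes A B C :: "real set"
  assumes [measurable]: "A \<in> sets borel" "B \<in> sets borel" "C \<in> sets borel"
    and AB: "A \<noteq> {}" "B \<noteq> {}"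
    and C: "\<And>a b. a \<in> A \<Longrightarrow> b \<in> B \<Longrightarrow> (a + b) / 2 \<in> C"
  shows "emeasure lborel A + emeasure lborel B \<le> 2 * emeasure lborel C"
proof -
  obtain a b where ab: "a \<in> A" "b \<in> B" using AB by auto
  let ?I = "\<lambda>k::nat. {- real k..real k}"
  have U: "(\<Union>k. S \<inter> ?I k) = S" for S :: "real set"
  proof -
    have "\<exists>k. x \<in> ?I k" for x
      using real_arch_simple[of "\<bar>x\<bar>"] by (metis abs_le_iff atLeastAtMost_iff minus_le_iff)
    then show ?thesis by blast
  qed
  have lim: "(\<lambda>k. emeasure lborel (S \<inter> ?I k)) \<longlonglongrightarrow> emeasure lborel S" if [measurable]: "S \<in> sets borel" for S
  proof -
    have "(\<lambda>k. emeasure lborel (S \<inter> ?I k)) \<longlonglongrightarrow> emeasure lborel (\<Union>k. S \<inter> ?I k)"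
      by (intro Lim_emeasure_incseq) (auto simp: incseq_def)
    then show ?thesis by (simp only: U)
  qed
  \<comment> \<open>The bounded case requires nonempty sets; a chosen point of \<open>A\<close> and
    one of \<open>B\<close> lie in the truncations only from some \<open>k\<close> on.\<close>
  have ev: "eventually (\<lambda>k. x \<in> ?I k) sequentially" for x
    using eventually_ge_at_top[of "nat \<lceil>\<bar>x\<bar>\<rceil>"]
  proof eventually_elim
    case (elim k)
    then have "\<bar>x\<bar> \<le> real k" by linarith
    then show ?case by auto
  qed
  have "eventually (\<lambda>k. emeasure lborel (A \<inter> ?I k) + emeasure lborel (B \<inter> ?I k) \<le> 2 * emeasure lborel C) sequentially"
    using ev[of a] ev[of b]
  proof eventually_elim
    case (elim k)
    show ?case
      by (rule midpoint_measure_bounded[where k=k]) (use elim ab C in auto)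
  qed
  then show ?thesis
    by (intro tendsto_upperbound[OF tendsto_add[OF lim lim]]) auto
qed

lemma ennreal_four_mult_le_square_add: "4 * (a * b) \<le> (a + b :: ennreal)\<^sup>2"
proof (cases "a = top \<or> b = top")
  case True
  then have "(a + b)\<^sup>2 = top" by (auto simp: power2_eq_square ennreal_mult_top)
  then show ?thesis by simp
next
  case False
  then obtain x y where "a = ennreal x" "b = ennreal y" "0 \<le> x" "0 \<le> y"
    by (metis ennreal_cases)
  moreover have "4 * (x * y) \<le> (x + y)\<^sup>2"
    using sum_squares_ge_zero[of "x - y" 0] by (simp add: power2_eq_square algebra_simps)
  ultimately show ?thesis
    by (simp add: ennreal_mult'[symmetric] ennreal_power ennreal_leI flip: ennreal_plus ennreal_numeral)
qed

text \<open>With both suprema equal to 1, the level sets of \<open>f\<close> and \<open>g\<close>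
  are nonempty at every height in \<open>(0, 1)\<close>, as the midpoint inequality for sets
  demands, and their midpoints lie in the level set of \<open>h\<close>. Integration over the
  heights even bounds the arithmetic mean of the two integrals.\<close>

lemma prekopa_normalized:
  fixes f g h :: "real \<Rightarrow> ennreal"
  assumes [measurable]: "f \<in> borel_measurable borel" "g \<in> borel_measurable borel" "h \<in> borel_measurable borel"
    and le: "\<And>x. f x \<le> 1" "\<And>x. g x \<le> 1"
    and sup: "\<And>t. t < 1 \<Longrightarrow> \<exists>x. t < f x" "\<And>t. t < 1 \<Longrightarrow> \<exists>x. t < g x"
    and h: "\<And>x y. f x * g y \<le> (h ((x + y) / 2))\<^sup>2"
  shows "(\<integral>\<^sup>+x. f x \<partial>lborel) + (\<integral>\<^sup>+x. g x \<partial>lborel) \<le> 2 * (\<integral>\<^sup>+x. h x \<partial>lborel)"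
proof -
  have *: "emeasure lborel {x. 0 < t \<and> ennreal t < f x} + emeasure lborel {x. 0 < t \<and> ennreal t < g x}
     \<le> 2 * emeasure lborel {x. 0 < t \<and> ennreal t < h x}" for t :: real
  proof (cases "0 < t \<and> t < 1")
    case False
    then have "t \<le> 0 \<or> 1 \<le> ennreal t" by auto
    then have "{x. 0 < t \<and> ennreal t < f x} = {}" "{x. 0 < t \<and> ennreal t < g x} = {}"
      using le by (metis (mono_tags, lifting) Collect_empty_eq leD order_trans)+
    then show ?thesis by (simp only: emeasure_empty) simp
  next
    case True
    then have t: "ennreal t < 1" by (simp add: ennreal_less_one_iff)
    show ?thesis
    proof (rule midpoint_measure)
      show "{x. 0 < t \<and> ennreal t < f x} \<noteq> {}" "{x. 0 < t \<and> ennreal t < g x} \<noteq> {}"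
        using sup t True by auto
      fix a b assume ab: "a \<in> {x. 0 < t \<and> ennreal t < f x}" "b \<in> {x. 0 < t \<and> ennreal t < g x}"
      have fin: "f a < top" "g b < top" using le[of a] le[of b] by (auto simp: le_less_trans)
      then obtain x y where xy: "f a = ennreal x" "g b = ennreal y" "0 \<le> x" "0 \<le> y"
        by (metis ennreal_cases less_irrefl)
      then have "t < x" "t < y" using ab True by (auto simp: ennreal_less_iff)
      then have "ennreal (t * t) < ennreal (x * y)"
        using True xy by (intro ennreal_lessI) (auto intro: mult_strict_mono)
      also have "\<dots> \<le> (h ((a+b)/2))\<^sup>2" using h[of a b] xy by (simp add: ennreal_mult')
      finally have "(ennreal t)\<^sup>2 < (h ((a+b)/2))\<^sup>2" using True by (simp add: power2_eq_square ennreal_mult')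
      then have "ennreal t < h ((a+b)/2)"
        by (meson leD le_less_linear power_mono zero_le)
      then show "(a + b) / 2 \<in> {x. 0 < t \<and> ennreal t < h x}" using True by auto
    qed auto
  qed
  have sf: "sigma_finite_measure (lborel::real measure)" by standard
  have "(\<integral>\<^sup>+t. emeasure lborel {x. 0 < t \<and> ennreal t < f x} \<partial>lborel) + (\<integral>\<^sup>+t. emeasure lborel {x. 0 < t \<and> ennreal t < g x} \<partial>lborel)
     = (\<integral>\<^sup>+t. emeasure lborel {x. 0 < t \<and> ennreal t < f x} + emeasure lborel {x. 0 < t \<and> ennreal t < g x} \<partial>lborel)"
    by (subst nn_integral_add) auto
  also have "\<dots> \<le> (\<integral>\<^sup>+t. 2 * emeasure lborel {x. 0 < t \<and> ennreal t < h x} \<partial>lborel)"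
    by (intro nn_integral_mono *)
  also have "\<dots> = 2 * (\<integral>\<^sup>+t. emeasure lborel {x. 0 < t \<and> ennreal t < h x} \<partial>lborel)"
    by (subst nn_integral_cmult) auto
  finally show ?thesis
    using layer_cake[of f lborel] layer_cake[of g lborel] layer_cake[of h lborel] sf by simp
qed


text \<open>Scaling \<open>f\<close>, \<open>g\<close>, \<open>h\<close> by \<open>1 / a\<close>,
  \<open>1 / b\<close>, \<open>1 / sqrt (a * b)\<close> preserves the hypothesis and normalizes the
  suprema, which boundedness makes finite. The additive inequality becomes multiplicative through
  \<open>4 x y \<le> (x + y)^2\<close>.\<close>

lemma prekopa_bounded:
  fixes f g h :: "real \<Rightarrow> ennreal"
  assumes [measurable]: "f \<in> borel_measurable borel" "g \<in> borel_measurable borel" "h \<in> borel_measurable borel"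
    and le: "\<And>x. f x \<le> ennreal K" "\<And>x. g x \<le> ennreal K"
    and h: "\<And>x y. f x * g y \<le> (h ((x + y) / 2))\<^sup>2"
  shows "(\<integral>\<^sup>+x. f x \<partial>lborel) * (\<integral>\<^sup>+x. g x \<partial>lborel) \<le> (\<integral>\<^sup>+x. h x \<partial>lborel)\<^sup>2"
proof (cases "(SUP x. f x) = 0 \<or> (SUP x. g x) = 0")
  case True
  then have "(\<forall>x. f x = 0) \<or> (\<forall>x. g x = 0)"
    by (metis SUP_upper UNIV_I le_zero_eq)
  then show ?thesis by (elim disjE) auto
next
  case False
  have "(SUP x. f x) \<le> ennreal K" "(SUP x. g x) \<le> ennreal K"
    using le by (auto intro: SUP_least)
  then have "(SUP x. f x) \<noteq> top" "(SUP x. g x) \<noteq> top"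
    by (metis ennreal_less_top le_less_trans less_irrefl)+
  then obtain a b where ab: "(SUP x. f x) = ennreal a" "(SUP x. g x) = ennreal b" "0 \<le> a" "0 \<le> b"
    by (metis ennreal_cases)
  with False have "0 < a" "0 < b" by (auto simp: less_le)
  define A B C where "A = ennreal (1/a)" "B = ennreal (1/b)" "C = ennreal (1 / sqrt (a * b))"
  have C2: "C\<^sup>2 = A * B"
    using \<open>0 < a\<close> \<open>0 < b\<close> by (simp add: A_B_C_def ennreal_power power_divide flip: ennreal_mult')
  have norm: "ennreal (1/c) * F x \<le> 1" "t < 1 \<Longrightarrow> \<exists>x. t < ennreal (1/c) * F x"
    if "(SUP x. F x) = ennreal c" "0 < c" for F :: "real \<Rightarrow> ennreal" and c x t
  proof -
    have "F x \<le> ennreal c" using that(1) by (metis SUP_upper UNIV_I)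
    then have "ennreal (1/c) * F x \<le> ennreal (1/c) * ennreal c" by (intro mult_left_mono) auto
    also have "\<dots> = 1" using that(2) by (simp flip: ennreal_mult')
    finally show "ennreal (1/c) * F x \<le> 1" .
    assume "t < 1"
    then obtain s where s: "t = ennreal s" "0 \<le> s" "s < 1"
      by (cases t) (auto simp: ennreal_less_one_iff)
    then have "ennreal (s * c) < (SUP x. F x)"
      using that s by (auto simp: ennreal_less_iff)
    then obtain x where x: "ennreal (s * c) < F x" by (auto simp: less_SUP_iff)
    have "ennreal (1/c) * ennreal (s * c) < ennreal (1/c) * F x"
      using x that(2) by (intro ennreal_mult_strict_left_mono) (auto simp: ennreal_zero_less_divide)
    moreover have "ennreal (1/c) * ennreal (s * c) = t"
      using that(2) s by (simp flip: ennreal_mult')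
    ultimately show "\<exists>x. t < ennreal (1/c) * F x" by auto
  qed
  have "(\<integral>\<^sup>+x. A * f x \<partial>lborel) + (\<integral>\<^sup>+x. B * g x \<partial>lborel) \<le> 2 * (\<integral>\<^sup>+x. C * h x \<partial>lborel)"
  proof (rule prekopa_normalized)
    show "A * f x \<le> 1" "B * g x \<le> 1" for x
      using norm ab \<open>0 < a\<close> \<open>0 < b\<close> unfolding A_B_C_def by auto
    show "\<exists>x. t < A * f x" "\<exists>x. t < B * g x" if "t < 1" for t
      using norm(2)[OF ab(1) \<open>0 < a\<close> that] norm(2)[OF ab(2) \<open>0 < b\<close> that] unfolding A_B_C_def by auto
    show "A * f x * (B * g y) \<le> (C * h ((x + y) / 2))\<^sup>2" for x y
      using mult_left_mono[OF h[of x y], of "A * B"] by (simp add: power_mult_distrib C2 mult_ac)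
  qed auto
  then have "A * (\<integral>\<^sup>+x. f x \<partial>lborel) + B * (\<integral>\<^sup>+x. g x \<partial>lborel) \<le> 2 * C * (\<integral>\<^sup>+x. h x \<partial>lborel)"
    by (simp add: nn_integral_cmult mult_ac)
  then have "(A * (\<integral>\<^sup>+x. f x \<partial>lborel) + B * (\<integral>\<^sup>+x. g x \<partial>lborel))\<^sup>2 \<le> (2 * C * (\<integral>\<^sup>+x. h x \<partial>lborel))\<^sup>2"
    by (intro power_mono) auto
  with ennreal_four_mult_le_square_add have
    "4 * (A * (\<integral>\<^sup>+x. f x \<partial>lborel) * (B * (\<integral>\<^sup>+x. g x \<partial>lborel))) \<le> (2 * C * (\<integral>\<^sup>+x. h x \<partial>lborel))\<^sup>2"
    by (rule order_trans)
  then have "(4 * (A * B)) * ((\<integral>\<^sup>+x. f x \<partial>lborel) * (\<integral>\<^sup>+x. g x \<partial>lborel)) \<le> (4 * (A * B)) * (\<integral>\<^sup>+x. h x \<partial>lborel)\<^sup>2"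
    by (simp add: power_mult_distrib C2 mult_ac)
  moreover have "4 * (A * B) \<noteq> 0" "4 * (A * B) \<noteq> top"
    using \<open>0 < a\<close> \<open>0 < b\<close> by (auto simp: A_B_C_def ennreal_mult_eq_top_iff)
  ultimately show ?thesis by (subst (asm) ennreal_mult_le_mult_iff) auto
qed

text \<open>Removes boundedness from Prekopa's inequality here, and later the truncation of the
  negative part of the logarithm.\<close>

lemma nn_integral_SUP_min:
  assumes [measurable]: "f \<in> borel_measurable M"
  shows "(SUP k::nat. \<integral>\<^sup>+x. min (f x) (of_nat k) \<partial>M) = (\<integral>\<^sup>+x. f x \<partial>M)"
proof -
  have "(SUP k::nat. min c (of_nat k)) = c" for c :: ennreal
  proof (rule antisym)
    show "(SUP k::nat. min c (of_nat k)) \<le> c" by (auto intro: SUP_least)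
    show "c \<le> (SUP k::nat. min c (of_nat k))"
    proof (rule dense_le)
      fix y assume y: "y < c"
      then obtain k :: nat where "y < of_nat k" by (metis ennreal_Ex_less_of_nat less_trans top.not_eq_extremum)
      then have "y \<le> min c (of_nat k)" using y by auto
      then show "y \<le> (SUP k::nat. min c (of_nat k))" by (meson SUP_upper2 UNIV_I)
    qed
  qed
  then show ?thesis
    by (subst nn_integral_monotone_convergence_SUP[symmetric])
      (auto simp: incseq_def le_fun_def intro: min.coboundedI2)
qed

text \<open>The midpoint map \<open>c\<close> is a parameter so that the property passes to products
  and to images under midpoint-preserving maps. Squaring \<open>h\<close> replaces a square root of
  \<open>f x * g y\<close> in \<open>ennreal\<close>.\<close>

definition prekopa :: "'b measure \<Rightarrow> ('b \<Rightarrow> 'b \<Rightarrow> 'b) \<Rightarrow> bool" where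
  "prekopa M c \<longleftrightarrow> (\<forall>f g h. f \<in> borel_measurable M \<longrightarrow> g \<in> borel_measurable M \<longrightarrow> h \<in> borel_measurable M \<longrightarrow>
     (\<forall>x\<in>space M. \<forall>y\<in>space M. f x * g y \<le> (h (c x y) :: ennreal)\<^sup>2) \<longrightarrow>
     (\<integral>\<^sup>+x. f x \<partial>M) * (\<integral>\<^sup>+x. g x \<partial>M) \<le> (\<integral>\<^sup>+x. h x \<partial>M)\<^sup>2)"

lemma prekopaD:
  assumes "prekopa M c" "f \<in> borel_measurable M" "g \<in> borel_measurable M" "h \<in> borel_measurable M"
    and "\<And>x y. x \<in> space M \<Longrightarrow> y \<in> space M \<Longrightarrow> f x * g y \<le> (h (c x y) :: ennreal)\<^sup>2"
  shows "(\<integral>\<^sup>+x. f x \<partial>M) * (\<integral>\<^sup>+x. g x \<partial>M) \<le> (\<integral>\<^sup>+x. h x \<partial>M)\<^sup>2"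
  using assms(1)[unfolded prekopa_def, rule_format, OF assms(2-4)] assms(5) by blast

lemma prekopa_real: "prekopa (lborel :: real measure) (\<lambda>x y. (x + y) / 2)"
  unfolding prekopa_def
proof (intro allI impI)
  fix f g h :: "real \<Rightarrow> ennreal"
  assume *: "f \<in> borel_measurable lborel" "g \<in> borel_measurable lborel" "h \<in> borel_measurable lborel"
    and h: "\<forall>x\<in>space lborel. \<forall>y\<in>space lborel. f x * g y \<le> (h ((x + y) / 2))\<^sup>2"
  note [measurable] = *[simplified]
  have "(\<integral>\<^sup>+x. min (f x) (of_nat k) \<partial>lborel) * (\<integral>\<^sup>+x. min (g x) (of_nat l) \<partial>lborel) \<le> (\<integral>\<^sup>+x. h x \<partial>lborel)\<^sup>2" for k l :: nat
  proof (rule prekopa_bounded)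
    have "of_nat j \<le> ennreal (real (max k l))" if "j \<le> max k l" for j :: nat
      using that by (metis ennreal_of_nat_eq_real_of_nat of_nat_mono)
    then show "min (f x) (of_nat k) \<le> ennreal (real (max k l))" "min (g x) (of_nat l) \<le> ennreal (real (max k l))" for x
      by (auto intro: min.coboundedI2)
    show "min (f x) (of_nat k) * min (g y) (of_nat l) \<le> (h ((x + y) / 2))\<^sup>2" for x y
      by (rule order_trans[OF mult_mono[of _ "f x" _ "g y"]]) (use h in auto)
  qed auto
  then have "(SUP k. (\<integral>\<^sup>+x. min (f x) (of_nat k) \<partial>lborel)) * (SUP l. \<integral>\<^sup>+x. min (g x) (of_nat l) \<partial>lborel) \<le> (\<integral>\<^sup>+x. h x \<partial>lborel)\<^sup>2"
    by (simp only: SUP_mult_left_ennreal) (intro SUP_least, simp only: SUP_mult_right_ennreal, intro SUP_least)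
  then show "(\<integral>\<^sup>+x. f x \<partial>lborel) * (\<integral>\<^sup>+x. g x \<partial>lborel) \<le> (\<integral>\<^sup>+x. h x \<partial>lborel)\<^sup>2"
    by (simp add: nn_integral_SUP_min)
qed

text \<open>Tensorization: for fixed first coordinates, the inequality on \<open>N\<close> is
  precisely the pointwise hypothesis on the inner integrals that the inequality on \<open>M\<close>
  asks for.\<close>

lemma prekopa_pair:
  assumes 1: "prekopa M c" and 2: "prekopa N d" and sf: "sigma_finite_measure N"
    and c: "\<And>x y. x \<in> space M \<Longrightarrow> y \<in> space M \<Longrightarrow> c x y \<in> space M"
  shows "prekopa (M \<Otimes>\<^sub>M N) (\<lambda>p q. (c (fst p) (fst q), d (snd p) (snd q)))"
  unfolding prekopa_def
proof (intro allI impI)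
  interpret N: sigma_finite_measure N by fact
  fix f g h :: "'a \<times> 'b \<Rightarrow> ennreal"
  assume [measurable]: "f \<in> borel_measurable (M \<Otimes>\<^sub>M N)" "g \<in> borel_measurable (M \<Otimes>\<^sub>M N)" "h \<in> borel_measurable (M \<Otimes>\<^sub>M N)"
    and h: "\<forall>x\<in>space (M \<Otimes>\<^sub>M N). \<forall>y\<in>space (M \<Otimes>\<^sub>M N). f x * g y \<le> (h (c (fst x) (fst y), d (snd x) (snd y)))\<^sup>2"
  have "(\<integral>\<^sup>+x. (\<integral>\<^sup>+y. f (x, y) \<partial>N) \<partial>M) * (\<integral>\<^sup>+x. (\<integral>\<^sup>+y. g (x, y) \<partial>N) \<partial>M) \<le> (\<integral>\<^sup>+x. (\<integral>\<^sup>+y. h (x, y) \<partial>N) \<partial>M)\<^sup>2"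
  proof (rule prekopaD[OF 1])
    fix x x' assume x: "x \<in> space M" "x' \<in> space M"
    note c[OF x, measurable]
    note x[measurable]
    show "(\<integral>\<^sup>+y. f (x, y) \<partial>N) * (\<integral>\<^sup>+y. g (x', y) \<partial>N) \<le> (\<integral>\<^sup>+y. h (c x x', y) \<partial>N)\<^sup>2"
      by (rule prekopaD[OF 2]) (use h x c[OF x] in \<open>auto simp: space_pair_measure\<close>)
  qed auto
  then show "(\<integral>\<^sup>+x. f x \<partial>(M \<Otimes>\<^sub>M N)) * (\<integral>\<^sup>+x. g x \<partial>(M \<Otimes>\<^sub>M N)) \<le> (\<integral>\<^sup>+x. h x \<partial>(M \<Otimes>\<^sub>M N))\<^sup>2"
    by (simp add: N.nn_integral_fst)
qed

text \<open>Transports the inequality from coordinate tuples to a Euclidean space along the map that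
  assembles a vector from its coordinates.\<close>

lemma prekopa_distr:
  assumes 1: "prekopa M c" and [measurable]: "T \<in> measurable M N"
    and T: "\<And>x y. x \<in> space M \<Longrightarrow> y \<in> space M \<Longrightarrow> T (c x y) = d (T x) (T y)"
  shows "prekopa (distr M N T) d"
  unfolding prekopa_def
proof (intro allI impI)
  fix f g h :: "'b \<Rightarrow> ennreal"
  assume *: "f \<in> borel_measurable (distr M N T)" "g \<in> borel_measurable (distr M N T)" "h \<in> borel_measurable (distr M N T)"
    and h: "\<forall>x\<in>space (distr M N T). \<forall>y\<in>space (distr M N T). f x * g y \<le> (h (d x y))\<^sup>2"
  note [measurable] = *[simplified]
  have "(\<integral>\<^sup>+x. f (T x) \<partial>M) * (\<integral>\<^sup>+x. g (T x) \<partial>M) \<le> (\<integral>\<^sup>+x. h (T x) \<partial>M)\<^sup>2"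
  proof (rule prekopaD[OF 1])
    fix x y assume xy: "x \<in> space M" "y \<in> space M"
    then show "f (T x) * g (T y) \<le> (h (T (c x y)))\<^sup>2"
      using h T[OF xy] measurable_space[OF assms(2)] by auto
  qed auto
  then show "(\<integral>\<^sup>+x. f x \<partial>distr M N T) * (\<integral>\<^sup>+x. g x \<partial>distr M N T) \<le> (\<integral>\<^sup>+x. h x \<partial>distr M N T)\<^sup>2"
    by (simp add: nn_integral_distr)
qed

lemma product_sigma_finite_lborel: "product_sigma_finite (\<lambda>_. lborel)"
  by standard

lemma prekopa_PiM:
  assumes "finite I"
  shows "prekopa (PiM I (\<lambda>_. lborel :: real measure)) (\<lambda>x y. \<lambda>i\<in>I. (x i + y i) / 2)"
  using assms
proof (induction I rule: finite_induct)
  case empty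
  show ?case unfolding prekopa_def PiM_empty
    by (auto simp: nn_integral_count_space_finite)
next
  case (insert i I)
  interpret product_sigma_finite "\<lambda>_. lborel :: real measure" by (rule product_sigma_finite_lborel)
  interpret S: sigma_finite_measure "PiM I (\<lambda>_. lborel :: real measure)" using insert by (intro sigma_finite)
  let ?P = "PiM I (\<lambda>_. lborel :: real measure) \<Otimes>\<^sub>M (lborel :: real measure)"
  have pp: "prekopa ?P (\<lambda>p q. ((\<lambda>i\<in>I. (fst p i + fst q i) / 2), (snd p + snd q) / 2))"
    by (rule prekopa_pair[OF insert.IH prekopa_real]) (auto simp: space_PiM sigma_finite_lborel)
  show ?case
    unfolding prekopa_def
  proof (intro allI impI)
    fix f g h :: "_ \<Rightarrow> ennreal"
    assume [measurable]: "f \<in> borel_measurable (PiM (insert i I) (\<lambda>_. lborel :: real measure))"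
      "g \<in> borel_measurable (PiM (insert i I) (\<lambda>_. lborel :: real measure))"
      "h \<in> borel_measurable (PiM (insert i I) (\<lambda>_. lborel :: real measure))"
      and h: "\<forall>x\<in>space (PiM (insert i I) (\<lambda>_. lborel :: real measure)). \<forall>y\<in>space (PiM (insert i I) (\<lambda>_. lborel :: real measure)).
         f x * g y \<le> (h (\<lambda>j\<in>insert i I. (x j + y j) / 2))\<^sup>2"
    have eq: "(\<integral>\<^sup>+x. u x \<partial>PiM (insert i I) (\<lambda>_. lborel :: real measure)) = (\<integral>\<^sup>+p. u ((fst p)(i := snd p)) \<partial>?P)"
      if [measurable]: "u \<in> borel_measurable (PiM (insert i I) (\<lambda>_. lborel :: real measure))" for u :: "_ \<Rightarrow> ennreal"
      using insert by (subst product_nn_integral_insert) (auto simp: lborel.nn_integral_fst[symmetric])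
    have "(\<integral>\<^sup>+p. f ((fst p)(i := snd p)) \<partial>?P) * (\<integral>\<^sup>+p. g ((fst p)(i := snd p)) \<partial>?P) \<le> (\<integral>\<^sup>+p. h ((fst p)(i := snd p)) \<partial>?P)\<^sup>2"
    proof (rule prekopaD[OF pp])
      fix p q assume pq: "p \<in> space ?P" "q \<in> space ?P"
      have "(\<lambda>j\<in>insert i I. (((fst p)(i := snd p)) j + ((fst q)(i := snd q)) j) / 2)
         = (\<lambda>i\<in>I. (fst p i + fst q i) / 2)(i := (snd p + snd q) / 2)"
        using insert by (auto simp: fun_eq_iff)
      moreover have "(fst p)(i := snd p) \<in> space (PiM (insert i I) (\<lambda>_. lborel :: real measure))"
         "(fst q)(i := snd q) \<in> space (PiM (insert i I) (\<lambda>_. lborel :: real measure))"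
        using pq by (auto simp: space_PiM space_pair_measure PiE_def extensional_def)
      ultimately show "f ((fst p)(i := snd p)) * g ((fst q)(i := snd q)) \<le>
          (h ((fst (\<lambda>i\<in>I. (fst p i + fst q i) / 2, (snd p + snd q) / 2))(i := snd (\<lambda>i\<in>I. (fst p i + fst q i) / 2, (snd p + snd q) / 2))))\<^sup>2"
        using h[rule_format, of "(fst p)(i := snd p)" "(fst q)(i := snd q)"] by simp
    qed auto
    then show "(\<integral>\<^sup>+x. f x \<partial>PiM (insert i I) (\<lambda>_. lborel :: real measure)) * (\<integral>\<^sup>+x. g x \<partial>PiM (insert i I) (\<lambda>_. lborel :: real measure))
        \<le> (\<integral>\<^sup>+x. h x \<partial>PiM (insert i I) (\<lambda>_. lborel :: real measure))\<^sup>2"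
      by (simp add: eq)
  qed
qed

lemma prekopa_euclidean: "prekopa (lborel :: 'a::euclidean_space measure) (\<lambda>x y. (1/2) *\<^sub>R (x + y))"
proof -
  have "prekopa (distr (PiM Basis (\<lambda>_. lborel :: real measure)) borel (\<lambda>f. \<Sum>b\<in>Basis. f b *\<^sub>R (b::'a))) (\<lambda>x y. (1/2) *\<^sub>R (x + y))"
    by (rule prekopa_distr[OF prekopa_PiM[OF finite_Basis]])
      (auto simp: scaleR_sum_right scaleR_add_left scaleR_add_right add_divide_distrib sum.distrib)
  then show ?thesis by (simp add: lborel_eq[symmetric])
qed

section \<open>Fubini along lines and Anderson's inequality\<close>

text \<open>If \<open>x\<close> were missing, the nearest points of \<open>S\<close> on its two
  sides would bound a gap, and their midpoint would lie in that gap.\<close>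

lemma midpoint_closed_Icc:
  fixes S :: "real set"
  assumes S: "closed S" "\<And>x y. x \<in> S \<Longrightarrow> y \<in> S \<Longrightarrow> (x + y) / 2 \<in> S"
    and ab: "a \<in> S" "b \<in> S" and x: "a \<le> x" "x \<le> b"
  shows "x \<in> S"
proof (rule ccontr)
  assume "x \<notin> S"
  define l where "l = Sup (S \<inter> {a..x})"
  define u where "u = Inf (S \<inter> {x..b})"
  have l: "l \<in> S \<inter> {a..x}" unfolding l_def
    by (rule closed_contains_Sup) (use S ab x in \<open>auto intro: closed_Int\<close>)
  have u: "u \<in> S \<inter> {x..b}" unfolding u_def
    by (rule closed_contains_Inf) (use S ab x in \<open>auto intro: closed_Int\<close>)
  have "l < x" "x < u" using l u \<open>x \<notin> S\<close> by (auto simp: less_le)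
  let ?m = "(l + u) / 2"
  have m: "?m \<in> S" using S(2) l u by auto
  show False
  proof (cases "?m \<le> x")
    case True
    then have "?m \<le> l" unfolding l_def
      using m l \<open>x < u\<close> \<open>l < x\<close> by (intro cSup_upper) (auto simp: l_def)
    then show False using \<open>l < x\<close> \<open>x < u\<close> by simp
  next
    case False
    then have "u \<le> ?m" unfolding u_def
      using m u \<open>x < u\<close> \<open>l < x\<close> by (intro cInf_lower) (auto simp: u_def)
    then show False using \<open>l < x\<close> \<open>x < u\<close> by simp
  qed
qed

text \<open>Applied to two maps: the reflection of all real coordinates, and the identity from
  \<open>lebesgue\<close> to \<open>lborel\<close>.\<close>

lemma distr_PiM_componentwise:
  assumes "finite I" and M: "product_sigma_finite M" and N: "product_sigma_finite N"
    and h: "\<And>i. h i \<in> measurable (M i) (N i)"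
    and d: "\<And>i. i \<in> I \<Longrightarrow> distr (M i) (N i) (h i) = N i"
  shows "distr (PiM I M) (PiM I N) (\<lambda>x. \<lambda>i\<in>I. h i (x i)) = PiM I N"
proof -
  interpret M: product_sigma_finite M by fact
  interpret N: product_sigma_finite N by fact
  note h[measurable]
  show ?thesis
  proof (rule N.PiM_eqI)
    fix A assume A: "\<And>i. i \<in> I \<Longrightarrow> A i \<in> sets (N i)"
    have [measurable]: "Pi\<^sub>E I A \<in> sets (PiM I N)" using A \<open>finite I\<close> by (intro sets_PiM_I_finite)
    have "emeasure (distr (PiM I M) (PiM I N) (\<lambda>x. \<lambda>i\<in>I. h i (x i))) (Pi\<^sub>E I A)
      = emeasure (PiM I M) ((\<lambda>x. \<lambda>i\<in>I. h i (x i)) -` Pi\<^sub>E I A \<inter> space (PiM I M))"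
      by (subst emeasure_distr) auto
    also have "(\<lambda>x. \<lambda>i\<in>I. h i (x i)) -` Pi\<^sub>E I A \<inter> space (PiM I M) = Pi\<^sub>E I (\<lambda>i. h i -` A i \<inter> space (M i))"
      by (auto simp: space_PiM PiE_iff)
    also have "emeasure (PiM I M) \<dots> = (\<Prod>i\<in>I. emeasure (M i) (h i -` A i \<inter> space (M i)))"
      using A h by (intro M.emeasure_PiM \<open>finite I\<close>) (auto intro: measurable_sets)
    also have "\<dots> = (\<Prod>i\<in>I. emeasure (N i) (A i))"
    proof (rule prod.cong)
      fix i assume "i \<in> I"
      then show "emeasure (M i) (h i -` A i \<inter> space (M i)) = emeasure (N i) (A i)"
        using emeasure_distr[OF h[of i] A[of i]] d[of i] by simp
    qed simp
    finally show "emeasure (distr (PiM I M) (PiM I N) (\<lambda>x. \<lambda>i\<in>I. h i (x i))) (Pi\<^sub>E I A) = (\<Prod>i\<in>I. emeasure (N i) (A i))" .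
  qed (use assms in auto)
qed

lemma distr_lborel_uminus_euclidean: "distr lborel lborel uminus = (lborel :: 'a::euclidean_space measure)"
proof -
  have "(lborel :: 'a measure) = density (distr lborel borel (\<lambda>x. 0 + (-1) *\<^sub>R x)) (\<lambda>_. \<bar>-1::real\<bar>^DIM('a))"
    by (rule lborel_affine) auto
  also have "\<dots> = distr lborel borel uminus"
    by (simp add: density_1)
  also have "\<dots> = distr lborel lborel uminus" by (rule distr_cong) auto
  finally show ?thesis by simp
qed

lemma nn_integral_lborel_translate:
  assumes [measurable]: "f \<in> borel_measurable borel"
  shows "(\<integral>\<^sup>+x. f (x + c) \<partial>lborel) = (\<integral>\<^sup>+x. f (x::'a::euclidean_space) \<partial>lborel)"
proof -
  have "(\<integral>\<^sup>+x. f x \<partial>distr lborel borel ((+) c)) = (\<integral>\<^sup>+x. f (c + x) \<partial>lborel)"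
    by (subst nn_integral_distr) auto
  then show ?thesis by (simp add: lborel_distr_plus add.commute)
qed

section \<open>Integration along the lines of a fixed direction\<close>

definition proj :: "'a::euclidean_space \<Rightarrow> 'a \<Rightarrow> 'a" where
  "proj \<theta> x = x - (x \<bullet> \<theta>) *\<^sub>R \<theta>"

text \<open>Stands in for Lebesgue measure on the hyperplane orthogonal to a unit vector
  \<open>\<theta>\<close>: every line parallel to \<open>\<theta>\<close> meets the slab in length
  one, so functions of \<open>proj \<theta> x\<close> have the same integral for both.\<close>

definition slab_measure :: "'a::euclidean_space \<Rightarrow> 'a measure" where
  "slab_measure \<theta> = density lborel (indicator {x. \<bar>x \<bullet> \<theta>\<bar> \<le> 1/2})"

lemma proj_measurable [measurable]: "proj \<theta> \<in> borel_measurable borel"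
  unfolding proj_def by measurable

lemma sets_slab_measure [simp, measurable_cong]: "sets (slab_measure \<theta>) = sets borel"
  by (simp add: slab_measure_def)

lemma space_slab_measure [simp]: "space (slab_measure \<theta>) = UNIV"
  by (simp add: slab_measure_def)

lemma sigma_finite_slab_measure: "sigma_finite_measure (slab_measure \<theta>)"
proof
  have le: "emeasure (slab_measure \<theta>) a \<le> emeasure lborel a" if [measurable]: "a \<in> sets borel" for a
  proof -
    have "emeasure (slab_measure \<theta>) a = (\<integral>\<^sup>+x. indicator {x. \<bar>x \<bullet> \<theta>\<bar> \<le> 1/2} x * indicator a x \<partial>lborel)"
      unfolding slab_measure_def by (subst emeasure_density) auto
    also have "\<dots> \<le> (\<integral>\<^sup>+x. indicator a x \<partial>lborel)"
      by (intro nn_integral_mono) (auto simp: indicator_def)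
    finally show ?thesis by simp
  qed
  obtain A :: "'a set set" where A: "countable A" "A \<subseteq> sets lborel" "\<Union>A = space lborel" "\<forall>a\<in>A. emeasure lborel a \<noteq> \<infinity>"
    using lborel.sigma_finite_countable by blast
  then have "\<forall>a\<in>A. emeasure (slab_measure \<theta>) a \<noteq> \<infinity>"
    using le by (metis infinity_ennreal_def neq_top_trans sets_lborel subsetD)
  then show "\<exists>A. countable A \<and> A \<subseteq> sets (slab_measure \<theta>) \<and> \<Union>A = space (slab_measure \<theta>) \<and> (\<forall>a\<in>A. emeasure (slab_measure \<theta>) a \<noteq> \<infinity>)"
    using A by auto
qed

lemma product_sigma_finite_slab: "product_sigma_finite (\<lambda>_. slab_measure \<theta>)"
  unfolding product_sigma_finite_def by (simp add: sigma_finite_slab_measure)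

lemma nn_integral_slab:
  assumes [measurable]: "f \<in> borel_measurable borel"
  shows "(\<integral>\<^sup>+x. f x \<partial>slab_measure \<theta>) = (\<integral>\<^sup>+x. indicator {x. \<bar>x \<bullet> \<theta>\<bar> \<le> 1/2} x * f x \<partial>lborel)"
  unfolding slab_measure_def by (subst nn_integral_density) auto

lemma proj_inner: "norm \<theta> = 1 \<Longrightarrow> proj \<theta> x \<bullet> \<theta> = 0"
  by (simp add: proj_def inner_diff_left norm_eq_1)

lemma proj_add_scale: "norm \<theta> = 1 \<Longrightarrow> proj \<theta> (x + t *\<^sub>R \<theta>) = proj \<theta> x"
  by (simp add: proj_def inner_add_left norm_eq_1 scaleR_add_left)

lemma proj_proj: "norm \<theta> = 1 \<Longrightarrow> proj \<theta> (proj \<theta> x) = proj \<theta> x"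
  by (simp add: proj_def[of \<theta> "proj \<theta> x"] proj_inner)

lemma proj_uminus: "proj \<theta> (- x) = - proj \<theta> x"
  by (simp add: proj_def)

lemma proj_mid: "proj \<theta> ((1/2) *\<^sub>R (x + y)) = (1/2) *\<^sub>R (proj \<theta> x + proj \<theta> y)"
  by (simp add: proj_def inner_add_left algebra_simps add_divide_distrib)

lemma nn_integral_lborel_shift_real:
  assumes [measurable]: "f \<in> borel_measurable borel"
  shows "(\<integral>\<^sup>+t. f t \<partial>lborel) = (\<integral>\<^sup>+t. f (c + t :: real) \<partial>lborel)"
  using nn_integral_lborel_translate[of f c] by (simp add: add.commute)

text \<open>Shifting \<open>t\<close> by \<open>x \<bullet> \<theta>\<close> replaces the projection
  of \<open>x\<close> by \<open>x\<close> itself. After interchanging the integrals and translating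
  \<open>x\<close> by \<open>t *\<^sub>R \<theta>\<close>, the slab condition confines
  \<open>t\<close> to an interval of length one.\<close>

lemma line_fubini:
  assumes [measurable]: "g \<in> borel_measurable borel" and \<theta>: "norm (\<theta>::'a::euclidean_space) = 1"
  shows "(\<integral>\<^sup>+x. g x \<partial>lborel) = (\<integral>\<^sup>+x. (\<integral>\<^sup>+t. g (proj \<theta> x + t *\<^sub>R \<theta>) \<partial>lborel) \<partial>slab_measure \<theta>)"
proof -
  let ?s = "\<lambda>x. indicator {x::'a. \<bar>x \<bullet> \<theta>\<bar> \<le> 1/2} x :: ennreal"
  have "(\<integral>\<^sup>+x. (\<integral>\<^sup>+t. g (proj \<theta> x + t *\<^sub>R \<theta>) \<partial>lborel) \<partial>slab_measure \<theta>)
      = (\<integral>\<^sup>+x. ?s x * (\<integral>\<^sup>+t. g (proj \<theta> x + t *\<^sub>R \<theta>) \<partial>lborel) \<partial>lborel)"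
    by (rule nn_integral_slab) measurable
  also have "\<dots> = (\<integral>\<^sup>+x. ?s x * (\<integral>\<^sup>+t. g (x + t *\<^sub>R \<theta>) \<partial>lborel) \<partial>lborel)"
  proof (rule nn_integral_cong)
    fix x
    have "(\<integral>\<^sup>+t. g (proj \<theta> x + t *\<^sub>R \<theta>) \<partial>lborel) = (\<integral>\<^sup>+t. g (proj \<theta> x + (x \<bullet> \<theta> + t) *\<^sub>R \<theta>) \<partial>lborel)"
      by (rule nn_integral_lborel_shift_real) measurable
    then show "?s x * (\<integral>\<^sup>+t. g (proj \<theta> x + t *\<^sub>R \<theta>) \<partial>lborel) = ?s x * (\<integral>\<^sup>+t. g (x + t *\<^sub>R \<theta>) \<partial>lborel)"
      by (simp add: proj_def scaleR_add_left)
  qed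
  also have "\<dots> = (\<integral>\<^sup>+x. (\<integral>\<^sup>+t. ?s x * g (x + t *\<^sub>R \<theta>) \<partial>lborel) \<partial>lborel)"
    by (intro nn_integral_cong nn_integral_cmult[symmetric]) measurable
  also have "\<dots> = (\<integral>\<^sup>+t. (\<integral>\<^sup>+x. ?s x * g (x + t *\<^sub>R \<theta>) \<partial>lborel) \<partial>lborel)"
    by (rule lborel_pair.Fubini') measurable
  also have "\<dots> = (\<integral>\<^sup>+t. (\<integral>\<^sup>+x. ?s (x - t *\<^sub>R \<theta>) * g x \<partial>lborel) \<partial>lborel)"
  proof (rule nn_integral_cong)
    fix t
    show "(\<integral>\<^sup>+x. ?s x * g (x + t *\<^sub>R \<theta>) \<partial>lborel) = (\<integral>\<^sup>+x. ?s (x - t *\<^sub>R \<theta>) * g x \<partial>lborel)"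
      using nn_integral_lborel_translate[of "\<lambda>x. ?s (x - t *\<^sub>R \<theta>) * g x" "t *\<^sub>R \<theta>"] by simp
  qed
  also have "\<dots> = (\<integral>\<^sup>+x. (\<integral>\<^sup>+t. ?s (x - t *\<^sub>R \<theta>) * g x \<partial>lborel) \<partial>lborel)"
    by (rule lborel_pair.Fubini'[symmetric]) measurable
  also have "\<dots> = (\<integral>\<^sup>+x. g x \<partial>lborel)"
  proof (intro nn_integral_cong)
    fix x
    have "(\<integral>\<^sup>+t. ?s (x - t *\<^sub>R \<theta>) * g x \<partial>lborel) = (\<integral>\<^sup>+t. indicator {x \<bullet> \<theta> - 1/2..x \<bullet> \<theta> + 1/2} t * g x \<partial>lborel)"
      using \<theta> by (intro nn_integral_cong) (auto simp: indicator_def inner_diff_left norm_eq_1 abs_if split: if_splits)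
    also have "\<dots> = g x" by (subst nn_integral_multc) auto
    finally show "(\<integral>\<^sup>+t. ?s (x - t *\<^sub>R \<theta>) * g x \<partial>lborel) = g x" .
  qed
  finally show ?thesis by simp
qed

lemma line_fubini_PiM:
  assumes "finite J" and \<theta>: "norm (\<theta>::'a::euclidean_space) = 1"
    and "g \<in> borel_measurable (PiM J (\<lambda>_. lborel))"
  shows "(\<integral>\<^sup>+X. g X \<partial>PiM J (\<lambda>_. lborel)) =
    (\<integral>\<^sup>+Y. (\<integral>\<^sup>+t. g (\<lambda>j\<in>J. proj \<theta> (Y j) + t j *\<^sub>R \<theta>) \<partial>PiM J (\<lambda>_. lborel)) \<partial>PiM J (\<lambda>_. slab_measure \<theta>))"
  using assms(1,3)
proof (induction J arbitrary: g rule: finite_induct)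
  case empty
  then show ?case by (simp add: PiM_empty nn_integral_count_space_finite restrict_def)
next
  case (insert k J)
  note [measurable] = insert.prems
  interpret L: product_sigma_finite "\<lambda>_. lborel :: 'a measure" by (rule product_sigma_finite_lborel)
  interpret R: product_sigma_finite "\<lambda>_. lborel :: real measure" by (rule product_sigma_finite_lborel)
  interpret S: product_sigma_finite "\<lambda>_. slab_measure \<theta>" by (rule product_sigma_finite_slab)
  interpret RJ: sigma_finite_measure "PiM J (\<lambda>_. lborel :: real measure)" using insert by (intro R.sigma_finite)
  interpret S1: sigma_finite_measure "slab_measure \<theta>" by (rule sigma_finite_slab_measure)
  interpret P: pair_sigma_finite "PiM J (\<lambda>_. lborel :: real measure)" "slab_measure \<theta>" by standard
  let ?q = "\<lambda>Y t. \<lambda>j\<in>J. proj \<theta> (Y j) + t j *\<^sub>R \<theta>"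
  let ?G = "\<lambda>X. (\<integral>\<^sup>+y. (\<integral>\<^sup>+s. g (X(k := proj \<theta> y + s *\<^sub>R \<theta>)) \<partial>lborel) \<partial>slab_measure \<theta>)"
  have "(\<integral>\<^sup>+X. g X \<partial>PiM (insert k J) (\<lambda>_. lborel)) = (\<integral>\<^sup>+X. (\<integral>\<^sup>+x. g (X(k := x)) \<partial>lborel) \<partial>PiM J (\<lambda>_. lborel))"
    using insert by (intro L.product_nn_integral_insert)
  also have "\<dots> = (\<integral>\<^sup>+X. ?G X \<partial>PiM J (\<lambda>_. lborel))"
    by (intro nn_integral_cong line_fubini \<theta>) measurable
  also have "\<dots> = (\<integral>\<^sup>+Y. (\<integral>\<^sup>+t. ?G (?q Y t) \<partial>PiM J (\<lambda>_. lborel)) \<partial>PiM J (\<lambda>_. slab_measure \<theta>))"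
    by (intro insert.IH) measurable
  also have "\<dots> = (\<integral>\<^sup>+Y. (\<integral>\<^sup>+y. (\<integral>\<^sup>+t. (\<integral>\<^sup>+s. g ((?q Y t)(k := proj \<theta> y + s *\<^sub>R \<theta>)) \<partial>lborel) \<partial>PiM J (\<lambda>_. lborel)) \<partial>slab_measure \<theta>) \<partial>PiM J (\<lambda>_. slab_measure \<theta>))"
  proof (intro nn_integral_cong)
    fix Y assume "Y \<in> space (PiM J (\<lambda>_. slab_measure \<theta>))"
    show "(\<integral>\<^sup>+t. ?G (?q Y t) \<partial>PiM J (\<lambda>_. lborel)) = (\<integral>\<^sup>+y. (\<integral>\<^sup>+t. (\<integral>\<^sup>+s. g ((?q Y t)(k := proj \<theta> y + s *\<^sub>R \<theta>)) \<partial>lborel) \<partial>PiM J (\<lambda>_. lborel)) \<partial>slab_measure \<theta>)"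
      by (rule P.Fubini'[symmetric]) measurable
  qed
  also have "\<dots> = (\<integral>\<^sup>+Y. (\<integral>\<^sup>+y. (\<integral>\<^sup>+t. g (\<lambda>j\<in>insert k J. proj \<theta> ((Y(k := y)) j) + t j *\<^sub>R \<theta>) \<partial>PiM (insert k J) (\<lambda>_. lborel)) \<partial>slab_measure \<theta>) \<partial>PiM J (\<lambda>_. slab_measure \<theta>))"
  proof (intro nn_integral_cong)
    fix Y y
    have "(\<integral>\<^sup>+t. g (\<lambda>j\<in>insert k J. proj \<theta> ((Y(k := y)) j) + t j *\<^sub>R \<theta>) \<partial>PiM (insert k J) (\<lambda>_. lborel))
      = (\<integral>\<^sup>+t. (\<integral>\<^sup>+s. g (\<lambda>j\<in>insert k J. proj \<theta> ((Y(k := y)) j) + (t(k := s)) j *\<^sub>R \<theta>) \<partial>lborel) \<partial>PiM J (\<lambda>_. lborel))"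
      using insert by (intro R.product_nn_integral_insert) measurable
    also have "\<dots> = (\<integral>\<^sup>+t. (\<integral>\<^sup>+s. g ((?q Y t)(k := proj \<theta> y + s *\<^sub>R \<theta>)) \<partial>lborel) \<partial>PiM J (\<lambda>_. lborel))"
      using insert by (intro nn_integral_cong arg_cong[where f=g]) (auto simp: fun_eq_iff)
    finally show "(\<integral>\<^sup>+t. (\<integral>\<^sup>+s. g ((?q Y t)(k := proj \<theta> y + s *\<^sub>R \<theta>)) \<partial>lborel) \<partial>PiM J (\<lambda>_. lborel))
      = (\<integral>\<^sup>+t. g (\<lambda>j\<in>insert k J. proj \<theta> ((Y(k := y)) j) + t j *\<^sub>R \<theta>) \<partial>PiM (insert k J) (\<lambda>_. lborel))" by simp
  qed
  also have "\<dots> = (\<integral>\<^sup>+Y. (\<integral>\<^sup>+t. g (\<lambda>j\<in>insert k J. proj \<theta> (Y j) + t j *\<^sub>R \<theta>) \<partial>PiM (insert k J) (\<lambda>_. lborel)) \<partial>PiM (insert k J) (\<lambda>_. slab_measure \<theta>))"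
  proof -
    interpret RJ: sigma_finite_measure "PiM (insert k J) (\<lambda>_. lborel :: real measure)" using insert by (intro R.sigma_finite) auto
    show ?thesis
    using insert by (intro S.product_nn_integral_insert[symmetric]) measurable
  qed
  finally show ?case .
qed

text \<open>Anderson's inequality for a symmetric set \<open>D\<close>, with midpoint log-concavity in the shift
  supplied by Prekopa's inequality and upper semicontinuity by closedness of the boxes.\<close>
lemma anderson_boxes:
  fixes D :: "('a::euclidean_space \<times> ('i \<Rightarrow> real)) set" and c w :: "'i \<Rightarrow> real"
  assumes "finite J"
    and [measurable]: "D \<in> sets (lborel \<Otimes>\<^sub>M PiM J (\<lambda>_. lborel))"
    and bound: "D \<subseteq> ball 0 R \<times> UNIV"
    and sym: "\<And>x t. (x, t) \<in> D \<Longrightarrow> (- x, \<lambda>j\<in>J. - t j) \<in> D"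
    and mid: "\<And>x t y u. (x, t) \<in> D \<Longrightarrow> (y, u) \<in> D \<Longrightarrow> ((1/2) *\<^sub>R (x + y), \<lambda>j\<in>J. (t j + u j) / 2) \<in> D"
    and s: "0 \<le> s" "s \<le> 1"
  shows "emeasure (lborel \<Otimes>\<^sub>M PiM J (\<lambda>_. lborel)) {p \<in> D. \<forall>j\<in>J. \<bar>snd p j - c j\<bar> \<le> w j}
    \<le> emeasure (lborel \<Otimes>\<^sub>M PiM J (\<lambda>_. lborel)) {p \<in> D. \<forall>j\<in>J. \<bar>snd p j - s * c j\<bar> \<le> w j}"
proof -
  interpret R: product_sigma_finite "\<lambda>_. lborel :: real measure" by (rule product_sigma_finite_lborel)
  interpret RJ: sigma_finite_measure "PiM J (\<lambda>_. lborel :: real measure)" using \<open>finite J\<close> by (intro R.sigma_finite)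
  interpret P: pair_sigma_finite "lborel :: 'a measure" "PiM J (\<lambda>_. lborel :: real measure)" by standard
  let ?P = "(lborel :: 'a measure) \<Otimes>\<^sub>M PiM J (\<lambda>_. lborel :: real measure)"
  \<comment> \<open>\<open>E \<sigma>\<close> is the part of \<open>D\<close> over the box with its
    centre moved to \<open>\<sigma>\<close> times \<open>c\<close>; the claim compares
    \<open>\<sigma> = 1\<close> with \<open>\<sigma> = s\<close>.\<close>
  define E where "E \<sigma> = {p \<in> D. \<forall>j\<in>J. \<bar>snd p j - \<sigma> * c j\<bar> \<le> w j}" for \<sigma>
  define m where "m \<sigma> = emeasure ?P (E \<sigma>)" for \<sigma>
  have Dsp: "D \<subseteq> space ?P" using sets.sets_into_space[OF assms(2)] .
  have E_meas[measurable]: "E \<sigma> \<in> sets ?P" for \<sigma>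
  proof -
    have "E \<sigma> = D \<inter> {p \<in> space ?P. \<forall>j\<in>J. \<bar>snd p j - \<sigma> * c j\<bar> \<le> w j}" using Dsp by (auto simp: E_def)
    also have "\<dots> \<in> sets ?P" using \<open>finite J\<close> by measurable
    finally show ?thesis .
  qed
  have m_eq: "m \<sigma> = (\<integral>\<^sup>+p. indicator (E \<sigma>) p \<partial>?P)" for \<sigma>
    by (simp only: nn_integral_indicator[OF E_meas] m_def)
  have E_bound: "E \<sigma> \<subseteq> ball 0 R \<times> (\<Pi>\<^sub>E j\<in>J. {- (\<bar>w j\<bar> + K * \<bar>c j\<bar>)..\<bar>w j\<bar> + K * \<bar>c j\<bar>})" if "\<bar>\<sigma>\<bar> \<le> K" for \<sigma> K
  proof
    fix p assume p: "p \<in> E \<sigma>"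
    have "snd p \<in> space (PiM J (\<lambda>_. lborel :: real measure))" using p Dsp by (auto simp: E_def space_pair_measure)
    moreover have "snd p j \<in> {- (\<bar>w j\<bar> + K * \<bar>c j\<bar>)..\<bar>w j\<bar> + K * \<bar>c j\<bar>}" if "j \<in> J" for j
    proof -
      have "\<bar>snd p j - \<sigma> * c j\<bar> \<le> w j" using p that by (auto simp: E_def)
      moreover have "\<bar>\<sigma> * c j\<bar> \<le> K * \<bar>c j\<bar>" using \<open>\<bar>\<sigma>\<bar> \<le> K\<close> by (simp add: abs_mult mult_right_mono)
      ultimately show ?thesis by (auto simp: abs_le_iff)
    qed
    ultimately show "p \<in> ball 0 R \<times> (\<Pi>\<^sub>E j\<in>J. {- (\<bar>w j\<bar> + K * \<bar>c j\<bar>)..\<bar>w j\<bar> + K * \<bar>c j\<bar>})"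
      using p bound by (auto simp: E_def space_PiM PiE_iff mem_Times_iff)
  qed
  have fin: "emeasure ?P (ball 0 R \<times> (\<Pi>\<^sub>E j\<in>J. {- (\<bar>w j\<bar> + K * \<bar>c j\<bar>)..\<bar>w j\<bar> + K * \<bar>c j\<bar>})) < \<infinity>" for K
  proof -
    have "emeasure ?P (ball 0 R \<times> (\<Pi>\<^sub>E j\<in>J. {- (\<bar>w j\<bar> + K * \<bar>c j\<bar>)..\<bar>w j\<bar> + K * \<bar>c j\<bar>}))
      = emeasure lborel (ball (0::'a) R) * (\<Prod>j\<in>J. emeasure lborel {- (\<bar>w j\<bar> + K * \<bar>c j\<bar>)..\<bar>w j\<bar> + K * \<bar>c j\<bar>})"
      using \<open>finite J\<close> by (subst RJ.emeasure_pair_measure_Times) (auto simp: R.emeasure_PiM)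
    also have "\<dots> < \<infinity>"
    proof -
      have "(\<Prod>j\<in>J. emeasure lborel {- (\<bar>w j\<bar> + K * \<bar>c j\<bar>)..\<bar>w j\<bar> + K * \<bar>c j\<bar>}) < top"
        by (simp add: emeasure_lborel_Icc_eq prod_ennreal del: emeasure_lborel_Icc)
      then show ?thesis
        using emeasure_lborel_ball_finite[of "0::'a" R] by (simp add: ennreal_mult_less_top)
    qed
    finally show ?thesis .
  qed
  have bigsets: "ball 0 R \<times> (\<Pi>\<^sub>E j\<in>J. {- (\<bar>w j\<bar> + K * \<bar>c j\<bar>)..\<bar>w j\<bar> + K * \<bar>c j\<bar>}) \<in> sets ?P" for K
    using \<open>finite J\<close> by (auto intro!: pair_measureI sets_PiM_I_finite)
  have pre: "prekopa ?P (\<lambda>p q. ((1/2) *\<^sub>R (fst p + fst q), \<lambda>j\<in>J. (snd p j + snd q j) / 2))"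
    by (intro prekopa_pair prekopa_euclidean prekopa_PiM \<open>finite J\<close>) (auto intro: R.sigma_finite \<open>finite J\<close>)
  \<comment> \<open>The midpoint of a point over the box at \<open>a\<close> and one over the box at
    \<open>b\<close> lies in \<open>D\<close> and over the box at \<open>(a + b) / 2\<close>, so
    Prekopa's inequality applies to the three indicators.\<close>
  have logc: "m a * m b \<le> (m ((a + b) / 2))\<^sup>2" for a b
  proof -
    have "(\<integral>\<^sup>+p. indicator (E a) p \<partial>?P) * (\<integral>\<^sup>+p. indicator (E b) p \<partial>?P) \<le> (\<integral>\<^sup>+p. indicator (E ((a+b)/2)) p \<partial>?P)\<^sup>2"
    proof (rule prekopaD[OF pre])
      fix p q
      have "((1/2) *\<^sub>R (fst p + fst q), \<lambda>j\<in>J. (snd p j + snd q j) / 2) \<in> E ((a + b) / 2)" if "p \<in> E a" "q \<in> E b"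
      proof -
        have "\<bar>(snd p j + snd q j) / 2 - (a + b) / 2 * c j\<bar> \<le> w j" if "j \<in> J" for j
        proof -
          have "\<bar>snd p j - a * c j\<bar> \<le> w j" "\<bar>snd q j - b * c j\<bar> \<le> w j"
            using \<open>p \<in> E a\<close> \<open>q \<in> E b\<close> \<open>j \<in> J\<close> by (auto simp: E_def)
          moreover have "(snd p j + snd q j) / 2 - (a + b) / 2 * c j = ((snd p j - a * c j) + (snd q j - b * c j)) / 2"
            by (simp add: field_simps)
          moreover have "\<bar>(u + v) / 2\<bar> \<le> r" if "\<bar>u\<bar> \<le> r" "\<bar>v\<bar> \<le> r" for u v r :: real
            using that by (auto simp: abs_if field_simps split: if_splits)
          ultimately show ?thesis by (simp only:)
        qed
        then show ?thesis using mid[of "fst p" "snd p" "fst q" "snd q"] that by (auto simp: E_def)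
      qed
      then show "indicator (E a) p * indicator (E b) q \<le>
          (indicator (E ((a+b)/2)) ((1/2) *\<^sub>R (fst p + fst q), \<lambda>j\<in>J. (snd p j + snd q j) / 2) :: ennreal)\<^sup>2"
        by (auto simp: indicator_def)
    qed auto
    then show ?thesis by (simp only: m_eq)
  qed
  \<comment> \<open>Reflection in the origin preserves \<open>D\<close> and both measures and
    carries the box at \<open>\<sigma>\<close> to the box at \<open>- \<sigma>\<close>.\<close>
  have even: "m (- \<sigma>) = m \<sigma>" for \<sigma>
  proof -
    have dR: "distr (PiM J (\<lambda>_. lborel)) (PiM J (\<lambda>_. lborel)) (\<lambda>t. \<lambda>j\<in>J. - t j :: real) = PiM J (\<lambda>_. lborel)"
      by (rule distr_PiM_componentwise)
        (use \<open>finite J\<close> in \<open>auto simp: product_sigma_finite_lborel distr_lborel_uminus_euclidean\<close>)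
    have refl_iff: "((- x, \<lambda>j\<in>J. - t j) \<in> E (-\<sigma>)) = ((x, t) \<in> E \<sigma>)" if "t \<in> space (PiM J (\<lambda>_. lborel :: real measure))" for x t \<sigma>
    proof -
      have tt: "(\<lambda>j\<in>J. - (\<lambda>j\<in>J. - t j) j) = t" using that by (auto simp: space_PiM PiE_def extensional_def fun_eq_iff)
      have "((- x, \<lambda>j\<in>J. - t j) \<in> D) = ((x, t) \<in> D)"
        using sym[of x t] sym[of "-x" "\<lambda>j\<in>J. - t j"] unfolding tt by auto
      moreover have "\<bar>- t j - - \<sigma> * c j\<bar> = \<bar>t j - \<sigma> * c j\<bar>" for j
        by (simp add: abs_minus_commute)
      ultimately show ?thesis by (auto simp: E_def)
    qed
    have "m (-\<sigma>) = (\<integral>\<^sup>+x. (\<integral>\<^sup>+t. indicator (E (-\<sigma>)) (x, t) \<partial>PiM J (\<lambda>_. lborel)) \<partial>lborel)"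
      by (simp add: m_eq RJ.nn_integral_fst)
    also have "\<dots> = (\<integral>\<^sup>+x. (\<integral>\<^sup>+t. indicator (E (-\<sigma>)) (x, t) \<partial>PiM J (\<lambda>_. lborel)) \<partial>distr lborel lborel uminus)"
      by (simp add: distr_lborel_uminus_euclidean)
    also have "\<dots> = (\<integral>\<^sup>+x. (\<integral>\<^sup>+t. indicator (E (-\<sigma>)) (-x, t) \<partial>PiM J (\<lambda>_. lborel)) \<partial>lborel)"
      by (subst nn_integral_distr) auto
    also have "\<dots> = (\<integral>\<^sup>+x. (\<integral>\<^sup>+t. indicator (E (-\<sigma>)) (-x, t) \<partial>distr (PiM J (\<lambda>_. lborel)) (PiM J (\<lambda>_. lborel)) (\<lambda>t. \<lambda>j\<in>J. - t j :: real)) \<partial>lborel)"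
      by (simp only: dR)
    also have "\<dots> = (\<integral>\<^sup>+x. (\<integral>\<^sup>+t. indicator (E (-\<sigma>)) (-x, \<lambda>j\<in>J. - t j) \<partial>PiM J (\<lambda>_. lborel)) \<partial>lborel)"
      by (intro nn_integral_cong, subst nn_integral_distr) auto
    also have "\<dots> = (\<integral>\<^sup>+x. (\<integral>\<^sup>+t. indicator (E \<sigma>) (x, t) \<partial>PiM J (\<lambda>_. lborel)) \<partial>lborel)"
      by (intro nn_integral_cong) (auto simp: indicator_def refl_iff)
    also have "\<dots> = m \<sigma>" by (simp add: m_eq RJ.nn_integral_fst)
    finally show ?thesis .
  qed
  have "m 1 \<le> m s"
  proof (cases "m 1 = 0")
    case False
    \<comment> \<open>Finiteness allows the squares in the midpoint inequality to be compared as
      squares of reals below.\<close>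
    have "m 1 \<noteq> top"
      using le_less_trans[OF emeasure_mono[OF E_bound[of 1 1] bigsets] fin] by (auto simp: m_def)
    have "closed {\<sigma>. m 1 \<le> m \<sigma>}"
      unfolding closed_sequential_limits
    proof (intro allI impI, elim conjE)
      fix x l assume xl: "\<forall>n. x n \<in> {\<sigma>. m 1 \<le> m \<sigma>}" "x \<longlonglongrightarrow> l"
      obtain K where K: "\<And>n. \<bar>x n\<bar> \<le> K"
        using convergent_imp_Bseq[of x] xl(2) unfolding Bseq_def convergent_def by auto
      \<comment> \<open>The sets \<open>F k\<close> decrease to the points that lie in infinitely
        many \<open>E (x n)\<close>; since the inequalities defining the boxes are not strict, these
        points lie in \<open>E l\<close>. Continuity from above is legitimate because all sets share
        one bounded box.\<close>
      define F where "F k = (\<Union>n\<in>{k..}. E (x n))" for k :: nat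
      have F_meas[measurable]: "F k \<in> sets ?P" for k unfolding F_def by (rule sets.countable_UN) (use E_meas in blast)
      have F0: "F k \<subseteq> ball 0 R \<times> (\<Pi>\<^sub>E j\<in>J. {- (\<bar>w j\<bar> + K * \<bar>c j\<bar>)..\<bar>w j\<bar> + K * \<bar>c j\<bar>})" for k
        unfolding F_def using E_bound[OF K] by blast
      have "emeasure ?P (F k) \<noteq> \<infinity>" for k
        using le_less_trans[OF emeasure_mono[OF F0 bigsets] fin, of k] by auto
      moreover have "decseq F"
        unfolding decseq_def F_def by (intro allI impI UN_mono) auto
      ultimately have lim: "(\<lambda>k. emeasure ?P (F k)) \<longlonglongrightarrow> emeasure ?P (\<Inter>k. F k)"
        using F_meas by (intro Lim_emeasure_decseq) blast+
      have "m 1 \<le> emeasure ?P (F k)" for k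
      proof -
        have "m 1 \<le> m (x k)" using xl by auto
        also have "\<dots> \<le> emeasure ?P (F k)" unfolding m_def by (rule emeasure_mono[OF _ F_meas]) (auto simp: F_def)
        finally show ?thesis .
      qed
      then have "m 1 \<le> emeasure ?P (\<Inter>k. F k)" by (intro tendsto_lowerbound[OF lim]) auto
      also have "\<dots> \<le> m l" unfolding m_def
      proof (rule emeasure_mono)
        show "(\<Inter>k. F k) \<subseteq> E l"
        proof
          fix p assume p: "p \<in> (\<Inter>k. F k)"
          have fr: "\<exists>n\<ge>k. p \<in> E (x n)" for k using p by (auto simp: F_def)
          have "\<bar>snd p j - l * c j\<bar> \<le> w j" if "j \<in> J" for j
          proof (rule ccontr)
            assume "\<not> \<bar>snd p j - l * c j\<bar> \<le> w j"
            moreover have "(\<lambda>n. \<bar>snd p j - x n * c j\<bar>) \<longlonglongrightarrow> \<bar>snd p j - l * c j\<bar>"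
              by (intro tendsto_intros xl)
            ultimately have "eventually (\<lambda>n. w j < \<bar>snd p j - x n * c j\<bar>) sequentially"
              by (intro order_tendstoD(1)) auto
            then obtain k where "\<And>n. n \<ge> k \<Longrightarrow> w j < \<bar>snd p j - x n * c j\<bar>"
              by (auto simp: eventually_sequentially)
            then show False using fr[of k] that by (force simp: E_def)
          qed
          moreover have "p \<in> D" using fr[of 0] by (auto simp: E_def)
          ultimately show "p \<in> E l" by (auto simp: E_def)
        qed
      qed (rule E_meas)
      finally show "l \<in> {\<sigma>. m 1 \<le> m \<sigma>}" by simp
    qed
    moreover have "(a + b) / 2 \<in> {\<sigma>. m 1 \<le> m \<sigma>}" if "a \<in> {\<sigma>. m 1 \<le> m \<sigma>}" "b \<in> {\<sigma>. m 1 \<le> m \<sigma>}" for a b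
    proof -
      have "(m 1)\<^sup>2 \<le> m a * m b" using that by (simp add: power2_eq_square mult_mono)
      also note logc[of a b]
      finally have *: "(m 1)\<^sup>2 \<le> (m ((a + b) / 2))\<^sup>2" .
      have "m 1 \<le> m ((a + b) / 2)"
      proof (rule ccontr)
        assume n: "\<not> m 1 \<le> m ((a + b) / 2)"
        obtain u where u: "m 1 = ennreal u" "0 \<le> u" using \<open>m 1 \<noteq> top\<close> by (metis ennreal_cases)
        moreover obtain v where v: "m ((a + b) / 2) = ennreal v" "0 \<le> v"
          using n by (metis ennreal_cases top_greatest)
        ultimately have "v < u" using n by (simp add: ennreal_le_iff not_le)
        then show False using * u v by (simp add: ennreal_power ennreal_le_iff)
      qed
      then show ?thesis by simp
    qed
    \<comment> \<open>Evenness puts -1 beside 1 into the superlevel set, so all positions between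
      them belong to it, in particular \<open>s\<close>.\<close>
    ultimately have "s \<in> {\<sigma>. m 1 \<le> m \<sigma>}"
      by (rule midpoint_closed_Icc[where a="-1" and b=1]) (use s even[of 1] in auto)
    then show ?thesis by simp
  qed auto
  then show ?thesis by (simp add: m_def E_def)
qed

section \<open>Contraction of intervals to the origin\<close>

text \<open>A null set in one factor spans a null cylinder even if the other factors have infinite
  measure, because a product in \<open>ennreal\<close> with a factor 0 is 0.\<close>

lemma AE_PiM_component:
  assumes "finite J" "product_sigma_finite M" "j \<in> J" "AE x in M j. P x"
  shows "AE t in PiM J M. P (t j)"
proof -
  interpret product_sigma_finite M by fact
  obtain N where N: "{x \<in> space (M j). \<not> P x} \<subseteq> N" "N \<in> null_sets (M j)"
    using assms(4) by (auto elim!: AE_E simp: null_sets_def)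
  let ?A = "Pi\<^sub>E J (\<lambda>i. if i = j then N else space (M i))"
  have "emeasure (PiM J M) ?A = (\<Prod>i\<in>J. emeasure (M i) (if i = j then N else space (M i)))"
    using N assms by (intro emeasure_PiM) auto
  also have "\<dots> = 0"
    using N assms by (intro prod_zero) (auto intro!: bexI[of _ j])
  finally have "?A \<in> null_sets (PiM J M)"
    using N assms by (auto simp: null_sets_def intro!: sets_PiM_I_finite)
  then show ?thesis
    by (rule AE_I') (use N \<open>j \<in> J\<close> in \<open>auto simp: space_PiM PiE_iff extensional_def\<close>)
qed

abbreviation iv :: "real \<Rightarrow> real \<Rightarrow> real \<Rightarrow> ennreal" where
  "iv c w \<equiv> indicator {c - w..c + w}"

text \<open>The only property of the kernel that the sliding argument uses. Anderson's inequality
  will supply it; the combinatorics of intervals below is independent of the geometry.\<close>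

definition centers_contract :: "'i set \<Rightarrow> (('i \<Rightarrow> real) \<Rightarrow> ennreal) \<Rightarrow> bool" where
  "centers_contract J G \<longleftrightarrow> (\<forall>c w s. (\<forall>j\<in>J. 0 < w j) \<longrightarrow> 0 \<le> s \<longrightarrow> s \<le> 1 \<longrightarrow>
     (\<integral>\<^sup>+t. G t * (\<Prod>j\<in>J. iv (c j) (w j) (t j)) \<partial>PiM J (\<lambda>_. lborel))
       \<le> (\<integral>\<^sup>+t. G t * (\<Prod>j\<in>J. iv (s * c j) (w j) (t j)) \<partial>PiM J (\<lambda>_. lborel)))"

text \<open>A pair is a centre with a half-width. Distinct intervals may share an endpoint but do
  not overlap further.\<close>

definition separated :: "(real \<times> real) set \<Rightarrow> bool" where
  "separated S \<longleftrightarrow> finite S \<and> (\<forall>p\<in>S. 0 < snd p) \<and> (\<forall>p\<in>S. \<forall>q\<in>S. p \<noteq> q \<longrightarrow> snd p + snd q \<le> \<bar>fst p - fst q\<bar>)"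

lemma iv_measurable [measurable]: "iv c w \<in> borel_measurable borel"
  by measurable

text \<open>A product of sums of intervals is a sum of boxes, one for each choice of an interval in
  every family. The factor \<open>a\<close> moves all centres at once, so the contraction property
  applies box by box.\<close>

lemma nn_integral_prod_sum:
  assumes "finite J" "\<And>j. j \<in> J \<Longrightarrow> finite (S j)"
    and [measurable]: "G \<in> borel_measurable (PiM J (\<lambda>_. lborel))"
  shows "(\<integral>\<^sup>+t. G t * (\<Prod>j\<in>J. \<Sum>p\<in>S j. iv (a * fst p) (snd p) (t j)) \<partial>PiM J (\<lambda>_. lborel))
   = (\<Sum>\<kappa>\<in>Pi\<^sub>E J S. \<integral>\<^sup>+t. G t * (\<Prod>j\<in>J. iv (a * fst (\<kappa> j)) (snd (\<kappa> j)) (t j)) \<partial>PiM J (\<lambda>_. lborel))"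
proof -
  have "(\<integral>\<^sup>+t. G t * (\<Prod>j\<in>J. \<Sum>p\<in>S j. iv (a * fst p) (snd p) (t j)) \<partial>PiM J (\<lambda>_. lborel))
     = (\<integral>\<^sup>+t. (\<Sum>\<kappa>\<in>Pi\<^sub>E J S. G t * (\<Prod>j\<in>J. iv (a * fst (\<kappa> j)) (snd (\<kappa> j)) (t j))) \<partial>PiM J (\<lambda>_. lborel))"
    using assms by (subst prod_sum_PiE) (auto simp: sum_distrib_left)
  also have "\<dots> = (\<Sum>\<kappa>\<in>Pi\<^sub>E J S. \<integral>\<^sup>+t. G t * (\<Prod>j\<in>J. iv (a * fst (\<kappa> j)) (snd (\<kappa> j)) (t j)) \<partial>PiM J (\<lambda>_. lborel))"
    by (rule nn_integral_sum) measurable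
  finally show ?thesis .
qed

text \<open>At the common endpoint \<open>c + w\<close> both intervals count, which is why this
  single point is excluded.\<close>

lemma iv_merge:
  assumes "c' - c = w + w'" "0 < w" "0 < w'" "u \<noteq> c + w"
  shows "iv (c + w') (w + w') u = iv c w u + iv c' w' u"
  using assms by (auto simp: indicator_def)

text \<open>Two intervals touch exactly when the centres are scaled by the ratio of the sum of
  half-widths to the distance of the centres; down to the largest such ratio nothing
  overlaps.\<close>

lemma separated_scale:
  assumes S: "separated S" and s: "0 < s" and le: "\<And>p q. p \<in> S \<Longrightarrow> q \<in> S \<Longrightarrow> p \<noteq> q \<Longrightarrow> (snd p + snd q) / \<bar>fst p - fst q\<bar> \<le> s"
  shows "separated ((\<lambda>p. (s * fst p, snd p)) ` S)" "inj_on (\<lambda>p. (s * fst p, snd p)) S"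
proof -
  have "snd p + snd q \<le> \<bar>s * fst p - s * fst q\<bar>" if "p \<in> S" "q \<in> S" "p \<noteq> q" for p q
  proof -
    have "0 < snd p" "0 < snd q" "snd p + snd q \<le> \<bar>fst p - fst q\<bar>" using S that by (auto simp: separated_def)
    then have "0 < \<bar>fst p - fst q\<bar>" by linarith
    then have "snd p + snd q \<le> s * \<bar>fst p - fst q\<bar>" using le[OF that] by (simp add: field_simps)
    also have "\<dots> = \<bar>s * fst p - s * fst q\<bar>" using s by (simp add: abs_mult flip: right_diff_distrib)
    finally show ?thesis .
  qed
  then show "separated ((\<lambda>p. (s * fst p, snd p)) ` S)"
    using S unfolding separated_def by force
  show "inj_on (\<lambda>p. (s * fst p, snd p)) S"
    using s by (auto simp: inj_on_def prod_eq_iff)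
qed

text \<open>The union of the touching intervals runs from \<open>fst p - snd p\<close> to
  \<open>fst q + snd q\<close>, which has centre \<open>fst p + snd q\<close> and half-width
  \<open>snd p + snd q\<close>. A third interval of positive length does not fit between
  \<open>p\<close> and \<open>q\<close>, so it stays on one side of the union.\<close>

lemma separated_merge:
  assumes S: "separated S" and pq: "p \<in> S" "q \<in> S" "p \<noteq> q" "fst q - fst p = snd p + snd q"
  defines "r \<equiv> (fst p + snd q, snd p + snd q)"
  shows "separated (insert r (S - {p, q}))" "r \<notin> S - {p, q}"
proof -
  have pos: "0 < snd x" if "x \<in> S" for x using S that by (auto simp: separated_def)
  have "snd x + (snd p + snd q) \<le> \<bar>fst x - (fst p + snd q)\<bar>" if "x \<in> S - {p, q}" for x
  proof -
    have "snd x + snd p \<le> \<bar>fst x - fst p\<bar>" "snd x + snd q \<le> \<bar>fst x - fst q\<bar>"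
      using S pq that by (auto simp: separated_def)
    moreover have "0 < snd p" "0 < snd q" "0 < snd x" using pos pq that by auto
    ultimately show ?thesis using pq(4) by (auto simp: abs_if split: if_splits)
  qed
  note * = this
  show "separated (insert r (S - {p, q}))"
    unfolding separated_def
  proof (intro conjI ballI impI)
    show "finite (insert r (S - {p, q}))" using S by (simp add: separated_def)
    show "0 < snd x" if "x \<in> insert r (S - {p, q})" for x
      using that pos[of x] pos[OF pq(1)] pos[OF pq(2)] by (auto simp: r_def)
    show "snd x + snd y \<le> \<bar>fst x - fst y\<bar>"
      if xy: "x \<in> insert r (S - {p, q})" "y \<in> insert r (S - {p, q})" "x \<noteq> y" for x y
    proof -
      consider "x = r" "y \<in> S - {p, q}" | "y = r" "x \<in> S - {p, q}" | "x \<in> S" "y \<in> S" using xy by auto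
      then show ?thesis
      proof cases
        case 1
        then show ?thesis using *[OF 1(2)] unfolding r_def by (simp add: abs_minus_commute add.commute)
      next
        case 2
        then show ?thesis using *[OF 2(2)] unfolding r_def by simp
      next
        case 3
        then show ?thesis using S xy(3) by (simp add: separated_def)
      qed
    qed
  qed
  show "r \<notin> S - {p, q}"
    using *[of r] pos[OF pq(1)] pos[OF pq(2)] by (auto simp: r_def)
qed

text \<open>All centres are scaled towards the origin until two intervals of one family touch; these are merged.\<close>
lemma contract_intervals:
  assumes J: "finite J" and [measurable]: "G \<in> borel_measurable (PiM J (\<lambda>_. lborel))"
    and G: "centers_contract J G"
    and S: "\<And>j. j \<in> J \<Longrightarrow> separated (S j)"
  shows "(\<integral>\<^sup>+t. G t * (\<Prod>j\<in>J. \<Sum>p\<in>S j. iv (fst p) (snd p) (t j)) \<partial>PiM J (\<lambda>_. lborel))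
    \<le> (\<integral>\<^sup>+t. G t * (\<Prod>j\<in>J. iv 0 (\<Sum>p\<in>S j. snd p) (t j)) \<partial>PiM J (\<lambda>_. lborel))"
  using S
proof (induction "\<Sum>j\<in>J. card (S j)" arbitrary: S rule: less_induct)
  case less
  let ?I = "\<lambda>f. integral\<^sup>N (PiM J (\<lambda>_. lborel)) f"
  have fin: "finite (S j)" if "j \<in> J" for j using less.prems that by (auto simp: separated_def)
  \<comment> \<open>The scale factors at which two intervals of the same family touch.\<close>
  define Rt where "Rt = (\<Union>j\<in>J. \<Union>p\<in>S j. \<Union>q\<in>S j - {p}. {(snd p + snd q) / \<bar>fst p - fst q\<bar>})"
  have slide: "?I (\<lambda>t. G t * (\<Prod>j\<in>J. \<Sum>p\<in>S j. iv (fst p) (snd p) (t j)))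
    \<le> ?I (\<lambda>t. G t * (\<Prod>j\<in>J. \<Sum>p\<in>S j. iv (s * fst p) (snd p) (t j)))" if "0 \<le> s" "s \<le> 1" for s
  proof -
    have "?I (\<lambda>t. G t * (\<Prod>j\<in>J. \<Sum>p\<in>S j. iv (1 * fst p) (snd p) (t j)))
       = (\<Sum>\<kappa>\<in>Pi\<^sub>E J S. ?I (\<lambda>t. G t * (\<Prod>j\<in>J. iv (1 * fst (\<kappa> j)) (snd (\<kappa> j)) (t j))))"
      by (rule nn_integral_prod_sum[OF J fin assms(2)])
    also have "\<dots> \<le> (\<Sum>\<kappa>\<in>Pi\<^sub>E J S. ?I (\<lambda>t. G t * (\<Prod>j\<in>J. iv (s * fst (\<kappa> j)) (snd (\<kappa> j)) (t j))))"
    proof (rule sum_mono)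
      fix \<kappa> assume \<kappa>: "\<kappa> \<in> Pi\<^sub>E J S"
      have "\<forall>j\<in>J. 0 < snd (\<kappa> j)" using \<kappa> less.prems by (auto simp: separated_def PiE_iff)
      then show "?I (\<lambda>t. G t * (\<Prod>j\<in>J. iv (1 * fst (\<kappa> j)) (snd (\<kappa> j)) (t j)))
        \<le> ?I (\<lambda>t. G t * (\<Prod>j\<in>J. iv (s * fst (\<kappa> j)) (snd (\<kappa> j)) (t j)))"
        using G[unfolded centers_contract_def, rule_format, of "\<lambda>j. snd (\<kappa> j)" s "\<lambda>j. fst (\<kappa> j)"] that by auto
    qed
    also have "\<dots> = ?I (\<lambda>t. G t * (\<Prod>j\<in>J. \<Sum>p\<in>S j. iv (s * fst p) (snd p) (t j)))"
      by (rule nn_integral_prod_sum[OF J fin assms(2), symmetric])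
    finally show ?thesis by simp
  qed
  show ?case
  proof (cases "\<exists>j\<in>J. S j = {}")
    case True
    then have "(\<Prod>j\<in>J. \<Sum>p\<in>S j. iv (fst p) (snd p) (t j)) = 0" for t :: "'a \<Rightarrow> real"
      using J by (intro prod_zero) (auto intro: bexI[rotated])
    then show ?thesis by (simp only: mult_zero_right nn_integral_const) simp
  next
    case nonempty: False
    show ?thesis
    proof (cases "Rt = {}")
      case True
      \<comment> \<open>No pair is left in any family, so each family is one interval and scaling by
        0 centres it.\<close>
      have "\<exists>p. S j = {p}" if "j \<in> J" for j
      proof -
        obtain p where "p \<in> S j" using nonempty \<open>j \<in> J\<close> by blast
        moreover have "q = p" if "q \<in> S j" for q
        proof (rule ccontr)
          assume "q \<noteq> p"
          then have "(snd p + snd q) / \<bar>fst p - fst q\<bar> \<in> Rt"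
            unfolding Rt_def using \<open>j \<in> J\<close> \<open>p \<in> S j\<close> \<open>q \<in> S j\<close> by blast
          then show False using True by simp
        qed
        ultimately show ?thesis by blast
      qed
      then obtain P where P: "\<And>j. j \<in> J \<Longrightarrow> S j = {P j}" by metis
      have "?I (\<lambda>t. G t * (\<Prod>j\<in>J. \<Sum>p\<in>S j. iv (fst p) (snd p) (t j)))
        \<le> ?I (\<lambda>t. G t * (\<Prod>j\<in>J. \<Sum>p\<in>S j. iv (0 * fst p) (snd p) (t j)))"
        by (rule slide) auto
      also have "\<dots> = ?I (\<lambda>t. G t * (\<Prod>j\<in>J. iv 0 (\<Sum>p\<in>S j. snd p) (t j)))"
        by (intro nn_integral_cong arg_cong[where f="\<lambda>x. G _ * x"] prod.cong) (auto simp: P)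
      finally show ?thesis .
    next
      case False
      have finR: "finite Rt" unfolding Rt_def using J fin by auto
      \<comment> \<open>As the scale decreases from 1, the largest ratio is the first one at which a
        collision occurs; all families are still separated there. Separation at scale 1 gives
        \<open>s \<le> 1\<close>.\<close>
      define s where "s = Max Rt"
      have "s \<in> Rt" using False finR by (auto simp: s_def)
      then obtain j0 p0 q0 where j0: "j0 \<in> J" "p0 \<in> S j0" "q0 \<in> S j0" "p0 \<noteq> q0" "s = (snd p0 + snd q0) / \<bar>fst p0 - fst q0\<bar>"
        unfolding Rt_def by blast
      obtain p q where pq: "p \<in> S j0" "q \<in> S j0" "p \<noteq> q" "s = (snd p + snd q) / \<bar>fst p - fst q\<bar>" "fst p \<le> fst q"
      proof (cases "fst p0 \<le> fst q0")
        case True then show ?thesis using that[of p0 q0] j0 by auto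
      next
        case False then show ?thesis using that[of q0 p0] j0 by (auto simp: abs_minus_commute add.commute)
      qed
      have sep: "snd p + snd q \<le> \<bar>fst p - fst q\<bar>" "0 < snd p" "0 < snd q"
        using less.prems[OF j0(1)] pq(1-3) unfolding separated_def by blast+
      then have "0 < fst q - fst p" "snd p + snd q \<le> fst q - fst p" using pq(5) by auto
      moreover have "s = (snd p + snd q) / (fst q - fst p)" using pq(4,5) by (simp add: abs_if)
      ultimately have s: "0 < s" "s \<le> 1" "s * (fst q - fst p) = snd p + snd q"
        using sep by simp_all
      have sle: "(snd x + snd y) / \<bar>fst x - fst y\<bar> \<le> s" if "j \<in> J" "x \<in> S j" "y \<in> S j" "x \<noteq> y" for j x y
        unfolding s_def using finR that by (intro Max_ge) (auto simp: Rt_def)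
      define T where "T j = (\<lambda>p. (s * fst p, snd p)) ` S j" for j
      have T: "separated (T j)" and inj: "inj_on (\<lambda>p. (s * fst p, snd p)) (S j)" if "j \<in> J" for j
        using separated_scale[OF less.prems[OF that] s(1) sle[OF that]] by (auto simp: T_def)
      define p' q' where "p' = (s * fst p, snd p)" and "q' = (s * fst q, snd q)"
      have p'q': "p' \<in> T j0" "q' \<in> T j0" "p' \<noteq> q'" "fst q' - fst p' = snd p' + snd q'"
        using pq s sep by (auto simp: T_def p'_def q'_def right_diff_distrib prod_eq_iff)
      define r where "r = (fst p' + snd q', snd p' + snd q')"
      define U where "U = T(j0 := insert r (T j0 - {p', q'}))"
      have rm: "separated (insert r (T j0 - {p', q'}))" "r \<notin> T j0 - {p', q'}"
        unfolding r_def using separated_merge[OF T[OF j0(1)] p'q'] by auto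
      have finT: "finite (T j)" if "j \<in> J" for j using T[OF that] by (simp add: separated_def)
      have sum2: "(\<Sum>x\<in>T j0. f x) = f p' + f q' + (\<Sum>x\<in>T j0 - {p', q'}. f x)" for f :: "_ \<Rightarrow> 'z::comm_monoid_add"
        using p'q' finT[OF j0(1)]
        by (subst sum.subset_diff[of "{p', q'}"]) (auto simp: add.commute)
      have sumU: "(\<Sum>x\<in>U j0. f x) = f r + (\<Sum>x\<in>T j0 - {p', q'}. f x)" for f :: "_ \<Rightarrow> 'z::comm_monoid_add"
        using rm finT[OF j0(1)] by (simp add: U_def)
      have "card (U j0) < card (S j0)"
      proof -
        have "card (U j0) = Suc (card (T j0 - {p', q'}))" using rm finT[OF j0(1)] by (simp add: U_def)
        also have "\<dots> < card (T j0)"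
          using p'q' finT[OF j0(1)] card_Diff_subset[of "{p',q'}" "T j0"] card_mono[of "T j0" "{p',q'}"] by auto
        also have "\<dots> = card (S j0)" unfolding T_def using inj[OF j0(1)] by (rule card_image)
        finally show ?thesis .
      qed
      moreover have "card (U j) \<le> card (S j)" if "j \<in> J" "j \<noteq> j0" for j
        using that fin card_image_le by (auto simp: U_def T_def)
      \<comment> \<open>Two intervals of the family \<open>j0\<close> have become one, so the total
        number of intervals, on which the induction runs, drops.\<close>
      ultimately have dec: "(\<Sum>j\<in>J. card (U j)) < (\<Sum>j\<in>J. card (S j))"
        using j0(1) J by (intro sum_strict_mono_ex1) (auto, metis less_imp_le)
      have sepU: "separated (U j)" if "j \<in> J" for j using rm T that by (auto simp: U_def)
      have "?I (\<lambda>t. G t * (\<Prod>j\<in>J. \<Sum>p\<in>S j. iv (fst p) (snd p) (t j)))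
        \<le> ?I (\<lambda>t. G t * (\<Prod>j\<in>J. \<Sum>p\<in>S j. iv (s * fst p) (snd p) (t j)))"
        using s by (intro slide) auto
      also have "\<dots> = ?I (\<lambda>t. G t * (\<Prod>j\<in>J. \<Sum>p\<in>T j. iv (fst p) (snd p) (t j)))"
        using inj by (intro nn_integral_cong arg_cong[where f="\<lambda>x. G _ * x"] prod.cong) (auto simp: T_def sum.reindex)
      also have "\<dots> = ?I (\<lambda>t. G t * (\<Prod>j\<in>J. \<Sum>p\<in>U j. iv (fst p) (snd p) (t j)))"
      proof (rule nn_integral_cong_AE)
        \<comment> \<open>Before merging, the shared endpoint \<open>fst p' + snd p'\<close> is
          counted twice; the two integrands differ at most on that null set.\<close>
        have "AE t in PiM J (\<lambda>_. lborel). t j0 \<noteq> fst p' + snd p'"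
          by (rule AE_PiM_component[OF J product_sigma_finite_lborel j0(1)]) (rule AE_lborel_singleton)
        then show "AE t in PiM J (\<lambda>_. lborel). G t * (\<Prod>j\<in>J. \<Sum>p\<in>T j. iv (fst p) (snd p) (t j))
          = G t * (\<Prod>j\<in>J. \<Sum>p\<in>U j. iv (fst p) (snd p) (t j))"
        proof eventually_elim
          case (elim t)
          have "(\<Sum>p\<in>T j. iv (fst p) (snd p) (t j)) = (\<Sum>p\<in>U j. iv (fst p) (snd p) (t j))" for j
          proof (cases "j = j0")
            case True
            have "iv (fst r) (snd r) (t j0) = iv (fst p') (snd p') (t j0) + iv (fst q') (snd q') (t j0)"
              unfolding r_def fst_conv snd_conv
              by (rule iv_merge) (use p'q' elim sep in \<open>auto simp: p'_def q'_def\<close>)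
            then show ?thesis unfolding True sum2 sumU by simp
          qed (simp add: U_def)
          then show ?case by simp
        qed
      qed
      also have "\<dots> \<le> ?I (\<lambda>t. G t * (\<Prod>j\<in>J. iv 0 (\<Sum>p\<in>U j. snd p) (t j)))"
        by (rule less.hyps[OF dec sepU])
      also have "\<dots> = ?I (\<lambda>t. G t * (\<Prod>j\<in>J. iv 0 (\<Sum>p\<in>S j. snd p) (t j)))"
      proof -
        have "(\<Sum>p\<in>U j. snd p) = (\<Sum>p\<in>S j. snd p)" if "j \<in> J" for j
        proof -
          have "(\<Sum>p\<in>U j. snd p) = (\<Sum>p\<in>T j. snd p)"
          proof (cases "j = j0")
            case True
            then show ?thesis unfolding True sum2 sumU by (simp add: r_def)
          qed (simp add: U_def)
          also have "\<dots> = (\<Sum>p\<in>S j. snd p)"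
            unfolding T_def using inj[OF that] by (simp add: sum.reindex)
          finally show ?thesis .
        qed
        then show ?thesis by (intro nn_integral_cong arg_cong[where f="\<lambda>x. G _ * x"] prod.cong) auto
      qed
      finally show ?thesis .
    qed
  qed
qed

section \<open>Approximation of measurable sets of reals by finite families of intervals\<close>

lemma ennreal_prod_mono:
  fixes f g :: "'i \<Rightarrow> ennreal"
  assumes "\<And>i. i \<in> I \<Longrightarrow> f i \<le> g i"
  shows "(\<Prod>i\<in>I. f i) \<le> (\<Prod>i\<in>I. g i)"
  using assms by (induction I rule: infinite_finite_induct) (auto intro: mult_mono)

lemma iv_mono: "w \<le> w' \<Longrightarrow> iv 0 w u \<le> iv 0 w' u"
  by (auto simp: indicator_def)

lemma iv_eq_open:
  assumes "0 \<le> x" "\<bar>u\<bar> < l \<or> x < \<bar>u\<bar> - l"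
  shows "iv 0 (l + x) u = indicator {- l<..<l} u"
  using assms by (auto simp: indicator_def abs_if split: if_splits)

text \<open>The open interiors are pairwise disjoint even when the closed intervals touch, and their
  lengths are twice the half-widths.\<close>

lemma separated_sum_le:
  assumes S: "separated S" and sub: "\<And>p. p \<in> S \<Longrightarrow> {fst p - snd p..fst p + snd p} \<subseteq> U"
    and [measurable]: "U \<in> sets borel" and fin: "emeasure lborel U < \<infinity>"
  shows "(\<Sum>p\<in>S. snd p) \<le> measure lborel U / 2"
proof -
  let ?I = "\<lambda>p::real\<times>real. {fst p - snd p<..<fst p + snd p}"
  have "disjoint_family_on ?I S"
    unfolding disjoint_family_on_def
  proof (intro ballI impI)
    fix p q assume "p \<in> S" "q \<in> S" "p \<noteq> q"
    then have "snd p + snd q \<le> \<bar>fst p - fst q\<bar>" using S unfolding separated_def by blast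
    then show "?I p \<inter> ?I q = {}" by (auto simp: abs_if split: if_splits)
  qed
  then have "measure lborel (\<Union>p\<in>S. ?I p) = (\<Sum>p\<in>S. measure lborel (?I p))"
    using S by (intro measure_finite_Union) (auto simp: separated_def)
  also have "\<dots> = (\<Sum>p\<in>S. 2 * snd p)"
    using S by (intro sum.cong) (auto simp: separated_def)
  finally have "2 * (\<Sum>p\<in>S. snd p) = measure lborel (\<Union>p\<in>S. ?I p)" by (simp add: sum_distrib_left)
  also have "\<dots> \<le> measure lborel U"
  proof (rule measure_mono_fmeasurable)
    show "(\<Union>p\<in>S. ?I p) \<subseteq> U" using sub by fastforce
    show "U \<in> fmeasurable lborel" using fin by (auto simp: fmeasurable_def)
    show "(\<Union>p\<in>S. ?I p) \<in> sets lborel" using S by (auto simp: separated_def intro!: sets.finite_UN)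
  qed
  finally show ?thesis by simp
qed

text \<open>The dyadic cells of side \<open>2^(-n)\<close> that lie inside \<open>U\<close>, given
  by centre and half-width. The bound \<open>4^n\<close> on the index keeps the family finite while
  the window, of radius about \<open>2^n\<close>, exhausts the line.\<close>

definition cells :: "nat \<Rightarrow> real set \<Rightarrow> (real \<times> real) set" where
  "cells n U = (\<lambda>k::int. ((real_of_int k + 1/2) / 2^n, (1/2) / 2^n)) `
     {k. \<bar>k\<bar> \<le> 4^n \<and> {real_of_int k / 2^n..(real_of_int k + 1) / 2^n} \<subseteq> U}"

lemma separated_cells: "separated (cells n U)"
proof -
  have "finite {k::int. \<bar>k\<bar> \<le> 4^n}"
    by (rule finite_subset[of _ "{- (4^n)..4^n}"]) auto
  then have "finite (cells n U)" unfolding cells_def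
    by (intro finite_imageI) (rule finite_subset[of _ "{k::int. \<bar>k\<bar> \<le> 4^n}"], auto)
  moreover have "snd p + snd q \<le> \<bar>fst p - fst q\<bar>" if pq: "p \<in> cells n U" "q \<in> cells n U" "p \<noteq> q" for p q
  proof -
    obtain k l :: int where kl: "p = ((real_of_int k + 1/2) / 2^n, (1/2) / 2^n)" "q = ((real_of_int l + 1/2) / 2^n, (1/2) / 2^n)"
      using pq unfolding cells_def by blast
    then have "k \<noteq> l" using pq by auto
    then have "1 \<le> \<bar>real_of_int k - real_of_int l\<bar>" by linarith
    then have "1 / 2^n \<le> \<bar>real_of_int k - real_of_int l\<bar> / 2^n" by (intro divide_right_mono) auto
    also have "\<dots> = \<bar>fst p - fst q\<bar>" by (simp add: kl abs_divide flip: diff_divide_distrib)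
    finally show ?thesis by (simp add: kl flip: add_divide_distrib)
  qed
  ultimately show ?thesis by (auto simp: separated_def cells_def)
qed

lemma cells_subset: "p \<in> cells n U \<Longrightarrow> {fst p - snd p..fst p + snd p} \<subseteq> U"
  by (auto simp: cells_def add_divide_distrib)

text \<open>The cell with index \<open>\<lfloor>u * 2^n\<rfloor>\<close> contains \<open>u\<close>
  and fits into \<open>U\<close> once its side is smaller than the distance to the complement. The
  sum may exceed 1, since a dyadic point can lie in two cells.\<close>

lemma eventually_cells_cover:
  assumes "open U" "u \<in> U"
  shows "eventually (\<lambda>n. 1 \<le> (\<Sum>p\<in>cells n U. iv (fst p) (snd p) u)) sequentially"
proof -
  obtain e where e: "0 < e" "ball u e \<subseteq> U" using assms openE by blast
  have "(\<lambda>n. (1/2::real)^n) \<longlonglongrightarrow> 0" by (rule LIMSEQ_realpow_zero) auto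
  then have 1: "eventually (\<lambda>n. (1/2::real)^n < e) sequentially" using e by (intro order_tendstoD) auto
  have 2: "eventually (\<lambda>n. \<bar>u\<bar> + 1 \<le> 2^n) sequentially"
  proof -
    obtain n0 where "\<bar>u\<bar> + 1 < 2^n0" using real_arch_pow[of 2 "\<bar>u\<bar> + 1"] by auto
    then have "\<bar>u\<bar> + 1 \<le> 2^n" if "n \<ge> n0" for n
      using that power_increasing[of n0 n "2::real"] by (meson less_imp_le one_le_numeral order_trans)
    then show ?thesis by (auto simp: eventually_sequentially)
  qed
  from 1 2 show ?thesis
  proof eventually_elim
    case (elim n)
    define k where "k = \<lfloor>u * 2^n\<rfloor>"
    have k: "real_of_int k \<le> u * 2^n" "u * 2^n < real_of_int k + 1" unfolding k_def by linarith+
    have "\<bar>u\<bar> * 2^n + 1 \<le> (\<bar>u\<bar> + 1) * 2^n" by (simp add: distrib_right)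
    also have "\<dots> \<le> 2^n * 2^n" using elim by (intro mult_right_mono) auto
    also have "\<dots> = 4^n" by (simp flip: power_mult_distrib)
    finally have "\<bar>u * 2^n\<bar> + 1 \<le> 4^n" by (simp add: abs_mult)
    then have "\<bar>real_of_int k\<bar> \<le> 4^n" using k by linarith
    then have "real_of_int \<bar>k\<bar> \<le> real_of_int (4^n)" by simp
    then have k4: "\<bar>k\<bar> \<le> 4^n" by (simp only: of_int_le_iff)
    have "{real_of_int k / 2^n..(real_of_int k + 1) / 2^n} \<subseteq> ball u e"
    proof
      fix v assume "v \<in> {real_of_int k / 2^n..(real_of_int k + 1) / 2^n}"
      then have "real_of_int k \<le> v * 2^n" "v * 2^n \<le> real_of_int k + 1" by (auto simp: field_simps)
      then have "\<bar>u * 2^n - v * 2^n\<bar> \<le> 1" using k by linarith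
      then have "\<bar>u - v\<bar> * 2^n \<le> 1" by (simp add: abs_mult flip: left_diff_distrib)
      then have "\<bar>u - v\<bar> \<le> (1/2)^n" by (simp add: power_divide field_simps)
      then show "v \<in> ball u e" using elim by (simp add: dist_real_def)
    qed
    then have cell: "((real_of_int k + 1/2) / 2^n, (1/2) / 2^n) \<in> cells n U"
      using e k4 by (auto simp: cells_def)
    have "iv ((real_of_int k + 1/2) / 2^n) ((1/2) / 2^n) u = 1"
      using k by (auto simp: indicator_def field_simps)
    then have "1 = iv (fst ((real_of_int k + 1/2) / 2^n, (1/2::real) / 2^n)) (snd ((real_of_int k + 1/2) / 2^n, (1/2::real) / 2^n)) u" by simp
    also have "\<dots> \<le> (\<Sum>p\<in>cells n U. iv (fst p) (snd p) u)"
      using cell separated_cells[of n U] by (intro member_le_sum) (auto simp: separated_def)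
    finally show ?case .
  qed
qed

text \<open>Fatou's lemma bounds the left side by the integrals over the dyadic cells inside the
  open sets. Each of these is contracted, and the total length of the cells is at most the measure
  of the open set.\<close>

lemma contract_open:
  assumes J: "finite J" and [measurable]: "G \<in> borel_measurable (PiM J (\<lambda>_. lborel))"
    and G: "centers_contract J G"
    and U: "\<And>j. j \<in> J \<Longrightarrow> open (U j)" "\<And>j. j \<in> J \<Longrightarrow> emeasure lborel (U j) < \<infinity>"
  shows "(\<integral>\<^sup>+t. G t * (\<Prod>j\<in>J. indicator (U j) (t j)) \<partial>PiM J (\<lambda>_. lborel))
    \<le> (\<integral>\<^sup>+t. G t * (\<Prod>j\<in>J. iv 0 (measure lborel (U j) / 2) (t j)) \<partial>PiM J (\<lambda>_. lborel))" (is "_ \<le> ?B")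
proof -
  let ?I = "\<lambda>f. integral\<^sup>N (PiM J (\<lambda>_. lborel)) f"
  let ?g = "\<lambda>n t. G t * (\<Prod>j\<in>J. \<Sum>p\<in>cells n (U j). iv (fst p) (snd p) (t j))"
  have "?I (\<lambda>t. G t * (\<Prod>j\<in>J. indicator (U j) (t j))) \<le> ?I (\<lambda>t. liminf (\<lambda>n. ?g n t))"
  proof (rule nn_integral_mono)
    fix t :: "'a \<Rightarrow> real"
    show "G t * (\<Prod>j\<in>J. indicator (U j) (t j)) \<le> liminf (\<lambda>n. ?g n t)"
    proof (cases "\<forall>j\<in>J. t j \<in> U j")
      case True
      have "eventually (\<lambda>n. \<forall>j\<in>J. 1 \<le> (\<Sum>p\<in>cells n (U j). iv (fst p) (snd p) (t j))) sequentially"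
        using J True U eventually_cells_cover by (intro eventually_ball_finite) auto
      then have "eventually (\<lambda>n. G t \<le> ?g n t) sequentially"
      proof eventually_elim
        case (elim n)
        then have "1 \<le> (\<Prod>j\<in>J. \<Sum>p\<in>cells n (U j). iv (fst p) (snd p) (t j))"
 using ennreal_prod_mono[of J "\<lambda>_. 1" "\<lambda>j. \<Sum>p\<in>cells n (U j). iv (fst p) (snd p) (t j)"] by simp
        then have "G t * 1 \<le> ?g n t" by (intro mult_left_mono) auto
        then show ?case by simp
      qed
      then have "G t \<le> liminf (\<lambda>n. ?g n t)" by (rule Liminf_bounded)
      then show ?thesis using True by simp
    next
      case False
      then have "(\<Prod>j\<in>J. indicator (U j) (t j) :: ennreal) = 0" using J by (intro prod_zero) (auto simp: indicator_def)
      then show ?thesis by (simp only: mult_zero_right zero_le)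
    qed
  qed
  also have "\<dots> \<le> liminf (\<lambda>n. ?I (?g n))"
    by (rule nn_integral_liminf) measurable
  also have "\<dots> \<le> liminf (\<lambda>n. ?B)"
  proof (intro Liminf_mono always_eventually allI)
    fix n
    have "?I (?g n) \<le> ?I (\<lambda>t. G t * (\<Prod>j\<in>J. iv 0 (\<Sum>p\<in>cells n (U j). snd p) (t j)))"
      by (rule contract_intervals[OF J assms(2) G]) (rule separated_cells)
    also have "\<dots> \<le> ?B"
    proof (intro nn_integral_mono mult_left_mono ennreal_prod_mono)
      fix t :: "'a \<Rightarrow> real" and j assume j: "j \<in> J"
      have "(\<Sum>p\<in>cells n (U j). snd p) \<le> measure lborel (U j) / 2"
        using U j by (intro separated_sum_le separated_cells cells_subset) auto
      then show "iv 0 (\<Sum>p\<in>cells n (U j). snd p) (t j) \<le> iv 0 (measure lborel (U j) / 2) (t j)"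
        by (auto simp: indicator_def)
    qed auto
    finally show "?I (?g n) \<le> ?B" .
  qed
  also have "\<dots> = ?B" by (simp add: Liminf_const)
  finally show ?thesis .
qed

text \<open>Open sets containing \<open>A j\<close> with excess at most \<open>1 / (n + 1)\<close>
  give centred closed intervals shrinking to half-length \<open>l j\<close>. The bound
  \<open>K\<close> on the kernel permits dominated convergence, and the open limit interval is the
  form in which \<open>steiner\<close> describes its sections.\<close>

lemma contract_measurable:
  assumes J: "finite J" and [measurable]: "G \<in> borel_measurable (PiM J (\<lambda>_. lborel))"
    and G: "centers_contract J G" and K: "\<And>t. G t \<le> ennreal K"
    and A: "\<And>j. j \<in> J \<Longrightarrow> A j \<in> sets borel" "\<And>j. j \<in> J \<Longrightarrow> emeasure lborel (A j) < \<infinity>"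
  shows "(\<integral>\<^sup>+t. G t * (\<Prod>j\<in>J. indicator (A j) (t j)) \<partial>PiM J (\<lambda>_. lborel))
    \<le> (\<integral>\<^sup>+t. G t * (\<Prod>j\<in>J. indicator {- (measure lborel (A j) / 2)<..<measure lborel (A j) / 2} (t j)) \<partial>PiM J (\<lambda>_. lborel))"
proof -
  let ?I = "\<lambda>f. integral\<^sup>N (PiM J (\<lambda>_. lborel)) f"
  let ?e = "\<lambda>n::nat. 1 / real (Suc n)"
  define l where "l j = measure lborel (A j) / 2" for j
  have l0: "0 \<le> l j" for j by (simp add: l_def)
  let ?h = "\<lambda>n t. G t * (\<Prod>j\<in>J. iv 0 (l j + ?e n) (t j))"
  have le: "?I (\<lambda>t. G t * (\<Prod>j\<in>J. indicator (A j) (t j))) \<le> ?I (?h n)" for n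
  proof -
    have "\<exists>U. open U \<and> A j \<subseteq> U \<and> emeasure lborel U < \<infinity> \<and> measure lborel U \<le> measure lborel (A j) + ?e n" if j: "j \<in> J" for j
    proof -
      obtain U where U: "open U" "A j \<subseteq> U" "emeasure lborel (U - A j) \<le> ennreal (?e n)"
        using outer_regular_lborel_le[OF A(1)[OF j], of "?e n"] by auto
      have "emeasure lborel U = emeasure lborel (A j) + emeasure lborel (U - A j)"
        using U A(1)[OF j] by (subst plus_emeasure) (auto simp: Un_absorb1)
      also have "\<dots> \<le> emeasure lborel (A j) + ennreal (?e n)" using U by (intro add_left_mono)
      also have "\<dots> = ennreal (measure lborel (A j) + ?e n)"
        using A(2)[OF j] by (simp add: emeasure_eq_ennreal_measure)
      finally have *: "emeasure lborel U \<le> ennreal (measure lborel (A j) + ?e n)" .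
      then have "measure lborel U \<le> measure lborel (A j) + ?e n"
        unfolding measure_def[of lborel U] by (intro enn2real_leI) auto
      moreover have "emeasure lborel U < \<infinity>" using * by (auto intro: le_less_trans)
      ultimately show ?thesis using U by blast
    qed
    then obtain U where U: "\<And>j. j \<in> J \<Longrightarrow> open (U j)" "\<And>j. j \<in> J \<Longrightarrow> A j \<subseteq> U j" "\<And>j. j \<in> J \<Longrightarrow> emeasure lborel (U j) < \<infinity>"
      "\<And>j. j \<in> J \<Longrightarrow> measure lborel (U j) \<le> measure lborel (A j) + ?e n" by metis
    have "?I (\<lambda>t. G t * (\<Prod>j\<in>J. indicator (A j) (t j))) \<le> ?I (\<lambda>t. G t * (\<Prod>j\<in>J. indicator (U j) (t j)))"
      using U(2) by (intro nn_integral_mono mult_left_mono ennreal_prod_mono) (auto simp: indicator_def)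
    also have "\<dots> \<le> ?I (\<lambda>t. G t * (\<Prod>j\<in>J. iv 0 (measure lborel (U j) / 2) (t j)))"
      by (rule contract_open[OF J assms(2) G]) (use U in auto)
    also have "\<dots> \<le> ?I (?h n)"
    proof (intro nn_integral_mono mult_left_mono ennreal_prod_mono)
      fix t :: "'a \<Rightarrow> real" and j assume j: "j \<in> J"
      have "measure lborel (U j) / 2 \<le> l j + ?e n / 2"
        using divide_right_mono[OF U(4)[OF j], of 2] unfolding l_def add_divide_distrib by simp
      moreover have "?e n / 2 \<le> ?e n" by (simp add: field_simps)
      ultimately have "measure lborel (U j) / 2 \<le> l j + ?e n" by linarith
      then show "iv 0 (measure lborel (U j) / 2) (t j) \<le> iv 0 (l j + ?e n) (t j)"
        by (auto simp: indicator_def)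
    qed auto
    finally show ?thesis .
  qed
  have "(\<lambda>n. ?I (?h n)) \<longlonglongrightarrow> ?I (\<lambda>t. G t * (\<Prod>j\<in>J. indicator {- l j<..<l j} (t j)))"
  proof (rule nn_integral_dominated_convergence[where w="\<lambda>t. ennreal K * (\<Prod>j\<in>J. iv 0 (l j + 1) (t j))"])
    show "AE t in PiM J (\<lambda>_. lborel). ?h n t \<le> ennreal K * (\<Prod>j\<in>J. iv 0 (l j + 1) (t j))" for n
    proof (intro AE_I2 mult_mono K ennreal_prod_mono)
      fix t :: "'a \<Rightarrow> real" and j
      show "iv 0 (l j + ?e n) (t j) \<le> iv 0 (l j + 1) (t j)"
        by (rule iv_mono) simp
    qed auto
    interpret R: product_sigma_finite "\<lambda>_. lborel :: real measure" by (rule product_sigma_finite_lborel)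
    have "?I (\<lambda>t. ennreal K * (\<Prod>j\<in>J. iv 0 (l j + 1) (t j))) = ennreal K * ?I (\<lambda>t. \<Prod>j\<in>J. iv 0 (l j + 1) (t j))"
      by (rule nn_integral_cmult) measurable
    also have "?I (\<lambda>t. \<Prod>j\<in>J. iv 0 (l j + 1) (t j)) = (\<Prod>j\<in>J. integral\<^sup>N lborel (iv 0 (l j + 1)))"
      by (rule R.product_nn_integral_prod[OF J]) measurable
    also have "ennreal K * (\<Prod>j\<in>J. integral\<^sup>N lborel (iv 0 (l j + 1))) < \<infinity>"
    proof -
      have "integral\<^sup>N lborel (iv 0 (l j + 1)) = ennreal (2 * l j + 2)" for j
        using l0[of j] by (subst nn_integral_indicator) (auto simp del: ennreal_plus)
      then have "(\<Prod>j\<in>J. integral\<^sup>N lborel (iv 0 (l j + 1))) = ennreal (\<Prod>j\<in>J. 2 * l j + 2)"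
        using l0 by (simp only:) (subst prod_ennreal, auto)
      then show ?thesis by (simp add: ennreal_mult_less_top)
    qed
    finally show "?I (\<lambda>t. ennreal K * (\<Prod>j\<in>J. iv 0 (l j + 1) (t j))) < \<infinity>" .
    \<comment> \<open>At the two points with \<open>\<bar>t j\<bar> = l j\<close> the closed
      intervals do not converge to the open one, so they are discarded.\<close>
    have "AE t in PiM J (\<lambda>_. lborel). \<forall>j\<in>J. t j \<noteq> l j \<and> t j \<noteq> - l j"
    proof (subst AE_ball_countable)
      show "\<forall>j\<in>J. AE t in PiM J (\<lambda>_. lborel). t j \<noteq> l j \<and> t j \<noteq> - l j"
      proof
        fix j assume "j \<in> J"
        have "AE u in lborel. u \<noteq> l j \<and> u \<noteq> - l j"
          using AE_lborel_singleton[of "l j"] AE_lborel_singleton[of "- l j"] by eventually_elim auto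
        then show "AE t in PiM J (\<lambda>_. lborel). t j \<noteq> l j \<and> t j \<noteq> - l j"
          by (rule AE_PiM_component[OF J product_sigma_finite_lborel \<open>j \<in> J\<close>])
      qed
    qed (use J in \<open>auto intro: countable_finite\<close>)
    then show "AE t in PiM J (\<lambda>_. lborel). (\<lambda>n. ?h n t) \<longlonglongrightarrow> G t * (\<Prod>j\<in>J. indicator {- l j<..<l j} (t j))"
    proof eventually_elim
      case (elim t)
      have "eventually (\<lambda>n. iv 0 (l j + ?e n) (t j) = indicator {- l j<..<l j} (t j)) sequentially" if "j \<in> J" for j
      proof (cases "\<bar>t j\<bar> < l j")
        case True
        then have "iv 0 (l j + ?e n) (t j) = indicator {- l j<..<l j} (t j)" for n
          by (intro iv_eq_open) auto
        then show ?thesis by simp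
      next
        case False
        then have "l j < \<bar>t j\<bar>" using elim that by (auto simp: abs_if split: if_splits)
        moreover have "?e \<longlonglongrightarrow> 0" by (rule LIMSEQ_Suc[OF lim_1_over_n])
        ultimately have "eventually (\<lambda>n. ?e n < \<bar>t j\<bar> - l j) sequentially"
          by (intro order_tendstoD(2)[of ?e 0]) auto
        then show ?thesis
          by eventually_elim (rule iv_eq_open, auto)
      qed
      then have "eventually (\<lambda>n. \<forall>j\<in>J. iv 0 (l j + ?e n) (t j) = indicator {- l j<..<l j} (t j)) sequentially"
        using J by (intro eventually_ball_finite) auto
      then have "eventually (\<lambda>n. ?h n t = G t * (\<Prod>j\<in>J. indicator {- l j<..<l j} (t j))) sequentially"
        by eventually_elim simp
      then show ?case by (rule tendsto_eventually)
    qed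
  qed measurable
  then have "?I (\<lambda>t. G t * (\<Prod>j\<in>J. indicator (A j) (t j))) \<le> ?I (\<lambda>t. G t * (\<Prod>j\<in>J. indicator {- l j<..<l j} (t j)))"
    by (rule tendsto_lowerbound) (use le in auto)
  then show ?thesis by (simp add: l_def)
qed

section \<open>Steiner symmetrization\<close>

lemma ball_measurable [measurable]: "ball (x::'a::metric_space) e \<in> sets borel"
  by simp

text \<open>The strict inequality makes the sections open centred intervals. A section of infinite
  length has \<open>measure\<close> 0 and would be lost, so the results on volumes and integrals
  below concern bounded sets.\<close>

definition steiner :: "'a::euclidean_space \<Rightarrow> 'a set \<Rightarrow> 'a set" where
  "steiner \<theta> A = {x. 2 * \<bar>x \<bullet> \<theta>\<bar> < measure lborel {t. proj \<theta> x + t *\<^sub>R \<theta> \<in> A}}"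

text \<open>Midpoint convexity is all that the midpoint form of Prekopa's inequality asks for, and
  it survives intersections, which the layering of several functions will need.\<close>

definition sym_midconvex :: "'i set \<Rightarrow> ('i \<Rightarrow> real) set \<Rightarrow> bool" where
  "sym_midconvex J L \<longleftrightarrow> L \<in> sets (PiM J (\<lambda>_. borel)) \<and> (\<forall>x\<in>L. (\<lambda>j\<in>J. - x j) \<in> L) \<and>
     (\<forall>x\<in>L. \<forall>y\<in>L. (\<lambda>j\<in>J. (x j + y j) / 2) \<in> L)"

definition section_integral :: "'i set \<Rightarrow> ('i \<Rightarrow> real) set \<Rightarrow> ('i \<Rightarrow> 'a::euclidean_space set) \<Rightarrow> ennreal" where
  "section_integral J L A = (\<integral>\<^sup>+x. (\<integral>\<^sup>+X. indicator (ball 0 1) x * indicator L (\<lambda>j\<in>J. X j \<bullet> x) * (\<Prod>j\<in>J. indicator (A j) (X j))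
      \<partial>PiM J (\<lambda>_. lborel)) \<partial>lborel)"

lemma sets_steiner [measurable]:
  assumes [measurable]: "A \<in> sets borel"
  shows "steiner \<theta> A \<in> sets borel"
proof -
  have "measure lborel {t. proj \<theta> x + t *\<^sub>R \<theta> \<in> A} = enn2real (\<integral>\<^sup>+t. indicator A (proj \<theta> x + t *\<^sub>R \<theta>) \<partial>lborel)" for x
  proof -
    have "emeasure lborel {t. proj \<theta> x + t *\<^sub>R \<theta> \<in> A} = (\<integral>\<^sup>+t. indicator {t. proj \<theta> x + t *\<^sub>R \<theta> \<in> A} t \<partial>lborel)"
      by (subst nn_integral_indicator) auto
    also have "\<dots> = (\<integral>\<^sup>+t. indicator A (proj \<theta> x + t *\<^sub>R \<theta>) \<partial>lborel)"
      by (intro nn_integral_cong) (auto simp: indicator_def)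
    finally show ?thesis by (simp add: measure_def)
  qed
  then show ?thesis unfolding steiner_def by simp measurable
qed

lemma inner_decompose:
  assumes "norm \<theta> = 1"
  shows "(proj \<theta> y + t *\<^sub>R \<theta>) \<bullet> (proj \<theta> x + s *\<^sub>R \<theta>) = proj \<theta> y \<bullet> proj \<theta> x + t * s"
  using assms proj_inner[OF assms, of y] proj_inner[OF assms, of x]
  by (simp add: inner_add_left inner_add_right inner_commute norm_eq_1)

text \<open>The projection has norm below 1 by orthogonality and the slab contributes at most 1/2.
  Thus all relevant base points lie in one bounded set.\<close>

lemma norm_decompose_less:
  assumes "norm \<theta> = 1" "\<bar>x \<bullet> \<theta>\<bar> \<le> 1/2" "norm (proj \<theta> x + s *\<^sub>R \<theta>) < 1"
  shows "norm x < 2"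
proof -
  have "(norm (proj \<theta> x + s *\<^sub>R \<theta>))\<^sup>2 = (norm (proj \<theta> x))\<^sup>2 + s * s"
    using inner_decompose[OF assms(1), of x s x s] by (simp add: power2_norm_eq_inner)
  then have "(norm (proj \<theta> x))\<^sup>2 \<le> (norm (proj \<theta> x + s *\<^sub>R \<theta>))\<^sup>2" by simp
  then have "norm (proj \<theta> x) < 1" using assms(3) by (meson le_less_trans norm_ge_zero power2_le_imp_le)
  moreover have "x = proj \<theta> x + (x \<bullet> \<theta>) *\<^sub>R \<theta>" by (simp add: proj_def)
  then have "norm x \<le> norm (proj \<theta> x) + \<bar>x \<bullet> \<theta>\<bar>"
    using norm_triangle_ineq[of "proj \<theta> x" "(x \<bullet> \<theta>) *\<^sub>R \<theta>"] assms(1) by simp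
  ultimately show ?thesis using assms(2) by linarith
qed

text \<open>What remains of the integrand when the coordinate \<open>s\<close> of \<open>x\<close>
  along \<open>\<theta>\<close> and the projections of the points \<open>Y j\<close> are fixed and
  the projection of \<open>x\<close> is integrated out: a function of the coordinates
  \<open>t\<close> of the points along \<open>\<theta>\<close>.\<close>

definition line_kernel :: "'i set \<Rightarrow> ('i \<Rightarrow> real) set \<Rightarrow> 'a::euclidean_space \<Rightarrow> real \<Rightarrow> ('i \<Rightarrow> 'a) \<Rightarrow> ('i \<Rightarrow> real) \<Rightarrow> ennreal" where
  "line_kernel J L \<theta> s Y t = (\<integral>\<^sup>+x. indicator (ball 0 1) (proj \<theta> x + s *\<^sub>R \<theta>) *
     indicator L (\<lambda>j\<in>J. proj \<theta> (Y j) \<bullet> proj \<theta> x + t j * s) \<partial>slab_measure \<theta>)"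

lemma line_kernel_bound:
  assumes "norm (\<theta>::'a::euclidean_space) = 1"
  shows "line_kernel J L \<theta> s Y t \<le> ennreal (measure lborel (ball (0::'a) 2))"
proof -
  have "line_kernel J L \<theta> s Y t \<le> (\<integral>\<^sup>+x. indicator (ball 0 1) (proj \<theta> x + s *\<^sub>R \<theta>) \<partial>slab_measure \<theta>)"
    unfolding line_kernel_def by (intro nn_integral_mono) (auto simp: indicator_def)
  also have "\<dots> = (\<integral>\<^sup>+x. indicator {x. \<bar>x \<bullet> \<theta>\<bar> \<le> 1/2} x * indicator (ball 0 1) (proj \<theta> x + s *\<^sub>R \<theta>) \<partial>lborel)"
    by (rule nn_integral_slab) measurable
  also have "\<dots> \<le> (\<integral>\<^sup>+x. indicator (ball (0::'a) 2) x \<partial>lborel)"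
    using norm_decompose_less[OF assms] by (intro nn_integral_mono) (auto simp: indicator_def)
  also have "\<dots> = ennreal (measure lborel (ball (0::'a) 2))"
    using emeasure_lborel_ball_finite[of "0::'a" 2] by (simp add: emeasure_eq_ennreal_measure)
  finally show ?thesis .
qed

lemma line_kernel_measurable [measurable]:
  assumes [measurable]: "L \<in> sets (PiM J (\<lambda>_. borel))"
  shows "line_kernel J L \<theta> s Y \<in> borel_measurable (PiM J (\<lambda>_. lborel))"
proof -
  interpret S: sigma_finite_measure "slab_measure \<theta>" by (rule sigma_finite_slab_measure)
  show ?thesis unfolding line_kernel_def by measurable
qed

text \<open>A box integral of the kernel is the measure of a section of one set \<open>D\<close> of
  pairs \<open>(x, t)\<close>. The inner products depend linearly on such a pair, so
  \<open>D\<close> inherits symmetry and midpoint convexity from \<open>L\<close>, and Anderson's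
  inequality for boxes applies.\<close>

lemma centers_contract_line_kernel:
  fixes J :: "'i set"
  assumes J: "finite J" and L: "sym_midconvex J L" and \<theta>: "norm (\<theta>::'a::euclidean_space) = 1"
  shows "centers_contract J (line_kernel J L \<theta> s Y)"
  unfolding centers_contract_def
proof (intro allI impI)
  fix c w :: "'i \<Rightarrow> real" and \<sigma> :: real
  assume w: "\<forall>j\<in>J. 0 < w j" and \<sigma>: "0 \<le> \<sigma>" "\<sigma> \<le> 1"
  interpret S: sigma_finite_measure "slab_measure \<theta>" by (rule sigma_finite_slab_measure)
  interpret R: product_sigma_finite "\<lambda>_. lborel :: real measure" by (rule product_sigma_finite_lborel)
  interpret RJ: sigma_finite_measure "PiM J (\<lambda>_. lborel :: real measure)" using J by (intro R.sigma_finite)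
  interpret P: pair_sigma_finite "lborel :: 'a measure" "PiM J (\<lambda>_. lborel :: real measure)" by standard
  have [measurable]: "L \<in> sets (PiM J (\<lambda>_. borel))" using L by (simp add: sym_midconvex_def)
  let ?P = "(lborel :: 'a measure) \<Otimes>\<^sub>M PiM J (\<lambda>_. lborel :: real measure)"
  \<comment> \<open>The slab condition is part of \<open>D\<close>, so that
    \<open>slab_measure\<close> becomes Lebesgue measure; it is itself symmetric and convex.\<close>
  define D where "D = {p \<in> space ?P. \<bar>fst p \<bullet> \<theta>\<bar> \<le> 1/2 \<and> proj \<theta> (fst p) + s *\<^sub>R \<theta> \<in> ball 0 1 \<and>
      (\<lambda>j\<in>J. proj \<theta> (Y j) \<bullet> proj \<theta> (fst p) + snd p j * s) \<in> L}"
  have D_meas: "D \<in> sets ?P" unfolding D_def by measurable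
  have eq: "(\<integral>\<^sup>+t. line_kernel J L \<theta> s Y t * (\<Prod>j\<in>J. iv (c j) (w j) (t j)) \<partial>PiM J (\<lambda>_. lborel))
     = emeasure ?P {p \<in> D. \<forall>j\<in>J. \<bar>snd p j - c j\<bar> \<le> w j}" for c
  proof -
    have "(\<integral>\<^sup>+t. line_kernel J L \<theta> s Y t * (\<Prod>j\<in>J. iv (c j) (w j) (t j)) \<partial>PiM J (\<lambda>_. lborel))
      = (\<integral>\<^sup>+t. (\<integral>\<^sup>+x. indicator {p \<in> D. \<forall>j\<in>J. \<bar>snd p j - c j\<bar> \<le> w j} (x, t) \<partial>lborel) \<partial>PiM J (\<lambda>_. lborel))"
    proof (rule nn_integral_cong)
      fix t assume t: "t \<in> space (PiM J (\<lambda>_. lborel :: real measure))"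
      have "line_kernel J L \<theta> s Y t * (\<Prod>j\<in>J. iv (c j) (w j) (t j)) =
        (\<integral>\<^sup>+x. indicator {x. \<bar>x \<bullet> \<theta>\<bar> \<le> 1/2} x * (indicator (ball 0 1) (proj \<theta> x + s *\<^sub>R \<theta>) *
          indicator L (\<lambda>j\<in>J. proj \<theta> (Y j) \<bullet> proj \<theta> x + t j * s)) \<partial>lborel) * (\<Prod>j\<in>J. iv (c j) (w j) (t j))"
        unfolding line_kernel_def by (subst nn_integral_slab) auto
      also have "\<dots> = (\<integral>\<^sup>+x. indicator {x. \<bar>x \<bullet> \<theta>\<bar> \<le> 1/2} x * (indicator (ball 0 1) (proj \<theta> x + s *\<^sub>R \<theta>) *
          indicator L (\<lambda>j\<in>J. proj \<theta> (Y j) \<bullet> proj \<theta> x + t j * s)) * (\<Prod>j\<in>J. iv (c j) (w j) (t j)) \<partial>lborel)"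
        by (rule nn_integral_multc[symmetric]) measurable
      also have "\<dots> = (\<integral>\<^sup>+x. indicator {p \<in> D. \<forall>j\<in>J. \<bar>snd p j - c j\<bar> \<le> w j} (x, t) \<partial>lborel)"
      proof (rule nn_integral_cong)
        fix x
        have pr: "(\<Prod>j\<in>J. iv (c j) (w j) (t j)) = (if \<forall>j\<in>J. \<bar>t j - c j\<bar> \<le> w j then 1 else 0)"
        proof (cases "\<forall>j\<in>J. \<bar>t j - c j\<bar> \<le> w j")
          case True
          then have "iv (c j) (w j) (t j) = 1" if "j \<in> J" for j
            using that by (auto simp: indicator_def abs_diff_le_iff)
          then show ?thesis using True by (simp cong: prod.cong)
        next
          case False
          then obtain j where "j \<in> J" "\<not> \<bar>t j - c j\<bar> \<le> w j" by auto
          then have "iv (c j) (w j) (t j) = 0" by (auto simp: indicator_def abs_diff_le_iff)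
          then have "(\<Prod>j\<in>J. iv (c j) (w j) (t j)) = 0" using J \<open>j \<in> J\<close> by (intro prod_zero) blast+
          then show ?thesis unfolding if_not_P[OF False] .
        qed
        show "indicator {x. \<bar>x \<bullet> \<theta>\<bar> \<le> 1/2} x * (indicator (ball 0 1) (proj \<theta> x + s *\<^sub>R \<theta>) *
          indicator L (\<lambda>j\<in>J. proj \<theta> (Y j) \<bullet> proj \<theta> x + t j * s)) * (\<Prod>j\<in>J. iv (c j) (w j) (t j))
          = indicator {p \<in> D. \<forall>j\<in>J. \<bar>snd p j - c j\<bar> \<le> w j} (x, t)"
          unfolding pr using t by (auto simp: indicator_def D_def space_pair_measure)
      qed
      finally show "line_kernel J L \<theta> s Y t * (\<Prod>j\<in>J. iv (c j) (w j) (t j)) = (\<integral>\<^sup>+x. indicator {p \<in> D. \<forall>j\<in>J. \<bar>snd p j - c j\<bar> \<le> w j} (x, t) \<partial>lborel)" .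
    qed
    also have "\<dots> = emeasure ?P {p \<in> D. \<forall>j\<in>J. \<bar>snd p j - c j\<bar> \<le> w j}"
    proof -
      have "{p \<in> D. \<forall>j\<in>J. \<bar>snd p j - c j\<bar> \<le> w j} = D \<inter> {p \<in> space ?P. \<forall>j\<in>J. \<bar>snd p j - c j\<bar> \<le> w j}"
        by (auto simp: D_def)
      also have "\<dots> \<in> sets ?P" using J D_meas by measurable
      finally have m: "{p \<in> D. \<forall>j\<in>J. \<bar>snd p j - c j\<bar> \<le> w j} \<in> sets ?P" .
      have "(\<integral>\<^sup>+t. (\<integral>\<^sup>+x. indicator {p \<in> D. \<forall>j\<in>J. \<bar>snd p j - c j\<bar> \<le> w j} (x, t) \<partial>lborel) \<partial>PiM J (\<lambda>_. lborel))
        = (\<integral>\<^sup>+p. indicator {p \<in> D. \<forall>j\<in>J. \<bar>snd p j - c j\<bar> \<le> w j} p \<partial>?P)"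
        by (rule P.nn_integral_snd) (intro borel_measurable_indicator m)
      then show ?thesis by (simp only: nn_integral_indicator[OF m])
    qed
    finally show ?thesis .
  qed
  have "emeasure ?P {p \<in> D. \<forall>j\<in>J. \<bar>snd p j - c j\<bar> \<le> w j} \<le> emeasure ?P {p \<in> D. \<forall>j\<in>J. \<bar>snd p j - \<sigma> * c j\<bar> \<le> w j}"
  proof (rule anderson_boxes[OF J D_meas _ _ _ \<sigma>])
    show "D \<subseteq> ball 0 2 \<times> UNIV"
      using norm_decompose_less[OF \<theta>] by (auto simp: D_def)
    fix x t assume xt: "(x, t) \<in> D"
    \<comment> \<open>The norm splits orthogonally into the projection and \<open>s\<close>, so
      changing only the sign of the projection does not change it.\<close>
    have "proj \<theta> (- x) + s *\<^sub>R \<theta> \<in> ball 0 1"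
    proof -
      have "(norm (proj \<theta> (- x) + s *\<^sub>R \<theta>))\<^sup>2 = (norm (proj \<theta> x + s *\<^sub>R \<theta>))\<^sup>2"
        using inner_decompose[OF \<theta>, of x s x s] inner_decompose[OF \<theta>, of "-x" s "-x" s]
        by (simp add: power2_norm_eq_inner proj_uminus)
      then have "norm (proj \<theta> (- x) + s *\<^sub>R \<theta>) = norm (proj \<theta> x + s *\<^sub>R \<theta>)" by simp
      then show ?thesis using xt by (simp add: D_def)
    qed
    moreover have "(\<lambda>j\<in>J. proj \<theta> (Y j) \<bullet> proj \<theta> (- x) + (\<lambda>j\<in>J. - t j) j * s) \<in> L"
    proof -
      have "(\<lambda>j\<in>J. - (\<lambda>j\<in>J. proj \<theta> (Y j) \<bullet> proj \<theta> x + t j * s) j) \<in> L"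
      proof -
        have "(\<lambda>j\<in>J. proj \<theta> (Y j) \<bullet> proj \<theta> x + t j * s) \<in> L" using xt by (simp add: D_def)
        then show ?thesis using L unfolding sym_midconvex_def by blast
      qed
      moreover have "(\<lambda>j\<in>J. - (\<lambda>j\<in>J. proj \<theta> (Y j) \<bullet> proj \<theta> x + t j * s) j) = (\<lambda>j\<in>J. proj \<theta> (Y j) \<bullet> proj \<theta> (- x) + (\<lambda>j\<in>J. - t j) j * s)"
        by (auto simp: fun_eq_iff proj_uminus)
      ultimately show ?thesis by simp
    qed
    ultimately show "(- x, \<lambda>j\<in>J. - t j) \<in> D"
      using xt by (simp add: D_def space_pair_measure space_PiM)
  next
    fix x t y u assume xt: "(x, t) \<in> D" and yu: "(y, u) \<in> D"
    have "proj \<theta> ((1/2) *\<^sub>R (x + y)) + s *\<^sub>R \<theta> = (1/2) *\<^sub>R ((proj \<theta> x + s *\<^sub>R \<theta>) + (proj \<theta> y + s *\<^sub>R \<theta>))"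
    proof -
      have "s *\<^sub>R \<theta> = (1/2) *\<^sub>R (s *\<^sub>R \<theta> + s *\<^sub>R \<theta>)" by (simp only: scaleR_half_double)
      then have "proj \<theta> ((1/2) *\<^sub>R (x + y)) + s *\<^sub>R \<theta> = (1/2) *\<^sub>R (proj \<theta> x + proj \<theta> y) + (1/2) *\<^sub>R (s *\<^sub>R \<theta> + s *\<^sub>R \<theta>)"
        by (simp only: proj_mid)
      then show ?thesis by (simp only: scaleR_add_right add_ac)
    qed
    moreover have "norm ((1/2) *\<^sub>R (a + b)) < 1" if "norm a < 1" "norm b < 1" for a b :: 'a
      using norm_triangle_ineq[of a b] that by simp
    ultimately have "proj \<theta> ((1/2) *\<^sub>R (x + y)) + s *\<^sub>R \<theta> \<in> ball 0 1"
      using xt yu by (simp add: D_def del: norm_scaleR)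
    moreover have "(\<lambda>j\<in>J. proj \<theta> (Y j) \<bullet> proj \<theta> ((1/2) *\<^sub>R (x + y)) + (\<lambda>j\<in>J. (t j + u j) / 2) j * s) \<in> L"
    proof -
      have "(\<lambda>j\<in>J. ((\<lambda>j\<in>J. proj \<theta> (Y j) \<bullet> proj \<theta> x + t j * s) j + (\<lambda>j\<in>J. proj \<theta> (Y j) \<bullet> proj \<theta> y + u j * s) j) / 2) \<in> L"
      proof -
        have "(\<lambda>j\<in>J. proj \<theta> (Y j) \<bullet> proj \<theta> x + t j * s) \<in> L" "(\<lambda>j\<in>J. proj \<theta> (Y j) \<bullet> proj \<theta> y + u j * s) \<in> L"
          using xt yu by (auto simp: D_def)
        then show ?thesis using L unfolding sym_midconvex_def by blast
      qed
      moreover have "(\<lambda>j\<in>J. ((\<lambda>j\<in>J. proj \<theta> (Y j) \<bullet> proj \<theta> x + t j * s) j + (\<lambda>j\<in>J. proj \<theta> (Y j) \<bullet> proj \<theta> y + u j * s) j) / 2)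
        = (\<lambda>j\<in>J. proj \<theta> (Y j) \<bullet> proj \<theta> ((1/2) *\<^sub>R (x + y)) + (\<lambda>j\<in>J. (t j + u j) / 2) j * s)"
        unfolding proj_mid by (auto simp: fun_eq_iff inner_add_right add_divide_distrib distrib_right)
      ultimately show ?thesis by simp
    qed
    moreover have "\<bar>((1/2) *\<^sub>R (x + y)) \<bullet> \<theta>\<bar> \<le> 1/2"
    proof -
      have "\<bar>x \<bullet> \<theta>\<bar> \<le> 1/2" "\<bar>y \<bullet> \<theta>\<bar> \<le> 1/2" using xt yu by (auto simp: D_def)
      then show ?thesis by (auto simp: inner_add_left abs_if split: if_splits)
    qed
    ultimately show "((1/2) *\<^sub>R (x + y), \<lambda>j\<in>J. (t j + u j) / 2) \<in> D"
      by (simp add: D_def space_pair_measure space_PiM)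
  qed
  then show "(\<integral>\<^sup>+t. line_kernel J L \<theta> s Y t * (\<Prod>j\<in>J. iv (c j) (w j) (t j)) \<partial>PiM J (\<lambda>_. lborel))
    \<le> (\<integral>\<^sup>+t. line_kernel J L \<theta> s Y t * (\<Prod>j\<in>J. iv (\<sigma> * c j) (w j) (t j)) \<partial>PiM J (\<lambda>_. lborel))"
    by (simp only: eq)
qed

lemma section_integral_lines:
  fixes A :: "'i \<Rightarrow> 'a::euclidean_space set"
  assumes J: "finite J" and \<theta>: "norm (\<theta>::'a) = 1"
    and [measurable]: "L \<in> sets (PiM J (\<lambda>_. borel))" and A: "\<And>j. j \<in> J \<Longrightarrow> A j \<in> sets borel"
  shows "section_integral J L A = (\<integral>\<^sup>+s. (\<integral>\<^sup>+Y. (\<integral>\<^sup>+t. line_kernel J L \<theta> s Y t *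
      (\<Prod>j\<in>J. indicator (A j) (proj \<theta> (Y j) + t j *\<^sub>R \<theta>)) \<partial>PiM J (\<lambda>_. lborel)) \<partial>PiM J (\<lambda>_. slab_measure \<theta>)) \<partial>lborel)"
proof -
  interpret S: sigma_finite_measure "slab_measure \<theta>" by (rule sigma_finite_slab_measure)
  interpret L': product_sigma_finite "\<lambda>_. lborel :: 'a measure" by (rule product_sigma_finite_lborel)
  interpret R: product_sigma_finite "\<lambda>_. lborel :: real measure" by (rule product_sigma_finite_lborel)
  interpret SJ: product_sigma_finite "\<lambda>_. slab_measure \<theta>" by (rule product_sigma_finite_slab)
  interpret RJ: sigma_finite_measure "PiM J (\<lambda>_. lborel :: real measure)" using J by (intro R.sigma_finite)
  interpret LJ: sigma_finite_measure "PiM J (\<lambda>_. lborel :: 'a measure)" using J by (intro L'.sigma_finite)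
  interpret SJ: sigma_finite_measure "PiM J (\<lambda>_. slab_measure \<theta>)" using J by (intro SJ.sigma_finite)
  interpret P1: pair_sigma_finite "slab_measure \<theta>" "lborel :: real measure" by standard
  interpret P2: pair_sigma_finite "slab_measure \<theta>" "PiM J (\<lambda>_. slab_measure \<theta>)" by standard
  interpret P3: pair_sigma_finite "slab_measure \<theta>" "PiM J (\<lambda>_. lborel :: real measure)" by standard
  \<comment> \<open>Nothing is assumed about \<open>A\<close> off \<open>J\<close>; the empty set as
    default makes every \<open>B j\<close> measurable without changing products over
    \<open>J\<close>. The same device recurs for densities below.\<close>
  define B where "B j = (if j \<in> J then A j else {})" for j
  have [measurable]: "B j \<in> sets borel" for j using A by (auto simp: B_def)
  have prB: "(\<Prod>j\<in>J. indicator (A j) (f j)) = (\<Prod>j\<in>J. indicator (B j) (f j) :: ennreal)" for f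
    by (intro prod.cong) (auto simp: B_def)
  let ?F = "\<lambda>x X. indicator (ball 0 1) x * indicator L (\<lambda>j\<in>J. X j \<bullet> x) * (\<Prod>j\<in>J. indicator (B j) (X j)) :: ennreal"
  let ?q = "\<lambda>Y t. \<lambda>j\<in>J. proj \<theta> (Y j) + t j *\<^sub>R \<theta>"
  let ?H = "\<lambda>x s Y t. indicator (ball 0 1) (proj \<theta> x + s *\<^sub>R \<theta>) * indicator L (\<lambda>j\<in>J. proj \<theta> (Y j) \<bullet> proj \<theta> x + t j * s) *
       (\<Prod>j\<in>J. indicator (B j) (proj \<theta> (Y j) + t j *\<^sub>R \<theta>)) :: ennreal"
  have FH: "?F (proj \<theta> x + s *\<^sub>R \<theta>) (?q Y t) = ?H x s Y t" for x s Y t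
  proof -
    have "(\<lambda>j\<in>J. ?q Y t j \<bullet> (proj \<theta> x + s *\<^sub>R \<theta>)) = (\<lambda>j\<in>J. proj \<theta> (Y j) \<bullet> proj \<theta> x + t j * s)"
      by (auto simp: fun_eq_iff inner_decompose[OF \<theta>])
    then show ?thesis by (simp cong: prod.cong)
  qed
  have "section_integral J L A = (\<integral>\<^sup>+x. (\<integral>\<^sup>+X. ?F x X \<partial>PiM J (\<lambda>_. lborel)) \<partial>lborel)"
    unfolding section_integral_def by (simp only: prB)
  also have "\<dots> = (\<integral>\<^sup>+x. (\<integral>\<^sup>+s. (\<integral>\<^sup>+X. ?F (proj \<theta> x + s *\<^sub>R \<theta>) X \<partial>PiM J (\<lambda>_. lborel)) \<partial>lborel) \<partial>slab_measure \<theta>)"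
    by (rule line_fubini[OF _ \<theta>]) measurable
  also have "\<dots> = (\<integral>\<^sup>+x. (\<integral>\<^sup>+s. (\<integral>\<^sup>+Y. (\<integral>\<^sup>+t. ?F (proj \<theta> x + s *\<^sub>R \<theta>) (?q Y t) \<partial>PiM J (\<lambda>_. lborel)) \<partial>PiM J (\<lambda>_. slab_measure \<theta>)) \<partial>lborel) \<partial>slab_measure \<theta>)"
    by (intro nn_integral_cong line_fubini_PiM[OF J \<theta>]) measurable
  also have "\<dots> = (\<integral>\<^sup>+x. (\<integral>\<^sup>+s. (\<integral>\<^sup>+Y. (\<integral>\<^sup>+t. ?H x s Y t \<partial>PiM J (\<lambda>_. lborel)) \<partial>PiM J (\<lambda>_. slab_measure \<theta>)) \<partial>lborel) \<partial>slab_measure \<theta>)"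
    by (simp only: FH)
  also have "\<dots> = (\<integral>\<^sup>+s. (\<integral>\<^sup>+x. (\<integral>\<^sup>+Y. (\<integral>\<^sup>+t. ?H x s Y t \<partial>PiM J (\<lambda>_. lborel)) \<partial>PiM J (\<lambda>_. slab_measure \<theta>)) \<partial>slab_measure \<theta>) \<partial>lborel)"
    by (rule P1.Fubini'[symmetric]) measurable
  also have "\<dots> = (\<integral>\<^sup>+s. (\<integral>\<^sup>+Y. (\<integral>\<^sup>+x. (\<integral>\<^sup>+t. ?H x s Y t \<partial>PiM J (\<lambda>_. lborel)) \<partial>slab_measure \<theta>) \<partial>PiM J (\<lambda>_. slab_measure \<theta>)) \<partial>lborel)"
    by (intro nn_integral_cong P2.Fubini'[symmetric]) measurable
  also have "\<dots> = (\<integral>\<^sup>+s. (\<integral>\<^sup>+Y. (\<integral>\<^sup>+t. (\<integral>\<^sup>+x. ?H x s Y t \<partial>slab_measure \<theta>) \<partial>PiM J (\<lambda>_. lborel)) \<partial>PiM J (\<lambda>_. slab_measure \<theta>)) \<partial>lborel)"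
    by (intro nn_integral_cong P3.Fubini'[symmetric]) measurable
  also have "\<dots> = (\<integral>\<^sup>+s. (\<integral>\<^sup>+Y. (\<integral>\<^sup>+t. line_kernel J L \<theta> s Y t *
      (\<Prod>j\<in>J. indicator (B j) (proj \<theta> (Y j) + t j *\<^sub>R \<theta>)) \<partial>PiM J (\<lambda>_. lborel)) \<partial>PiM J (\<lambda>_. slab_measure \<theta>)) \<partial>lborel)"
    unfolding line_kernel_def by (intro nn_integral_cong nn_integral_multc) measurable
  finally show ?thesis by (simp only: prB)
qed

lemma emeasure_line_bounded:
  assumes "A \<subseteq> ball 0 R" "norm (\<theta>::'a::euclidean_space) = 1" and [measurable]: "A \<in> sets borel"
  shows "emeasure lborel {t. x + t *\<^sub>R \<theta> \<in> A} < \<infinity>"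
proof -
  have "{t. x + t *\<^sub>R \<theta> \<in> A} \<subseteq> {- (R + norm x)..R + norm x}"
  proof
    fix t assume "t \<in> {t. x + t *\<^sub>R \<theta> \<in> A}"
    then have "norm (x + t *\<^sub>R \<theta>) < R" using assms(1) by (auto simp: subset_iff)
    moreover have "norm (t *\<^sub>R \<theta>) \<le> norm (x + t *\<^sub>R \<theta>) + norm x"
      using norm_triangle_ineq4[of "x + t *\<^sub>R \<theta>" x] by simp
    ultimately have "\<bar>t\<bar> \<le> R + norm x" using assms(2) by simp
    then show "t \<in> {- (R + norm x)..R + norm x}" by auto
  qed
  then have "emeasure lborel {t. x + t *\<^sub>R \<theta> \<in> A} \<le> emeasure lborel {- (R + norm x)..R + norm x}"
    by (intro emeasure_mono) auto
  also have "\<dots> < \<infinity>" by (simp add: emeasure_lborel_Icc_eq)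
  finally show ?thesis .
qed

lemma steiner_line:
  assumes "norm \<theta> = 1"
  shows "indicator (steiner \<theta> A) (proj \<theta> y + t *\<^sub>R \<theta>) =
    indicator {- (measure lborel {t. proj \<theta> y + t *\<^sub>R \<theta> \<in> A} / 2)<..<measure lborel {t. proj \<theta> y + t *\<^sub>R \<theta> \<in> A} / 2} t"
proof -
  have "(proj \<theta> y + t *\<^sub>R \<theta>) \<bullet> \<theta> = t" using proj_inner[OF assms, of y] assms by (simp add: inner_add_left norm_eq_1)
  moreover have "proj \<theta> (proj \<theta> y + t *\<^sub>R \<theta>) = proj \<theta> y"
    by (simp add: proj_add_scale[OF assms] proj_proj[OF assms])
  ultimately show ?thesis by (auto simp: steiner_def indicator_def abs_if split: if_splits)
qed

text \<open>For all fixed \<open>s\<close> and \<open>Y\<close> the sections of the sets along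
  \<open>\<theta>\<close> are contracted to centred intervals of the same length, and these are the
  sections of the symmetrized sets.\<close>

lemma section_integral_steiner:
  fixes A :: "'i \<Rightarrow> 'a::euclidean_space set"
  assumes J: "finite J" and \<theta>: "norm (\<theta>::'a) = 1" and L: "sym_midconvex J L"
    and A: "\<And>j. j \<in> J \<Longrightarrow> A j \<in> sets borel" "\<And>j. j \<in> J \<Longrightarrow> A j \<subseteq> ball 0 R"
  shows "section_integral J L A \<le> section_integral J L (\<lambda>j. steiner \<theta> (A j))"
proof -
  have Lm: "L \<in> sets (PiM J (\<lambda>_. borel))" using L by (simp add: sym_midconvex_def)
  let ?R = "\<lambda>A. (\<integral>\<^sup>+s. (\<integral>\<^sup>+Y. (\<integral>\<^sup>+t. line_kernel J L \<theta> s Y t *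
      (\<Prod>j\<in>J. indicator (A j) (proj \<theta> (Y j) + t j *\<^sub>R \<theta>)) \<partial>PiM J (\<lambda>_. lborel)) \<partial>PiM J (\<lambda>_. slab_measure \<theta>)) \<partial>lborel)"
  have eq: "section_integral J L A = ?R A"
    by (rule section_integral_lines[OF J \<theta> Lm A(1)])
  have eq': "section_integral J L (\<lambda>j. steiner \<theta> (A j)) = ?R (\<lambda>j. steiner \<theta> (A j))"
    by (rule section_integral_lines[OF J \<theta> Lm sets_steiner[OF A(1)]])
  show ?thesis
    unfolding eq eq'
  proof (rule nn_integral_mono, rule nn_integral_mono)
    fix s and Y :: "'i \<Rightarrow> 'a"
    let ?A = "\<lambda>j. {t. proj \<theta> (Y j) + t *\<^sub>R \<theta> \<in> A j}"
    have "(\<integral>\<^sup>+t. line_kernel J L \<theta> s Y t * (\<Prod>j\<in>J. indicator (A j) (proj \<theta> (Y j) + t j *\<^sub>R \<theta>)) \<partial>PiM J (\<lambda>_. lborel))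
       = (\<integral>\<^sup>+t. line_kernel J L \<theta> s Y t * (\<Prod>j\<in>J. indicator (?A j) (t j)) \<partial>PiM J (\<lambda>_. lborel))"
      by (intro nn_integral_cong arg_cong[where f="\<lambda>x. line_kernel _ _ _ _ _ _ * x"] prod.cong) (auto simp: indicator_def)
    also have "\<dots> \<le> (\<integral>\<^sup>+t. line_kernel J L \<theta> s Y t * (\<Prod>j\<in>J. indicator {- (measure lborel (?A j) / 2)<..<measure lborel (?A j) / 2} (t j)) \<partial>PiM J (\<lambda>_. lborel))"
    proof (rule contract_measurable[OF J line_kernel_measurable[OF Lm] centers_contract_line_kernel[OF J L \<theta>] line_kernel_bound[OF \<theta>]])
      fix j assume j: "j \<in> J"
      note A(1)[OF j, measurable]
      show "?A j \<in> sets borel" by measurable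
      show "emeasure lborel (?A j) < \<infinity>" by (rule emeasure_line_bounded[OF A(2)[OF j] \<theta> A(1)[OF j]])
    qed
    also have "\<dots> = (\<integral>\<^sup>+t. line_kernel J L \<theta> s Y t * (\<Prod>j\<in>J. indicator (steiner \<theta> (A j)) (proj \<theta> (Y j) + t j *\<^sub>R \<theta>)) \<partial>PiM J (\<lambda>_. lborel))"
      by (simp only: steiner_line[OF \<theta>])
    finally show "(\<integral>\<^sup>+t. line_kernel J L \<theta> s Y t * (\<Prod>j\<in>J. indicator (A j) (proj \<theta> (Y j) + t j *\<^sub>R \<theta>)) \<partial>PiM J (\<lambda>_. lborel))
      \<le> (\<integral>\<^sup>+t. line_kernel J L \<theta> s Y t * (\<Prod>j\<in>J. indicator (steiner \<theta> (A j)) (proj \<theta> (Y j) + t j *\<^sub>R \<theta>)) \<partial>PiM J (\<lambda>_. lborel))" .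
  qed
qed

section \<open>Gain in overlap with a centred ball under one symmetrization\<close>

definition line_length :: "'a::euclidean_space \<Rightarrow> 'a set \<Rightarrow> 'a \<Rightarrow> real" where
  "line_length \<theta> A x = measure lborel {t. proj \<theta> x + t *\<^sub>R \<theta> \<in> A}"

lemma nn_integral_line:
  assumes "A \<subseteq> ball 0 R" "norm (\<theta>::'a::euclidean_space) = 1" and [measurable]: "A \<in> sets borel"
  shows "(\<integral>\<^sup>+t. indicator A (proj \<theta> x + t *\<^sub>R \<theta>) \<partial>lborel) = ennreal (line_length \<theta> A x)"
proof -
  have "(\<integral>\<^sup>+t. indicator A (proj \<theta> x + t *\<^sub>R \<theta>) \<partial>lborel) = (\<integral>\<^sup>+t. indicator {t. proj \<theta> x + t *\<^sub>R \<theta> \<in> A} t \<partial>lborel)"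
    by (intro nn_integral_cong) (auto simp: indicator_def)
  also have "\<dots> = emeasure lborel {t. proj \<theta> x + t *\<^sub>R \<theta> \<in> A}" by (subst nn_integral_indicator) auto
  also have "\<dots> = ennreal (line_length \<theta> A x)"
    unfolding line_length_def using emeasure_line_bounded[OF assms, of "proj \<theta> x"] by (intro emeasure_eq_ennreal_measure) auto
  finally show ?thesis .
qed

lemma emeasure_lines:
  assumes "A \<subseteq> ball 0 R" "norm (\<theta>::'a::euclidean_space) = 1" and [measurable]: "A \<in> sets borel"
  shows "emeasure lborel A = (\<integral>\<^sup>+x. ennreal (line_length \<theta> A x) \<partial>slab_measure \<theta>)"
proof -
  have "emeasure lborel A = (\<integral>\<^sup>+x. indicator A x \<partial>lborel)" by simp
  also have "\<dots> = (\<integral>\<^sup>+x. (\<integral>\<^sup>+t. indicator A (proj \<theta> x + t *\<^sub>R \<theta>) \<partial>lborel) \<partial>slab_measure \<theta>)"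
    by (rule line_fubini[OF _ assms(2)]) measurable
  finally show ?thesis by (simp only: nn_integral_line[OF assms])
qed

lemma norm_line_sq:
  assumes "norm \<theta> = 1"
  shows "(norm (proj \<theta> x + t *\<^sub>R \<theta>))\<^sup>2 = (norm (proj \<theta> x))\<^sup>2 + t\<^sup>2"
  unfolding power2_norm_eq_inner inner_decompose[OF assms] by (simp add: power2_eq_square)

lemma ball_line:
  assumes "norm \<theta> = 1" "0 \<le> r"
  shows "{t. proj \<theta> x + t *\<^sub>R \<theta> \<in> ball 0 r} = {- (line_length \<theta> (ball 0 r) x / 2)<..<line_length \<theta> (ball 0 r) x / 2}"
    and "line_length \<theta> (ball 0 r) x = 2 * sqrt (max 0 (r\<^sup>2 - (norm (proj \<theta> x))\<^sup>2))"
proof -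
  define c where "c = max 0 (r\<^sup>2 - (norm (proj \<theta> x))\<^sup>2)"
  have eq: "{t. proj \<theta> x + t *\<^sub>R \<theta> \<in> ball 0 r} = {- sqrt c<..<sqrt c}"
  proof (intro set_eqI)
    fix t
    have "t \<in> {t. proj \<theta> x + t *\<^sub>R \<theta> \<in> ball 0 r} \<longleftrightarrow> (norm (proj \<theta> x + t *\<^sub>R \<theta>))\<^sup>2 < r\<^sup>2"
      using power2_less_imp_less[of "norm (proj \<theta> x + t *\<^sub>R \<theta>)" r]
        power_strict_mono[of "norm (proj \<theta> x + t *\<^sub>R \<theta>)" r 2] assms(2) by auto
    also have "\<dots> \<longleftrightarrow> t\<^sup>2 < c"
    proof -
      have "a + s < b \<longleftrightarrow> s < max 0 (b - a)" if "0 \<le> s" for a b s :: real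
        using that by (simp add: max_def) linarith
      then show ?thesis unfolding norm_line_sq[OF assms(1)] c_def by simp
    qed
    also have "\<dots> \<longleftrightarrow> \<bar>t\<bar> < sqrt c" by (metis real_sqrt_abs real_sqrt_less_iff)
    finally show "t \<in> {t. proj \<theta> x + t *\<^sub>R \<theta> \<in> ball 0 r} \<longleftrightarrow> t \<in> {- sqrt c<..<sqrt c}" by auto
  qed
  have "0 \<le> sqrt c" by (simp add: c_def)
  then have ll: "line_length \<theta> (ball 0 r) x = 2 * sqrt c" unfolding line_length_def eq by simp
  then show "{t. proj \<theta> x + t *\<^sub>R \<theta> \<in> ball 0 r} = {- (line_length \<theta> (ball 0 r) x / 2)<..<line_length \<theta> (ball 0 r) x / 2}"
    using eq by simp
  show "line_length \<theta> (ball 0 r) x = 2 * sqrt (max 0 (r\<^sup>2 - (norm (proj \<theta> x))\<^sup>2))"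
    using ll by (simp add: c_def)
qed

lemma line_fmeasurable:
  assumes "A \<subseteq> ball 0 R" "norm (\<theta>::'a::euclidean_space) = 1" and [measurable]: "A \<in> sets borel"
  shows "{t. x + t *\<^sub>R \<theta> \<in> A} \<in> fmeasurable lborel"
proof -
  have "{t. x + t *\<^sub>R \<theta> \<in> A} \<in> sets lborel" by measurable
  then show ?thesis using emeasure_line_bounded[OF assms, of x] by (auto simp: fmeasurable_def)
qed

lemma line_length_mono:
  assumes "A \<subseteq> B" "B \<subseteq> ball 0 R" "norm (\<theta>::'a::euclidean_space) = 1" and [measurable]: "A \<in> sets borel" "B \<in> sets borel"
  shows "line_length \<theta> A x \<le> line_length \<theta> B x"
  unfolding line_length_def
proof (rule measure_mono_fmeasurable)
  show "{t. proj \<theta> x + t *\<^sub>R \<theta> \<in> A} \<in> sets lborel" by measurable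
qed (use assms line_fmeasurable[of B R \<theta>] in auto)

text \<open>A ball already has centred sections, so a shorter centred section stays within the
  section of the ball.\<close>

lemma steiner_subset_ball:
  assumes "A \<subseteq> ball 0 R" "norm (\<theta>::'a::euclidean_space) = 1" and [measurable]: "A \<in> sets borel" and "0 \<le> R"
  shows "steiner \<theta> A \<subseteq> ball 0 R"
proof
  fix x assume x: "x \<in> steiner \<theta> A"
  have "2 * \<bar>x \<bullet> \<theta>\<bar> < line_length \<theta> A x" using x by (simp add: steiner_def line_length_def)
  also have "\<dots> \<le> line_length \<theta> (ball 0 R) x" using assms by (intro line_length_mono) auto
  finally have "x \<bullet> \<theta> \<in> {- (line_length \<theta> (ball 0 R) x / 2)<..<line_length \<theta> (ball 0 R) x / 2}" by (auto simp: abs_if split: if_splits)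
  then have "proj \<theta> x + (x \<bullet> \<theta>) *\<^sub>R \<theta> \<in> ball 0 R" unfolding ball_line(1)[OF assms(2,4), symmetric] by simp
  then show "x \<in> ball 0 R" by (simp add: proj_def)
qed

lemma line_length_nonneg: "0 \<le> line_length \<theta> A x"
  by (simp add: line_length_def)

lemma steiner_line_set:
  assumes "norm \<theta> = 1"
  shows "{t. proj \<theta> x + t *\<^sub>R \<theta> \<in> steiner \<theta> A} = {- (line_length \<theta> A x / 2)<..<line_length \<theta> A x / 2}"
proof (rule set_eqI)
  fix t
  have "(proj \<theta> x + t *\<^sub>R \<theta>) \<bullet> \<theta> = t" using proj_inner[OF assms, of x] assms by (simp add: inner_add_left norm_eq_1)
  moreover have "proj \<theta> (proj \<theta> x + t *\<^sub>R \<theta>) = proj \<theta> x"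
    by (simp add: proj_add_scale[OF assms] proj_proj[OF assms])
  ultimately show "t \<in> {t. proj \<theta> x + t *\<^sub>R \<theta> \<in> steiner \<theta> A} \<longleftrightarrow> t \<in> {- (line_length \<theta> A x / 2)<..<line_length \<theta> A x / 2}"
    by (auto simp: steiner_def line_length_def abs_if split: if_splits)
qed

lemma line_length_steiner:
  assumes "norm \<theta> = 1"
  shows "line_length \<theta> (steiner \<theta> A) x = line_length \<theta> A x"
  using steiner_line_set[OF assms, of x A] line_length_nonneg[of \<theta> A x] by (simp add: line_length_def)

lemma emeasure_steiner:
  assumes "A \<subseteq> ball 0 R" "norm (\<theta>::'a::euclidean_space) = 1" "A \<in> sets borel" "0 \<le> R"
  shows "emeasure lborel (steiner \<theta> A) = emeasure lborel A"
  using emeasure_lines[OF assms(1-3)] emeasure_lines[OF steiner_subset_ball[OF assms] assms(2) sets_steiner[OF assms(3)]]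
  by (simp add: line_length_steiner[OF assms(2)])

text \<open>After symmetrization both sections are centred, hence nested, and their intersection has
  the smaller of the two lengths. With \<open>u\<close> the length of \<open>A\<close> outside the
  ball and \<open>v\<close> the length of the ball outside \<open>A\<close>, the gain is
  \<open>min u v\<close>. The weaker bound \<open>u * v / (2 * R)\<close> is used because it is
  bilinear and therefore can be integrated over lines and directions.\<close>

lemma line_length_steiner_Int_ball:
  fixes \<theta> :: "'a::euclidean_space"
  assumes A: "A \<subseteq> ball 0 R" "A \<in> sets borel" and \<theta>: "norm \<theta> = 1" and r: "0 \<le> r" "r \<le> R" "0 < R"
  shows "line_length \<theta> (A \<inter> ball 0 r) x + line_length \<theta> (A - ball 0 r) x * line_length \<theta> (ball 0 r - A) x / (2 * R)
    \<le> line_length \<theta> (steiner \<theta> A \<inter> ball 0 r) x"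
proof -
  note [measurable] = A(2)
  have bR: "ball (0::'a) r \<subseteq> ball 0 R" using r by auto
  let ?l = "\<lambda>S. {t. proj \<theta> x + t *\<^sub>R \<theta> \<in> S}"
  have split: "line_length \<theta> S x = line_length \<theta> (S \<inter> T) x + line_length \<theta> (S - T) x"
    if S: "S \<subseteq> ball 0 R" and [measurable]: "S \<in> sets borel" "T \<in> sets borel" for S T
  proof -
    have "?l S = ?l (S \<inter> T) \<union> ?l (S - T)" by auto
    moreover have "measure lborel (?l (S \<inter> T) \<union> ?l (S - T)) = measure lborel (?l (S \<inter> T)) + measure lborel (?l (S - T))"
    proof (rule measure_Un3[THEN trans])
      show "?l (S \<inter> T) \<in> fmeasurable lborel" "?l (S - T) \<in> fmeasurable lborel"
        using S \<theta> line_fmeasurable[of "S \<inter> T" R \<theta> "proj \<theta> x"] line_fmeasurable[of "S - T" R \<theta> "proj \<theta> x"] by auto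
      have "?l (S \<inter> T) \<inter> ?l (S - T) = {}" by auto
      then show "measure lborel (?l (S \<inter> T)) + measure lborel (?l (S - T)) - measure lborel (?l (S \<inter> T) \<inter> ?l (S - T)) = measure lborel (?l (S \<inter> T)) + measure lborel (?l (S - T))" by (simp only: measure_empty diff_0_right)
    qed
    ultimately show ?thesis by (simp add: line_length_def)
  qed
  define i u v where "i = line_length \<theta> (A \<inter> ball 0 r) x" and "u = line_length \<theta> (A - ball 0 r) x" and "v = line_length \<theta> (ball 0 r - A) x"
  have lA: "line_length \<theta> A x = i + u" using split[of A "ball 0 r"] A by (simp add: i_def u_def)
  have lB: "line_length \<theta> (ball 0 r) x = i + v" using split[of "ball 0 r" A] A bR by (simp add: i_def v_def Int_commute)
  have R2: "line_length \<theta> S x \<le> 2 * R" if "S \<subseteq> ball 0 R" "S \<in> sets borel" for S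
  proof -
    have "line_length \<theta> S x \<le> line_length \<theta> (ball 0 R) x" using that \<theta> by (intro line_length_mono) auto
    also have "\<dots> = 2 * sqrt (max 0 (R\<^sup>2 - (norm (proj \<theta> x))\<^sup>2))" using ball_line(2)[OF \<theta>, of R x] r by simp
    also have "\<dots> \<le> 2 * sqrt (R\<^sup>2)" by (intro mult_left_mono real_sqrt_le_mono) auto
    finally show ?thesis using r by simp
  qed
  have uv: "0 \<le> u" "0 \<le> v" "u \<le> 2 * R" "v \<le> 2 * R"
    unfolding u_def v_def using A bR by (auto intro!: R2 line_length_nonneg)
  have "?l (steiner \<theta> A \<inter> ball 0 r) = ?l (steiner \<theta> A) \<inter> ?l (ball 0 r)" by auto
  also have "\<dots> = {- (min (i + u) (i + v) / 2)<..<min (i + u) (i + v) / 2}"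
    unfolding steiner_line_set[OF \<theta>] ball_line(1)[OF \<theta> r(1)] lA lB by (auto simp: min_def split: if_splits)
  finally have "line_length \<theta> (steiner \<theta> A \<inter> ball 0 r) x = measure lborel {- (min (i + u) (i + v) / 2)<..<min (i + u) (i + v) / 2}"
    by (simp only: line_length_def)
  also have "\<dots> = i + min u v"
    using uv line_length_nonneg[of \<theta> "A \<inter> ball 0 r" x] by (auto simp: i_def min_def)
  finally have "line_length \<theta> (steiner \<theta> A \<inter> ball 0 r) x = i + min u v" .
  moreover have "u * v / (2 * R) \<le> min u v"
  proof -
    have "u * v \<le> min u v * (2 * R)"
    proof (cases "u \<le> v")
      case True
      then show ?thesis using mult_left_mono[OF uv(4,1)] by simp
    next
      case False
      then show ?thesis using mult_left_mono[OF uv(3,2)] by (simp add: mult.commute)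
    qed
    then show ?thesis using r by (subst pos_divide_le_eq) auto
  qed
  ultimately show ?thesis by (simp add: i_def u_def v_def)
qed

definition line_overlap :: "'a::euclidean_space \<Rightarrow> 'a set \<Rightarrow> 'a set \<Rightarrow> ennreal" where
  "line_overlap v U V = (\<integral>\<^sup>+x. indicator U x * (\<integral>\<^sup>+t. indicator V (x + t *\<^sub>R v) \<partial>lborel) \<partial>lborel)"

text \<open>The inner integral is the same for all starting points on one line, so each line
  contributes the product of the two section lengths.\<close>

lemma line_overlap_eq:
  assumes U: "U \<subseteq> ball 0 R" "V \<subseteq> ball 0 R" and \<theta>: "norm (\<theta>::'a::euclidean_space) = 1" and [measurable]: "U \<in> sets borel" "V \<in> sets borel"
  shows "line_overlap \<theta> U V = (\<integral>\<^sup>+x. ennreal (line_length \<theta> U x * line_length \<theta> V x) \<partial>slab_measure \<theta>)"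
proof -
  have "line_overlap \<theta> U V = (\<integral>\<^sup>+x. (\<integral>\<^sup>+s. indicator U (proj \<theta> x + s *\<^sub>R \<theta>) *
      (\<integral>\<^sup>+t. indicator V (proj \<theta> x + s *\<^sub>R \<theta> + t *\<^sub>R \<theta>) \<partial>lborel) \<partial>lborel) \<partial>slab_measure \<theta>)"
    unfolding line_overlap_def by (rule line_fubini[OF _ \<theta>]) measurable
  also have "\<dots> = (\<integral>\<^sup>+x. (\<integral>\<^sup>+s. indicator U (proj \<theta> x + s *\<^sub>R \<theta>) * ennreal (line_length \<theta> V x) \<partial>lborel) \<partial>slab_measure \<theta>)"
  proof (intro nn_integral_cong)
    fix x s
    have "(\<integral>\<^sup>+t. indicator V (proj \<theta> x + t *\<^sub>R \<theta>) \<partial>lborel) = (\<integral>\<^sup>+t. indicator V (proj \<theta> x + (s + t) *\<^sub>R \<theta>) \<partial>lborel)"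
      by (rule nn_integral_lborel_shift_real) measurable
    then show "indicator U (proj \<theta> x + s *\<^sub>R \<theta>) * (\<integral>\<^sup>+t. indicator V (proj \<theta> x + s *\<^sub>R \<theta> + t *\<^sub>R \<theta>) \<partial>lborel)
      = indicator U (proj \<theta> x + s *\<^sub>R \<theta>) * ennreal (line_length \<theta> V x)"
      by (simp add: nn_integral_line[OF U(2) \<theta>] scaleR_add_left add.assoc)
  qed
  also have "\<dots> = (\<integral>\<^sup>+x. ennreal (line_length \<theta> U x) * ennreal (line_length \<theta> V x) \<partial>slab_measure \<theta>)"
    by (intro nn_integral_cong, subst nn_integral_multc) (auto simp: nn_integral_line[OF U(1) \<theta>])
  finally show ?thesis by (simp add: ennreal_mult line_length_nonneg)
qed

lemma line_length_measurable [measurable]: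
  assumes [measurable]: "A \<in> sets borel"
  shows "line_length \<theta> A \<in> borel_measurable borel"
proof -
  have "line_length \<theta> A x = enn2real (\<integral>\<^sup>+t. indicator A (proj \<theta> x + t *\<^sub>R \<theta>) \<partial>lborel)" for x
  proof -
    have "emeasure lborel {t. proj \<theta> x + t *\<^sub>R \<theta> \<in> A} = (\<integral>\<^sup>+t. indicator {t. proj \<theta> x + t *\<^sub>R \<theta> \<in> A} t \<partial>lborel)"
      by (subst nn_integral_indicator) auto
    also have "\<dots> = (\<integral>\<^sup>+t. indicator A (proj \<theta> x + t *\<^sub>R \<theta>) \<partial>lborel)"
      by (intro nn_integral_cong) (auto simp: indicator_def)
    finally show ?thesis by (simp add: measure_def line_length_def)
  qed
  then have "line_length \<theta> A = (\<lambda>x. enn2real (\<integral>\<^sup>+t. indicator A (proj \<theta> x + t *\<^sub>R \<theta>) \<partial>lborel))" by (rule ext)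
  then show ?thesis by simp
qed

lemma emeasure_steiner_Int_ball:
  fixes \<theta> :: "'a::euclidean_space"
  assumes A: "A \<subseteq> ball 0 R" "A \<in> sets borel" and \<theta>: "norm \<theta> = 1" and r: "0 \<le> r" "r \<le> R" "0 < R"
  shows "emeasure lborel (A \<inter> ball 0 r) + ennreal (1 / (2 * R)) * line_overlap \<theta> (A - ball 0 r) (ball 0 r - A)
    \<le> emeasure lborel (steiner \<theta> A \<inter> ball 0 r)"
proof -
  note [measurable] = A(2)
  have bR: "ball (0::'a) r \<subseteq> ball 0 R" using r by auto
  have "emeasure lborel (A \<inter> ball 0 r) + ennreal (1 / (2 * R)) * line_overlap \<theta> (A - ball 0 r) (ball 0 r - A)
    = (\<integral>\<^sup>+x. ennreal (line_length \<theta> (A \<inter> ball 0 r) x) \<partial>slab_measure \<theta>) +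
      ennreal (1 / (2 * R)) * (\<integral>\<^sup>+x. ennreal (line_length \<theta> (A - ball 0 r) x * line_length \<theta> (ball 0 r - A) x) \<partial>slab_measure \<theta>)"
    using A bR by (subst line_overlap_eq[where R=R], (auto simp: \<theta>)[5]) (subst emeasure_lines[where R=R and \<theta>=\<theta>], auto simp: \<theta>)
  also have "\<dots> = (\<integral>\<^sup>+x. ennreal (line_length \<theta> (A \<inter> ball 0 r) x) + ennreal (1 / (2 * R)) * ennreal (line_length \<theta> (A - ball 0 r) x * line_length \<theta> (ball 0 r - A) x) \<partial>slab_measure \<theta>)"
    by (subst nn_integral_add) (auto simp: nn_integral_cmult)
  also have "\<dots> \<le> (\<integral>\<^sup>+x. ennreal (line_length \<theta> (steiner \<theta> A \<inter> ball 0 r) x) \<partial>slab_measure \<theta>)"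
  proof (rule nn_integral_mono)
    fix x
    have "ennreal (line_length \<theta> (A \<inter> ball 0 r) x) + ennreal (1 / (2 * R)) * ennreal (line_length \<theta> (A - ball 0 r) x * line_length \<theta> (ball 0 r - A) x)
      = ennreal (line_length \<theta> (A \<inter> ball 0 r) x + line_length \<theta> (A - ball 0 r) x * line_length \<theta> (ball 0 r - A) x / (2 * R))"
      using r by (simp add: line_length_nonneg flip: ennreal_mult' ennreal_plus)
    also have "\<dots> \<le> ennreal (line_length \<theta> (steiner \<theta> A \<inter> ball 0 r) x)"
      by (intro ennreal_leI line_length_steiner_Int_ball assms)
    finally show "ennreal (line_length \<theta> (A \<inter> ball 0 r) x) + ennreal (1 / (2 * R)) * ennreal (line_length \<theta> (A - ball 0 r) x * line_length \<theta> (ball 0 r - A) x)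
      \<le> ennreal (line_length \<theta> (steiner \<theta> A \<inter> ball 0 r) x)" .
  qed
  also have "\<dots> = emeasure lborel (steiner \<theta> A \<inter> ball 0 r)"
    using A \<theta> bR by (intro emeasure_lines[symmetric, where R=R]) auto
  finally show ?thesis .
qed

section \<open>Approximation of balls by Steiner symmetrization\<close>

lemma nn_integral_lborel_affine:
  fixes f :: "'a::euclidean_space \<Rightarrow> ennreal"
  assumes [measurable]: "f \<in> borel_measurable borel" and "c \<noteq> 0"
  shows "(\<integral>\<^sup>+y. f y \<partial>lborel) = ennreal (\<bar>c\<bar> ^ DIM('a)) * (\<integral>\<^sup>+v. f (x + c *\<^sub>R v) \<partial>lborel)"
proof -
  have "(\<integral>\<^sup>+y. f y \<partial>lborel) = (\<integral>\<^sup>+y. f y \<partial>density (distr lborel borel (\<lambda>v. x + c *\<^sub>R v)) (\<lambda>_. \<bar>c\<bar> ^ DIM('a)))"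
    using lborel_affine[OF assms(2), of x] by simp
  also have "\<dots> = (\<integral>\<^sup>+y. ennreal (\<bar>c\<bar> ^ DIM('a)) * f y \<partial>distr lborel borel (\<lambda>v. x + c *\<^sub>R v))"
    by (subst nn_integral_density) auto
  also have "\<dots> = (\<integral>\<^sup>+v. ennreal (\<bar>c\<bar> ^ DIM('a)) * f (x + c *\<^sub>R v) \<partial>lborel)"
    by (subst nn_integral_distr) auto
  finally show ?thesis by (simp add: nn_integral_cmult)
qed

text \<open>Averaging over this set of vectors replaces integration over the unit sphere, so that
  only Lebesgue measure occurs.\<close>

definition annulus :: "'a::euclidean_space set" where
  "annulus = {v. 1 \<le> norm v \<and> norm v < 2}"

lemma annulus_measurable [measurable]: "annulus \<in> sets borel"
  unfolding annulus_def by measurable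

lemma nn_integral_dilated_annulus:
  fixes x :: "'a::euclidean_space"
  assumes "0 < t" and [measurable]: "V \<in> sets borel"
  shows "(\<integral>\<^sup>+v. indicator annulus v * indicator V (x + t *\<^sub>R v) \<partial>lborel) =
     (\<integral>\<^sup>+y. ennreal (1 / t ^ DIM('a)) * (indicator annulus ((1/t) *\<^sub>R (y - x)) * indicator V y) \<partial>lborel)"
proof -
  have "(\<integral>\<^sup>+y. indicator annulus ((1/t) *\<^sub>R (y - x)) * indicator V y \<partial>lborel)
    = ennreal (\<bar>t\<bar> ^ DIM('a)) * (\<integral>\<^sup>+v. indicator annulus ((1/t) *\<^sub>R (x + t *\<^sub>R v - x)) * indicator V (x + t *\<^sub>R v) \<partial>lborel)"
    using assms(1) by (intro nn_integral_lborel_affine) auto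
  also have "(\<lambda>v. (1/t) *\<^sub>R (x + t *\<^sub>R v - x)) = (\<lambda>v. v)" using assms(1) by (auto simp: fun_eq_iff)
  finally have *: "(\<integral>\<^sup>+y. indicator annulus ((1/t) *\<^sub>R (y - x)) * indicator V y \<partial>lborel)
    = ennreal (t ^ DIM('a)) * (\<integral>\<^sup>+v. indicator annulus v * indicator V (x + t *\<^sub>R v) \<partial>lborel)"
    using assms(1) by (simp add: fun_eq_iff)
  have "(\<integral>\<^sup>+y. ennreal (1 / t ^ DIM('a)) * (indicator annulus ((1/t) *\<^sub>R (y - x)) * indicator V y) \<partial>lborel)
    = ennreal (1 / t ^ DIM('a)) * (ennreal (t ^ DIM('a)) * (\<integral>\<^sup>+v. indicator annulus v * indicator V (x + t *\<^sub>R v) \<partial>lborel))"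
    by (subst nn_integral_cmult) (auto simp: *)
  also have "\<dots> = (ennreal (1 / t ^ DIM('a)) * ennreal (t ^ DIM('a))) * (\<integral>\<^sup>+v. indicator annulus v * indicator V (x + t *\<^sub>R v) \<partial>lborel)"
    by (simp only: mult.assoc)
  also have "ennreal (1 / t ^ DIM('a)) * ennreal (t ^ DIM('a)) = 1"
    using assms(1) by (simp flip: ennreal_mult')
  finally show ?thesis by simp
qed

text \<open>Substituting \<open>y = x + t v\<close> gives \<open>y\<close> the weight
  \<open>t^(-n)\<close> whenever \<open>(y - x) / t\<close> lies in the annulus. For
  \<open>d = |y - x|\<close> this happens for \<open>d / 2 < t \<le> d\<close>, which contributes at
  least \<open>(d / 2) d^(-n)\<close>. Since \<open>d \<le> 2 R\<close>, this is at least the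
  constant \<open>1/2 (2 R)^(1 - n)\<close>.\<close>

lemma overlap_integral_point:
  fixes x :: "'a::euclidean_space"
  assumes V: "V \<subseteq> ball 0 R" and x: "norm x < R" and [measurable]: "V \<in> sets borel"
  shows "ennreal (1/2 * (1 / (2 * R)) ^ (DIM('a) - 1)) * emeasure lborel V
    \<le> (\<integral>\<^sup>+t. (\<integral>\<^sup>+v. indicator annulus v * indicator V (x + t *\<^sub>R v) \<partial>lborel) \<partial>lborel)"
proof -
  let ?n = "DIM('a)"
  let ?c = "ennreal (1/2 * (1 / (2 * R)) ^ (?n - 1))"
  have R: "0 < R" using x norm_ge_zero[of x] by linarith
  have pt: "?c \<le> (\<integral>\<^sup>+t. indicator {0<..} t * (ennreal (1 / t ^ ?n) * indicator annulus ((1/t) *\<^sub>R (y - x))) \<partial>lborel)"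
    if y: "y \<in> V" "y \<noteq> x" for y
  proof -
    define d where "d = norm (y - x)"
    have d: "0 < d" "d \<le> 2 * R"
      using y x V norm_triangle_ineq4[of y x] by (auto simp: d_def subset_iff)
    have n: "Suc (?n - 1) = ?n" using DIM_positive[where 'a='a] by linarith
    have "(1 / (2 * R)) ^ (?n - 1) \<le> (1 / d) ^ (?n - 1)"
      using d R by (intro power_mono divide_left_mono) auto
    moreover have "1 / d ^ ?n * (d / 2) = 1/2 * (1/d) ^ (?n - 1)"
    proof -
      have "d ^ ?n = d * d ^ (?n - 1)" by (metis n power_Suc)
      then show ?thesis using d by (simp add: power_divide)
    qed
    ultimately have "?c \<le> ennreal (1 / d ^ ?n * (d / 2))"
      by (intro ennreal_leI) simp
    also have "\<dots> = ennreal (1 / d ^ ?n) * emeasure lborel {d/2<..d}"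
      using d by (simp flip: ennreal_mult')
    also have "\<dots> = (\<integral>\<^sup>+t. ennreal (1 / d ^ ?n) * indicator {d/2<..d} t \<partial>lborel)"
      by (simp add: nn_integral_cmult)
    also have "\<dots> \<le> (\<integral>\<^sup>+t. indicator {0<..} t * (ennreal (1 / t ^ ?n) * indicator annulus ((1/t) *\<^sub>R (y - x))) \<partial>lborel)"
    proof (rule nn_integral_mono)
      fix t
      show "ennreal (1 / d ^ ?n) * indicator {d/2<..d} t \<le> indicator {0<..} t * (ennreal (1 / t ^ ?n) * indicator annulus ((1/t) *\<^sub>R (y - x)))"
      proof (cases "t \<in> {d/2<..d}")
        case True
        then have t: "0 < t" "t \<le> d" "d < 2 * t" using d by auto
        have "norm ((1/t) *\<^sub>R (y - x)) = d / t" unfolding norm_scaleR d_def using t by simp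
        moreover have "1 \<le> d / t" "d / t < 2" using t by (auto simp: field_simps)
        ultimately have "(1/t) *\<^sub>R (y - x) \<in> annulus" by (simp only: annulus_def mem_Collect_eq)
        moreover have "1 / d ^ ?n \<le> 1 / t ^ ?n"
          using t d by (intro divide_left_mono power_mono) auto
        ultimately show ?thesis using t by (auto simp: indicator_def intro: ennreal_leI)
      qed simp
    qed
    finally show ?thesis .
  qed
  have "?c * emeasure lborel V = (\<integral>\<^sup>+y. ?c * indicator V y \<partial>lborel)" by (simp add: nn_integral_cmult)
  also have "\<dots> \<le> (\<integral>\<^sup>+y. (\<integral>\<^sup>+t. indicator {0<..} t * (ennreal (1 / t ^ ?n) * indicator annulus ((1/t) *\<^sub>R (y - x))) \<partial>lborel) * indicator V y \<partial>lborel)"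
  proof (rule nn_integral_mono_AE)
    have "AE y in lborel. y \<noteq> x" by (rule AE_lborel_singleton)
    then show "AE y in lborel. ?c * indicator V y \<le> (\<integral>\<^sup>+t. indicator {0<..} t * (ennreal (1 / t ^ ?n) * indicator annulus ((1/t) *\<^sub>R (y - x))) \<partial>lborel) * indicator V y"
      by eventually_elim (use pt in \<open>auto simp: indicator_def\<close>)
  qed
  also have "\<dots> = (\<integral>\<^sup>+y. (\<integral>\<^sup>+t. indicator {0<..} t * (ennreal (1 / t ^ ?n) * (indicator annulus ((1/t) *\<^sub>R (y - x)) * indicator V y)) \<partial>lborel) \<partial>lborel)"
    by (intro nn_integral_cong, subst nn_integral_multc[symmetric]) (auto simp: mult_ac)
  also have "\<dots> = (\<integral>\<^sup>+t. (\<integral>\<^sup>+y. indicator {0<..} t * (ennreal (1 / t ^ ?n) * (indicator annulus ((1/t) *\<^sub>R (y - x)) * indicator V y)) \<partial>lborel) \<partial>lborel)"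
    by (rule lborel_pair.Fubini') measurable
  also have "\<dots> \<le> (\<integral>\<^sup>+t. (\<integral>\<^sup>+v. indicator annulus v * indicator V (x + t *\<^sub>R v) \<partial>lborel) \<partial>lborel)"
  proof (rule nn_integral_mono)
    fix t :: real
    show "(\<integral>\<^sup>+y. indicator {0<..} t * (ennreal (1 / t ^ ?n) * (indicator annulus ((1/t) *\<^sub>R (y - x)) * indicator V y)) \<partial>lborel)
      \<le> (\<integral>\<^sup>+v. indicator annulus v * indicator V (x + t *\<^sub>R v) \<partial>lborel)"
    proof (cases "0 < t")
      case True
      then show ?thesis by (simp add: nn_integral_dilated_annulus[OF True])
    qed simp
  qed
  finally show ?thesis .
qed

lemma overlap_integral:
  fixes U V :: "'a::euclidean_space set"
  assumes U: "U \<subseteq> ball 0 R" "V \<subseteq> ball 0 R" and [measurable]: "U \<in> sets borel" "V \<in> sets borel"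
  shows "ennreal (1/2 * (1 / (2 * R)) ^ (DIM('a) - 1)) * (emeasure lborel U * emeasure lborel V)
    \<le> (\<integral>\<^sup>+v. indicator annulus v * line_overlap v U V \<partial>lborel)"
proof -
  let ?c = "ennreal (1/2 * (1 / (2 * R)) ^ (DIM('a) - 1))"
  have "?c * (emeasure lborel U * emeasure lborel V) = (\<integral>\<^sup>+x. (?c * emeasure lborel V) * indicator U x \<partial>lborel)"
    by (subst nn_integral_cmult) (auto simp: mult_ac)
  also have "\<dots> \<le> (\<integral>\<^sup>+x. (\<integral>\<^sup>+t. (\<integral>\<^sup>+v. indicator annulus v * indicator V (x + t *\<^sub>R v) \<partial>lborel) \<partial>lborel) * indicator U x \<partial>lborel)"
    using overlap_integral_point[OF U(2)] U(1) by (intro nn_integral_mono) (auto simp: indicator_def subset_iff)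
  also have "\<dots> = (\<integral>\<^sup>+x. (\<integral>\<^sup>+v. (\<integral>\<^sup>+t. indicator annulus v * indicator V (x + t *\<^sub>R v) \<partial>lborel) \<partial>lborel) * indicator U x \<partial>lborel)"
    by (intro nn_integral_cong arg_cong[where f="\<lambda>z. z * indicator U _"] lborel_pair.Fubini') measurable
  also have "\<dots> = (\<integral>\<^sup>+x. (\<integral>\<^sup>+v. indicator annulus v * (indicator U x * (\<integral>\<^sup>+t. indicator V (x + t *\<^sub>R v) \<partial>lborel)) \<partial>lborel) \<partial>lborel)"
    by (intro nn_integral_cong, subst nn_integral_multc[symmetric], measurable)
      (intro nn_integral_cong, subst nn_integral_cmult, auto simp: mult_ac)
  also have "\<dots> = (\<integral>\<^sup>+v. (\<integral>\<^sup>+x. indicator annulus v * (indicator U x * (\<integral>\<^sup>+t. indicator V (x + t *\<^sub>R v) \<partial>lborel)) \<partial>lborel) \<partial>lborel)"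
    by (rule lborel_pair.Fubini') measurable
  also have "\<dots> = (\<integral>\<^sup>+v. indicator annulus v * line_overlap v U V \<partial>lborel)"
    unfolding line_overlap_def by (intro nn_integral_cong nn_integral_cmult) measurable
  finally show ?thesis .
qed

text \<open>Normalizing \<open>v\<close> stretches the parameter \<open>t\<close> by
  \<open>norm v\<close>, which is at least 1 on the annulus.\<close>

lemma line_overlap_sgn:
  assumes "v \<in> annulus" and [measurable]: "U \<in> sets borel" "V \<in> sets borel"
  shows "line_overlap v U V \<le> line_overlap (sgn v) U V"
  unfolding line_overlap_def
proof (rule nn_integral_mono, rule mult_left_mono)
  fix x
  have v: "1 \<le> norm v" using assms(1) by (simp add: annulus_def)
  have "(\<integral>\<^sup>+t. indicator V (x + t *\<^sub>R v) \<partial>lborel) \<le> ennreal (norm v) * (\<integral>\<^sup>+t. indicator V (x + t *\<^sub>R v) \<partial>lborel)"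
    using mult_right_mono[of 1 "ennreal (norm v)" "(\<integral>\<^sup>+t. indicator V (x + t *\<^sub>R v) \<partial>lborel)"] v by simp
  also have "\<dots> = ennreal \<bar>norm v\<bar> * (\<integral>\<^sup>+t. indicator V (x + (0 + norm v * t) *\<^sub>R sgn v) \<partial>lborel)"
  proof -
    have "(0 + norm v * t) *\<^sub>R sgn v = t *\<^sub>R v" for t
      using v by (auto simp: sgn_div_norm)
    then show ?thesis by simp
  qed
  also have "\<dots> = (\<integral>\<^sup>+t. indicator V (x + t *\<^sub>R sgn v) \<partial>lborel)"
    using v by (intro nn_integral_real_affine[symmetric]) auto
  finally show "(\<integral>\<^sup>+t. indicator V (x + t *\<^sub>R v) \<partial>lborel) \<le> (\<integral>\<^sup>+t. indicator V (x + t *\<^sub>R sgn v) \<partial>lborel)" .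
qed auto

lemma line_overlap_measurable [measurable]:
  assumes [measurable]: "U \<in> sets borel" "V \<in> sets borel"
  shows "(\<lambda>v. line_overlap v U V) \<in> borel_measurable borel"
  unfolding line_overlap_def by measurable

text \<open>The bound holds on average over the directions of the vectors \<open>v\<close> with \<open>1 \<le> |v| < 2\<close>.\<close>
lemma exists_direction:
  fixes U V :: "'i \<Rightarrow> 'a::euclidean_space set"
  assumes J: "finite J" and R: "0 < R"
    and UV: "\<And>j. j \<in> J \<Longrightarrow> U j \<subseteq> ball 0 R" "\<And>j. j \<in> J \<Longrightarrow> V j \<subseteq> ball 0 R"
      "\<And>j. j \<in> J \<Longrightarrow> U j \<in> sets borel" "\<And>j. j \<in> J \<Longrightarrow> V j \<in> sets borel"
  shows "\<exists>\<theta>. norm \<theta> = 1 \<and> ennreal (1/2 * (1 / (2 * R)) ^ (DIM('a) - 1) / (2 * measure lborel (ball (0::'a) 2))) *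
      (\<Sum>j\<in>J. emeasure lborel (U j) * emeasure lborel (V j)) \<le> (\<Sum>j\<in>J. line_overlap \<theta> (U j) (V j))"
proof (rule ccontr)
  let ?a = "1/2 * (1 / (2 * R)) ^ (DIM('a) - 1)" and ?M = "measure lborel (ball (0::'a) 2)"
  let ?T = "\<Sum>j\<in>J. emeasure lborel (U j) * emeasure lborel (V j)"
  assume neg: "\<not> ?thesis"
  have M: "0 < ?M" "emeasure lborel (ball (0::'a) 2) = ennreal ?M"
    using emeasure_lborel_ball_finite[of "0::'a" 2] by (auto simp: content_ball_pos emeasure_eq_ennreal_measure)
  have a: "0 < ?a" using R by simp
  have lt: "(\<Sum>j\<in>J. line_overlap \<theta> (U j) (V j)) < ennreal (?a / (2 * ?M)) * ?T" if "norm \<theta> = 1" for \<theta>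
    using neg that by (meson not_le)
  have fin: "emeasure lborel S < top" if "S \<subseteq> ball (0::'a) R" "S \<in> sets borel" for S
    using that emeasure_mono[of S "ball 0 R" lborel] emeasure_lborel_ball_finite[of "0::'a" R] by (auto intro: le_less_trans)
  have Tfin: "?T < top" using J UV fin by (auto simp: ennreal_mult_less_top)
  then obtain T where T: "?T = ennreal T" "0 \<le> T" by (metis ennreal_cases less_irrefl)
  obtain b where "b \<in> (Basis::'a set)" using nonempty_Basis by blast
  then have "norm b = 1" by simp
  \<comment> \<open>The assumed strict inequality in any one direction already rules out
    \<open>?T = 0\<close>.\<close>
  from lt[OF this] have "?T \<noteq> 0" by auto
  then have "0 < T" using T by (auto simp: less_le)
  \<comment> \<open>The annulus lies in the ball of radius 2, whose measure is \<open>?M\<close>.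
    Integrating the assumed upper bounds therefore gives \<open>?a * T \<le> ?a * T / 2\<close>; the
    extra factor 2 in the constant is what makes this contradictory.\<close>
  have "ennreal ?a * ?T \<le> (\<Sum>j\<in>J. \<integral>\<^sup>+v. indicator annulus v * line_overlap v (U j) (V j) \<partial>lborel)"
    unfolding sum_distrib_left using UV by (intro sum_mono overlap_integral) auto
  also have "\<dots> = (\<integral>\<^sup>+v. (\<Sum>j\<in>J. indicator annulus v * line_overlap v (U j) (V j)) \<partial>lborel)"
    using UV by (intro nn_integral_sum[symmetric]) auto
  also have "\<dots> \<le> (\<integral>\<^sup>+v. ennreal (?a / (2 * ?M)) * ?T * indicator (ball (0::'a) 2) v \<partial>lborel)"
  proof (rule nn_integral_mono)
    fix v :: 'a
    show "(\<Sum>j\<in>J. indicator annulus v * line_overlap v (U j) (V j)) \<le> ennreal (?a / (2 * ?M)) * ?T * indicator (ball (0::'a) 2) v"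
    proof (cases "v \<in> annulus")
      case True
      then have "norm (sgn v) = 1" "v \<in> ball 0 2" by (auto simp: annulus_def norm_sgn)
      have "(\<Sum>j\<in>J. indicator annulus v * line_overlap v (U j) (V j)) \<le> (\<Sum>j\<in>J. line_overlap (sgn v) (U j) (V j))"
        using True UV line_overlap_sgn[OF True] by (intro sum_mono) auto
      also have "\<dots> \<le> ennreal (?a / (2 * ?M)) * ?T" using lt[OF \<open>norm (sgn v) = 1\<close>] by simp
      finally show ?thesis using \<open>v \<in> ball 0 2\<close> by simp
    qed simp
  qed
  also have "\<dots> = ennreal (?a / (2 * ?M)) * ?T * ennreal ?M"
    using M by (subst nn_integral_cmult) auto
  finally have "ennreal (?a * T) \<le> ennreal (?a / (2 * ?M) * T * ?M)"
    using a M \<open>0 < T\<close> unfolding T by (simp flip: ennreal_mult')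
  then have "?a * T \<le> ?a / (2 * ?M) * T * ?M" using a M \<open>0 < T\<close> by (subst (asm) ennreal_le_iff) auto
  also have "\<dots> = ?a * T / 2" using M by simp
  finally show False using a \<open>0 < T\<close> mult_pos_pos[OF a \<open>0 < T\<close>] by linarith
qed

text \<open>A tuple in the product of the \<open>A j\<close> but outside that of the
  \<open>B j\<close> has some entry in \<open>A k - B k\<close>, while its other entries lie in the
  ball of radius \<open>R\<close>. Summing over \<open>k\<close> bounds the loss.\<close>

lemma section_integral_perturb:
  fixes A B :: "'i \<Rightarrow> 'a::euclidean_space set"
  assumes J: "finite J" and [measurable]: "L \<in> sets (PiM J (\<lambda>_. borel))"
    and A: "\<And>j. j \<in> J \<Longrightarrow> A j \<in> sets borel" "\<And>j. j \<in> J \<Longrightarrow> A j \<subseteq> ball 0 R" and B: "\<And>j. j \<in> J \<Longrightarrow> B j \<in> sets borel"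
  shows "section_integral J L A \<le> section_integral J L B +
     emeasure lborel (ball (0::'a) 1) * emeasure lborel (ball (0::'a) R) ^ (card J - 1) * (\<Sum>k\<in>J. emeasure lborel (A k - B k))"
proof -
  interpret L': product_sigma_finite "\<lambda>_. lborel :: 'a measure" by (rule product_sigma_finite_lborel)
  interpret LJ: sigma_finite_measure "PiM J (\<lambda>_. lborel :: 'a measure)" using J by (intro L'.sigma_finite)
  define A' B' where "A' j = (if j \<in> J then A j else {})" and "B' j = (if j \<in> J then B j else {})" for j
  have [measurable]: "A' j \<in> sets borel" "B' j \<in> sets borel" for j using A B by (auto simp: A'_def B'_def)
  have pr: "(\<Prod>j\<in>J. indicator (A j) (f j)) = (\<Prod>j\<in>J. indicator (A' j) (f j) :: ennreal)"
    "(\<Prod>j\<in>J. indicator (B j) (f j)) = (\<Prod>j\<in>J. indicator (B' j) (f j) :: ennreal)" for f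
    by (auto intro!: prod.cong simp: A'_def B'_def)
  define E where "E k j = (if j = k then A' k - B' k else ball (0::'a) R)" for k j
  have [measurable]: "E k j \<in> sets borel" for k j by (simp add: E_def)
  let ?I = "\<lambda>f. integral\<^sup>N (PiM J (\<lambda>_. lborel)) f"
  let ?b = "\<lambda>x. indicator (ball (0::'a) 1) x :: ennreal"
  let ?w = "\<lambda>x X. ?b x * indicator L (\<lambda>j\<in>J. X j \<bullet> x) :: ennreal"
  have bound: "(\<Prod>j\<in>J. indicator (A' j) (X j)) \<le> (\<Prod>j\<in>J. indicator (B' j) (X j)) + (\<Sum>k\<in>J. \<Prod>j\<in>J. indicator (E k j) (X j) :: ennreal)" for X
  proof (cases "\<forall>j\<in>J. X j \<in> A' j")
    case False
    then have "(\<Prod>j\<in>J. indicator (A' j) (X j) :: ennreal) = 0" using J by (intro prod_zero) (auto simp: indicator_def)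
    then show ?thesis by (simp only: zero_le)
  next
    case True
    then have one: "(\<Prod>j\<in>J. indicator (A' j) (X j) :: ennreal) = 1" by simp
    show ?thesis
    proof (cases "\<forall>j\<in>J. X j \<in> B' j")
      case True
      then have "(\<Prod>j\<in>J. indicator (B' j) (X j) :: ennreal) = 1" by simp
      then show ?thesis unfolding one by simp
    next
      case False
      then obtain k where k: "k \<in> J" "X k \<notin> B' k" by auto
      have "X j \<in> E k j" if "j \<in> J" for j
        using True k that A(2)[OF that] by (auto simp: E_def A'_def)
      then have "(\<Prod>j\<in>J. indicator (E k j) (X j) :: ennreal) = 1" by simp
      moreover have "(\<Prod>j\<in>J. indicator (E k j) (X j) :: ennreal) \<le> (\<Sum>k\<in>J. \<Prod>j\<in>J. indicator (E k j) (X j))"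
        using J k by (intro member_le_sum) auto
      ultimately show ?thesis unfolding one using add_increasing[of "\<Prod>j\<in>J. indicator (B' j) (X j) :: ennreal"] by simp
    qed
  qed
  have "section_integral J L A = (\<integral>\<^sup>+x. ?I (\<lambda>X. ?w x X * (\<Prod>j\<in>J. indicator (A' j) (X j))) \<partial>lborel)"
    unfolding section_integral_def by (simp only: pr)
  also have "\<dots> \<le> (\<integral>\<^sup>+x. ?I (\<lambda>X. ?w x X * (\<Prod>j\<in>J. indicator (B' j) (X j)) + ?b x * (\<Sum>k\<in>J. \<Prod>j\<in>J. indicator (E k j) (X j))) \<partial>lborel)"
  proof (intro nn_integral_mono)
    fix x X
    have "?w x X * (\<Prod>j\<in>J. indicator (A' j) (X j)) \<le> ?w x X * (\<Prod>j\<in>J. indicator (B' j) (X j)) + ?w x X * (\<Sum>k\<in>J. \<Prod>j\<in>J. indicator (E k j) (X j))"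
      unfolding distrib_left[symmetric] by (intro mult_left_mono bound) auto
    also have "\<dots> \<le> ?w x X * (\<Prod>j\<in>J. indicator (B' j) (X j)) + ?b x * (\<Sum>k\<in>J. \<Prod>j\<in>J. indicator (E k j) (X j))"
      by (intro add_left_mono mult_right_mono) (auto simp: indicator_def)
    finally show "?w x X * (\<Prod>j\<in>J. indicator (A' j) (X j)) \<le> ?w x X * (\<Prod>j\<in>J. indicator (B' j) (X j)) + ?b x * (\<Sum>k\<in>J. \<Prod>j\<in>J. indicator (E k j) (X j))" .
  qed
  also have "\<dots> = (\<integral>\<^sup>+x. ?I (\<lambda>X. ?w x X * (\<Prod>j\<in>J. indicator (B' j) (X j))) + ?b x * ?I (\<lambda>X. \<Sum>k\<in>J. \<Prod>j\<in>J. indicator (E k j) (X j)) \<partial>lborel)"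
    by (intro nn_integral_cong, subst nn_integral_add) (auto simp: nn_integral_cmult)
  also have "\<dots> = (\<integral>\<^sup>+x. ?I (\<lambda>X. ?w x X * (\<Prod>j\<in>J. indicator (B' j) (X j))) \<partial>lborel) + (\<integral>\<^sup>+x. ?b x * ?I (\<lambda>X. \<Sum>k\<in>J. \<Prod>j\<in>J. indicator (E k j) (X j)) \<partial>lborel)"
    by (rule nn_integral_add) measurable
  also have "(\<integral>\<^sup>+x. ?I (\<lambda>X. ?w x X * (\<Prod>j\<in>J. indicator (B' j) (X j))) \<partial>lborel) = section_integral J L B"
    unfolding section_integral_def by (simp only: pr)
  also have "(\<integral>\<^sup>+x. ?b x * ?I (\<lambda>X. \<Sum>k\<in>J. \<Prod>j\<in>J. indicator (E k j) (X j)) \<partial>lborel)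
     = emeasure lborel (ball (0::'a) 1) * ?I (\<lambda>X. \<Sum>k\<in>J. \<Prod>j\<in>J. indicator (E k j) (X j))"
    by (subst nn_integral_multc) auto
  also have "?I (\<lambda>X. \<Sum>k\<in>J. \<Prod>j\<in>J. indicator (E k j) (X j)) = (\<Sum>k\<in>J. ?I (\<lambda>X. \<Prod>j\<in>J. indicator (E k j) (X j)))"
    by (rule nn_integral_sum) measurable
  also have "\<dots> = (\<Sum>k\<in>J. emeasure lborel (ball (0::'a) R) ^ (card J - 1) * emeasure lborel (A k - B k))"
  proof (rule sum.cong)
    fix k assume k: "k \<in> J"
    have "?I (\<lambda>X. \<Prod>j\<in>J. indicator (E k j) (X j)) = (\<Prod>j\<in>J. integral\<^sup>N lborel (indicator (E k j)))"
      by (rule L'.product_nn_integral_prod[OF J]) measurable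
    also have "\<dots> = (\<Prod>j\<in>J. emeasure lborel (E k j))" by simp
    also have "\<dots> = emeasure lborel (E k k) * (\<Prod>j\<in>J - {k}. emeasure lborel (E k j))"
      using J k by (rule prod.remove)
    also have "(\<Prod>j\<in>J - {k}. emeasure lborel (E k j)) = (\<Prod>j\<in>J - {k}. emeasure lborel (ball (0::'a) R))"
      by (rule prod.cong) (auto simp: E_def)
    finally show "?I (\<lambda>X. \<Prod>j\<in>J. indicator (E k j) (X j)) = emeasure lborel (ball (0::'a) R) ^ (card J - 1) * emeasure lborel (A k - B k)"
      using k J by (simp add: E_def A'_def B'_def mult.commute)
  qed simp
  finally show ?thesis by (simp add: sum_distrib_left mult.assoc)
qed

text \<open>Over all tuples of sets with these volumes and no smaller section integral, the infimum of the total
  distance to the balls is zero: a positive infimum could be undercut by one further symmetrization in the direction of \<open>exists_direction\<close>.\<close>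
lemma section_integral_balls_bounded:
  fixes A :: "'i \<Rightarrow> 'a::euclidean_space set"
  assumes J: "finite J" and L: "sym_midconvex J L" and R: "0 < R"
    and A: "\<And>j. j \<in> J \<Longrightarrow> A j \<in> sets borel" "\<And>j. j \<in> J \<Longrightarrow> A j \<subseteq> ball 0 R"
    and r: "\<And>j. j \<in> J \<Longrightarrow> 0 \<le> r j \<and> r j \<le> R" "\<And>j. j \<in> J \<Longrightarrow> emeasure lborel (ball (0::'a) (r j)) = emeasure lborel (A j)"
  shows "section_integral J L A \<le> section_integral J L (\<lambda>j. ball (0::'a) (r j))"
proof (cases "J = {}")
  case True
  then show ?thesis by (simp add: section_integral_def)
next
  case False
  then have cJ: "0 < card J" using J by (simp add: card_gt_0_iff)
  have Lm: "L \<in> sets (PiM J (\<lambda>_. borel))" using L by (simp add: sym_midconvex_def)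
  let ?B = "\<lambda>j. ball (0::'a) (r j)"
  \<comment> \<open>The competitors of the minimization: tuples of the right volumes whose section
    integral is at least that of \<open>A\<close>.\<close>
  define C where "C A' \<longleftrightarrow> (\<forall>j\<in>J. A' j \<in> sets borel \<and> A' j \<subseteq> ball 0 R \<and> emeasure lborel (A' j) = emeasure lborel (A j)) \<and>
     section_integral J L A \<le> section_integral J L A'" for A' :: "'i \<Rightarrow> 'a set"
  define \<delta> where "\<delta> A' = (\<Sum>j\<in>J. measure lborel (?B j - A' j))" for A' :: "'i \<Rightarrow> 'a set"
  have fm: "S \<in> fmeasurable lborel" if "S \<subseteq> ball (0::'a) R" "S \<in> sets borel" for S
    using that emeasure_mono[of S "ball 0 R" lborel] emeasure_lborel_ball_finite[of "0::'a" R]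
    by (auto intro: le_less_trans simp: fmeasurable_def)
  have Bsub: "?B j \<subseteq> ball 0 R" if "j \<in> J" for j using r(1)[OF that] by auto
  have em: "emeasure lborel S = ennreal (measure lborel S)" if "S \<subseteq> ball (0::'a) R" "S \<in> sets borel" for S
    using fm[OF that] by (simp add: emeasure_eq_measure2)
  have sums: "(\<Sum>j\<in>J. emeasure lborel (X j)) = ennreal (\<Sum>j\<in>J. measure lborel (X j))"
    if "\<And>j. j \<in> J \<Longrightarrow> X j \<subseteq> ball (0::'a) R" "\<And>j. j \<in> J \<Longrightarrow> X j \<in> sets borel" for X :: "'i \<Rightarrow> 'a set"
  proof -
    have "(\<Sum>j\<in>J. emeasure lborel (X j)) = (\<Sum>j\<in>J. ennreal (measure lborel (X j)))"
      using em that by (intro sum.cong) auto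
    also have "\<dots> = ennreal (\<Sum>j\<in>J. measure lborel (X j))" by (rule sum_ennreal) auto
    finally show ?thesis .
  qed
  \<comment> \<open>Equal volumes make the two halves of the symmetric difference equally large;
    this turns the products in the overlap bound into squares.\<close>
  have diffs: "measure lborel (?B j - A' j) = measure lborel (?B j) - measure lborel (A' j \<inter> ?B j)"
    "measure lborel (A' j - ?B j) = measure lborel (?B j - A' j)" if "C A'" "j \<in> J" for A' j
  proof -
    have A': "A' j \<subseteq> ball 0 R" "A' j \<in> sets borel" "emeasure lborel (A' j) = emeasure lborel (?B j)"
      using that r(2) by (auto simp: C_def)
    show 1: "measure lborel (?B j - A' j) = measure lborel (?B j) - measure lborel (A' j \<inter> ?B j)"
    proof -
      have "?B j - A' j = ?B j - A' j \<inter> ?B j" by auto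
      then show ?thesis
        using measure_Diff[of lborel "?B j" "A' j \<inter> ?B j"] A'(2) em[OF Bsub[OF that(2)]] by simp
    qed
    have "A' j - ?B j = A' j - A' j \<inter> ?B j" by auto
    then have "measure lborel (A' j - ?B j) = measure lborel (A' j) - measure lborel (A' j \<inter> ?B j)"
      using measure_Diff[of lborel "A' j" "A' j \<inter> ?B j"] A'(2) em[OF A'(1,2)] by simp
    moreover have "measure lborel (A' j) = measure lborel (?B j)" using A'(3) by (simp add: measure_def)
    ultimately show "measure lborel (A' j - ?B j) = measure lborel (?B j - A' j)" using 1 by simp
  qed
  \<comment> \<open>\<open>\<kappa>\<close> comes from the averaging over directions. In
    \<open>\<kappa>'\<close> the factor \<open>1 / (2 * R)\<close> comes from the gain on a single
    line and the division by \<open>card J\<close> from the Cauchy-Schwarz inequality.\<close>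
  define \<kappa> where "\<kappa> = 1/2 * (1 / (2 * R)) ^ (DIM('a) - 1) / (2 * measure lborel (ball (0::'a) 2))"
  define \<kappa>' where "\<kappa>' = \<kappa> / (2 * R) / real (card J)"
  have "0 < measure lborel (ball (0::'a) 2)" by (simp add: content_ball_pos)
  then have \<kappa>: "0 < \<kappa>" using R by (simp add: \<kappa>_def)
  then have \<kappa>': "0 < \<kappa>'" using R cJ by (simp add: \<kappa>'_def)
  \<comment> \<open>One direction serves all sets simultaneously, so the symmetrized tuple is again
    a competitor, and the distance drops by a multiple of its square.\<close>
  have step: "\<exists>A''. C A'' \<and> \<delta> A'' \<le> \<delta> A' - \<kappa>' * (\<delta> A')\<^sup>2" if CA: "C A'" for A'
  proof -
    have A': "A' j \<subseteq> ball 0 R" "A' j \<in> sets borel" if "j \<in> J" for j using CA that by (auto simp: C_def)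
    have "\<exists>\<theta>. norm \<theta> = 1 \<and> ennreal \<kappa> * (\<Sum>j\<in>J. emeasure lborel (A' j - ?B j) * emeasure lborel (?B j - A' j))
        \<le> (\<Sum>j\<in>J. line_overlap \<theta> (A' j - ?B j) (?B j - A' j))"
      unfolding \<kappa>_def
    proof (rule exists_direction[OF J R])
      fix j assume j: "j \<in> J"
      show "A' j - ?B j \<subseteq> ball 0 R" by (rule subset_trans[OF Diff_subset A'(1)[OF j]])
      show "?B j - A' j \<subseteq> ball 0 R" by (rule subset_trans[OF Diff_subset Bsub[OF j]])
      show "A' j - ?B j \<in> sets borel" "?B j - A' j \<in> sets borel" using A'(2)[OF j] by auto
    qed
    then obtain \<theta> where \<theta>: "norm \<theta> = 1" and ov: "ennreal \<kappa> * (\<Sum>j\<in>J. emeasure lborel (A' j - ?B j) * emeasure lborel (?B j - A' j))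
        \<le> (\<Sum>j\<in>J. line_overlap \<theta> (A' j - ?B j) (?B j - A' j))" by blast
    define S where "S j = steiner \<theta> (A' j)" for j
    have S: "S j \<subseteq> ball 0 R" "S j \<in> sets borel" "emeasure lborel (S j) = emeasure lborel (A' j)" if "j \<in> J" for j
      unfolding S_def using steiner_subset_ball[OF A'(1)[OF that] \<theta> A'(2)[OF that]] sets_steiner[OF A'(2)[OF that]]
        emeasure_steiner[OF A'(1)[OF that] \<theta> A'(2)[OF that]] R by simp_all
    have CS: "C S"
      unfolding C_def
    proof (intro conjI ballI)
      show "section_integral J L A \<le> section_integral J L S"
        using CA section_integral_steiner[OF J \<theta> L, of A' R] A' unfolding C_def S_def by (auto intro: order_trans)
    qed (use S CA in \<open>auto simp: C_def\<close>)
    let ?i = "\<lambda>X j. measure lborel (X j \<inter> ?B j)"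
    let ?d = "\<lambda>j. measure lborel (?B j - A' j)"
    have "ennreal ((\<Sum>j\<in>J. ?i A' j) + 1 / (2 * R) * (\<kappa> * (\<Sum>j\<in>J. (?d j)\<^sup>2))) =
       (\<Sum>j\<in>J. emeasure lborel (A' j \<inter> ?B j)) + ennreal (1 / (2 * R)) * (ennreal \<kappa> * (\<Sum>j\<in>J. emeasure lborel (A' j - ?B j) * emeasure lborel (?B j - A' j)))"
    proof -
      have 1: "(\<Sum>j\<in>J. emeasure lborel (A' j \<inter> ?B j)) = ennreal (\<Sum>j\<in>J. ?i A' j)"
        using A' by (intro sums) auto
      have 2: "(\<Sum>j\<in>J. emeasure lborel (A' j - ?B j) * emeasure lborel (?B j - A' j)) = ennreal (\<Sum>j\<in>J. (?d j)\<^sup>2)"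
      proof -
      have "(\<Sum>j\<in>J. emeasure lborel (A' j - ?B j) * emeasure lborel (?B j - A' j)) = (\<Sum>j\<in>J. ennreal ((?d j)\<^sup>2))"
      proof (rule sum.cong)
        fix j assume j: "j \<in> J"
        have "emeasure lborel (A' j - ?B j) = ennreal (?d j)"
          using em[of "A' j - ?B j"] A'[OF j] diffs(2)[OF CA j] by auto
        moreover have "emeasure lborel (?B j - A' j) = ennreal (?d j)"
          using Bsub[OF j] A'[OF j] by (intro em) auto
        ultimately show "emeasure lborel (A' j - ?B j) * emeasure lborel (?B j - A' j) = ennreal ((?d j)\<^sup>2)"
          by (simp add: power2_eq_square ennreal_mult')
      qed simp
      also have "\<dots> = ennreal (\<Sum>j\<in>J. (?d j)\<^sup>2)" by (rule sum_ennreal) auto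
      finally show ?thesis .
      qed
      show ?thesis unfolding 1 2 using R \<kappa>
        by (simp add: sum_nonneg flip: ennreal_mult' ennreal_plus)
    qed
    also have "\<dots> \<le> (\<Sum>j\<in>J. emeasure lborel (A' j \<inter> ?B j)) + ennreal (1 / (2 * R)) * (\<Sum>j\<in>J. line_overlap \<theta> (A' j - ?B j) (?B j - A' j))"
      by (intro add_left_mono mult_left_mono ov) auto
    also have "\<dots> = (\<Sum>j\<in>J. emeasure lborel (A' j \<inter> ?B j) + ennreal (1 / (2 * R)) * line_overlap \<theta> (A' j - ?B j) (?B j - A' j))"
      by (simp add: sum.distrib sum_distrib_left)
    also have "\<dots> \<le> (\<Sum>j\<in>J. emeasure lborel (S j \<inter> ?B j))"
      unfolding S_def using A' r(1) R \<theta> by (intro sum_mono emeasure_steiner_Int_ball) auto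
    also have "\<dots> = ennreal (\<Sum>j\<in>J. ?i S j)"
      using S(1,2) by (intro sums) auto
    finally have gain: "(\<Sum>j\<in>J. ?i A' j) + 1 / (2 * R) * (\<kappa> * (\<Sum>j\<in>J. (?d j)\<^sup>2)) \<le> (\<Sum>j\<in>J. ?i S j)"
      by (subst (asm) ennreal_le_iff) (auto intro: sum_nonneg)
    \<comment> \<open>Cauchy-Schwarz passes from the sum of the squared distances back to the square
      of the total distance.\<close>
    have "(\<delta> A')\<^sup>2 \<le> real (card J) * (\<Sum>j\<in>J. (?d j)\<^sup>2)"
      unfolding \<delta>_def using sum_squared_le_sum_of_squares[of ?d J] by (simp add: mult.commute)
    then have "(\<delta> A')\<^sup>2 / real (card J) \<le> (\<Sum>j\<in>J. (?d j)\<^sup>2)"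
      using cJ by (simp add: field_simps)
    then have "\<kappa> / (2 * R) * ((\<delta> A')\<^sup>2 / real (card J)) \<le> \<kappa> / (2 * R) * (\<Sum>j\<in>J. (?d j)\<^sup>2)"
      using \<kappa> R by (intro mult_left_mono) auto
    then have "\<kappa>' * (\<delta> A')\<^sup>2 \<le> 1 / (2 * R) * (\<kappa> * (\<Sum>j\<in>J. (?d j)\<^sup>2))" by (simp add: \<kappa>'_def)
    moreover have "\<delta> X = (\<Sum>j\<in>J. measure lborel (?B j)) - (\<Sum>j\<in>J. ?i X j)" if "C X" for X
      unfolding \<delta>_def using diffs(1)[OF that] by (simp add: sum_subtractf)
    ultimately have "\<delta> S \<le> \<delta> A' - \<kappa>' * (\<delta> A')\<^sup>2" using gain CA CS by fastforce
    then show ?thesis using CS by blast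
  qed
  have small: "\<exists>A'. C A' \<and> \<delta> A' < \<epsilon>" if "0 < \<epsilon>" for \<epsilon>
  proof (rule ccontr)
    assume neg: "\<not> ?thesis"
    define D where "D = {\<delta> A' |A'. C A'}"
    have "C A" using A by (simp add: C_def)
    then have ne: "D \<noteq> {}" by (auto simp: D_def)
    have ge: "\<epsilon> \<le> y" if "y \<in> D" for y using neg that by (auto simp: D_def not_less)
    then have bdd: "bdd_below D" by (rule bdd_belowI)
    define d where "d = Inf D"
    have d: "\<epsilon> \<le> d" unfolding d_def using ne ge by (intro cInf_greatest) auto
    then have "0 < d" using \<open>0 < \<epsilon>\<close> by simp
    \<comment> \<open>A competitor within \<open>\<kappa>' * d^2\<close> of the infimum loses at
      least that amount in one step and would fall below the infimum.\<close>
    then have "d < d + \<kappa>' * d\<^sup>2" using \<kappa>' by simp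
    then obtain y where "y \<in> D" "y < d + \<kappa>' * d\<^sup>2" unfolding d_def using cInf_lessD[OF ne] by blast
    then obtain A' where A': "C A'" "\<delta> A' < d + \<kappa>' * d\<^sup>2" by (auto simp: D_def)
    obtain A'' where A'': "C A''" "\<delta> A'' \<le> \<delta> A' - \<kappa>' * (\<delta> A')\<^sup>2" using step[OF A'(1)] by blast
    have "d \<le> \<delta> A'" "d \<le> \<delta> A''" unfolding d_def using A' A'' bdd by (auto intro!: cInf_lower simp: D_def)
    then have "\<kappa>' * d\<^sup>2 \<le> \<kappa>' * (\<delta> A')\<^sup>2" using \<open>0 < d\<close> \<kappa>' by (intro mult_left_mono power_mono) auto
    then show False using A' A'' \<open>d \<le> \<delta> A''\<close> by linarith
  qed
  \<comment> \<open>The constant of the perturbation estimate; it does not depend on the competitor,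
    so competitors close to the balls give the claim up to any error.\<close>
  define M where "M = measure lborel (ball (0::'a) 1) * measure lborel (ball (0::'a) R) ^ (card J - 1)"
  have M0: "0 \<le> M" by (simp add: M_def)
  have Mem: "emeasure lborel (ball (0::'a) 1) * emeasure lborel (ball (0::'a) R) ^ (card J - 1) = ennreal M"
    using emeasure_lborel_ball_finite[of "0::'a" 1] emeasure_lborel_ball_finite[of "0::'a" R]
    by (simp add: M_def ennreal_mult' ennreal_power emeasure_eq_ennreal_measure)
  show ?thesis
  proof (rule ennreal_le_epsilon)
    fix e :: real assume "0 < e"
    then have "0 < e / (M + 1)" using M0 by simp
    then obtain A' where A': "C A'" "\<delta> A' < e / (M + 1)" using small by blast
    have "section_integral J L A \<le> section_integral J L A'" using A' by (simp add: C_def)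
    also have "\<dots> \<le> section_integral J L ?B + ennreal M * (\<Sum>k\<in>J. emeasure lborel (A' k - ?B k))"
      unfolding Mem[symmetric] using A' by (intro section_integral_perturb[OF J Lm]) (auto simp: C_def)
    also have "(\<Sum>k\<in>J. emeasure lborel (A' k - ?B k)) = ennreal (\<delta> A')"
    proof -
      have "emeasure lborel (A' k - ?B k) = ennreal (measure lborel (?B k - A' k))" if "k \<in> J" for k
      proof -
        have k: "A' k \<subseteq> ball 0 R" "A' k \<in> sets borel" using A'(1) that by (auto simp: C_def)
        have "emeasure lborel (A' k - ?B k) = ennreal (measure lborel (A' k - ?B k))"
          by (rule em[OF subset_trans[OF Diff_subset k(1)]]) (use k in auto)
        then show ?thesis by (simp only: diffs(2)[OF A'(1) that])
      qed
      then show ?thesis by (simp add: \<delta>_def)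
    qed
    also have "ennreal M * ennreal (\<delta> A') \<le> ennreal e"
    proof -
      have "M * \<delta> A' \<le> M * (e / (M + 1))" using A' M0 by (intro mult_left_mono) auto
      also have "\<dots> \<le> e" using M0 \<open>0 < e\<close> by (simp add: field_simps)
      finally show ?thesis using M0 by (simp add: ennreal_leI flip: ennreal_mult')
    qed
    finally show "section_integral J L A \<le> section_integral J L ?B + ennreal e" by (simp add: add_left_mono)
  qed
qed

section \<open>Rearrangement of functions\<close>

lemma emeasure_lebesgue_borel: "A \<in> sets borel \<Longrightarrow> emeasure lebesgue A = emeasure lborel A"
  by simp

definition ball_radius :: "'a::euclidean_space itself \<Rightarrow> real \<Rightarrow> real" where
  "ball_radius _ c = root DIM('a) (c / unit_ball_vol (real DIM('a)))"

lemma ball_radius: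
  assumes "0 \<le> c"
  shows "0 \<le> ball_radius TYPE('a::euclidean_space) c"
    and "emeasure lborel (ball (0::'a) (ball_radius TYPE('a) c)) = ennreal c"
proof -
  have v: "0 < unit_ball_vol (real DIM('a))" by simp
  show nn: "0 \<le> ball_radius TYPE('a) c" using assms v by (simp add: ball_radius_def)
  have "(ball_radius TYPE('a) c) ^ DIM('a) = c / unit_ball_vol (real DIM('a))"
    unfolding ball_radius_def using assms v by (intro real_root_pow_pos2) auto
  then show "emeasure lborel (ball (0::'a) (ball_radius TYPE('a) c)) = ennreal c"
    using emeasure_ball[OF nn, of "0::'a"] v by (simp del: unit_ball_vol_pos)
qed

lemma ball_radius_unique:
  assumes "0 \<le> r" "emeasure lborel (ball (0::'a::euclidean_space) r) = ennreal c" "0 \<le> c"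
  shows "r = ball_radius TYPE('a) c"
proof -
  have v: "0 < unit_ball_vol (real DIM('a))" by simp
  have "unit_ball_vol (real DIM('a)) * r ^ DIM('a) = c"
    using assms(2,3) emeasure_ball[OF assms(1), of "0::'a"] v assms(1)
    by (simp del: unit_ball_vol_pos)
  then have "c / unit_ball_vol (real DIM('a)) = r ^ DIM('a)" using v by (metis less_irrefl nonzero_mult_div_cancel_left)
  then show ?thesis unfolding ball_radius_def using assms(1) by (simp add: real_root_power_cancel)
qed

lemma ball_radius_mono: "c \<le> d \<Longrightarrow> ball_radius TYPE('a::euclidean_space) c \<le> ball_radius TYPE('a) d"
  unfolding ball_radius_def by (intro real_root_le_mono divide_right_mono) auto

lemma sym_set_eq:
  assumes "emeasure lebesgue A = ennreal c" "0 \<le> c"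
  shows "sym_set A = ball (0::'a::euclidean_space) (ball_radius TYPE('a) c)"
proof -
  have "(THE r. 0 \<le> r \<and> emeasure lebesgue (ball (0::'a) r) = emeasure lebesgue A) = ball_radius TYPE('a) c"
  proof (rule the_equality)
    show "0 \<le> ball_radius TYPE('a) c \<and> emeasure lebesgue (ball (0::'a) (ball_radius TYPE('a) c)) = emeasure lebesgue A"
      using ball_radius[OF assms(2), where 'a='a] assms(1) by simp
    fix r assume r: "0 \<le> r \<and> emeasure lebesgue (ball (0::'a) r) = emeasure lebesgue A"
    then show "r = ball_radius TYPE('a) c"
      using assms by (intro ball_radius_unique) auto
  qed
  then show ?thesis by (simp add: sym_set_def)
qed

lemma sym_set_borel:
  assumes "A \<in> sets borel" "emeasure lborel A < \<infinity>"
  shows "sym_set A = ball (0::'a::euclidean_space) (ball_radius TYPE('a) (measure lborel A))"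
  using assms by (intro sym_set_eq) (auto simp: emeasure_eq_ennreal_measure)

text \<open>Unbounded sets are exhausted by their intersections with growing balls. Fatou's lemma
  handles the left side; on the right the balls for the truncated sets have smaller volume and hence
  lie in \<open>sym_set (A j)\<close>.\<close>

lemma section_integral_sym:
  fixes A :: "'i \<Rightarrow> 'a::euclidean_space set"
  assumes J: "finite J" and L: "sym_midconvex J L"
    and A: "\<And>j. j \<in> J \<Longrightarrow> A j \<in> sets borel" "\<And>j. j \<in> J \<Longrightarrow> emeasure lborel (A j) < \<infinity>"
  shows "section_integral J L A \<le> section_integral J L (\<lambda>j. sym_set (A j))"
proof -
  interpret L': product_sigma_finite "\<lambda>_. lborel :: 'a measure" by (rule product_sigma_finite_lborel)
  interpret LJ: sigma_finite_measure "PiM J (\<lambda>_. lborel :: 'a measure)" using J by (intro L'.sigma_finite)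
  have [measurable]: "L \<in> sets (PiM J (\<lambda>_. borel))" using L by (simp add: sym_midconvex_def)
  define A' where "A' k j = (if j \<in> J then A j \<inter> ball 0 (real (Suc k)) else {})" for k j
  define B where "B j = (if j \<in> J then A j else {})" for j
  have Am[measurable]: "A' k j \<in> sets borel" "B j \<in> sets borel" for k j using A by (auto simp: A'_def B_def)
  let ?P = "lborel \<Otimes>\<^sub>M PiM J (\<lambda>_. lborel :: 'a measure)"
  let ?F = "\<lambda>A p. indicator (ball (0::'a) 1) (fst p) * indicator L (\<lambda>j\<in>J. snd p j \<bullet> fst p) * (\<Prod>j\<in>J. indicator (A j) (snd p j)) :: ennreal"
  have rep: "section_integral J L A = (\<integral>\<^sup>+p. ?F A p \<partial>?P)" if [measurable]: "\<And>j. A j \<in> sets borel" for A :: "'i \<Rightarrow> 'a set"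
    unfolding section_integral_def by (subst LJ.nn_integral_fst[symmetric]) auto
  have "section_integral J L A = section_integral J L B"
    unfolding section_integral_def by (intro nn_integral_cong arg_cong[where f="\<lambda>z. _ * z"] prod.cong) (auto simp: B_def)
  also have "\<dots> = (\<integral>\<^sup>+p. ?F B p \<partial>?P)" by (rule rep) measurable
  also have "\<dots> \<le> (\<integral>\<^sup>+p. liminf (\<lambda>k. ?F (A' k) p) \<partial>?P)"
  proof (rule nn_integral_mono)
    fix p :: "'a \<times> ('i \<Rightarrow> 'a)"
    have "eventually (\<lambda>k. indicator (B j) (snd p j) = (indicator (A' k j) (snd p j) :: ennreal)) sequentially" for j
    proof -
      have "eventually (\<lambda>k. norm (snd p j) < real (Suc k)) sequentially"
        using eventually_gt_at_top[of "nat \<lceil>norm (snd p j)\<rceil>"] by eventually_elim linarith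
      then show ?thesis by eventually_elim (auto simp: A'_def B_def indicator_def)
    qed
    then have "eventually (\<lambda>k. \<forall>j\<in>J. indicator (B j) (snd p j) = (indicator (A' k j) (snd p j) :: ennreal)) sequentially"
      using J by (intro eventually_ball_finite) auto
    then have "eventually (\<lambda>k. ?F B p \<le> ?F (A' k) p) sequentially"
      by eventually_elim simp
    then show "?F B p \<le> liminf (\<lambda>k. ?F (A' k) p)" by (rule Liminf_bounded)
  qed
  also have "\<dots> \<le> liminf (\<lambda>k. \<integral>\<^sup>+p. ?F (A' k) p \<partial>?P)"
    by (rule nn_integral_liminf) measurable
  also have "\<dots> \<le> liminf (\<lambda>k. section_integral J L (\<lambda>j. sym_set (A j)))"
  proof (intro Liminf_mono always_eventually allI)
    fix k
    let ?r = "\<lambda>j. ball_radius TYPE('a) (measure lborel (A' k j))"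
    have fin: "emeasure lborel (A' k j) = ennreal (measure lborel (A' k j))" for j
    proof (rule emeasure_eq_ennreal_measure)
      have "emeasure lborel (A' k j) \<le> emeasure lborel (ball (0::'a) (real (Suc k)))"
        by (intro emeasure_mono) (auto simp: A'_def)
      then show "emeasure lborel (A' k j) \<noteq> top" using emeasure_lborel_ball_finite[of "0::'a" "real (Suc k)"] by (auto simp: top_unique)
    qed
    have "(\<integral>\<^sup>+p. ?F (A' k) p \<partial>?P) = section_integral J L (A' k)" by (rule rep[symmetric]) measurable
    also have "\<dots> \<le> section_integral J L (\<lambda>j. ball (0::'a) (?r j))"
    proof (rule section_integral_balls_bounded[OF J L, where R="real (Suc k)"])
      fix j assume j: "j \<in> J"
      show "A' k j \<subseteq> ball 0 (real (Suc k))" by (auto simp: A'_def)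
      show "emeasure lborel (ball (0::'a) (?r j)) = emeasure lborel (A' k j)"
        unfolding fin by (rule ball_radius) simp
      have "emeasure lborel (ball (0::'a) (real (Suc k))) = ennreal (measure lborel (ball (0::'a) (real (Suc k))))"
        using emeasure_lborel_ball_finite[of "0::'a" "real (Suc k)"] by (intro emeasure_eq_ennreal_measure) auto
      then have "real (Suc k) = ball_radius TYPE('a) (measure lborel (ball (0::'a) (real (Suc k))))"
        by (intro ball_radius_unique) auto
      moreover have "measure lborel (A' k j) \<le> measure lborel (ball (0::'a) (real (Suc k)))"
      proof (rule measure_mono_fmeasurable)
        show "ball (0::'a) (real (Suc k)) \<in> fmeasurable lborel"
          using emeasure_lborel_ball_finite[of "0::'a" "real (Suc k)"] unfolding fmeasurable_def by simp
        show "A' k j \<in> sets lborel" by simp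
        show "A' k j \<subseteq> ball (0::'a) (real (Suc k))" by (auto simp: A'_def)
      qed
      then have "?r j \<le> ball_radius TYPE('a) (measure lborel (ball (0::'a) (real (Suc k))))" by (rule ball_radius_mono)
      ultimately show "0 \<le> ?r j \<and> ?r j \<le> real (Suc k)"
        using ball_radius(1)[of "measure lborel (A' k j)", where 'a='a] by simp
    qed auto
    also have "\<dots> \<le> section_integral J L (\<lambda>j. sym_set (A j))"
      unfolding section_integral_def
    proof (intro nn_integral_mono mult_left_mono ennreal_prod_mono)
      fix j and X :: "'i \<Rightarrow> 'a" assume j: "j \<in> J"
      have "measure lborel (A' k j) \<le> measure lborel (A j)"
      proof (rule measure_mono_fmeasurable)
        show "A j \<in> fmeasurable lborel" using A[OF j] unfolding fmeasurable_def by simp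
        show "A' k j \<in> sets lborel" by simp
        show "A' k j \<subseteq> A j" by (auto simp: A'_def)
      qed
      then have "ball (0::'a) (?r j) \<subseteq> sym_set (A j)"
        unfolding sym_set_borel[OF A[OF j]] by (intro subset_ball ball_radius_mono)
      then show "indicator (ball (0::'a) (?r j)) (X j) \<le> (indicator (sym_set (A j)) (X j) :: ennreal)"
        by (auto simp: indicator_def)
    qed auto
    finally show "(\<integral>\<^sup>+p. ?F (A' k) p \<partial>?P) \<le> section_integral J L (\<lambda>j. sym_set (A j))" .
  qed
  also have "\<dots> = section_integral J L (\<lambda>j. sym_set (A j))" by (simp add: Liminf_const)
  finally show ?thesis .
qed

section \<open>From sets to quasiconcave functions and densities\<close>

definition inner_functional :: "'i set \<Rightarrow> (('i \<Rightarrow> real) \<Rightarrow> ennreal) \<Rightarrow> ('i \<Rightarrow> 'a::euclidean_space \<Rightarrow> ennreal) \<Rightarrow> ennreal" where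
  "inner_functional J Q g = (\<integral>\<^sup>+x. (\<integral>\<^sup>+X. indicator (ball 0 1) x * Q (\<lambda>j\<in>J. X j \<bullet> x) * (\<Prod>j\<in>J. g j (X j))
      \<partial>PiM J (\<lambda>_. lborel)) \<partial>lborel)"

lemma ennreal_layer: "(\<integral>\<^sup>+t. (if 0 < t \<and> ennreal t < c then 1 else 0) \<partial>(lborel :: real measure)) = c"
proof -
  have "(\<integral>\<^sup>+t. (if 0 < t \<and> ennreal t < c then 1 else 0) \<partial>(lborel :: real measure)) = (\<integral>\<^sup>+t. indicator {t::real. 0 < t \<and> ennreal t < c} t \<partial>lborel)"
    by (intro nn_integral_cong) (auto simp: indicator_def)
  then show ?thesis by (subst (asm) nn_integral_indicator) (auto simp: emeasure_less_ennreal)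
qed

text \<open>Evenness and quasiconcavity expressed by level sets, at the positive heights that the
  layer cake formula uses.\<close>

definition sym_quasiconcave :: "'i set \<Rightarrow> (('i \<Rightarrow> real) \<Rightarrow> ennreal) \<Rightarrow> bool" where
  "sym_quasiconcave J q \<longleftrightarrow> q \<in> borel_measurable (PiM J (\<lambda>_. borel)) \<and>
     (\<forall>t>0. sym_midconvex J {y \<in> space (PiM J (\<lambda>_. borel)). ennreal t < q y})"

lemma sym_midconvex_Int: "sym_midconvex J L \<Longrightarrow> sym_midconvex J M \<Longrightarrow> sym_midconvex J (L \<inter> M)"
  unfolding sym_midconvex_def by auto

lemma sym_midconvex_space: "sym_midconvex J (space (PiM J (\<lambda>_. borel)))"
  unfolding sym_midconvex_def
proof (intro conjI sets.top)
qed (auto simp: space_PiM)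

lemma inner_functional_layer:
  fixes g :: "'i \<Rightarrow> 'a::euclidean_space \<Rightarrow> ennreal"
  assumes J: "finite J" and [measurable]: "Q \<in> borel_measurable (PiM J (\<lambda>_. borel))" "q \<in> borel_measurable (PiM J (\<lambda>_. borel))"
    and g: "\<And>j. j \<in> J \<Longrightarrow> g j \<in> borel_measurable borel"
  shows "inner_functional J (\<lambda>y. Q y * q y) g =
    (\<integral>\<^sup>+t. indicator {0<..} t * inner_functional J (\<lambda>y. Q y * indicator {y \<in> space (PiM J (\<lambda>_. borel)). ennreal t < q y} y) g \<partial>lborel)"
proof -
  interpret L': product_sigma_finite "\<lambda>_. lborel :: 'a measure" by (rule product_sigma_finite_lborel)
  interpret LJ: sigma_finite_measure "PiM J (\<lambda>_. lborel :: 'a measure)" using J by (intro L'.sigma_finite)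
  interpret P: pair_sigma_finite "PiM J (\<lambda>_. lborel :: 'a measure)" "lborel :: real measure" by standard
  define h where "h j = (if j \<in> J then g j else (\<lambda>_. 0))" for j
  have [measurable]: "h j \<in> borel_measurable borel" for j using g by (auto simp: h_def)
  have pr: "(\<Prod>j\<in>J. g j (X j)) = (\<Prod>j\<in>J. h j (X j))" for X by (intro prod.cong) (auto simp: h_def)
  let ?y = "\<lambda>x X. \<lambda>j\<in>J. X j \<bullet> x"
  let ?w = "\<lambda>x X. indicator (ball (0::'a) 1) x * Q (?y x X) * (\<Prod>j\<in>J. h j (X j))"
  let ?i = "\<lambda>t x X. if 0 < (t::real) \<and> ennreal t < q (?y x X) then 1 else 0 :: ennreal"
  have "inner_functional J (\<lambda>y. Q y * q y) g = (\<integral>\<^sup>+x. (\<integral>\<^sup>+X. ?w x X * (\<integral>\<^sup>+t. ?i t x X \<partial>lborel) \<partial>PiM J (\<lambda>_. lborel)) \<partial>lborel)"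
    unfolding inner_functional_def pr ennreal_layer by (simp only: mult_ac)
  also have "\<dots> = (\<integral>\<^sup>+x. (\<integral>\<^sup>+X. (\<integral>\<^sup>+t. ?w x X * ?i t x X \<partial>lborel) \<partial>PiM J (\<lambda>_. lborel)) \<partial>lborel)"
    by (intro nn_integral_cong nn_integral_cmult[symmetric]) measurable
  also have "\<dots> = (\<integral>\<^sup>+x. (\<integral>\<^sup>+t. (\<integral>\<^sup>+X. ?w x X * ?i t x X \<partial>PiM J (\<lambda>_. lborel)) \<partial>lborel) \<partial>lborel)"
    by (intro nn_integral_cong P.Fubini'[symmetric]) measurable
  also have "\<dots> = (\<integral>\<^sup>+t. (\<integral>\<^sup>+x. (\<integral>\<^sup>+X. ?w x X * ?i t x X \<partial>PiM J (\<lambda>_. lborel)) \<partial>lborel) \<partial>lborel)"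
    by (rule lborel_pair.Fubini') measurable
  also have "\<dots> = (\<integral>\<^sup>+t. indicator {0<..} t * inner_functional J (\<lambda>y. Q y * indicator {y \<in> space (PiM J (\<lambda>_. borel)). ennreal t < q y} y) g \<partial>lborel)"
  proof (rule nn_integral_cong)
    fix t :: real
    have "?w x X * ?i t x X = indicator {0<..} t * (indicator (ball (0::'a) 1) x * (Q (?y x X) * indicator {y \<in> space (PiM J (\<lambda>_. borel)). ennreal t < q y} (?y x X)) * (\<Prod>j\<in>J. h j (X j)))" for x X
      by (auto simp: indicator_def space_PiM)
    then show "(\<integral>\<^sup>+x. (\<integral>\<^sup>+X. ?w x X * ?i t x X \<partial>PiM J (\<lambda>_. lborel)) \<partial>lborel) =
      indicator {0<..} t * inner_functional J (\<lambda>y. Q y * indicator {y \<in> space (PiM J (\<lambda>_. borel)). ennreal t < q y} y) g"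
      unfolding inner_functional_def pr
      by (simp only:) (subst nn_integral_cmult, measurable, subst nn_integral_cmult, measurable)
  qed
  finally show ?thesis .
qed

text \<open>The set \<open>L\<close> accumulates the level sets of the factors already layered. It
  stays symmetric and midpoint convex under intersection, so the induction over \<open>I\<close>
  ends with a section integral for a single set.\<close>

lemma inner_functional_quasiconcave_sets:
  fixes A :: "'i \<Rightarrow> 'a::euclidean_space set"
  assumes J: "finite J" and "finite I" and q: "\<And>i. i \<in> I \<Longrightarrow> sym_quasiconcave J (q i)" and L: "sym_midconvex J L"
    and A: "\<And>j. j \<in> J \<Longrightarrow> A j \<in> sets borel" "\<And>j. j \<in> J \<Longrightarrow> emeasure lborel (A j) < \<infinity>"
  shows "inner_functional J (\<lambda>y. indicator L y * (\<Prod>i\<in>I. q i y)) (\<lambda>j. indicator (A j))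
    \<le> inner_functional J (\<lambda>y. indicator L y * (\<Prod>i\<in>I. q i y)) (\<lambda>j. indicator (sym_set (A j)))"
  using \<open>finite I\<close> q L
proof (induction I arbitrary: L rule: finite_induct)
  case empty
  have "inner_functional J (\<lambda>y. indicator L y * (\<Prod>i\<in>{}. q i y)) (\<lambda>j. indicator (B j)) = section_integral J L B" for B :: "'i \<Rightarrow> 'a set"
    by (simp add: inner_functional_def section_integral_def)
  then show ?case using section_integral_sym[OF J empty(2) A] by simp
next
  case (insert i I)
  have Lm[measurable]: "L \<in> sets (PiM J (\<lambda>_. borel))" using insert by (simp add: sym_midconvex_def)
  have qm: "q k \<in> borel_measurable (PiM J (\<lambda>_. borel))" if "k \<in> insert i I" for k
    using insert.prems(1)[OF that] by (simp add: sym_quasiconcave_def)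
  let ?Q = "\<lambda>y. indicator L y * (\<Prod>i\<in>I. q i y)"
  have Qm: "?Q \<in> borel_measurable (PiM J (\<lambda>_. borel))" using qm by auto
  have eq: "inner_functional J (\<lambda>y. indicator L y * (\<Prod>i\<in>insert i I. q i y)) g =
      (\<integral>\<^sup>+t. indicator {0<..} t * inner_functional J (\<lambda>y. indicator (L \<inter> {y \<in> space (PiM J (\<lambda>_. borel)). ennreal t < q i y}) y * (\<Prod>i\<in>I. q i y)) g \<partial>lborel)"
    if g: "\<And>j. j \<in> J \<Longrightarrow> g j \<in> borel_measurable borel" for g :: "'i \<Rightarrow> 'a \<Rightarrow> ennreal"
  proof -
    have "(\<lambda>y. indicator L y * (\<Prod>i\<in>insert i I. q i y)) = (\<lambda>y. ?Q y * q i y)"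
      using insert by (auto simp: fun_eq_iff mult_ac)
    moreover have "(\<lambda>y. ?Q y * indicator {y \<in> space (PiM J (\<lambda>_. borel)). ennreal t < q i y} y)
       = (\<lambda>y. indicator (L \<inter> {y \<in> space (PiM J (\<lambda>_. borel)). ennreal t < q i y}) y * (\<Prod>i\<in>I. q i y))" for t
      by (auto simp: fun_eq_iff indicator_inter_arith mult_ac)
    ultimately show ?thesis
      using inner_functional_layer[OF J Qm qm[of i] g] by simp
  qed
  show ?case
  proof (subst (1 2) eq)
    show "(\<integral>\<^sup>+t. indicator {0<..} t * inner_functional J (\<lambda>y. indicator (L \<inter> {y \<in> space (PiM J (\<lambda>_. borel)). ennreal t < q i y}) y * (\<Prod>i\<in>I. q i y)) (\<lambda>j. indicator (A j)) \<partial>lborel)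
      \<le> (\<integral>\<^sup>+t. indicator {0<..} t * inner_functional J (\<lambda>y. indicator (L \<inter> {y \<in> space (PiM J (\<lambda>_. borel)). ennreal t < q i y}) y * (\<Prod>i\<in>I. q i y)) (\<lambda>j. indicator (sym_set (A j))) \<partial>lborel)"
    proof (rule nn_integral_mono)
      fix t :: real
      show "indicator {0<..} t * inner_functional J (\<lambda>y. indicator (L \<inter> {y \<in> space (PiM J (\<lambda>_. borel)). ennreal t < q i y}) y * (\<Prod>i\<in>I. q i y)) (\<lambda>j. indicator (A j))
       \<le> indicator {0<..} t * inner_functional J (\<lambda>y. indicator (L \<inter> {y \<in> space (PiM J (\<lambda>_. borel)). ennreal t < q i y}) y * (\<Prod>i\<in>I. q i y)) (\<lambda>j. indicator (sym_set (A j)))"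
      proof (cases "0 < t")
        case True
        have "sym_midconvex J (L \<inter> {y \<in> space (PiM J (\<lambda>_. borel)). ennreal t < q i y})"
          using insert.prems True by (intro sym_midconvex_Int) (auto simp: sym_quasiconcave_def)
        then show ?thesis using insert by (intro mult_left_mono insert.IH) auto
      qed simp
    qed
  qed (use A in \<open>auto simp: sym_set_borel\<close>)
qed

text \<open>An integrable Borel density has this property by Markov's inequality; it ensures that
  \<open>sym_set\<close> of each level set at a positive height is a genuine ball of the same
  volume.\<close>

definition finite_levels :: "('a::euclidean_space \<Rightarrow> real) \<Rightarrow> bool" where
  "finite_levels F \<longleftrightarrow> F \<in> borel_measurable borel \<and> (\<forall>x. 0 \<le> F x) \<and> (\<forall>t>0. emeasure lborel {y. t < F y} < \<infinity>)"

text \<open>The integral in \<open>sym_rearr\<close> before its conversion to a real number, for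
  which Fubini's theorem is available without regard to finiteness.\<close>

definition sym_layers :: "('a::euclidean_space \<Rightarrow> real) \<Rightarrow> 'a \<Rightarrow> ennreal" where
  "sym_layers F x = (\<integral>\<^sup>+t. indicator {0<..} t * indicator (sym_set {y. t < F y}) x \<partial>lborel)"

lemma ball_radius_measurable [measurable]: "ball_radius TYPE('a::euclidean_space) \<in> borel_measurable borel"
  by (rule borel_measurable_mono) (simp add: mono_def ball_radius_mono)

text \<open>Joint measurability in height and point becomes visible once membership in
  \<open>sym_set\<close> is written as a comparison of \<open>norm x\<close> with the radius
  belonging to the measure of the level set.\<close>

lemma sym_levels_measurable:
  assumes "finite_levels F"
  shows "(\<lambda>(t, x). indicator {0<..} t * indicator (sym_set {y. t < F y}) x :: ennreal) \<in> borel_measurable (lborel \<Otimes>\<^sub>M (lborel :: 'a::euclidean_space measure))"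
proof -
  have [measurable]: "F \<in> borel_measurable borel" using assms by (simp add: finite_levels_def)
  have eq: "indicator {0<..} t * indicator (sym_set {y. t < F y}) x =
     (if 0 < t \<and> norm x < ball_radius TYPE('a) (enn2real (\<integral>\<^sup>+y. (if t < F y then 1 else 0) \<partial>lborel)) then 1 else 0 :: ennreal)" for t x
  proof (cases "0 < t")
    case True
    have "(\<integral>\<^sup>+y. (if t < F y then 1 else 0) \<partial>lborel) = (\<integral>\<^sup>+y. indicator {y. t < F y} y \<partial>lborel)"
      by (intro nn_integral_cong) (auto simp: indicator_def)
    then have "enn2real (\<integral>\<^sup>+y. (if t < F y then 1 else 0) \<partial>lborel) = measure lborel {y. t < F y}"
      by (subst (asm) nn_integral_indicator) (auto simp: measure_def)
    then show ?thesis using assms True by (subst sym_set_borel) (auto simp: indicator_def finite_levels_def)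
  qed simp
  show ?thesis unfolding eq by measurable
qed

text \<open>The functional is linear in each density separately, so a superposition in one slot can
  be taken out by Fubini's theorem.\<close>

lemma inner_functional_mix:
  fixes g :: "'i \<Rightarrow> 'a::euclidean_space \<Rightarrow> ennreal" and h :: "real \<Rightarrow> 'a \<Rightarrow> ennreal"
  assumes J: "finite J" and k: "k \<in> J" and [measurable]: "Q \<in> borel_measurable (PiM J (\<lambda>_. borel))"
    and g: "\<And>j. j \<in> J \<Longrightarrow> g j \<in> borel_measurable borel"
    and [measurable]: "(\<lambda>(t, x). h t x) \<in> borel_measurable (lborel \<Otimes>\<^sub>M lborel)"
  shows "inner_functional J Q (g(k := (\<lambda>x. \<integral>\<^sup>+t. h t x \<partial>lborel))) = (\<integral>\<^sup>+t. inner_functional J Q (g(k := h t)) \<partial>lborel)"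
proof -
  interpret L': product_sigma_finite "\<lambda>_. lborel :: 'a measure" by (rule product_sigma_finite_lborel)
  interpret LJ: sigma_finite_measure "PiM J (\<lambda>_. lborel :: 'a measure)" using J by (intro L'.sigma_finite)
  interpret P: pair_sigma_finite "PiM J (\<lambda>_. lborel :: 'a measure)" "lborel :: real measure" by standard
  define g' where "g' j = (if j \<in> J then g j else (\<lambda>_. 0))" for j
  have [measurable]: "g' j \<in> borel_measurable borel" for j using g by (auto simp: g'_def)
  have pr: "(\<Prod>j\<in>J. (g(k := f)) j (X j)) = (\<Prod>j\<in>J - {k}. g' j (X j)) * f (X k)" for f X
  proof -
    have "(\<Prod>j\<in>J. (g(k := f)) j (X j)) = f (X k) * (\<Prod>j\<in>J - {k}. (g(k := f)) j (X j))"
      using J k by (subst prod.remove) auto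
    also have "(\<Prod>j\<in>J - {k}. (g(k := f)) j (X j)) = (\<Prod>j\<in>J - {k}. g' j (X j))"
      by (intro prod.cong) (auto simp: g'_def)
    finally show ?thesis by (simp add: mult.commute)
  qed
  let ?w = "\<lambda>x X. indicator (ball (0::'a) 1) x * Q (\<lambda>j\<in>J. X j \<bullet> x) * (\<Prod>j\<in>J - {k}. g' j (X j))"
  have [measurable]: "(\<lambda>X. X k) \<in> measurable (PiM J (\<lambda>_. lborel)) (lborel :: 'a measure)"
    using k by (rule measurable_component_singleton)
  have "inner_functional J Q (g(k := (\<lambda>x. \<integral>\<^sup>+t. h t x \<partial>lborel))) = (\<integral>\<^sup>+x. (\<integral>\<^sup>+X. ?w x X * (\<integral>\<^sup>+t. h t (X k) \<partial>lborel) \<partial>PiM J (\<lambda>_. lborel)) \<partial>lborel)"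
    unfolding inner_functional_def pr by (simp only: mult.assoc)
  also have "\<dots> = (\<integral>\<^sup>+x. (\<integral>\<^sup>+X. (\<integral>\<^sup>+t. ?w x X * h t (X k) \<partial>lborel) \<partial>PiM J (\<lambda>_. lborel)) \<partial>lborel)"
    by (intro nn_integral_cong nn_integral_cmult[symmetric]) measurable
  also have "\<dots> = (\<integral>\<^sup>+x. (\<integral>\<^sup>+t. (\<integral>\<^sup>+X. ?w x X * h t (X k) \<partial>PiM J (\<lambda>_. lborel)) \<partial>lborel) \<partial>lborel)"
    by (intro nn_integral_cong P.Fubini'[symmetric]) measurable
  also have "\<dots> = (\<integral>\<^sup>+t. (\<integral>\<^sup>+x. (\<integral>\<^sup>+X. ?w x X * h t (X k) \<partial>PiM J (\<lambda>_. lborel)) \<partial>lborel) \<partial>lborel)"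
    by (rule lborel_pair.Fubini') measurable
  also have "\<dots> = (\<integral>\<^sup>+t. inner_functional J Q (g(k := h t)) \<partial>lborel)"
    unfolding inner_functional_def pr by (simp only: mult.assoc)
  finally show ?thesis .
qed

lemma inner_functional_rearrangement:
  fixes F :: "'i \<Rightarrow> 'a::euclidean_space \<Rightarrow> real"
  assumes J: "finite J" and I: "finite I" and q: "\<And>i. i \<in> I \<Longrightarrow> sym_quasiconcave J (q i)"
    and F: "\<And>j. j \<in> J \<Longrightarrow> finite_levels (F j)"
  shows "inner_functional J (\<lambda>y. \<Prod>i\<in>I. q i y) (\<lambda>j x. ennreal (F j x)) \<le> inner_functional J (\<lambda>y. \<Prod>i\<in>I. q i y) (\<lambda>j. sym_layers (F j))"
proof -
  let ?Q = "\<lambda>y. \<Prod>i\<in>I. q i y"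
  have "q i \<in> borel_measurable (PiM J (\<lambda>_. borel))" if "i \<in> I" for i using q[OF that] by (simp add: sym_quasiconcave_def)
  then have Qm: "?Q \<in> borel_measurable (PiM J (\<lambda>_. borel))" by auto
  have Fm: "F j \<in> borel_measurable borel" if "j \<in> J" for j using F[OF that] by (simp add: finite_levels_def)
  have symm: "sym_layers (F j) \<in> borel_measurable borel" if "j \<in> J" for j
  proof -
    have "(\<lambda>(x, t). indicator {0<..} t * indicator (sym_set {y. t < F j y}) x :: ennreal) \<in> borel_measurable (lborel \<Otimes>\<^sub>M lborel)"
      using measurable_pair_swap[OF sym_levels_measurable[OF F[OF that]]] by (simp add: case_prod_beta)
    then have "(\<lambda>x. \<integral>\<^sup>+t. indicator {0<..} t * indicator (sym_set {y. t < F j y}) x \<partial>lborel) \<in> borel_measurable lborel"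
      by (rule lborel.borel_measurable_nn_integral)
    then show ?thesis by (simp add: sym_layers_def[abs_def])
  qed
  \<comment> \<open>The mixed form needed for induction: indices in \<open>K\<close> carry
    functions, the others indicators of arbitrary sets of finite measure. Enlarging \<open>K\<close>
    by \<open>k\<close> layers the function at \<open>k\<close> and uses the hypothesis for each of
    its level sets.\<close>
  have main: "inner_functional J ?Q (\<lambda>j. if j \<in> K then (\<lambda>x. ennreal (F j x)) else indicator (A j))
     \<le> inner_functional J ?Q (\<lambda>j. if j \<in> K then sym_layers (F j) else indicator (sym_set (A j)))"
    if "finite K" "K \<subseteq> J" "\<And>j. j \<in> J \<Longrightarrow> A j \<in> sets borel \<and> emeasure lborel (A j) < \<infinity>" for K A
    using that
  proof (induction K arbitrary: A rule: finite_induct)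
    case empty
    have "inner_functional J ?Q g = inner_functional J (\<lambda>y. indicator (space (PiM J (\<lambda>_. borel))) y * (\<Prod>i\<in>I. q i y)) g" for g :: "'i \<Rightarrow> 'a \<Rightarrow> ennreal"
    proof -
      have "indicator (space (PiM J (\<lambda>_. borel))) (\<lambda>j\<in>J. X j \<bullet> x) = (1 :: ennreal)" for x and X :: "'i \<Rightarrow> 'a"
        by (auto simp: indicator_def space_PiM)
      then show ?thesis unfolding inner_functional_def by simp
    qed
    then show ?case
      using inner_functional_quasiconcave_sets[OF J I q sym_midconvex_space, where A=A] empty by simp
  next
    case (insert k K)
    have k: "k \<in> J" using insert by simp
    let ?g = "\<lambda>j. if j \<in> K then (\<lambda>x. ennreal (F j x)) else indicator (A j)"
    let ?g' = "\<lambda>j. if j \<in> K then sym_layers (F j) else indicator (sym_set (A j))"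
    have gm: "?g j \<in> borel_measurable borel" "?g' j \<in> borel_measurable borel" if "j \<in> J" for j
      using insert.prems(2)[OF that] Fm[OF that] symm[OF that] by (auto simp: sym_set_borel)
    have Fk[measurable]: "F k \<in> borel_measurable borel" by (rule Fm[OF k])
    have Fe: "ennreal (F k x) = (\<integral>\<^sup>+t. (if 0 < t \<and> t < F k x then 1 else 0) \<partial>lborel)" for x
    proof -
      have "(0 < t \<and> ennreal t < ennreal (F k x)) = (0 < t \<and> t < F k x)" for t
        using ennreal_less_iff[of t "F k x"] by auto
      then show ?thesis using ennreal_layer[of "ennreal (F k x)"] by simp
    qed
    have "(\<lambda>j. if j \<in> insert k K then (\<lambda>x. ennreal (F j x)) else indicator (A j)) = ?g(k := (\<lambda>x. \<integral>\<^sup>+t. (if 0 < t \<and> t < F k x then 1 else 0) \<partial>lborel))"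
      by (auto simp: fun_eq_iff Fe)
    then have "inner_functional J ?Q (\<lambda>j. if j \<in> insert k K then (\<lambda>x. ennreal (F j x)) else indicator (A j))
       = inner_functional J ?Q (?g(k := (\<lambda>x. \<integral>\<^sup>+t. (if 0 < t \<and> t < F k x then 1 else 0) \<partial>lborel)))" by simp
    also have "\<dots> = (\<integral>\<^sup>+t. inner_functional J ?Q (?g(k := (\<lambda>x. if 0 < t \<and> t < F k x then 1 else 0))) \<partial>lborel)"
      by (rule inner_functional_mix[OF J k Qm gm(1)]) measurable
    also have "\<dots> \<le> (\<integral>\<^sup>+t. inner_functional J ?Q (?g'(k := (\<lambda>x. indicator {0<..} t * indicator (sym_set {y. t < F k y}) x))) \<partial>lborel)"
    proof (rule nn_integral_mono)
      fix t :: real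
      show "inner_functional J ?Q (?g(k := (\<lambda>x. if 0 < t \<and> t < F k x then 1 else 0)))
        \<le> inner_functional J ?Q (?g'(k := (\<lambda>x. indicator {0<..} t * indicator (sym_set {y. t < F k y}) x)))"
      proof (cases "0 < t")
        case True
        let ?A = "A(k := {y. t < F k y})"
        have "?g(k := (\<lambda>x. if 0 < t \<and> t < F k x then 1 else 0)) = (\<lambda>j. if j \<in> K then (\<lambda>x. ennreal (F j x)) else indicator (?A j))"
          using insert True by (auto simp: fun_eq_iff indicator_def)
        moreover have "?g'(k := (\<lambda>x. indicator {0<..} t * indicator (sym_set {y. t < F k y}) x)) = (\<lambda>j. if j \<in> K then sym_layers (F j) else indicator (sym_set (?A j)))"
          using insert True by (auto simp: fun_eq_iff indicator_def)
        moreover have "?A j \<in> sets borel \<and> emeasure lborel (?A j) < \<infinity>" if "j \<in> J" for j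
          using insert.prems(2)[OF that] F[OF k] True by (auto simp: finite_levels_def)
        ultimately show ?thesis using insert.IH[of ?A] insert.prems by auto
      next
        case False
        have "(\<Prod>j\<in>J. (?g(k := (\<lambda>x. if 0 < t \<and> t < F k x then 1 else 0))) j (X j)) = 0" for X
          using False J k by (intro prod_zero) (auto intro!: bexI[of _ k])
        then have "inner_functional J ?Q (?g(k := (\<lambda>x. if 0 < t \<and> t < F k x then 1 else 0))) = 0"
          unfolding inner_functional_def by (simp only: mult_zero_right nn_integral_const) simp
        then show ?thesis by simp
      qed
    qed
    also have "\<dots> = inner_functional J ?Q (?g'(k := (\<lambda>x. \<integral>\<^sup>+t. indicator {0<..} t * indicator (sym_set {y. t < F k y}) x \<partial>lborel)))"
      by (rule inner_functional_mix[OF J k Qm gm(2) sym_levels_measurable[OF F[OF k]], symmetric])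
    also have "?g'(k := (\<lambda>x. \<integral>\<^sup>+t. indicator {0<..} t * indicator (sym_set {y. t < F k y}) x \<partial>lborel)) = (\<lambda>j. if j \<in> insert k K then sym_layers (F j) else indicator (sym_set (A j)))"
      by (auto simp: fun_eq_iff sym_layers_def)
    finally show ?case .
  qed
  have cong: "inner_functional J ?Q g = inner_functional J ?Q g'" if "\<And>j. j \<in> J \<Longrightarrow> g j = g' j" for g g' :: "'i \<Rightarrow> 'a \<Rightarrow> ennreal"
    unfolding inner_functional_def using that by (auto intro!: nn_integral_cong arg_cong[where f="\<lambda>z. _ * z"] prod.cong)
  have "inner_functional J ?Q (\<lambda>j x. ennreal (F j x)) = inner_functional J ?Q (\<lambda>j. if j \<in> J then (\<lambda>x. ennreal (F j x)) else indicator ((\<lambda>_. {}) j))"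
    by (rule cong) simp
  also have "\<dots> \<le> inner_functional J ?Q (\<lambda>j. if j \<in> J then sym_layers (F j) else indicator (sym_set ((\<lambda>_. {}) j)))"
    by (rule main[OF J]) auto
  also have "\<dots> = inner_functional J ?Q (\<lambda>j. sym_layers (F j))"
    by (rule cong) simp
  finally show ?thesis .
qed

section \<open>Volumes of star-shaped sets as limits of dual volumes\<close>

lemma epow_measurable [measurable]: "(\<lambda>x. epow x q) \<in> borel_measurable borel"
  unfolding epow_def by measurable

lemma ennreal_less_epow_iff:
  assumes "0 < a" "0 < t"
  shows "ennreal t < epow c a \<longleftrightarrow> ennreal (t powr (1 / a)) < c"
proof (cases c)
  case (real r)
  show ?thesis
  proof (cases "r = 0")
    case True
    then show ?thesis using real assms by (simp add: epow_def)
  next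
    case False
    then have r: "0 < r" using real by simp
    have "t < r powr a \<longleftrightarrow> t powr (1/a) < r"
    proof -
      have "t < r powr a \<longleftrightarrow> t powr (1/a) < (r powr a) powr (1/a)"
        using assms r powr_less_mono2[of "1/a" t "r powr a"] powr_mono2[of "1/a" "r powr a" t]
        by (cases "t < r powr a") auto
      then show ?thesis using assms r by (simp add: powr_powr)
    qed
    then show ?thesis using real r assms by (simp add: epow_def ennreal_less_iff)
  qed
next
  case top
  then show ?thesis using assms by (simp add: epow_def)
qed

text \<open>Homogeneity of degree \<open>-1\<close>, in the only form needed for \<open>star_vol\<close>.\<close>
definition inv_homogeneous :: "('a::euclidean_space \<Rightarrow> ennreal) \<Rightarrow> bool" where
  "inv_homogeneous r \<longleftrightarrow> (\<forall>s>0. \<forall>x. ennreal s < r x \<longleftrightarrow> 1 < r (s *\<^sub>R x))"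

text \<open>Homogeneity turns the radial condition at \<open>x\<close> into \<open>1 < r x\<close>;
  the origin, which \<open>star_set\<close> always contains, is a null set.\<close>

lemma star_vol_inv_homogeneous:
  fixes r :: "'a::euclidean_space \<Rightarrow> ennreal"
  assumes hom: "inv_homogeneous r" and [measurable]: "r \<in> borel_measurable borel"
  shows "star_vol r = emeasure lborel {x. 1 < r x}"
proof -
  have eq: "(ennreal (norm x) < r (sgn x)) = (1 < r x)" if "x \<noteq> 0" for x
  proof -
    have "norm x *\<^sub>R sgn x = x" using that by (simp add: sgn_div_norm)
    then show ?thesis using hom[unfolded inv_homogeneous_def, rule_format, of "norm x" "sgn x"] that by simp
  qed
  have "star_set r = {x. 1 < r x} \<union> {0}" using eq by (auto simp: star_set_def)
  then have "star_vol r = emeasure lebesgue ({x. 1 < r x} \<union> {0})" by (simp add: star_vol_def)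
  also have "\<dots> = emeasure lborel ({x. 1 < r x} \<union> {0})" by (rule emeasure_lebesgue_borel) measurable
  also have "\<dots> = emeasure lborel {x. 1 < r x}" by (rule emeasure_Un_null_set) auto
  finally show ?thesis .
qed

text \<open>The normalizing factor of dual volumes: at \<open>n / a\<close> it equals
  \<open>a / (n - a)\<close> for \<open>a < n\<close>, which blows up as \<open>a\<close> tends to
  \<open>n\<close>.\<close>

definition powr_tail :: "real \<Rightarrow> ennreal" where
  "powr_tail b = (\<integral>\<^sup>+t. ennreal (t powr - b) * indicator {1<..} t \<partial>lborel)"

lemma powr_tail_eq:
  assumes "1 < b"
  shows "powr_tail b = ennreal (1 / (b - 1))"
proof -
  have "((\<lambda>t. t powr - b) has_integral - (1 powr (- b + 1)) / (- b + 1)) {1..}"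
    using assms by (intro has_integral_powr_to_inf) auto
  then have "(\<integral>\<^sup>+t. ennreal (t powr - b) * indicator {1..} t \<partial>lborel) = ennreal (- (1 powr (- b + 1)) / (- b + 1))"
    by (intro nn_integral_has_integral_lebesgue') auto
  moreover have "(\<integral>\<^sup>+t. ennreal (t powr - b) * indicator {1..} t \<partial>lborel) = powr_tail b"
    unfolding powr_tail_def
  proof (rule nn_integral_cong_AE)
    show "AE t in lborel. ennreal (t powr - b) * indicator {1..} t = ennreal (t powr - b) * indicator {1<..} t"
      using AE_lborel_singleton[of "1::real"] by eventually_elim (auto simp: indicator_def)
  qed
  moreover have "- (1 powr (- b + 1)) / (- b + 1) = 1 / (b - 1)"
    using assms by (simp add: divide_simps)
  ultimately show ?thesis by simp
qed

text \<open>The condition means \<open>d powr a < t\<close>, and substituting a multiple of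
  \<open>d powr a\<close> for \<open>t\<close> reduces the integral to the one starting at
  1.\<close>

lemma nn_integral_powr_shell:
  assumes "0 < d" "0 < a"
  shows "(\<integral>\<^sup>+t. (if 0 < t \<and> d < t powr (1 / a) then ennreal (t powr - (N / a)) else 0) \<partial>lborel) = ennreal (d powr (a - N)) * powr_tail (N / a)"
proof -
  let ?f = "\<lambda>t::real. if 0 < t \<and> d < t powr (1 / a) then ennreal (t powr - (N / a)) else 0"
  have da: "0 < d powr a" using assms by simp
  have "(\<integral>\<^sup>+t. ?f t \<partial>lborel) = ennreal \<bar>d powr a\<bar> * (\<integral>\<^sup>+t. ?f (0 + d powr a * t) \<partial>lborel)"
    using da by (intro nn_integral_real_affine) auto
  also have "(\<integral>\<^sup>+t. ?f (0 + d powr a * t) \<partial>lborel) = (\<integral>\<^sup>+t. ennreal (d powr - N) * (ennreal (t powr - (N / a)) * indicator {1<..} t) \<partial>lborel)"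
  proof (rule nn_integral_cong)
    fix t :: real
    show "?f (0 + d powr a * t) = ennreal (d powr - N) * (ennreal (t powr - (N / a)) * indicator {1<..} t)"
    proof (cases "0 < t")
      case True
      have "(d powr a * t) powr (1/a) = d * t powr (1/a)"
        using True assms by (simp add: powr_mult powr_powr)
      then have "d < (d powr a * t) powr (1/a) \<longleftrightarrow> 1 < t powr (1/a)" using assms by simp
      also have "\<dots> \<longleftrightarrow> 1 < t"
        using True assms powr_less_mono2[of "1/a" 1 t] powr_mono2[of "1/a" t 1] by (cases "1 < t") auto
      finally have 1: "d < (d powr a * t) powr (1/a) \<longleftrightarrow> 1 < t" .
      have "(d powr a * t) powr - (N / a) = d powr - N * t powr - (N / a)"
        using True assms by (simp add: powr_mult powr_powr)
      then show ?thesis using 1 True da by (auto simp: indicator_def ennreal_mult')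
    next
      case False
      then have "\<not> 0 < d powr a * t" using da by (simp add: zero_less_mult_iff)
      then show ?thesis using False by (auto simp: indicator_def)
    qed
  qed
  also have "\<dots> = ennreal (d powr - N) * powr_tail (N / a)"
    unfolding powr_tail_def by (rule nn_integral_cmult) measurable
  also have "ennreal \<bar>d powr a\<bar> * (ennreal (d powr - N) * powr_tail (N / a)) = ennreal (d powr (a - N)) * powr_tail (N / a)"
    using assms by (simp add: mult.assoc[symmetric] powr_diff powr_minus divide_inverse flip: ennreal_mult')
  finally show ?thesis .
qed

text \<open>By homogeneity, the points of the unit ball where the \<open>a\<close>-th power of
  \<open>r\<close> exceeds \<open>t\<close> become, after dilation by \<open>t powr (1 / a)\<close>,
  the points of \<open>{x. 1 < r x}\<close> with norm below \<open>t powr (1 / a)\<close>.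
  Integrating over \<open>t\<close> first leaves the weight \<open>norm x powr (a - n)\<close>,
  which tends to 1 as \<open>a\<close> tends to \<open>n\<close>.\<close>

lemma nn_integral_epow_ball:
  fixes a :: real and r :: "'a::euclidean_space \<Rightarrow> ennreal"
  assumes hom: "inv_homogeneous r" and [measurable]: "r \<in> borel_measurable borel" and a: "0 < a"
  shows "(\<integral>\<^sup>+x. indicator (ball 0 1) x * epow (r x) a \<partial>lborel) =
    powr_tail (DIM('a) / a) * (\<integral>\<^sup>+x. indicator {x. 1 < r x} x * ennreal (norm x powr (a - DIM('a))) \<partial>lborel)"
proof -
  let ?n = "real DIM('a)"
  have "(\<integral>\<^sup>+x. indicator (ball 0 1) x * epow (r x) a \<partial>lborel) =
     (\<integral>\<^sup>+x. (\<integral>\<^sup>+t. indicator (ball 0 1) x * (if 0 < t \<and> ennreal t < epow (r x) a then 1 else 0) \<partial>(lborel::real measure)) \<partial>lborel)"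
    by (intro nn_integral_cong) (subst nn_integral_cmult, auto simp: ennreal_layer)
  also have "\<dots> = (\<integral>\<^sup>+t. (\<integral>\<^sup>+x. indicator (ball 0 1) x * (if 0 < t \<and> ennreal t < epow (r x) a then 1 else 0) \<partial>lborel) \<partial>(lborel::real measure))"
    by (rule lborel_pair.Fubini') measurable
  also have "\<dots> = (\<integral>\<^sup>+t. (\<integral>\<^sup>+y. indicator {x. 1 < r x} y * (if 0 < t \<and> norm y < t powr (1/a) then ennreal (t powr - (?n / a)) else 0) \<partial>lborel) \<partial>lborel)"
  proof (rule nn_integral_cong)
    fix t :: real
    show "(\<integral>\<^sup>+x. indicator (ball (0::'a) 1) x * (if 0 < t \<and> ennreal t < epow (r x) a then 1 else 0) \<partial>lborel) =
      (\<integral>\<^sup>+y. indicator {x. 1 < r x} y * (if 0 < t \<and> norm y < t powr (1/a) then ennreal (t powr - (?n / a)) else 0) \<partial>lborel)"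
    proof (cases "0 < t")
      case True
      define s where "s = t powr (1/a)"
      have s: "0 < s" using True by (simp add: s_def)
      \<comment> \<open>The Jacobian of the dilation cancels the weight
        \<open>t powr - (n / a)\<close>.\<close>
      have sn: "ennreal (t powr - (?n / a)) * ennreal (\<bar>s\<bar> ^ DIM('a)) = 1"
      proof -
        have "\<bar>s\<bar> ^ DIM('a) = s powr ?n" using s by (simp add: powr_realpow)
        also have "\<dots> = t powr (?n / a)" by (simp add: s_def powr_powr)
        finally have "t powr - (?n / a) * \<bar>s\<bar> ^ DIM('a) = 1" using True by (simp add: powr_minus)
        then show ?thesis by (simp flip: ennreal_mult')
      qed
      let ?f = "\<lambda>y. indicator {x. 1 < r x} y * (if norm y < s then 1 else 0) :: ennreal"
      have "(\<integral>\<^sup>+y. indicator {x. 1 < r x} y * (if 0 < t \<and> norm y < t powr (1/a) then ennreal (t powr - (?n / a)) else 0) \<partial>lborel)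
        = (\<integral>\<^sup>+y. ennreal (t powr - (?n / a)) * ?f y \<partial>lborel)"
        using True by (intro nn_integral_cong) (auto simp: s_def indicator_def)
      also have "\<dots> = ennreal (t powr - (?n / a)) * (\<integral>\<^sup>+y. ?f y \<partial>lborel)"
        by (rule nn_integral_cmult) measurable
      also have "(\<integral>\<^sup>+y. ?f y \<partial>lborel) = ennreal (\<bar>s\<bar> ^ DIM('a)) * (\<integral>\<^sup>+x. ?f (0 + s *\<^sub>R x) \<partial>lborel)"
        using s by (intro nn_integral_lborel_affine) auto
      also have "ennreal (t powr - (?n / a)) * (ennreal (\<bar>s\<bar> ^ DIM('a)) * (\<integral>\<^sup>+x. ?f (0 + s *\<^sub>R x) \<partial>lborel)) = (\<integral>\<^sup>+x. ?f (0 + s *\<^sub>R x) \<partial>lborel)"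
        unfolding mult.assoc[symmetric] sn by simp
      also have "\<dots> = (\<integral>\<^sup>+x. indicator (ball (0::'a) 1) x * (if 0 < t \<and> ennreal t < epow (r x) a then 1 else 0) \<partial>lborel)"
      proof (rule nn_integral_cong)
        fix x :: 'a
        have "(1 < r (s *\<^sub>R x)) = (ennreal t < epow (r x) a)"
          using hom[unfolded inv_homogeneous_def] s ennreal_less_epow_iff[OF a True, of "r x"] by (simp add: s_def)
        moreover have "norm (s *\<^sub>R x) < s \<longleftrightarrow> norm x < 1" using s by simp
        ultimately show "?f (0 + s *\<^sub>R x) = indicator (ball (0::'a) 1) x * (if 0 < t \<and> ennreal t < epow (r x) a then 1 else 0)"
          using True by (auto simp: indicator_def simp del: norm_scaleR)
      qed
      finally show ?thesis by simp
    qed simp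
  qed
  also have "\<dots> = (\<integral>\<^sup>+y. (\<integral>\<^sup>+t. indicator {x. 1 < r x} y * (if 0 < t \<and> norm y < t powr (1/a) then ennreal (t powr - (?n / a)) else 0) \<partial>lborel) \<partial>lborel)"
    by (rule lborel_pair.Fubini') measurable
  also have "\<dots> = (\<integral>\<^sup>+y. powr_tail (?n / a) * (indicator {x. 1 < r x} y * ennreal (norm y powr (a - ?n))) \<partial>lborel)"
  proof (rule nn_integral_cong_AE)
    have "AE y in lborel. y \<noteq> (0::'a)" by (rule AE_lborel_singleton)
    then show "AE y in lborel. (\<integral>\<^sup>+t. indicator {x. 1 < r x} y * (if 0 < t \<and> norm y < t powr (1/a) then ennreal (t powr - (?n / a)) else 0) \<partial>lborel)
      = powr_tail (?n / a) * (indicator {x. 1 < r x} y * ennreal (norm y powr (a - ?n)))"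
    proof eventually_elim
      case (elim y)
      have "(\<integral>\<^sup>+t. indicator {x. 1 < r x} y * (if 0 < t \<and> norm y < t powr (1/a) then ennreal (t powr - (?n / a)) else 0) \<partial>lborel)
        = indicator {x. 1 < r x} y * (\<integral>\<^sup>+t. (if 0 < t \<and> norm y < t powr (1/a) then ennreal (t powr - (?n / a)) else 0) \<partial>lborel)"
        by (rule nn_integral_cmult) measurable
      then show ?case using nn_integral_powr_shell[of "norm y" a ?n] elim a by (simp add: mult_ac)
    qed
  qed
  also have "\<dots> = powr_tail (?n / a) * (\<integral>\<^sup>+y. indicator {x. 1 < r x} y * ennreal (norm y powr (a - ?n)) \<partial>lborel)"
    by (rule nn_integral_cmult) measurable
  finally show ?thesis .
qed

text \<open>The integrand is the excess of \<open>norm x powr - b\<close> over 1 inside the unit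
  ball. At height \<open>t\<close> its level set is the ball of radius
  \<open>(1 + t) powr - (1 / b)\<close> without the centre, where the power is 0 by
  convention.\<close>

lemma nn_integral_norm_powr_excess:
  assumes "0 < b"
  shows "(\<integral>\<^sup>+x. indicator (ball (0::'a::euclidean_space) 1) x * ennreal (norm x powr - b - 1) \<partial>lborel)
    = ennreal (unit_ball_vol (real DIM('a))) * powr_tail (DIM('a) / b)"
proof -
  let ?n = "real DIM('a)" and ?v = "unit_ball_vol (real DIM('a))"
  let ?f = "\<lambda>x::'a. indicator (ball 0 1) x * ennreal (norm x powr - b - 1)"
  have "(\<integral>\<^sup>+x. ?f x \<partial>lborel) = (\<integral>\<^sup>+t. emeasure lborel {x\<in>space lborel. 0 < t \<and> ennreal t < ?f x} \<partial>lborel)"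
    by (rule layer_cake) (auto intro: sigma_finite_lborel)
  also have "\<dots> = (\<integral>\<^sup>+t. ennreal ?v * (ennreal ((1 + t) powr - (?n / b)) * indicator {1<..} (1 + t)) \<partial>lborel)"
  proof (rule nn_integral_cong)
    fix t :: real
    show "emeasure lborel {x\<in>space lborel. 0 < t \<and> ennreal t < ?f x} = ennreal ?v * (ennreal ((1 + t) powr - (?n / b)) * indicator {1<..} (1 + t))"
    proof (cases "0 < t")
      case True
      define s where "s = (1 + t) powr - (1 / b)"
      have s: "0 < s" "s < 1" using True assms by (auto simp: s_def powr_less_one)
      have "(0 < t \<and> ennreal t < ?f x) = (x \<in> ball 0 s - {0})" for x
      proof (cases "x = 0")
        case False
        then have x: "0 < norm x" by simp
        have "norm x < s \<longleftrightarrow> 1 + t < norm x powr - b"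
        proof
          assume "norm x < s"
          then have "s powr - b < norm x powr - b" using x assms by (intro powr_less_mono2_neg) auto
          then show "1 + t < norm x powr - b" using True assms by (simp add: s_def powr_powr)
        next
          assume "1 + t < norm x powr - b"
          then have "(norm x powr - b) powr - (1/b) < (1 + t) powr - (1/b)" using True assms by (intro powr_less_mono2_neg) auto
          then show "norm x < s" using x assms by (simp add: s_def powr_powr)
        qed
        then show ?thesis using True s x False by (auto simp: indicator_def ennreal_less_iff)
      qed (use True in \<open>simp add: ennreal_neg\<close>)
      note eq = this
      have "{x\<in>space lborel. 0 < t \<and> ennreal t < ?f x} = ball 0 s - {0}"
        by (simp only: eq space_lborel space_borel UNIV_I simp_thms Collect_mem_eq)
      moreover have "emeasure lborel (ball 0 s - {0::'a}) = emeasure lborel (ball (0::'a) s)"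
        by (rule emeasure_Diff_null_set) auto
      moreover have "s ^ DIM('a) = (1 + t) powr - (?n / b)"
      proof -
        have "s ^ DIM('a) = s powr ?n" using s by (simp add: powr_realpow)
        then show ?thesis by (simp add: s_def powr_powr)
      qed
      ultimately show ?thesis using True s emeasure_ball[of s "0::'a"] by (simp add: ennreal_mult')
    qed (auto simp: indicator_def)
  qed
  also have "\<dots> = ennreal ?v * (\<integral>\<^sup>+t. (ennreal ((1 + t) powr - (?n / b)) * indicator {1<..} (1 + t)) \<partial>lborel)"
    by (rule nn_integral_cmult) measurable
  also have "(\<integral>\<^sup>+t. (ennreal ((1 + t) powr - (?n / b)) * indicator {1<..} (1 + t)) \<partial>lborel) = powr_tail (?n / b)"
    unfolding powr_tail_def by (rule nn_integral_lborel_shift_real[symmetric]) measurable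
  finally show ?thesis .
qed

text \<open>The weight is at most 1 outside the unit ball and 1 plus the excess inside it. The error
  term does not depend on \<open>S\<close>, so the estimate is uniform over random sets.\<close>

lemma nn_integral_norm_powr_le:
  fixes S :: "'a::euclidean_space set"
  assumes b: "0 < b" and [measurable]: "S \<in> sets borel"
  shows "(\<integral>\<^sup>+x. indicator S x * ennreal (norm x powr - b) \<partial>lborel)
    \<le> emeasure lborel S + ennreal (unit_ball_vol (real DIM('a))) * powr_tail (DIM('a) / b)"
proof -
  have "(\<integral>\<^sup>+x. indicator S x * ennreal (norm x powr - b) \<partial>lborel) \<le> (\<integral>\<^sup>+x. indicator S x + indicator (ball 0 1) x * ennreal (norm x powr - b - 1) \<partial>lborel)"
  proof (rule nn_integral_mono)
    fix x :: 'a
    show "indicator S x * ennreal (norm x powr - b) \<le> indicator S x + indicator (ball 0 1) x * ennreal (norm x powr - b - 1)"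
    proof (cases "norm x < 1 \<and> x \<noteq> 0")
      case True
      then have "1 powr - b \<le> norm x powr - b" using b by (intro powr_mono2') auto
      then have "ennreal (norm x powr - b) = 1 + ennreal (norm x powr - b - 1)"
        by (subst ennreal_1[symmetric], subst ennreal_plus[symmetric]) auto
      then show ?thesis using True by (auto simp: indicator_def)
    next
      case False
      then have "norm x powr - b \<le> 1"
        using b powr_mono2'[of "- b" 1 "norm x"] by (cases "x = 0") auto
      then have "ennreal (norm x powr - b) \<le> 1" by simp
      then show ?thesis by (auto simp: indicator_def add_increasing2)
    qed
  qed
  also have "\<dots> = (\<integral>\<^sup>+x. indicator S x \<partial>lborel) + (\<integral>\<^sup>+x. indicator (ball (0::'a) 1) x * ennreal (norm x powr - b - 1) \<partial>lborel)"
    by (rule nn_integral_add) measurable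
  finally show ?thesis by (simp add: nn_integral_norm_powr_excess[OF b])
qed

text \<open>Comparing the dual volumes of all orders \<open>a < n\<close> and letting \<open>a\<close> tend to \<open>n\<close>.\<close>
lemma dual_volume_limit:
  fixes r1 :: "'v \<Rightarrow> 'a::euclidean_space \<Rightarrow> ennreal" and r2 :: "'w \<Rightarrow> 'a \<Rightarrow> ennreal"
  assumes M: "sigma_finite_measure M1" "sigma_finite_measure M2" "emeasure M2 (space M2) \<le> 1"
    and [measurable]: "(\<lambda>(w, x). r1 w x) \<in> borel_measurable (M1 \<Otimes>\<^sub>M lborel)" "(\<lambda>(w, x). r2 w x) \<in> borel_measurable (M2 \<Otimes>\<^sub>M lborel)"
    and hom: "\<And>w. w \<in> space M1 \<Longrightarrow> inv_homogeneous (r1 w)" "\<And>w. w \<in> space M2 \<Longrightarrow> inv_homogeneous (r2 w)"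
    and le: "\<And>a::real. 0 < a \<Longrightarrow> a < DIM('a) \<Longrightarrow> (\<integral>\<^sup>+w. (\<integral>\<^sup>+x. indicator (ball 0 1) x * epow (r1 w x) a \<partial>lborel) \<partial>M1)
       \<le> (\<integral>\<^sup>+w. (\<integral>\<^sup>+x. indicator (ball 0 1) x * epow (r2 w x) a \<partial>lborel) \<partial>M2)"
  shows "(\<integral>\<^sup>+w. emeasure lborel {x. 1 < r1 w x} \<partial>M1) \<le> (\<integral>\<^sup>+w. emeasure lborel {x. 1 < r2 w x} \<partial>M2)"
proof -
  interpret M1: sigma_finite_measure M1 by fact
  interpret M2: sigma_finite_measure M2 by fact
  let ?n = "real DIM('a)"
  have n1: "1 \<le> ?n" using DIM_positive[where 'a='a] by linarith
  have rm1[measurable]: "r1 w \<in> borel_measurable borel" if "w \<in> space M1" for w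
    using measurable_Pair2[OF assms(4) that] by simp
  have rm2[measurable]: "r2 w \<in> borel_measurable borel" if "w \<in> space M2" for w
    using measurable_Pair2[OF assms(5) that] by simp
  define s1 where "s1 w x = (if 1 < r1 w x then 1 else 0 :: ennreal)" for w x
  define s2 where "s2 w x = (if 1 < r2 w x then 1 else 0 :: ennreal)" for w x
  have [measurable]: "(\<lambda>(w, x). s1 w x) \<in> borel_measurable (M1 \<Otimes>\<^sub>M lborel)" unfolding s1_def by measurable
  have [measurable]: "(\<lambda>(w, x). s2 w x) \<in> borel_measurable (M2 \<Otimes>\<^sub>M lborel)" unfolding s2_def by measurable
  have s1: "s1 w x = indicator {x. 1 < r1 w x} x" and s2: "s2 v x = indicator {x. 1 < r2 v x} x" for w v x
    by (auto simp: s1_def s2_def)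
  define T1 where "T1 b = (\<integral>\<^sup>+w. (\<integral>\<^sup>+x. s1 w x * ennreal (norm x powr - b) \<partial>lborel) \<partial>M1)" for b
  define T2 where "T2 b = (\<integral>\<^sup>+w. (\<integral>\<^sup>+x. s2 w x * ennreal (norm x powr - b) \<partial>lborel) \<partial>M2)" for b
  define V2 where "V2 = (\<integral>\<^sup>+w. emeasure lborel {x. 1 < r2 w x} \<partial>M2)"
  define c where "c b = ennreal (unit_ball_vol ?n) * powr_tail (?n / b)" for b
  \<comment> \<open>For orders below the dimension the normalizing factor is finite and positive and
    cancels.\<close>
  have T12: "T1 b \<le> T2 b" if b: "0 < b" "b < ?n" for b
  proof -
    define a where "a = ?n - b"
    have a: "0 < a" "a < ?n" using b by (auto simp: a_def)
    have e: "- b = a - ?n" by (simp add: a_def)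
    have na: "1 < ?n / a" using a by (simp add: field_simps)
    have t: "powr_tail (?n / a) = ennreal (1 / (?n / a - 1))" "0 < 1 / (?n / a - 1)"
      using powr_tail_eq[OF na] na by simp_all
    have "(\<integral>\<^sup>+w. (\<integral>\<^sup>+x. indicator (ball 0 1) x * epow (r1 w x) a \<partial>lborel) \<partial>M1) = (\<integral>\<^sup>+w. powr_tail (?n / a) * (\<integral>\<^sup>+x. s1 w x * ennreal (norm x powr - b) \<partial>lborel) \<partial>M1)"
      unfolding s1 e using hom(1) rm1 a by (intro nn_integral_cong nn_integral_epow_ball) auto
    also have "\<dots> = powr_tail (?n / a) * T1 b" unfolding T1_def by (rule nn_integral_cmult) measurable
    finally have 1: "(\<integral>\<^sup>+w. (\<integral>\<^sup>+x. indicator (ball 0 1) x * epow (r1 w x) a \<partial>lborel) \<partial>M1) = powr_tail (?n / a) * T1 b" .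
    have "(\<integral>\<^sup>+w. (\<integral>\<^sup>+x. indicator (ball 0 1) x * epow (r2 w x) a \<partial>lborel) \<partial>M2) = (\<integral>\<^sup>+w. powr_tail (?n / a) * (\<integral>\<^sup>+x. s2 w x * ennreal (norm x powr - b) \<partial>lborel) \<partial>M2)"
      unfolding s2 e using hom(2) rm2 a by (intro nn_integral_cong nn_integral_epow_ball) auto
    also have "\<dots> = powr_tail (?n / a) * T2 b" unfolding T2_def by (rule nn_integral_cmult) measurable
    finally have "powr_tail (?n / a) * T1 b \<le> powr_tail (?n / a) * T2 b" using le[OF a] 1 by simp
    then show ?thesis using t by (subst (asm) ennreal_mult_le_mult_iff) auto
  qed
  \<comment> \<open>The total mass of \<open>M2\<close> is at most 1, so the uniform error
    \<open>c b\<close> survives the integration over \<open>w\<close> unchanged.\<close>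
  have T2: "T2 b \<le> V2 + c b" if b: "0 < b" for b
  proof -
    have "T2 b \<le> (\<integral>\<^sup>+w. emeasure lborel {x. 1 < r2 w x} + c b \<partial>M2)"
      unfolding T2_def s2 c_def using rm2 b by (intro nn_integral_mono nn_integral_norm_powr_le) auto
    also have "\<dots> = V2 + c b * emeasure M2 (space M2)"
    proof -
      have "(\<lambda>w. \<integral>\<^sup>+x. s2 w x \<partial>lborel) \<in> borel_measurable M2" by measurable
      moreover have "(\<integral>\<^sup>+x. s2 w x \<partial>lborel) = emeasure lborel {x. 1 < r2 w x}" if "w \<in> space M2" for w
        unfolding s2 using rm2[OF that] by (subst nn_integral_indicator) auto
      ultimately have "(\<lambda>w. emeasure lborel {x. 1 < r2 w x}) \<in> borel_measurable M2" by (simp cong: measurable_cong)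
      then show ?thesis unfolding V2_def by (subst nn_integral_add) auto
    qed
    also have "\<dots> \<le> V2 + c b * 1" using M(3) by (intro add_left_mono mult_left_mono) auto
    finally show ?thesis by simp
  qed
  \<comment> \<open>The shift by 2 keeps \<open>b\<close> at most 1/2, hence below the dimension
    even in dimension one.\<close>
  let ?b = "\<lambda>k::nat. 1 / real (k + 2)"
  have b: "0 < ?b k" "?b k < ?n" for k
  proof -
    have "?b k \<le> 1 / 2" by (intro divide_left_mono) auto
    then show "?b k < ?n" using n1 by linarith
  qed simp
  have "(\<integral>\<^sup>+w. emeasure lborel {x. 1 < r1 w x} \<partial>M1) \<le> (\<integral>\<^sup>+w. liminf (\<lambda>k. \<integral>\<^sup>+x. s1 w x * ennreal (norm x powr - ?b k) \<partial>lborel) \<partial>M1)"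
  \<comment> \<open>Away from the origin the weights tend to 1, so Fatou's lemma, over
    \<open>x\<close> here and over \<open>w\<close> afterwards, bounds the volumes of
    \<open>r1\<close> from above by weighted integrals.\<close>
  proof (rule nn_integral_mono)
    fix w assume w: "w \<in> space M1"
    note rm1[OF w, measurable]
    have [measurable]: "s1 w \<in> borel_measurable borel" unfolding s1_def by measurable
    have "emeasure lborel {x. 1 < r1 w x} = (\<integral>\<^sup>+x. s1 w x \<partial>lborel)" unfolding s1 by (subst nn_integral_indicator) auto
    also have "\<dots> \<le> (\<integral>\<^sup>+x. liminf (\<lambda>k. s1 w x * ennreal (norm x powr - ?b k)) \<partial>lborel)"
    proof (rule nn_integral_mono_AE)
      have "AE x in lborel. x \<noteq> (0::'a)" by (rule AE_lborel_singleton)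
      then show "AE x in lborel. s1 w x \<le> liminf (\<lambda>k. s1 w x * ennreal (norm x powr - ?b k))"
      proof eventually_elim
        case (elim x)
        have "(\<lambda>k. - ?b k) \<longlonglongrightarrow> - 0" by (intro tendsto_minus LIMSEQ_ignore_initial_segment lim_1_over_n)
        then have "(\<lambda>k. norm x powr - ?b k) \<longlonglongrightarrow> norm x powr - 0" using elim by (intro tendsto_powr tendsto_const) auto
        then have "(\<lambda>k. ennreal (norm x powr - ?b k)) \<longlonglongrightarrow> ennreal (norm x powr - 0)" by (rule tendsto_ennrealI)
        then have "(\<lambda>k. s1 w x * ennreal (norm x powr - ?b k)) \<longlonglongrightarrow> s1 w x * 1"
          using elim by (intro ennreal_tendsto_cmult) (auto simp: s1_def)
        then have "liminf (\<lambda>k. s1 w x * ennreal (norm x powr - ?b k)) = s1 w x"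
          by (simp add: lim_imp_Liminf)
        then show ?case by simp
      qed
    qed
    also have "\<dots> \<le> liminf (\<lambda>k. \<integral>\<^sup>+x. s1 w x * ennreal (norm x powr - ?b k) \<partial>lborel)"
      by (rule nn_integral_liminf) measurable
    finally show "emeasure lborel {x. 1 < r1 w x} \<le> liminf (\<lambda>k. \<integral>\<^sup>+x. s1 w x * ennreal (norm x powr - ?b k) \<partial>lborel)" .
  qed
  also have "\<dots> \<le> liminf (\<lambda>k. T1 (?b k))"
    unfolding T1_def by (rule nn_integral_liminf) measurable
  also have "\<dots> \<le> liminf (\<lambda>k. V2 + c (?b k))"
    using order_trans[OF T12[OF b] T2[OF b(1)]] by (intro Liminf_mono always_eventually allI)
  also have "\<dots> = V2"
  proof -
    \<comment> \<open>Since \<open>n / b\<close> is at least \<open>k + 2\<close>, the tail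
      \<open>1 / (n / b - 1)\<close> is at most \<open>1 / (k + 1)\<close>.\<close>
    have cle: "c (?b k) \<le> ennreal (unit_ball_vol ?n * (1 / real (k + 1)))" for k
    proof -
      have nb: "?n / ?b k = ?n * real (k + 2)" by simp
      have "1 * real (k + 2) \<le> ?n * real (k + 2)" using n1 by (intro mult_right_mono) auto
      then have "real k + 2 \<le> ?n / ?b k" unfolding nb mult_1 by linarith
      then have ge: "real (k + 1) \<le> ?n / ?b k - 1" "1 < ?n / ?b k" by linarith+
      have "powr_tail (?n / ?b k) = ennreal (1 / (?n / ?b k - 1))" by (rule powr_tail_eq[OF ge(2)])
      also have "\<dots> \<le> ennreal (1 / real (k + 1))" using ge by (intro ennreal_leI divide_left_mono mult_pos_pos) auto
      finally have "c (?b k) \<le> ennreal (unit_ball_vol ?n) * ennreal (1 / real (k + 1))"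
        unfolding c_def by (intro mult_left_mono) auto
      then show ?thesis by (subst ennreal_mult) auto
    qed
    have "(\<lambda>k. unit_ball_vol ?n * (1 / real (k + 1))) \<longlonglongrightarrow> unit_ball_vol ?n * 0"
      by (intro tendsto_mult tendsto_const LIMSEQ_ignore_initial_segment lim_1_over_n)
    then have "(\<lambda>k. ennreal (unit_ball_vol ?n * (1 / real (k + 1)))) \<longlonglongrightarrow> ennreal (unit_ball_vol ?n * 0)"
      by (rule tendsto_ennrealI)
    then have L: "(\<lambda>k. ennreal (unit_ball_vol ?n * (1 / real (k + 1)))) \<longlonglongrightarrow> 0"
      by (simp only: mult_zero_right ennreal_0)
    have "(\<lambda>k. c (?b k)) \<longlonglongrightarrow> 0"
      by (rule tendsto_sandwich[OF always_eventually[OF allI[OF zero_le]] always_eventually[OF allI[OF cle]] tendsto_const L])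
    then have "(\<lambda>k. V2 + c (?b k)) \<longlonglongrightarrow> V2 + 0" by (intro tendsto_add tendsto_const)
    then show ?thesis by (simp add: lim_imp_Liminf)
  qed
  finally show ?thesis unfolding V2_def .
qed

section \<open>Negative powers as superpositions of exponentials\<close>

definition eexp :: "ennreal \<Rightarrow> ennreal" where
  "eexp z = (if z = \<infinity> then 0 else ennreal (exp (- enn2real z)))"

lemma eexp_measurable [measurable]: "eexp \<in> borel_measurable borel"
  unfolding eexp_def by measurable

lemma eexp_ennreal [simp]: "0 \<le> z \<Longrightarrow> eexp (ennreal z) = ennreal (exp (- z))"
  by (simp add: eexp_def)

lemma eexp_top [simp]: "eexp top = 0"
  by (simp add: eexp_def)

lemma eexp_le_1: "eexp z \<le> 1"
  by (auto simp: eexp_def)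

lemma eexp_antimono: "y \<le> z \<Longrightarrow> eexp z \<le> eexp y"
  by (cases y; cases z) (auto simp: top_unique)

text \<open>For positive finite \<open>G\<close> this is the substitution of \<open>s / G\<close>
  for \<open>s\<close> in Euler's integral. At \<open>G = 0\<close> the integral diverges and at
  infinity it vanishes, in agreement with the conventions of \<open>epow\<close>.\<close>

lemma gamma_integral_ennreal:
  assumes "0 < \<alpha>"
  shows "(\<integral>\<^sup>+s. (if 0 < s then ennreal (s powr (\<alpha> - 1)) * eexp (ennreal s * G) else 0) \<partial>lborel) = ennreal (Gamma \<alpha>) * epow G (- \<alpha>)"
proof -
  define I where "I G = (\<integral>\<^sup>+s. (if 0 < s then ennreal (s powr (\<alpha> - 1)) * eexp (ennreal s * G) else 0) \<partial>lborel)" for G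
  have \<Gamma>: "0 < Gamma \<alpha>" using assms by (rule Gamma_real_pos)
  have G1: "(\<integral>\<^sup>+s. (if 0 < s then ennreal (s powr (\<alpha> - 1) * exp (- s)) else 0) \<partial>lborel) = ennreal (Gamma \<alpha>)"
  proof -
    have "ennreal (Gamma \<alpha>) = (\<integral>\<^sup>+t. ennreal (indicator {0..} t * t powr (\<alpha> - 1) / exp t) \<partial>lborel)"
      using Gamma_conv_nn_integral_real[OF assms] by simp
    also have "\<dots> = (\<integral>\<^sup>+s. (if 0 < s then ennreal (s powr (\<alpha> - 1) * exp (- s)) else 0) \<partial>lborel)"
      by (intro nn_integral_cong) (auto simp: indicator_def exp_minus divide_inverse)
    finally show ?thesis by simp
  qed
  have pos: "I (ennreal g) = ennreal (Gamma \<alpha> * g powr - \<alpha>)" if "0 < g" for g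
  proof -
    let ?f = "\<lambda>s. if 0 < s then ennreal (s powr (\<alpha> - 1)) * eexp (ennreal s * ennreal g) else 0"
    have "I (ennreal g) = ennreal \<bar>1/g\<bar> * (\<integral>\<^sup>+s. ?f (0 + (1/g) * s) \<partial>lborel)"
      unfolding I_def using that by (intro nn_integral_real_affine) auto
    also have "(\<integral>\<^sup>+s. ?f (0 + (1/g) * s) \<partial>lborel) = (\<integral>\<^sup>+s. ennreal ((1/g) powr (\<alpha> - 1)) * (if 0 < s then ennreal (s powr (\<alpha> - 1) * exp (- s)) else 0) \<partial>lborel)"
    proof (rule nn_integral_cong)
      fix s :: real
      show "?f (0 + (1/g) * s) = ennreal ((1/g) powr (\<alpha> - 1)) * (if 0 < s then ennreal (s powr (\<alpha> - 1) * exp (- s)) else 0)"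
      proof (cases "0 < s")
        case True
        have "((1/g) * s) powr (\<alpha> - 1) = (1/g) powr (\<alpha> - 1) * s powr (\<alpha> - 1)" by (rule powr_mult)
        moreover have "ennreal ((1/g) * s) * ennreal g = ennreal s" using True that by (simp flip: ennreal_mult')
        moreover have "0 < (1/g) * s" using True that by simp
        ultimately show ?thesis using True by (simp add: ennreal_mult' mult.assoc)
      next
        case False
        then have "\<not> 0 < (1/g) * s" using that by (simp add: zero_less_divide_iff)
        then show ?thesis using False by simp
      qed
    qed
    also have "\<dots> = ennreal ((1/g) powr (\<alpha> - 1)) * ennreal (Gamma \<alpha>)"
      by (subst nn_integral_cmult) (auto simp: G1)
    also have "ennreal \<bar>1/g\<bar> * (ennreal ((1/g) powr (\<alpha> - 1)) * ennreal (Gamma \<alpha>)) = ennreal (1/g * ((1/g) powr (\<alpha> - 1) * Gamma \<alpha>))"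
      using that \<Gamma> by (simp flip: ennreal_mult')
    also have "1/g * ((1/g) powr (\<alpha> - 1) * Gamma \<alpha>) = Gamma \<alpha> * g powr - \<alpha>"
      using that by (simp add: powr_diff powr_divide powr_minus divide_simps)
    finally show ?thesis .
  qed
  show ?thesis unfolding I_def[symmetric]
  proof (cases G)
    case (real g)
    show "I G = ennreal (Gamma \<alpha>) * epow G (- \<alpha>)"
    proof (cases "g = 0")
      case False
      then show ?thesis using real pos[of g] \<Gamma> assms by (simp add: epow_def ennreal_mult')
    next
      case True
      have le: "ennreal (Gamma \<alpha> * g powr - \<alpha>) \<le> I 0" if "0 < g" for g
        unfolding pos[OF that, symmetric] I_def by (intro nn_integral_mono) (auto intro!: mult_left_mono eexp_antimono)
      have "I 0 = top"
      proof (rule ccontr)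
        assume "I 0 \<noteq> top"
        then obtain y where y: "I 0 = ennreal y" "0 \<le> y" by (metis ennreal_cases)
        \<comment> \<open>Chosen so that \<open>Gamma \<alpha> * g powr - \<alpha>\<close> equals
          \<open>y + 1\<close>; by monotonicity the integral at \<open>G = 0\<close> would exceed
          its assumed value \<open>y\<close>.\<close>
        define g where "g = ((y + 1) / Gamma \<alpha>) powr (- 1 / \<alpha>)"
        have q: "0 < (y + 1) / Gamma \<alpha>" using y \<Gamma> by simp
        then have "0 < g" unfolding g_def by (metis less_irrefl powr_gt_zero)
        have "(- 1 / \<alpha>) * - \<alpha> = 1" using assms by simp
        then have "g powr - \<alpha> = (y + 1) / Gamma \<alpha>" unfolding g_def powr_powr using powr_one[OF less_imp_le[OF q]] by simp
        then have "ennreal (y + 1) \<le> ennreal y" using le[OF \<open>0 < g\<close>] y \<Gamma> by simp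
        then show False using y by (simp add: ennreal_le_iff del: ennreal_plus)
      qed
      moreover have "ennreal (Gamma \<alpha>) \<noteq> 0" using \<Gamma> by (metis ennreal_eq_0_iff leD)
      ultimately show ?thesis using real True assms by (simp add: epow_def ennreal_mult_top)
    qed
  next
    case top
    have "I G = (\<integral>\<^sup>+s. 0 \<partial>(lborel::real measure))" unfolding I_def using top
      by (intro nn_integral_cong) (auto simp: ennreal_mult_top)
    then show "I G = ennreal (Gamma \<alpha>) * epow G (- \<alpha>)" using top assms by (simp add: epow_def)
  qed
qed

section \<open>Support functions and densities\<close>

lemma os_convex_body_nonempty: "os_convex_body m C \<Longrightarrow> C \<noteq> {}"
  by (auto simp: os_convex_body_def)

lemma continuous_on_linear_functional:
  "continuous_on UNIV (\<lambda>y::nat \<Rightarrow> real. \<Sum>j<m. c j * y j)"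
  by (intro continuous_intros continuous_on_product_coordinates)

lemma supp_fun_bdd:
  assumes "os_convex_body m C"
  shows "bdd_above ((\<lambda>c. \<Sum>j<m. c j * y j) ` C)"
proof -
  have "continuous_on C (\<lambda>c. \<Sum>j<m. y j * c j)"
    using continuous_on_linear_functional[of y m] continuous_on_subset by blast
  then have "compact ((\<lambda>c. \<Sum>j<m. y j * c j) ` C)"
    using assms by (intro compact_continuous_image) (auto simp: os_convex_body_def)
  then have "bounded ((\<lambda>c. \<Sum>j<m. c j * y j) ` C)"
    by (simp add: mult.commute compact_imp_bounded)
  then show ?thesis by (rule bounded_imp_bdd_above)
qed

lemma supp_fun_upper:
  assumes "os_convex_body m C" "c \<in> C"
  shows "(\<Sum>j<m. c j * y j) \<le> supp_fun m C y"
  unfolding supp_fun_def by (rule cSUP_upper[OF assms(2) supp_fun_bdd[OF assms(1)]])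

lemma supp_fun_least:
  assumes "os_convex_body m C" "\<And>c. c \<in> C \<Longrightarrow> (\<Sum>j<m. c j * y j) \<le> u"
  shows "supp_fun m C y \<le> u"
  unfolding supp_fun_def using os_convex_body_nonempty[OF assms(1)] assms(2) by (rule cSUP_least)

lemma supp_fun_even_le:
  assumes C: "os_convex_body m C"
  shows "supp_fun m C (\<lambda>j. - y j) \<le> supp_fun m C y"
proof (rule supp_fun_least[OF C])
  fix c assume "c \<in> C"
  then have "(\<lambda>j. - c j) \<in> C" using C by (auto simp: os_convex_body_def)
  from supp_fun_upper[OF C this, of y] show "(\<Sum>j<m. c j * - y j) \<le> supp_fun m C y" by (simp add: sum_negf)
qed

lemma supp_fun_even:
  assumes C: "os_convex_body m C"
  shows "supp_fun m C (\<lambda>j. - y j) = supp_fun m C y"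
  using supp_fun_even_le[OF C, of y] supp_fun_even_le[OF C, of "\<lambda>j. - y j"] by simp

text \<open>The support function has the same value at \<open>y\<close> and \<open>- y\<close>, and
  for any \<open>c\<close> in \<open>C\<close> this value dominates two opposite numbers.\<close>

lemma supp_fun_nonneg:
  assumes C: "os_convex_body m C"
  shows "0 \<le> supp_fun m C y"
proof -
  obtain c where c: "c \<in> C" using os_convex_body_nonempty[OF C] by auto
  have "(\<Sum>j<m. c j * y j) \<le> supp_fun m C y" "(\<Sum>j<m. c j * - y j) \<le> supp_fun m C (\<lambda>j. - y j)"
    by (rule supp_fun_upper[OF C c])+
  then show ?thesis by (simp add: supp_fun_even[OF C] sum_negf)
qed

lemma supp_fun_scale_le:
  assumes C: "os_convex_body m C" and "0 < s"
  shows "supp_fun m C (\<lambda>j. s * y j) \<le> s * supp_fun m C y"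
proof (rule supp_fun_least[OF C])
  fix c assume "c \<in> C"
  have "(\<Sum>j<m. c j * (s * y j)) = s * (\<Sum>j<m. c j * y j)" by (simp add: sum_distrib_left mult_ac)
  also have "\<dots> \<le> s * supp_fun m C y"
    using supp_fun_upper[OF C \<open>c \<in> C\<close>, of y] \<open>0 < s\<close> by (intro mult_left_mono) auto
  finally show "(\<Sum>j<m. c j * (s * y j)) \<le> s * supp_fun m C y" .
qed

lemma supp_fun_scale:
  assumes C: "os_convex_body m C" and s: "0 < s"
  shows "supp_fun m C (\<lambda>j. s * y j) = s * supp_fun m C y"
proof (rule antisym[OF supp_fun_scale_le[OF assms]])
  have "supp_fun m C y = supp_fun m C (\<lambda>j. (1/s) * (s * y j))" using s by simp
  also have "\<dots> \<le> (1/s) * supp_fun m C (\<lambda>j. s * y j)" using s by (intro supp_fun_scale_le[OF C]) simp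
  finally show "s * supp_fun m C y \<le> supp_fun m C (\<lambda>j. s * y j)" using s by (simp add: field_simps)
qed

lemma supp_fun_mid:
  assumes C: "os_convex_body m C"
  shows "supp_fun m C (\<lambda>j. (y j + z j) / 2) \<le> max (supp_fun m C y) (supp_fun m C z)"
proof (rule supp_fun_least[OF C])
  fix c assume "c \<in> C"
  have "(\<Sum>j<m. c j * ((y j + z j) / 2)) = ((\<Sum>j<m. c j * y j) + (\<Sum>j<m. c j * z j)) / 2"
    by (simp add: sum.distrib[symmetric] sum_divide_distrib distrib_left)
  then show "(\<Sum>j<m. c j * ((y j + z j) / 2)) \<le> max (supp_fun m C y) (supp_fun m C z)"
    using supp_fun_upper[OF C \<open>c \<in> C\<close>, of y] supp_fun_upper[OF C \<open>c \<in> C\<close>, of z] by (auto simp: max_def)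
qed

lemma supp_fun_cong: "(\<And>j. j < m \<Longrightarrow> y j = z j) \<Longrightarrow> supp_fun m C y = supp_fun m C z"
  unfolding supp_fun_def by (intro arg_cong[where f=Sup] image_cong sum.cong) auto

text \<open>A supremum of continuous functions is lower semicontinuous, so its superlevel sets are
  open, however many \<open>c\<close> there are.\<close>

lemma supp_fun_measurable:
  assumes C: "os_convex_body m C"
  shows "supp_fun m C \<in> borel_measurable borel"
proof -
  have "open {y. t < supp_fun m C y}" for t
  proof -
    have "{y. t < supp_fun m C y} = (\<Union>c\<in>C. {y. t < (\<Sum>j<m. c j * y j)})"
      unfolding supp_fun_def by (auto simp: less_cSUP_iff[OF os_convex_body_nonempty[OF C] supp_fun_bdd[OF C]])
    moreover have "open {y::nat \<Rightarrow> real. t < (\<Sum>j<m. c j * y j)}" for c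
      using continuous_on_linear_functional by (intro open_Collect_less continuous_on_const) auto
    ultimately show ?thesis by auto
  qed
  then show ?thesis by (subst borel_measurable_iff_greater) (auto intro: borel_open)
qed

lemma supp_fun_measurable_coordinates:
  assumes C: "os_convex_body m C" and e: "\<And>j. j < m \<Longrightarrow> (\<lambda>w. g w j) \<in> borel_measurable M"
  shows "(\<lambda>w. supp_fun m C (g w)) \<in> borel_measurable M"
proof -
  have [measurable]: "supp_fun m C \<in> borel_measurable borel" by (rule supp_fun_measurable[OF C])
  \<comment> \<open>Coordinates from \<open>m\<close> on are set to 0, since measurability is known
    only below \<open>m\<close>; the support function does not see them.\<close>
  have "(\<lambda>w. \<lambda>j. if j < m then g w j else 0) \<in> borel_measurable M"
  proof (rule measurable_coordinatewise_then_product)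
    show "(\<lambda>w. if i < m then g w i else 0) \<in> borel_measurable M" for i
      using e[of i] by (cases "i < m") auto
  qed
  then have "(\<lambda>w. supp_fun m C (\<lambda>j. if j < m then g w j else 0)) \<in> borel_measurable M" by measurable
  moreover have "supp_fun m C (\<lambda>j. if j < m then g w j else 0) = supp_fun m C (g w)" for w
    by (rule supp_fun_cong) simp
  ultimately show ?thesis by simp
qed

text \<open>The support function is even and convex, so a decreasing function of it is even and
  quasiconcave. The map \<open>e\<close> names the coordinates in \<open>J\<close> that the body
  occupies, such as one row of the array of random points.\<close>

lemma sym_quasiconcave_supp_fun:
  fixes \<phi> :: "real \<Rightarrow> ennreal"
  assumes C: "os_convex_body m C" and e: "\<And>j. j < m \<Longrightarrow> e j \<in> J"
    and [measurable]: "\<phi> \<in> borel_measurable borel" and \<phi>: "\<And>s t. 0 \<le> s \<Longrightarrow> s \<le> t \<Longrightarrow> \<phi> t \<le> \<phi> s"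
  shows "sym_quasiconcave J (\<lambda>y. \<phi> (supp_fun m C (\<lambda>j. y (e j))))"
proof -
  let ?h = "\<lambda>y. supp_fun m C (\<lambda>j. y (e j))"
  have [measurable]: "?h \<in> borel_measurable (PiM J (\<lambda>_. borel))"
    using e by (intro supp_fun_measurable_coordinates[OF C] measurable_component_singleton) auto
  show ?thesis
    unfolding sym_quasiconcave_def
  proof (intro conjI allI impI)
    show "(\<lambda>y. \<phi> (?h y)) \<in> borel_measurable (PiM J (\<lambda>_. borel))" by measurable
    fix t :: real
    show "sym_midconvex J {y \<in> space (PiM J (\<lambda>_. borel)). ennreal t < \<phi> (?h y)}"
      unfolding sym_midconvex_def
    proof (intro conjI ballI)
      show "{y \<in> space (PiM J (\<lambda>_. borel)). ennreal t < \<phi> (?h y)} \<in> sets (PiM J (\<lambda>_. borel))" by measurable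
    next
      fix x assume x: "x \<in> {y \<in> space (PiM J (\<lambda>_. borel)). ennreal t < \<phi> (?h y)}"
      have "?h (\<lambda>j\<in>J. - x j) = supp_fun m C (\<lambda>j. - x (e j))" using e by (intro supp_fun_cong) auto
      then show "(\<lambda>j\<in>J. - x j) \<in> {y \<in> space (PiM J (\<lambda>_. borel)). ennreal t < \<phi> (?h y)}"
        using x by (simp add: supp_fun_even[OF C] space_PiM)
    next
      fix x y assume x: "x \<in> {y \<in> space (PiM J (\<lambda>_. borel)). ennreal t < \<phi> (?h y)}" and y: "y \<in> {y \<in> space (PiM J (\<lambda>_. borel)). ennreal t < \<phi> (?h y)}"
      have "?h (\<lambda>j\<in>J. (x j + y j) / 2) = supp_fun m C (\<lambda>j. (x (e j) + y (e j)) / 2)" using e by (intro supp_fun_cong) auto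
      also have "\<dots> \<le> max (?h x) (?h y)" by (rule supp_fun_mid[OF C])
      finally have "\<phi> (max (?h x) (?h y)) \<le> \<phi> (?h (\<lambda>j\<in>J. (x j + y j) / 2))"
        by (intro \<phi> supp_fun_nonneg[OF C])
      moreover have "ennreal t < \<phi> (max (?h x) (?h y))" using x y by (auto simp: max_def)
      ultimately show "(\<lambda>j\<in>J. (x j + y j) / 2) \<in> {y \<in> space (PiM J (\<lambda>_. borel)). ennreal t < \<phi> (?h y)}"
        by (simp add: space_PiM)
    qed
  qed
qed

section \<open>Lebesgue densities and their Borel versions\<close>

lemma sigma_finite_lebesgue: "sigma_finite_measure (lebesgue :: 'a::euclidean_space measure)"
proof
  obtain A :: "'a set set" where A: "countable A" "A \<subseteq> sets lborel" "\<Union>A = space lborel" "\<forall>a\<in>A. emeasure lborel a \<noteq> \<infinity>"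
    using lborel.sigma_finite_countable by blast
  then show "\<exists>A. countable A \<and> A \<subseteq> sets (lebesgue :: 'a measure) \<and> \<Union>A = space lebesgue \<and> (\<forall>a\<in>A. emeasure lebesgue a \<noteq> \<infinity>)"
    by (intro exI[of _ A]) (auto simp: subset_iff)
qed

text \<open>The densities are replaced almost everywhere by Borel functions. The integrand is then
  measurable for the product of \<open>lborel\<close>, which is the image of the product of
  \<open>lebesgue\<close> under the identity.\<close>

lemma nn_integral_PiM_lebesgue_weight:
  fixes f :: "'i \<Rightarrow> 'a::euclidean_space \<Rightarrow> real" and W :: "'i \<Rightarrow> 'a \<Rightarrow> ennreal"
  assumes J: "finite J" and G[measurable]: "G \<in> borel_measurable (PiM J (\<lambda>_. lborel))"
    and f: "\<And>j x. j \<in> J \<Longrightarrow> 0 \<le> f j x" and W: "\<And>j. j \<in> J \<Longrightarrow> W j \<in> borel_measurable borel"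
    and eq: "\<And>j. j \<in> J \<Longrightarrow> AE x in lebesgue. ennreal (f j x) = W j x"
  shows "(\<integral>\<^sup>+X. G X * ennreal (\<Prod>j\<in>J. f j (X j)) \<partial>PiM J (\<lambda>_. lebesgue)) = (\<integral>\<^sup>+X. G X * (\<Prod>j\<in>J. W j (X j)) \<partial>PiM J (\<lambda>_. lborel))"
proof -
  have psf: "product_sigma_finite (\<lambda>_. lebesgue :: 'a measure)"
    unfolding product_sigma_finite_def by (simp add: sigma_finite_lebesgue)
  have "(\<integral>\<^sup>+X. G X * ennreal (\<Prod>j\<in>J. f j (X j)) \<partial>PiM J (\<lambda>_. lebesgue)) = (\<integral>\<^sup>+X. G X * (\<Prod>j\<in>J. W j (X j)) \<partial>PiM J (\<lambda>_. lebesgue))"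
  proof (rule nn_integral_cong_AE)
    have "AE X in PiM J (\<lambda>_. lebesgue). \<forall>j\<in>J. ennreal (f j (X j)) = W j (X j)"
      using J eq by (subst AE_ball_countable) (auto intro!: countable_finite AE_PiM_component[OF J psf])
    then show "AE X in PiM J (\<lambda>_. lebesgue). G X * ennreal (\<Prod>j\<in>J. f j (X j)) = G X * (\<Prod>j\<in>J. W j (X j))"
      by eventually_elim (simp add: prod_ennreal[symmetric] f)
  qed
  also have "\<dots> = (\<integral>\<^sup>+X. G X * (\<Prod>j\<in>J. W j (X j)) \<partial>distr (PiM J (\<lambda>_. lebesgue)) (PiM J (\<lambda>_. lborel)) (\<lambda>X. \<lambda>j\<in>J. X j))"
  proof -
    have [measurable]: "(\<lambda>x. x) \<in> measurable lebesgue (lborel :: 'a measure)"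
      by (rule measurable_completion) simp
    have m: "(\<lambda>X. \<lambda>j\<in>J. X j) \<in> measurable (PiM J (\<lambda>_. lebesgue)) (PiM J (\<lambda>_. lborel :: 'a measure))"
    proof (rule measurable_restrict)
      fix j assume "j \<in> J"
      then have "(\<lambda>X. X j) \<in> measurable (PiM J (\<lambda>_. lebesgue)) (lebesgue :: 'a measure)" by (rule measurable_component_singleton)
      then show "(\<lambda>X. X j) \<in> measurable (PiM J (\<lambda>_. lebesgue)) (lborel :: 'a measure)" by measurable
    qed
    have gm: "(\<lambda>X. G X * (\<Prod>j\<in>J. W j (X j))) \<in> borel_measurable (PiM J (\<lambda>_. lborel))"
    proof -
      have "(\<lambda>X. W j (X j)) \<in> borel_measurable (PiM J (\<lambda>_. lborel))" if "j \<in> J" for j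
        using W[OF that] that by (intro measurable_compose[OF measurable_component_singleton]) auto
      then show ?thesis by (intro borel_measurable_times_ennreal G borel_measurable_prod_ennreal)
    qed
    have "(\<lambda>j\<in>J. X j) = X" if "X \<in> space (PiM J (\<lambda>_. lebesgue :: 'a measure))" for X
      using that by (auto simp: space_PiM PiE_def extensional_def fun_eq_iff)
    then show ?thesis
      using gm by (subst nn_integral_distr[OF m]) (auto intro!: nn_integral_cong)
  qed
  also have "distr (PiM J (\<lambda>_. lebesgue)) (PiM J (\<lambda>_. lborel :: 'a measure)) (\<lambda>X. \<lambda>j\<in>J. X j) = PiM J (\<lambda>_. lborel)"
  proof (rule distr_PiM_componentwise[OF J psf product_sigma_finite_lborel])
    show "(\<lambda>x. x) \<in> measurable lebesgue (lborel :: 'a measure)" by (rule measurable_completion) simp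
    show "distr lebesgue lborel (\<lambda>x. x) = (lborel :: 'a measure)"
      by (subst distr_completion) (auto simp: distr_id)
  qed
  finally show ?thesis .
qed

lemma sym_layers_measurable:
  assumes "finite_levels F"
  shows "sym_layers F \<in> borel_measurable borel"
proof -
  have "(\<lambda>(x, t). indicator {0<..} t * indicator (sym_set {y. t < F y}) x :: ennreal) \<in> borel_measurable (lborel \<Otimes>\<^sub>M lborel)"
    using measurable_pair_swap[OF sym_levels_measurable[OF assms]] by (simp add: case_prod_beta)
  then have "(\<lambda>x. \<integral>\<^sup>+t. indicator {0<..} t * indicator (sym_set {y. t < F y}) x \<partial>lborel) \<in> borel_measurable lborel"
    by (rule lborel.borel_measurable_nn_integral)
  then show ?thesis by (simp add: sym_layers_def[abs_def])
qed

text \<open>Each layer is replaced by a ball of the same measure, so the layer cake integrals agree;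
  rearranged densities are again probability densities.\<close>

lemma nn_integral_sym_layers:
  fixes F :: "'a::euclidean_space \<Rightarrow> real"
  assumes F: "finite_levels F"
  shows "(\<integral>\<^sup>+x. sym_layers F x \<partial>lborel) = (\<integral>\<^sup>+x. ennreal (F x) \<partial>lborel)"
proof -
  have [measurable]: "F \<in> borel_measurable borel" using F by (simp add: finite_levels_def)
  have "(\<integral>\<^sup>+x. sym_layers F x \<partial>lborel) = (\<integral>\<^sup>+t. (\<integral>\<^sup>+x. indicator {0<..} t * indicator (sym_set {y. t < F y}) x \<partial>lborel) \<partial>lborel)"
    unfolding sym_layers_def
    by (rule lborel_pair.Fubini') (rule sym_levels_measurable[OF F])
  also have "\<dots> = (\<integral>\<^sup>+t. emeasure lborel {x\<in>space lborel. 0 < t \<and> ennreal t < ennreal (F x)} \<partial>lborel)"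
  proof (rule nn_integral_cong)
    fix t :: real
    show "(\<integral>\<^sup>+x. indicator {0<..} t * indicator (sym_set {y. t < F y}) x \<partial>lborel) = emeasure lborel {x\<in>space lborel. 0 < t \<and> ennreal t < ennreal (F x)}"
    proof (cases "0 < t")
      case True
      then have fin: "emeasure lborel {y. t < F y} < \<infinity>" using F by (simp add: finite_levels_def)
      have "{x\<in>space lborel. 0 < t \<and> ennreal t < ennreal (F x)} = {y. t < F y}"
        using True by (auto simp: ennreal_less_iff)
      moreover have "emeasure lborel (sym_set {y. t < F y}) = emeasure lborel {y. t < F y}"
      proof -
        have "emeasure lborel {y. t < F y} = ennreal (measure lborel {y. t < F y})"
          using fin by (intro emeasure_eq_ennreal_measure) auto
        moreover have "emeasure lborel (sym_set {y. t < F y}) = ennreal (measure lborel {y. t < F y})"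
          using fin by (subst sym_set_borel) (simp, simp, rule ball_radius(2), simp)
        ultimately show ?thesis by simp
      qed
      moreover have "sym_set {y. t < F y} \<in> sets borel" using fin by (subst sym_set_borel) auto
      ultimately show ?thesis using True by simp
    qed simp
  qed
  also have "\<dots> = (\<integral>\<^sup>+x. ennreal (F x) \<partial>lborel)"
    by (rule layer_cake[symmetric]) (auto intro: sigma_finite_lborel)
  finally show ?thesis .
qed

text \<open>Rearrangement sees a function only through the measures of its level sets, so passing to
  a Borel version \<open>F\<close> leaves every \<open>sym_set\<close> literally unchanged.\<close>

lemma Pn_weights:
  fixes f :: "'a::euclidean_space \<Rightarrow> real"
  assumes f: "Pn f"
  shows "\<exists>F. finite_levels F \<and> (AE x in lebesgue. ennreal (f x) = ennreal (F x)) \<and> (\<integral>\<^sup>+x. ennreal (F x) \<partial>lborel) = 1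
    \<and> (\<forall>x. ennreal (sym_rearr f x) = sym_layers F x) \<and> (\<forall>x. 0 \<le> sym_rearr f x)"
proof -
  have fm: "f \<in> borel_measurable lebesgue" and f0: "\<And>x. 0 \<le> f x" and f1: "(\<integral>\<^sup>+x. ennreal (f x) \<partial>lebesgue) = 1"
    using f by (auto simp: Pn_def)
  obtain M where M: "AE x in lebesgue. \<bar>f x\<bar> \<le> M" using f by (auto simp: Pn_def)
  obtain F0 where F0: "F0 \<in> borel_measurable lborel" "AE x in lborel. f x = F0 x"
    using completion_ex_borel_measurable_real[OF fm] by blast
  define F where "F x = max 0 (F0 x)" for x
  have [measurable]: "F \<in> borel_measurable borel" using F0(1) unfolding F_def by simp
  have F_nn: "0 \<le> F x" for x by (simp add: F_def)
  have ae: "AE x in lborel. f x = F x" using F0(2) by eventually_elim (metis F_def f0 max.absorb2)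
  then have aeL: "AE x in lebesgue. f x = F x" by (rule AE_completion)
  have int: "(\<integral>\<^sup>+x. ennreal (F x) \<partial>lborel) = 1"
  proof -
    have "(\<integral>\<^sup>+x. ennreal (F x) \<partial>lborel) = (\<integral>\<^sup>+x. ennreal (f x) \<partial>lborel)"
      using ae by (intro nn_integral_cong_AE) auto
    then show ?thesis using f1 by (simp add: nn_integral_completion)
  qed
  \<comment> \<open>Markov's inequality, as the integral is 1.\<close>
  have lev: "emeasure lborel {y. t < F y} < \<infinity>" if t: "0 < t" for t
  proof -
    have "ennreal t * emeasure lborel {y. t < F y} = (\<integral>\<^sup>+x. ennreal t * indicator {y. t < F y} x \<partial>lborel)"
      by (subst nn_integral_cmult) auto
    also have "\<dots> \<le> (\<integral>\<^sup>+x. ennreal (F x) \<partial>lborel)" using t by (intro nn_integral_mono) (auto simp: indicator_def ennreal_leI)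
    also have "\<dots> = 1" by (rule int)
    finally have "ennreal t * emeasure lborel {y. t < F y} \<noteq> top" by (auto simp: top_unique)
    then show ?thesis using t by (auto simp: ennreal_mult_eq_top_iff less_top)
  qed
  then have FL: "finite_levels F" by (auto simp: finite_levels_def F_nn)
  have sym_eq: "sym_set {y. t < f y} = sym_set {y. t < F y}" for t
  proof -
    have "{y. t < f y} \<in> sets lebesgue" using fm unfolding borel_measurable_iff_greater by simp
    moreover have "{y. t < F y} \<in> sets lebesgue" by simp
    ultimately have "emeasure lebesgue {y. t < f y} = emeasure lebesgue {y. t < F y}"
      using aeL by (intro emeasure_eq_AE) auto
    then show ?thesis by (simp add: sym_set_def)
  qed
  \<comment> \<open>Above the essential bound \<open>M\<close> the level sets are null and their
    rearrangements are empty balls. Hence the layer integral is finite at every point, and the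
    conversion to a real number in \<open>sym_rearr\<close> loses nothing.\<close>
  have fin: "sym_layers F x < top" for x
  proof -
    have empty: "sym_set {y. t < F y} = {}" if t: "max 0 M < t" for t
    proof -
      have "AE x in lebesgue. \<not> t < F x" using M aeL by eventually_elim (use t in auto)
      then have "emeasure lebesgue {y. t < F y} = 0" using emeasure_eq_0_AE[of "\<lambda>x. t < F x" "lebesgue"] by simp
      then have "sym_set {y. t < F y} = ball (0::'a) (ball_radius TYPE('a) 0)" by (intro sym_set_eq) auto
      then show ?thesis by (simp add: ball_radius_def)
    qed
    have "sym_layers F x \<le> (\<integral>\<^sup>+t. indicator {0..max 0 M} t \<partial>lborel)"
      unfolding sym_layers_def
    proof (rule nn_integral_mono)
      fix t
      show "indicator {0<..} t * indicator (sym_set {y. t < F y}) x \<le> (indicator {0..max 0 M} t :: ennreal)"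
        using empty[of t] by (cases "max 0 M < t") (auto simp: indicator_def)
    qed
    also have "\<dots> < top" by (simp add: emeasure_lborel_Icc_eq)
    finally show ?thesis .
  qed
  have "sym_rearr f x = enn2real (sym_layers F x)" for x
    unfolding sym_rearr_def sym_layers_def sym_eq ..
  then have "\<forall>x. ennreal (sym_rearr f x) = sym_layers F x" "\<forall>x. 0 \<le> sym_rearr f x" using fin by auto
  moreover have "AE x in lebesgue. ennreal (f x) = ennreal (F x)" using aeL by eventually_elim simp
  ultimately show ?thesis using FL int by blast
qed

lemma inner_functional_integral:
  fixes g :: "'i \<Rightarrow> 'a::euclidean_space \<Rightarrow> ennreal"
  assumes J: "finite J" and g: "\<And>j. j \<in> J \<Longrightarrow> g j \<in> borel_measurable borel"
    and k[measurable]: "(\<lambda>(s, y). k s y) \<in> borel_measurable ((lborel :: real measure) \<Otimes>\<^sub>M PiM J (\<lambda>_. borel))"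
  shows "inner_functional J (\<lambda>y. \<integral>\<^sup>+s. k s y \<partial>lborel) g = (\<integral>\<^sup>+s. inner_functional J (k s) g \<partial>lborel)"
proof -
  interpret L': product_sigma_finite "\<lambda>_. lborel :: 'a measure" by (rule product_sigma_finite_lborel)
  interpret LJ: sigma_finite_measure "PiM J (\<lambda>_. lborel :: 'a measure)" using J by (intro L'.sigma_finite)
  interpret P: pair_sigma_finite "PiM J (\<lambda>_. lborel :: 'a measure)" "lborel :: real measure" by standard
  define h where "h j = (if j \<in> J then g j else (\<lambda>_. 0))" for j
  have [measurable]: "h j \<in> borel_measurable borel" for j using g by (auto simp: h_def)
  have pr: "(\<Prod>j\<in>J. g j (X j)) = (\<Prod>j\<in>J. h j (X j))" for X by (intro prod.cong) (auto simp: h_def)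
  let ?y = "\<lambda>x X. \<lambda>j\<in>J. X j \<bullet> x"
  let ?w = "\<lambda>x X. indicator (ball (0::'a) 1) x * (\<Prod>j\<in>J. h j (X j))"
  have "inner_functional J (\<lambda>y. \<integral>\<^sup>+s. k s y \<partial>lborel) g = (\<integral>\<^sup>+x. (\<integral>\<^sup>+X. ?w x X * (\<integral>\<^sup>+s. k s (?y x X) \<partial>lborel) \<partial>PiM J (\<lambda>_. lborel)) \<partial>lborel)"
    unfolding inner_functional_def pr by (simp only: mult_ac)
  also have "\<dots> = (\<integral>\<^sup>+x. (\<integral>\<^sup>+X. (\<integral>\<^sup>+s. ?w x X * k s (?y x X) \<partial>lborel) \<partial>PiM J (\<lambda>_. lborel)) \<partial>lborel)"
    by (intro nn_integral_cong nn_integral_cmult[symmetric]) measurable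
  also have "\<dots> = (\<integral>\<^sup>+x. (\<integral>\<^sup>+s. (\<integral>\<^sup>+X. ?w x X * k s (?y x X) \<partial>PiM J (\<lambda>_. lborel)) \<partial>lborel) \<partial>lborel)"
    by (intro nn_integral_cong P.Fubini'[symmetric]) measurable
  also have "\<dots> = (\<integral>\<^sup>+s. (\<integral>\<^sup>+x. (\<integral>\<^sup>+X. ?w x X * k s (?y x X) \<partial>PiM J (\<lambda>_. lborel)) \<partial>lborel) \<partial>lborel)"
    by (rule lborel_pair.Fubini') measurable
  also have "\<dots> = (\<integral>\<^sup>+s. inner_functional J (k s) g \<partial>lborel)"
    unfolding inner_functional_def pr by (simp only: mult_ac)
  finally show ?thesis .
qed

section \<open>Rules for extended powers\<close>

lemma epow_inverse_less_iff:
  assumes "0 < d" "0 < s"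
  shows "ennreal s < epow G (- 1 / d) \<longleftrightarrow> ennreal (s powr d) * G < 1"
proof (cases G)
  case (real g)
  show ?thesis
  proof (cases "g = 0")
    case True
    then show ?thesis using real assms by (simp add: epow_def)
  next
    case False
    then have g: "0 < g" using real by simp
    have "s < g powr (- 1 / d) \<longleftrightarrow> g < s powr - d"
    proof
      assume "s < g powr (- 1 / d)"
      then have "(g powr (- 1 / d)) powr - d < s powr - d" using assms by (intro powr_less_mono2_neg) auto
      then show "g < s powr - d" using assms g by (simp add: powr_powr)
    next
      assume "g < s powr - d"
      then have "(s powr - d) powr (- 1 / d) < g powr (- 1 / d)" using assms g by (intro powr_less_mono2_neg) auto
      then show "s < g powr (- 1 / d)" using assms by (simp add: powr_powr)
    qed
    also have "\<dots> \<longleftrightarrow> s powr d * g < 1" using assms by (simp add: powr_minus field_simps)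
    finally show ?thesis using real g assms by (simp add: epow_def ennreal_less_iff ennreal_less_one_iff flip: ennreal_mult')
  qed
next
  case top
  then show ?thesis using assms by (simp add: epow_def ennreal_mult_top)
qed

lemma epow_epow:
  assumes "0 < d" "0 < a"
  shows "epow (epow G (- 1 / d)) a = epow G (- (a / d))"
proof (cases G)
  case (real g)
  then show ?thesis using assms by (cases "g = 0") (auto simp: epow_def powr_powr)
next
  case top
  then show ?thesis using assms by (simp add: epow_def)
qed

lemma epow_ennreal: "0 < p \<Longrightarrow> 0 \<le> h \<Longrightarrow> epow (ennreal h) p = ennreal (h powr p)"
  by (cases "h = 0") (auto simp: epow_def)

text \<open>A finite base never has negative power 0, so when one base vanishes the right side is
  infinite, as the left side is.\<close>

lemma epow_neg_mult:
  assumes "0 \<le> a" "0 \<le> b" "0 < q"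
  shows "epow (ennreal (a * b)) (- q) = epow (ennreal a) (- q) * epow (ennreal b) (- q)"
proof (cases "a = 0 \<or> b = 0")
  case True
  then show ?thesis using assms by (cases "a = 0"; cases "b = 0") (auto simp: epow_def ennreal_mult_top ennreal_top_mult)
next
  case False
  then have "0 < a" "0 < b" "0 < a * b" using assms by auto
  then show ?thesis using assms(3) by (simp add: epow_def powr_mult flip: ennreal_mult')
qed

lemma epow_neg_prod:
  assumes "\<And>i. i \<in> I \<Longrightarrow> 0 \<le> h i" "0 < q"
  shows "epow (ennreal (\<Prod>i\<in>I. h i)) (- q) = (\<Prod>i\<in>I. epow (ennreal (h i)) (- q))"
  using assms(1)
proof (induction I rule: infinite_finite_induct)
  case (insert i I)
  then show ?case using epow_neg_mult[of "h i" "\<Prod>i\<in>I. h i" q] assms(2) by (simp add: prod_nonneg)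
qed (use assms(2) in \<open>auto simp: epow_def\<close>)

section \<open>Expected volumes of empirical sets\<close>

lemma inner_functional_cmult:
  fixes g :: "'i \<Rightarrow> 'a::euclidean_space \<Rightarrow> ennreal"
  assumes J: "finite J" and g: "\<And>j. j \<in> J \<Longrightarrow> g j \<in> borel_measurable borel" and [measurable]: "Q \<in> borel_measurable (PiM J (\<lambda>_. borel))"
  shows "inner_functional J (\<lambda>y. c * Q y) g = c * inner_functional J Q g"
proof -
  interpret L': product_sigma_finite "\<lambda>_. lborel :: 'a measure" by (rule product_sigma_finite_lborel)
  interpret LJ: sigma_finite_measure "PiM J (\<lambda>_. lborel :: 'a measure)" using J by (intro L'.sigma_finite)
  define h where "h j = (if j \<in> J then g j else (\<lambda>_. 0))" for j
  have [measurable]: "h j \<in> borel_measurable borel" for j using g by (auto simp: h_def)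
  have pr: "(\<Prod>j\<in>J. g j (X j)) = (\<Prod>j\<in>J. h j (X j))" for X by (intro prod.cong) (auto simp: h_def)
  have "inner_functional J (\<lambda>y. c * Q y) g = (\<integral>\<^sup>+x. (\<integral>\<^sup>+X. c * (indicator (ball 0 1) x * Q (\<lambda>j\<in>J. X j \<bullet> x) * (\<Prod>j\<in>J. h j (X j))) \<partial>PiM J (\<lambda>_. lborel)) \<partial>lborel)"
    unfolding inner_functional_def pr by (simp only: mult_ac)
  also have "\<dots> = (\<integral>\<^sup>+x. c * (\<integral>\<^sup>+X. (indicator (ball 0 1) x * Q (\<lambda>j\<in>J. X j \<bullet> x) * (\<Prod>j\<in>J. h j (X j))) \<partial>PiM J (\<lambda>_. lborel)) \<partial>lborel)"
    by (intro nn_integral_cong nn_integral_cmult) measurable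
  also have "\<dots> = c * inner_functional J Q g"
    unfolding inner_functional_def pr by (rule nn_integral_cmult) measurable
  finally show ?thesis .
qed

text \<open>For probability densities this is the joint law of independent points, the point with
  index \<open>j\<close> having density \<open>W j\<close>.\<close>

definition weight_measure :: "'i set \<Rightarrow> ('i \<Rightarrow> 'a::euclidean_space \<Rightarrow> ennreal) \<Rightarrow> ('i \<Rightarrow> 'a) measure" where
  "weight_measure J W = density (PiM J (\<lambda>_. lborel)) (\<lambda>X. \<Prod>j\<in>J. W j (X j))"

lemma prod_weights_measurable:
  assumes W: "\<And>j. j \<in> J \<Longrightarrow> W j \<in> borel_measurable borel"
  shows "(\<lambda>X. \<Prod>j\<in>J. W j (X j) :: ennreal) \<in> borel_measurable (PiM J (\<lambda>_. lborel))"
proof (rule borel_measurable_prod_ennreal)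
  fix j assume j: "j \<in> J"
  show "(\<lambda>X. W j (X j)) \<in> borel_measurable (PiM J (\<lambda>_. lborel))"
    using W[OF j] j by (intro measurable_compose[OF measurable_component_singleton]) auto
qed

lemma emeasure_weight_measure:
  fixes W :: "'i \<Rightarrow> 'a::euclidean_space \<Rightarrow> ennreal"
  assumes J: "finite J" and W: "\<And>j. j \<in> J \<Longrightarrow> W j \<in> borel_measurable borel" "\<And>j. j \<in> J \<Longrightarrow> (\<integral>\<^sup>+x. W j x \<partial>lborel) = 1"
  shows "emeasure (weight_measure J W) (space (weight_measure J W)) = 1"
proof -
  interpret L': product_sigma_finite "\<lambda>_. lborel :: 'a measure" by (rule product_sigma_finite_lborel)
  note m = prod_weights_measurable[OF W(1)]
  have "emeasure (weight_measure J W) (space (weight_measure J W)) = (\<integral>\<^sup>+X. (\<Prod>j\<in>J. W j (X j)) * indicator (space (PiM J (\<lambda>_. lborel))) X \<partial>PiM J (\<lambda>_. lborel))"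
    unfolding weight_measure_def space_density by (rule emeasure_density[OF m sets.top])
  also have "\<dots> = (\<integral>\<^sup>+X. (\<Prod>j\<in>J. W j (X j)) \<partial>PiM J (\<lambda>_. lborel))"
    by (intro nn_integral_cong) auto
  also have "\<dots> = (\<Prod>j\<in>J. \<integral>\<^sup>+x. W j x \<partial>lborel)"
    using W(1) by (intro L'.product_nn_integral_prod[OF J]) auto
  finally show ?thesis using W(2) by simp
qed

lemma prob_weight_measure:
  fixes W :: "'i \<Rightarrow> 'a::euclidean_space \<Rightarrow> ennreal"
  assumes "finite J" and "\<And>j. j \<in> J \<Longrightarrow> W j \<in> borel_measurable borel" "\<And>j. j \<in> J \<Longrightarrow> (\<integral>\<^sup>+x. W j x \<partial>lborel) = 1"
  shows "finite_measure (weight_measure J W)"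
  by (rule finite_measureI) (simp add: emeasure_weight_measure[OF assms])

lemma nn_integral_weight_measure:
  assumes "\<And>j. j \<in> J \<Longrightarrow> W j \<in> borel_measurable borel" "G \<in> borel_measurable (PiM J (\<lambda>_. lborel))"
  shows "(\<integral>\<^sup>+X. G X \<partial>weight_measure J W) = (\<integral>\<^sup>+X. G X * (\<Prod>j\<in>J. W j (X j)) \<partial>PiM J (\<lambda>_. lborel))"
  unfolding weight_measure_def
  by (subst nn_integral_density[OF prod_weights_measurable[OF assms(1)] assms(2)]) (auto simp: mult.commute)

lemma inner_functional_weight_measure:
  fixes W :: "'i \<Rightarrow> 'a::euclidean_space \<Rightarrow> ennreal"
  assumes J: "finite J" and W: "\<And>j. j \<in> J \<Longrightarrow> W j \<in> borel_measurable borel"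
    and [measurable]: "Q \<in> borel_measurable (PiM J (\<lambda>_. borel))"
  shows "(\<integral>\<^sup>+X. (\<integral>\<^sup>+x. indicator (ball 0 1) x * Q (\<lambda>j\<in>J. X j \<bullet> x) \<partial>lborel) \<partial>weight_measure J W) = inner_functional J Q W"
proof -
  interpret L': product_sigma_finite "\<lambda>_. lborel :: 'a measure" by (rule product_sigma_finite_lborel)
  interpret LJ: sigma_finite_measure "PiM J (\<lambda>_. lborel :: 'a measure)" using J by (intro L'.sigma_finite)
  interpret P: pair_sigma_finite "lborel :: 'a measure" "PiM J (\<lambda>_. lborel :: 'a measure)" by standard
  have [measurable]: "(\<lambda>X. \<Prod>j\<in>J. W j (X j)) \<in> borel_measurable (PiM J (\<lambda>_. lborel))" by (rule prod_weights_measurable[OF W])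
  have "(\<integral>\<^sup>+X. (\<integral>\<^sup>+x. indicator (ball 0 1) x * Q (\<lambda>j\<in>J. X j \<bullet> x) \<partial>lborel) \<partial>weight_measure J W)
    = (\<integral>\<^sup>+X. (\<integral>\<^sup>+x. indicator (ball 0 1) x * Q (\<lambda>j\<in>J. X j \<bullet> x) \<partial>lborel) * (\<Prod>j\<in>J. W j (X j)) \<partial>PiM J (\<lambda>_. lborel))"
    by (intro nn_integral_weight_measure W) measurable
  also have "\<dots> = (\<integral>\<^sup>+X. (\<integral>\<^sup>+x. indicator (ball 0 1) x * Q (\<lambda>j\<in>J. X j \<bullet> x) * (\<Prod>j\<in>J. W j (X j)) \<partial>lborel) \<partial>PiM J (\<lambda>_. lborel))"
    by (intro nn_integral_cong nn_integral_multc[symmetric]) measurable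
  also have "\<dots> = inner_functional J Q W"
    unfolding inner_functional_def by (rule P.Fubini') measurable
  finally show ?thesis .
qed

lemma star_vol_measurable:
  assumes J: "finite J" and [measurable]: "(\<lambda>(X, x). r X x) \<in> borel_measurable (PiM J (\<lambda>_. lborel) \<Otimes>\<^sub>M (lborel :: 'a::euclidean_space measure))"
    and hom: "\<And>X. inv_homogeneous (r X)"
  shows "(\<lambda>X. star_vol (r X)) \<in> borel_measurable (PiM J (\<lambda>_. lborel))"
    and "X \<in> space (PiM J (\<lambda>_. lborel)) \<Longrightarrow> star_vol (r X) = emeasure lborel {x. 1 < r X x}"
proof -
  have rm[measurable]: "r X \<in> borel_measurable borel" if "X \<in> space (PiM J (\<lambda>_. lborel))" for X
    using measurable_Pair2[OF assms(2) that] by simp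
  show *: "star_vol (r X) = emeasure lborel {x. 1 < r X x}" if "X \<in> space (PiM J (\<lambda>_. lborel))" for X
    by (rule star_vol_inv_homogeneous[OF hom rm[OF that]])
  have "star_vol (r X) = (\<integral>\<^sup>+x. (if 1 < r X x then 1 else 0) \<partial>lborel)" if X: "X \<in> space (PiM J (\<lambda>_. lborel))" for X
  proof -
    have "(\<integral>\<^sup>+x. (if 1 < r X x then 1 else 0) \<partial>lborel) = (\<integral>\<^sup>+x. indicator {x. 1 < r X x} x \<partial>lborel)"
      by (intro nn_integral_cong) (auto simp: indicator_def)
    also have "\<dots> = emeasure lborel {x. 1 < r X x}" using rm[OF X] by (subst nn_integral_indicator) auto
    finally show ?thesis using *[OF X] by simp
  qed
  moreover have "(\<lambda>X. \<integral>\<^sup>+x. (if 1 < r X x then 1 else 0) \<partial>lborel) \<in> borel_measurable (PiM J (\<lambda>_. lborel))" by measurable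
  ultimately show "(\<lambda>X. star_vol (r X)) \<in> borel_measurable (PiM J (\<lambda>_. lborel))"
    by (simp cong: measurable_cong)
qed

text \<open>For \<open>g\<close> homogeneous of degree \<open>d\<close> the radius
  \<open>epow g (- 1 / d)\<close> has degree -1, and its power of order \<open>a\<close> is
  \<open>epow g (- (a / d))\<close>. Thus the comparison of the functionals is the comparison of
  expected dual volumes, from which the limit gives expected volumes.\<close>

lemma expected_star_vol_le:
  fixes W W' :: "'i \<Rightarrow> 'a::euclidean_space \<Rightarrow> ennreal" and g :: "('i \<Rightarrow> real) \<Rightarrow> ennreal"
  assumes J: "finite J"
    and W: "\<And>j. j \<in> J \<Longrightarrow> W j \<in> borel_measurable borel" "\<And>j. j \<in> J \<Longrightarrow> (\<integral>\<^sup>+x. W j x \<partial>lborel) = 1"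
    and W': "\<And>j. j \<in> J \<Longrightarrow> W' j \<in> borel_measurable borel" "\<And>j. j \<in> J \<Longrightarrow> (\<integral>\<^sup>+x. W' j x \<partial>lborel) = 1"
    and gm[measurable]: "g \<in> borel_measurable (PiM J (\<lambda>_. borel))" and d: "0 < d"
    and hom: "\<And>s y. 0 < s \<Longrightarrow> g (\<lambda>j\<in>J. s * y j) = ennreal (s powr d) * g (\<lambda>j\<in>J. y j)"
    and le: "\<And>a::real. 0 < a \<Longrightarrow> inner_functional J (\<lambda>y. epow (g y) (- (a / d))) W \<le> inner_functional J (\<lambda>y. epow (g y) (- (a / d))) W'"
  defines "r \<equiv> \<lambda>X x. epow (g (\<lambda>j\<in>J. X j \<bullet> x)) (- 1 / d)"
  shows "(\<lambda>X. star_vol (r X)) \<in> borel_measurable (PiM J (\<lambda>_. lborel))"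
    and "(\<integral>\<^sup>+X. star_vol (r X) * (\<Prod>j\<in>J. W j (X j)) \<partial>PiM J (\<lambda>_. lborel)) \<le> (\<integral>\<^sup>+X. star_vol (r X) * (\<Prod>j\<in>J. W' j (X j)) \<partial>PiM J (\<lambda>_. lborel))"
proof -
  have rm[measurable]: "(\<lambda>(X, x). r X x) \<in> borel_measurable (PiM J (\<lambda>_. lborel) \<Otimes>\<^sub>M (lborel :: 'a measure))"
    unfolding r_def by measurable
  have rh: "inv_homogeneous (r X)" for X
    unfolding inv_homogeneous_def
  proof (intro allI impI)
    fix s :: real and x assume s: "0 < s"
    have "(\<lambda>j\<in>J. X j \<bullet> (s *\<^sub>R x)) = (\<lambda>j\<in>J. s * (X j \<bullet> x))" by (simp add: fun_eq_iff)
    then have "r X (s *\<^sub>R x) = epow (ennreal (s powr d) * g (\<lambda>j\<in>J. X j \<bullet> x)) (- 1 / d)"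
      unfolding r_def using hom[OF s, of "\<lambda>j. X j \<bullet> x"] by simp
    then show "ennreal s < r X x \<longleftrightarrow> 1 < r X (s *\<^sub>R x)"
      using epow_inverse_less_iff[OF d s, of "g (\<lambda>j\<in>J. X j \<bullet> x)"]
        epow_inverse_less_iff[OF d zero_less_one, of "ennreal (s powr d) * g (\<lambda>j\<in>J. X j \<bullet> x)"]
      by (simp add: r_def)
  qed
  show sv: "(\<lambda>X. star_vol (r X)) \<in> borel_measurable (PiM J (\<lambda>_. lborel))"
    by (rule star_vol_measurable(1)[OF J rm rh])
  interpret M1: finite_measure "weight_measure J W" by (rule prob_weight_measure[OF J W])
  interpret M2: finite_measure "weight_measure J W'" by (rule prob_weight_measure[OF J W'])
  have sets_eq: "sets (weight_measure J V) = sets (PiM J (\<lambda>_. lborel))" for V :: "'i \<Rightarrow> 'a \<Rightarrow> ennreal"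
    by (simp add: weight_measure_def)
  have sp: "space (weight_measure J V) = space (PiM J (\<lambda>_. lborel))" for V :: "'i \<Rightarrow> 'a \<Rightarrow> ennreal"
    by (simp add: weight_measure_def)
  have rmW: "(\<lambda>(X, x). r X x) \<in> borel_measurable (weight_measure J V \<Otimes>\<^sub>M lborel)" for V :: "'i \<Rightarrow> 'a \<Rightarrow> ennreal"
    using rm by (simp add: sets_eq cong: measurable_cong_sets sets_pair_measure_cong)
  have "(\<integral>\<^sup>+X. emeasure lborel {x. 1 < r X x} \<partial>weight_measure J W) \<le> (\<integral>\<^sup>+X. emeasure lborel {x. 1 < r X x} \<partial>weight_measure J W')"
  proof (rule dual_volume_limit[OF M1.sigma_finite_measure_axioms M2.sigma_finite_measure_axioms _ rmW rmW])
    show "emeasure (weight_measure J W') (space (weight_measure J W')) \<le> 1" by (simp add: emeasure_weight_measure[OF J W'])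
    fix a :: real assume a: "0 < a"
    have eq: "(\<integral>\<^sup>+X. (\<integral>\<^sup>+x. indicator (ball 0 1) x * epow (r X x) a \<partial>lborel) \<partial>weight_measure J V) = inner_functional J (\<lambda>y. epow (g y) (- (a / d))) V"
      if "\<And>j. j \<in> J \<Longrightarrow> V j \<in> borel_measurable borel" for V
    proof -
      have "inner_functional J (\<lambda>y. epow (g y) (- (a / d))) V = (\<integral>\<^sup>+X. (\<integral>\<^sup>+x. indicator (ball 0 1) x * epow (g (\<lambda>j\<in>J. X j \<bullet> x)) (- (a / d)) \<partial>lborel) \<partial>weight_measure J V)"
        by (rule inner_functional_weight_measure[symmetric, OF J that]) measurable
      then show ?thesis unfolding r_def by (simp only: epow_epow[OF d a])
    qed
    show "(\<integral>\<^sup>+X. (\<integral>\<^sup>+x. indicator (ball 0 1) x * epow (r X x) a \<partial>lborel) \<partial>weight_measure J W)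
      \<le> (\<integral>\<^sup>+X. (\<integral>\<^sup>+x. indicator (ball 0 1) x * epow (r X x) a \<partial>lborel) \<partial>weight_measure J W')"
      using le[OF a] eq[of W] eq[of W'] W(1) W'(1) by simp
  qed (rule rh)+
  moreover have "(\<integral>\<^sup>+X. emeasure lborel {x. 1 < r X x} \<partial>weight_measure J V) = (\<integral>\<^sup>+X. star_vol (r X) * (\<Prod>j\<in>J. V j (X j)) \<partial>PiM J (\<lambda>_. lborel))"
    if "\<And>j. j \<in> J \<Longrightarrow> V j \<in> borel_measurable borel" for V
  proof -
    have "(\<integral>\<^sup>+X. emeasure lborel {x. 1 < r X x} \<partial>weight_measure J V) = (\<integral>\<^sup>+X. star_vol (r X) \<partial>weight_measure J V)"
      using star_vol_measurable(2)[OF J rm rh] by (intro nn_integral_cong) (simp add: sp)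
    then show ?thesis using nn_integral_weight_measure[OF that sv] by simp
  qed
  ultimately show "(\<integral>\<^sup>+X. star_vol (r X) * (\<Prod>j\<in>J. W j (X j)) \<partial>PiM J (\<lambda>_. lborel)) \<le> (\<integral>\<^sup>+X. star_vol (r X) * (\<Prod>j\<in>J. W' j (X j)) \<partial>PiM J (\<lambda>_. lborel))"
    using W(1) W'(1) by simp
qed

text \<open>A negative power of the sum in \<open>g\<close> does not factor over \<open>i\<close>,
  but the Gamma integral writes it as a superposition of \<open>exp (- s * g y)\<close>, which does.
  Each factor decreases in a support function.\<close>

lemma inner_functional_power_mean_le:
  fixes F :: "nat \<times> nat \<Rightarrow> 'a::euclidean_space \<Rightarrow> real" and m :: "nat \<Rightarrow> nat" and N :: nat and C :: "nat \<Rightarrow> (nat \<Rightarrow> real) set" and p a :: real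
  defines "J \<equiv> SIGMA i:{..<N}. {..<m i}"
  assumes C: "\<And>i. i < N \<Longrightarrow> os_convex_body (m i) (C i)" and F: "\<And>j. j \<in> J \<Longrightarrow> finite_levels (F j)"
    and p: "0 < p" and a: "0 < a" and N: "0 < N"
  defines "g \<equiv> \<lambda>y. (\<Sum>i<N. epow (ennreal (supp_fun (m i) (C i) (\<lambda>j. y (i, j)))) p) / of_nat N"
  shows "inner_functional J (\<lambda>y. epow (g y) (- (a / p))) (\<lambda>j x. ennreal (F j x)) \<le> inner_functional J (\<lambda>y. epow (g y) (- (a / p))) (\<lambda>j. sym_layers (F j))"
proof -
  have J: "finite J" by (simp add: J_def)
  define \<alpha> where "\<alpha> = a / p"
  have \<alpha>: "0 < \<alpha>" using a p by (simp add: \<alpha>_def)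
  define h where "h i y = supp_fun (m i) (C i) (\<lambda>j. y (i, j))" for i and y :: "nat \<times> nat \<Rightarrow> real"
  have h0: "0 \<le> h i y" if "i < N" for i y unfolding h_def by (rule supp_fun_nonneg[OF C[OF that]])
  have hm: "h i \<in> borel_measurable (PiM J (\<lambda>_. borel))" if "i < N" for i
    unfolding h_def using that by (intro supp_fun_measurable_coordinates[OF C[OF that]] measurable_component_singleton) (auto simp: J_def)
  define \<phi> where "\<phi> s t = ennreal (exp (- (s * t powr p / real N)))" for s t :: real
  \<comment> \<open>The integrand of the Gamma integral with \<open>eexp (ennreal s * g y)\<close>
    split into one factor for every body.\<close>
  define k where "k s y = (if 0 < s then ennreal (s powr (\<alpha> - 1)) * (\<Prod>i<N. \<phi> s (h i y)) else 0)" for s y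
  have ge: "g y = ennreal ((\<Sum>i<N. h i y powr p) / real N)" for y
  proof -
    have "(\<Sum>i<N. epow (ennreal (h i y)) p) = ennreal (\<Sum>i<N. h i y powr p)"
      using h0 p by (simp add: epow_ennreal)
    then show ?thesis unfolding g_def h_def[symmetric] using N
      by (simp add: divide_ennreal sum_nonneg flip: ennreal_of_nat_eq_real_of_nat)
        (simp add: divide_ennreal sum_nonneg ennreal_of_nat_eq_real_of_nat)
  qed
  have gm: "g \<in> borel_measurable (PiM J (\<lambda>_. borel))"
    unfolding ge[abs_def] using hm by measurable
  have gk: "ennreal (Gamma \<alpha>) * epow (g y) (- \<alpha>) = (\<integral>\<^sup>+s. k s y \<partial>lborel)" for y
  proof -
    have "eexp (ennreal s * g y) = (\<Prod>i<N. \<phi> s (h i y))" if s: "0 < s" for s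
    proof -
      have "eexp (ennreal s * g y) = ennreal (exp (- (s * ((\<Sum>i<N. h i y powr p) / real N))))"
        unfolding ge using s by (subst ennreal_mult'[symmetric]) (auto intro!: eexp_ennreal mult_nonneg_nonneg divide_nonneg_nonneg sum_nonneg)
      also have "- (s * ((\<Sum>i<N. h i y powr p) / real N)) = (\<Sum>i<N. - (s * h i y powr p / real N))"
        by (simp add: sum_negf sum_distrib_left sum_divide_distrib)
      also have "ennreal (exp \<dots>) = (\<Prod>i<N. \<phi> s (h i y))"
        by (simp add: exp_sum \<phi>_def prod_ennreal)
      finally show ?thesis .
    qed
    then show ?thesis unfolding gamma_integral_ennreal[OF \<alpha>, symmetric] k_def by (intro nn_integral_cong) auto
  qed
  have km: "(\<lambda>(s, y). k s y) \<in> borel_measurable (lborel \<Otimes>\<^sub>M PiM J (\<lambda>_. borel))"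
  proof -
    have "(\<lambda>x. \<phi> (fst x) (h i (snd x))) \<in> borel_measurable (lborel \<Otimes>\<^sub>M PiM J (\<lambda>_. borel))" if "i < N" for i
      using hm[OF that] unfolding \<phi>_def by measurable
    then have "(\<lambda>x. \<Prod>i<N. \<phi> (fst x) (h i (snd x))) \<in> borel_measurable (lborel \<Otimes>\<^sub>M PiM J (\<lambda>_. borel))"
      by (intro borel_measurable_prod_ennreal) auto
    then show ?thesis unfolding k_def case_prod_beta by measurable
  qed
  have kQ: "(\<lambda>y. \<Prod>i<N. \<phi> s (h i y)) \<in> borel_measurable (PiM J (\<lambda>_. borel))" for s
  proof (rule borel_measurable_prod_ennreal)
    fix i assume "i \<in> {..<N}"
    then show "(\<lambda>y. \<phi> s (h i y)) \<in> borel_measurable (PiM J (\<lambda>_. borel))" using hm[of i] unfolding \<phi>_def by simp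
  qed
  have Wm: "(\<lambda>x. ennreal (F j x)) \<in> borel_measurable borel" "sym_layers (F j) \<in> borel_measurable borel" if "j \<in> J" for j
    using F[OF that] sym_layers_measurable[OF F[OF that]] by (auto simp: finite_levels_def)
  have G0: "ennreal (Gamma \<alpha>) \<noteq> 0" "ennreal (Gamma \<alpha>) \<noteq> top" using Gamma_real_pos[OF \<alpha>] by (auto simp: ennreal_eq_0_iff)
  have em: "(\<lambda>y. epow (g y) (- \<alpha>)) \<in> borel_measurable (PiM J (\<lambda>_. borel))" using gm by measurable
  have rep: "ennreal (Gamma \<alpha>) * inner_functional J (\<lambda>y. epow (g y) (- \<alpha>)) V = (\<integral>\<^sup>+s. inner_functional J (k s) V \<partial>lborel)"
    if "\<And>j. j \<in> J \<Longrightarrow> V j \<in> borel_measurable borel" for V :: "nat \<times> nat \<Rightarrow> 'a \<Rightarrow> ennreal"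
  proof -
    have "ennreal (Gamma \<alpha>) * inner_functional J (\<lambda>y. epow (g y) (- \<alpha>)) V = inner_functional J (\<lambda>y. ennreal (Gamma \<alpha>) * epow (g y) (- \<alpha>)) V"
      by (rule inner_functional_cmult[OF J that em, symmetric])
    also have "\<dots> = inner_functional J (\<lambda>y. \<integral>\<^sup>+s. k s y \<partial>lborel) V" by (simp only: gk)
    also have "\<dots> = (\<integral>\<^sup>+s. inner_functional J (k s) V \<partial>lborel)" by (rule inner_functional_integral[OF J that km])
    finally show ?thesis .
  qed
  have "ennreal (Gamma \<alpha>) * inner_functional J (\<lambda>y. epow (g y) (- \<alpha>)) (\<lambda>j x. ennreal (F j x)) \<le> ennreal (Gamma \<alpha>) * inner_functional J (\<lambda>y. epow (g y) (- \<alpha>)) (\<lambda>j. sym_layers (F j))"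
  proof (subst (1 2) rep)
  show "(\<integral>\<^sup>+s. inner_functional J (k s) (\<lambda>j x. ennreal (F j x)) \<partial>lborel) \<le> (\<integral>\<^sup>+s. inner_functional J (k s) (\<lambda>j. sym_layers (F j)) \<partial>lborel)"
  proof (rule nn_integral_mono)
    fix s :: real
    show "inner_functional J (k s) (\<lambda>j x. ennreal (F j x)) \<le> inner_functional J (k s) (\<lambda>j. sym_layers (F j))"
    proof (cases "0 < s")
      case True
      have ks: "k s = (\<lambda>y. ennreal (s powr (\<alpha> - 1)) * (\<Prod>i<N. \<phi> s (h i y)))" using True by (auto simp: k_def fun_eq_iff)
      have "inner_functional J (\<lambda>y. \<Prod>i<N. \<phi> s (h i y)) (\<lambda>j x. ennreal (F j x)) \<le> inner_functional J (\<lambda>y. \<Prod>i<N. \<phi> s (h i y)) (\<lambda>j. sym_layers (F j))"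
      proof (rule inner_functional_rearrangement[OF J finite_lessThan _ F])
        fix i assume "i \<in> {..<N}"
        then have i: "i < N" by simp
        show "sym_quasiconcave J (\<lambda>y. \<phi> s (h i y))"
          unfolding h_def
        proof (rule sym_quasiconcave_supp_fun[OF C[OF i]])
          show "(i, j) \<in> J" if "j < m i" for j using that i by (simp add: J_def)
          show "\<phi> s \<in> borel_measurable borel" unfolding \<phi>_def by measurable
          show "\<phi> s t \<le> \<phi> s u" if "0 \<le> u" "u \<le> t" for t u
            unfolding \<phi>_def using that True p N by (intro ennreal_leI) (auto intro!: divide_right_mono mult_left_mono powr_mono2)
        qed
      qed
      moreover have "inner_functional J (k s) V = ennreal (s powr (\<alpha> - 1)) * inner_functional J (\<lambda>y. \<Prod>i<N. \<phi> s (h i y)) V"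
        if "\<And>j. j \<in> J \<Longrightarrow> V j \<in> borel_measurable borel" for V :: "nat \<times> nat \<Rightarrow> 'a \<Rightarrow> ennreal"
        unfolding ks by (rule inner_functional_cmult[OF J that kQ])
      ultimately show ?thesis using Wm by (simp add: mult_left_mono)
    next
      case False
      then show ?thesis by (simp add: k_def inner_functional_def)
    qed
  qed
  qed (use Wm in auto)
  then show ?thesis using G0 by (subst (asm) ennreal_mult_le_mult_iff) (auto simp: \<alpha>_def)
qed

section \<open>Expectations inside the exponential\<close>

text \<open>One row of an array of independent points, relabelled from \<open>{i} \<times> K\<close>
  to \<open>K\<close>.\<close>

lemma distr_PiM_copy:
  fixes i :: 'i and K :: "'k set" and M :: "'c measure"
  assumes K: "finite K" and M: "sigma_finite_measure M"
  shows "distr (PiM ({i} \<times> K) (\<lambda>_. M)) (PiM K (\<lambda>_. M)) (\<lambda>Y. \<lambda>j\<in>K. Y (i, j)) = PiM K (\<lambda>_. M)"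
proof -
  interpret product_sigma_finite "\<lambda>_::'k. M" unfolding product_sigma_finite_def using M by simp
  interpret P: product_sigma_finite "\<lambda>_::'i \<times> 'k. M" unfolding product_sigma_finite_def using M by simp
  have m: "(\<lambda>Y. \<lambda>j\<in>K. Y (i, j)) \<in> measurable (PiM ({i} \<times> K) (\<lambda>_. M)) (PiM K (\<lambda>_. M))"
    by (intro measurable_restrict measurable_component_singleton) auto
  show ?thesis
  proof (rule PiM_eqI[OF K])
    fix A assume A: "\<And>j. j \<in> K \<Longrightarrow> A j \<in> sets M"
    have AK: "Pi\<^sub>E K A \<in> sets (PiM K (\<lambda>_. M))" using A K by (intro sets_PiM_I_finite) auto
    have "emeasure (distr (PiM ({i} \<times> K) (\<lambda>_. M)) (PiM K (\<lambda>_. M)) (\<lambda>Y. \<lambda>j\<in>K. Y (i, j))) (Pi\<^sub>E K A)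
      = emeasure (PiM ({i} \<times> K) (\<lambda>_. M)) ((\<lambda>Y. \<lambda>j\<in>K. Y (i, j)) -` Pi\<^sub>E K A \<inter> space (PiM ({i} \<times> K) (\<lambda>_. M)))"
      by (rule emeasure_distr[OF m AK])
    also have "(\<lambda>Y. \<lambda>j\<in>K. Y (i, j)) -` Pi\<^sub>E K A \<inter> space (PiM ({i} \<times> K) (\<lambda>_. M)) = Pi\<^sub>E ({i} \<times> K) (\<lambda>p. A (snd p))"
    proof -
      have "y \<in> space M" if "j \<in> K" "y \<in> A j" for j y using sets.sets_into_space[OF A[OF that(1)]] that(2) by auto
      then show ?thesis by (auto simp: space_PiM PiE_iff extensional_def)
    qed
    also have "emeasure (PiM ({i} \<times> K) (\<lambda>_. M)) \<dots> = (\<Prod>p\<in>{i} \<times> K. emeasure M (A (snd p)))"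
      using A K by (intro P.emeasure_PiM) auto
    also have "\<dots> = (\<Prod>j\<in>K. emeasure M (A j))"
      by (rule prod.reindex_bij_witness[of _ "\<lambda>j. (i, j)" snd]) auto
    finally show "emeasure (distr (PiM ({i} \<times> K) (\<lambda>_. M)) (PiM K (\<lambda>_. M)) (\<lambda>Y. \<lambda>j\<in>K. Y (i, j))) (Pi\<^sub>E K A) = (\<Prod>j\<in>K. emeasure M (A j))" .
  qed simp
qed

text \<open>Independence of the rows: splitting off one row at a time by Fubini's theorem gives one
  factor each, all equal.\<close>

lemma nn_integral_PiM_copies:
  fixes I :: "'i set" and K :: "'k set" and M :: "'c measure"
  assumes I: "finite I" and K: "finite K" and M: "sigma_finite_measure M" and G[measurable]: "G \<in> borel_measurable (PiM K (\<lambda>_. M))"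
  shows "(\<integral>\<^sup>+X. (\<Prod>i\<in>I. G (\<lambda>j\<in>K. X (i, j)) :: ennreal) \<partial>PiM (I \<times> K) (\<lambda>_. M)) = (\<integral>\<^sup>+Y. G Y \<partial>PiM K (\<lambda>_. M)) ^ card I"
  using I
proof (induction I rule: finite_induct)
  case empty
  then show ?case by (simp add: PiM_empty nn_integral_count_space_finite)
next
  case (insert i I)
  interpret P: product_sigma_finite "\<lambda>_::'i \<times> 'k. M" unfolding product_sigma_finite_def using M by simp
  have m: "(\<lambda>Y. \<lambda>j\<in>K. Y (i, j)) \<in> measurable (PiM ({i} \<times> K) (\<lambda>_. M)) (PiM K (\<lambda>_. M))" for i :: 'i
    by (intro measurable_restrict measurable_component_singleton) auto
  have m1: "(\<lambda>Y. G (\<lambda>j\<in>K. Y (i, j))) \<in> borel_measurable (PiM (I' \<times> K) (\<lambda>_. M))" if "i \<in> I'" for i :: 'i and I'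
    by (rule measurable_compose[OF _ G]) (use that in \<open>intro measurable_restrict measurable_component_singleton, auto\<close>)
  have dis: "({i} \<times> K) \<inter> (I \<times> K) = {}" using insert by auto
  have un: "insert i I \<times> K = ({i} \<times> K) \<union> (I \<times> K)" by auto
  have "(\<integral>\<^sup>+X. (\<Prod>l\<in>insert i I. G (\<lambda>j\<in>K. X (l, j))) \<partial>PiM (insert i I \<times> K) (\<lambda>_. M))
     = (\<integral>\<^sup>+Y. (\<integral>\<^sup>+Z. (\<Prod>l\<in>insert i I. G (\<lambda>j\<in>K. merge ({i} \<times> K) (I \<times> K) (Y, Z) (l, j))) \<partial>PiM (I \<times> K) (\<lambda>_. M)) \<partial>PiM ({i} \<times> K) (\<lambda>_. M))"
    unfolding un
  proof (rule P.product_nn_integral_fold[OF dis])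
    show "(\<lambda>X. \<Prod>l\<in>insert i I. G (\<lambda>j\<in>K. X (l, j))) \<in> borel_measurable (PiM (({i} \<times> K) \<union> (I \<times> K)) (\<lambda>_. M))"
      unfolding un[symmetric] using m1[of _ "insert i I"] by (intro borel_measurable_prod_ennreal) auto
  qed (use insert K in auto)
  also have "\<dots> = (\<integral>\<^sup>+Y. (\<integral>\<^sup>+Z. G (\<lambda>j\<in>K. Y (i, j)) * (\<Prod>i\<in>I. G (\<lambda>j\<in>K. Z (i, j))) \<partial>PiM (I \<times> K) (\<lambda>_. M)) \<partial>PiM ({i} \<times> K) (\<lambda>_. M))"
  proof (intro nn_integral_cong)
    fix Y Z :: "'i \<times> 'k \<Rightarrow> 'c"
    have "(\<lambda>j\<in>K. merge ({i} \<times> K) (I \<times> K) (Y, Z) (i, j)) = (\<lambda>j\<in>K. Y (i, j))" by (auto simp: fun_eq_iff merge_def)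
    moreover have "(\<lambda>j\<in>K. merge ({i} \<times> K) (I \<times> K) (Y, Z) (i', j)) = (\<lambda>j\<in>K. Z (i', j))" if "i' \<in> I" for i'
      using that insert by (auto simp: fun_eq_iff merge_def)
    ultimately show "(\<Prod>l\<in>insert i I. G (\<lambda>j\<in>K. merge ({i} \<times> K) (I \<times> K) (Y, Z) (l, j))) = G (\<lambda>j\<in>K. Y (i, j)) * (\<Prod>i\<in>I. G (\<lambda>j\<in>K. Z (i, j)))"
      using insert by simp
  qed
  also have "\<dots> = (\<integral>\<^sup>+Y. G (\<lambda>j\<in>K. Y (i, j)) * (\<integral>\<^sup>+Z. (\<Prod>i\<in>I. G (\<lambda>j\<in>K. Z (i, j))) \<partial>PiM (I \<times> K) (\<lambda>_. M)) \<partial>PiM ({i} \<times> K) (\<lambda>_. M))"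
    using m1[of _ I] by (intro nn_integral_cong nn_integral_cmult borel_measurable_prod_ennreal) auto
  also have "\<dots> = (\<integral>\<^sup>+Y. G (\<lambda>j\<in>K. Y (i, j)) \<partial>PiM ({i} \<times> K) (\<lambda>_. M)) * (\<integral>\<^sup>+Y. G Y \<partial>PiM K (\<lambda>_. M)) ^ card I"
    unfolding insert.IH by (rule nn_integral_multc) (rule m1, simp)
  also have "(\<integral>\<^sup>+Y. G (\<lambda>j\<in>K. Y (i, j)) \<partial>PiM ({i} \<times> K) (\<lambda>_. M)) = (\<integral>\<^sup>+Y. G Y \<partial>distr (PiM ({i} \<times> K) (\<lambda>_. M)) (PiM K (\<lambda>_. M)) (\<lambda>Y. \<lambda>j\<in>K. Y (i, j)))"
    by (rule nn_integral_distr[symmetric, OF m]) simp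
  also have "\<dots> = (\<integral>\<^sup>+Y. G Y \<partial>PiM K (\<lambda>_. M))" by (simp only: distr_PiM_copy[OF K M])
  finally show ?case using insert by simp
qed

text \<open>Continuity also at infinity, where the value is 0; expectations in the limit may be
  infinite.\<close>

lemma tendsto_eexp:
  assumes "(a \<longlongrightarrow> A) Fl"
  shows "((\<lambda>k. eexp (a k)) \<longlongrightarrow> eexp A) Fl"
proof (cases A)
  case (real \<alpha>)
  have ev: "eventually (\<lambda>k. a k < top) Fl" using assms real by (intro order_tendstoD(2)) auto
  have "((\<lambda>k. enn2real (a k)) \<longlongrightarrow> \<alpha>) Fl" using assms real by (intro tendsto_enn2real) auto
  then have "((\<lambda>k. ennreal (exp (- enn2real (a k)))) \<longlongrightarrow> ennreal (exp (- \<alpha>))) Fl"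
    by (intro tendsto_ennrealI tendsto_exp tendsto_minus)
  moreover have "eventually (\<lambda>k. ennreal (exp (- enn2real (a k))) = eexp (a k)) Fl"
    using ev by eventually_elim (auto simp: eexp_def)
  ultimately show ?thesis using real by (auto intro: Lim_transform_eventually)
next
  case top
  have "eventually (\<lambda>k. eexp (a k) < e) Fl" if e: "0 < e" for e :: ennreal
  proof -
    obtain d where d: "0 < d" "ennreal d < e"
    proof (cases e)
      case (real \<epsilon>)
      then have "0 < \<epsilon> / 2" "ennreal (\<epsilon> / 2) < e" using e by (auto simp: ennreal_less_iff)
      then show ?thesis by (rule that)
    next
      case top
      then show ?thesis using that[of 1] by simp
    qed
    have "eventually (\<lambda>k. ennreal \<bar>ln d\<bar> < a k) Fl" using assms top by (intro order_tendstoD(1)) auto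
    then show ?thesis
    proof eventually_elim
      case (elim k)
      have "eexp (a k) \<le> eexp (ennreal \<bar>ln d\<bar>)" using elim by (intro eexp_antimono) auto
      also have "\<dots> = ennreal (exp (- \<bar>ln d\<bar>))" by simp
      also have "\<dots> \<le> ennreal (exp (ln d))" by (intro ennreal_leI) auto
      also have "\<dots> < e" using d by simp
      finally show ?case .
    qed
  qed
  then show ?thesis using top by (intro order_tendstoI) auto
qed

context
  fixes M :: "'w measure" and Y :: "'w \<Rightarrow> real"
  assumes prob: "emeasure M (space M) = 1" and Ym[measurable]: "Y \<in> borel_measurable M" and Y0: "\<And>w. 0 \<le> Y w"
begin

text \<open>Jensen's inequality for the exponential at the mean \<open>c\<close> of
  \<open>Y / N\<close>, raised to the power \<open>N\<close>. If the mean is infinite, the left side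
  is 0.\<close>

lemma eexp_expectation_le:
  assumes N: "0 < N"
  shows "eexp (\<integral>\<^sup>+w. ennreal (Y w) \<partial>M) \<le> (\<integral>\<^sup>+w. ennreal (exp (- (Y w / real N))) \<partial>M) ^ N"
proof -
  let ?u = "\<integral>\<^sup>+w. ennreal (exp (- (Y w / real N))) \<partial>M"
  have EY: "(\<integral>\<^sup>+w. ennreal (Y w) \<partial>M) = ennreal (real N) * (\<integral>\<^sup>+w. ennreal (Y w / real N) \<partial>M)"
    using N by (subst nn_integral_cmult[symmetric]) (auto intro!: nn_integral_cong simp: Y0 simp flip: ennreal_mult')
  show ?thesis
  proof (cases "\<integral>\<^sup>+w. ennreal (Y w / real N) \<partial>M")
    case top
    then show ?thesis using N unfolding EY by (simp add: ennreal_mult_top)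
  next
    case (real c)
    \<comment> \<open>The tangent to the exponential at the mean, with the negative term moved to
      the other side so that both sides can be integrated in \<open>ennreal\<close>.\<close>
    have pt: "ennreal (exp (- c) * (1 + c)) \<le> ennreal (exp (- (Y w / real N))) + ennreal (exp (- c)) * ennreal (Y w / real N)" for w
    proof -
      have "1 + (c - Y w / real N) \<le> exp (c - Y w / real N)" by (rule exp_ge_add_one_self)
      then have "exp (- c) * (1 + (c - Y w / real N)) \<le> exp (- c) * exp (c - Y w / real N)" by (intro mult_left_mono) auto
      also have "\<dots> = exp (- (Y w / real N))" by (simp flip: exp_add)
      finally have "exp (- c) * (1 + c) \<le> exp (- (Y w / real N)) + exp (- c) * (Y w / real N)" by (simp add: algebra_simps)
      then have "ennreal (exp (- c) * (1 + c)) \<le> ennreal (exp (- (Y w / real N)) + exp (- c) * (Y w / real N))" by (rule ennreal_leI)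
      also have "\<dots> = ennreal (exp (- (Y w / real N))) + ennreal (exp (- c)) * ennreal (Y w / real N)"
        using Y0[of w] N by (simp add: ennreal_mult' del: times_divide_eq_right)
      finally show ?thesis .
    qed
    have "ennreal (exp (- c) * (1 + c)) = (\<integral>\<^sup>+w. ennreal (exp (- c) * (1 + c)) \<partial>M)" using prob by simp
    also have "\<dots> \<le> (\<integral>\<^sup>+w. ennreal (exp (- (Y w / real N))) + ennreal (exp (- c)) * ennreal (Y w / real N) \<partial>M)"
      by (intro nn_integral_mono pt)
    also have "\<dots> = ?u + ennreal (exp (- c)) * ennreal c"
      by (subst nn_integral_add) (auto simp: nn_integral_cmult real)
    finally have *: "ennreal (exp (- c) * (1 + c)) \<le> ?u + ennreal (exp (- c) * c)" using real by (simp add: ennreal_mult')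
    have "ennreal (exp (- c)) \<le> ?u"
    proof (cases ?u)
      case (real v)
      then have "ennreal (exp (- c) * (1 + c)) \<le> ennreal (v + exp (- c) * c)" using * \<open>0 \<le> c\<close> by simp
      then have "exp (- c) * (1 + c) \<le> v + exp (- c) * c" using real \<open>0 \<le> c\<close> by (subst (asm) ennreal_le_iff) auto
      then show ?thesis using real by (simp add: distrib_left ennreal_leI)
    qed simp
    then have "ennreal (exp (- c)) ^ N \<le> ?u ^ N" by (intro power_mono) auto
    moreover have "eexp (\<integral>\<^sup>+w. ennreal (Y w) \<partial>M) = ennreal (exp (- c)) ^ N"
      unfolding EY real using \<open>0 \<le> c\<close> by (simp add: ennreal_power exp_of_nat_mult[symmetric] flip: ennreal_mult')
    ultimately show ?thesis by simp
  qed
qed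

text \<open>With \<open>u\<close> the expectation on the left, \<open>u \<le> exp (u - 1)\<close>
  gives \<open>u ^ N \<le> exp (- N * (1 - u))\<close>.\<close>

lemma power_expectation_le_eexp:
  assumes N: "0 < N"
  shows "(\<integral>\<^sup>+w. ennreal (exp (- (Y w / real N))) \<partial>M) ^ N \<le> eexp (\<integral>\<^sup>+w. ennreal (real N * (1 - exp (- (Y w / real N)))) \<partial>M)"
proof -
  let ?u = "\<integral>\<^sup>+w. ennreal (exp (- (Y w / real N))) \<partial>M" and ?v = "\<integral>\<^sup>+w. ennreal (1 - exp (- (Y w / real N))) \<partial>M"
  have "?v + ?u = (\<integral>\<^sup>+w. ennreal (1 - exp (- (Y w / real N))) + ennreal (exp (- (Y w / real N))) \<partial>M)"
    by (rule nn_integral_add[symmetric]) measurable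
  also have "\<dots> = (\<integral>\<^sup>+w. 1 \<partial>M)"
    using Y0 by (intro nn_integral_cong) (simp flip: ennreal_plus)
  also have "\<dots> = 1" using prob by simp
  finally have uv: "?v + ?u = 1" .
  have "x \<noteq> top" if "x \<le> 1" for x :: ennreal using that by (auto simp: top_unique)
  moreover have "?u \<le> 1" "?v \<le> 1" using uv by (metis add.commute le_iff_add)+
  ultimately have "?u \<noteq> top" "?v \<noteq> top" by blast+
  then obtain u v where u: "?u = ennreal u" "0 \<le> u" and v: "?v = ennreal v" "0 \<le> v" by (meson ennreal_cases)
  have "ennreal (v + u) = ennreal 1" using uv u v by simp
  then have vu: "v = 1 - u" using u(2) v(2) by (subst (asm) ennreal_inj) auto
  have "(\<integral>\<^sup>+w. ennreal (real N * (1 - exp (- (Y w / real N)))) \<partial>M) = ennreal (real N) * ?v"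
    by (subst nn_integral_cmult[symmetric]) (auto simp: ennreal_mult')
  also have "\<dots> = ennreal (real N * (1 - u))" using v vu by (simp add: ennreal_mult')
  finally have "eexp (\<integral>\<^sup>+w. ennreal (real N * (1 - exp (- (Y w / real N)))) \<partial>M) = ennreal (exp (- (real N * (1 - u))))"
    using v vu by simp
  moreover have "u ^ N \<le> exp (- (real N * (1 - u)))"
  proof -
    have "u \<le> exp (u - 1)" using exp_ge_add_one_self[of "u - 1"] by simp
    then have "u ^ N \<le> exp (u - 1) ^ N" using u by (intro power_mono) auto
    also have "\<dots> = exp (real N * (u - 1))" by (simp add: exp_of_nat_mult)
    finally show ?thesis by (simp add: algebra_simps)
  qed
  ultimately show ?thesis using u by (simp add: ennreal_power ennreal_leI)
qed

text \<open>The truncations converge to \<open>Y\<close> and never exceed it. Fatou's lemma and this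
  bound together give convergence of the integrals even when the limit is infinite.\<close>

lemma tendsto_expectation_truncated:
  "(\<lambda>k. \<integral>\<^sup>+w. ennreal (real (Suc k) * (1 - exp (- (Y w / real (Suc k))))) \<partial>M) \<longlonglongrightarrow> (\<integral>\<^sup>+w. ennreal (Y w) \<partial>M)"
proof -
  let ?z = "\<lambda>k w. ennreal (real (Suc k) * (1 - exp (- (Y w / real (Suc k)))))"
  have zle: "?z k w \<le> ennreal (Y w)" for k w
  proof (rule ennreal_leI)
    have "1 - exp (- (Y w / real (Suc k))) \<le> Y w / real (Suc k)" using exp_ge_add_one_self[of "- (Y w / real (Suc k))"] by simp
    then have "real (Suc k) * (1 - exp (- (Y w / real (Suc k)))) \<le> real (Suc k) * (Y w / real (Suc k))" by (intro mult_left_mono) auto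
    then show "real (Suc k) * (1 - exp (- (Y w / real (Suc k)))) \<le> Y w" by simp
  qed
  have zlim: "(\<lambda>k. ?z k w) \<longlonglongrightarrow> ennreal (Y w)" for w
  proof -
    have "((\<lambda>t. (exp (- Y w * t) - 1) / t) \<longlongrightarrow> - Y w) (at 0)"
    proof -
      have "((\<lambda>t. exp (- Y w * t)) has_real_derivative - Y w) (at 0)"
        by (auto intro!: derivative_eq_intros)
      then show ?thesis by (simp add: has_field_derivative_iff)
    qed
    moreover have "filterlim (\<lambda>k. 1 / real (Suc k)) (at 0) sequentially"
      by (intro filterlim_atI LIMSEQ_Suc[OF lim_1_over_n]) auto
    ultimately have "(\<lambda>k. (exp (- Y w * (1 / real (Suc k))) - 1) / (1 / real (Suc k))) \<longlonglongrightarrow> - Y w"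
      by (rule filterlim_compose)
    then have "(\<lambda>k. - ((exp (- Y w * (1 / real (Suc k))) - 1) / (1 / real (Suc k)))) \<longlonglongrightarrow> - (- Y w)" by (rule tendsto_minus)
    moreover have "(\<lambda>k. - ((exp (- Y w * (1 / real (Suc k))) - 1) / (1 / real (Suc k)))) = (\<lambda>k. real (Suc k) * (1 - exp (- (Y w / real (Suc k)))))"
      by (simp add: fun_eq_iff field_simps)
    ultimately show ?thesis by (intro tendsto_ennrealI) simp
  qed
  have "(\<integral>\<^sup>+w. ennreal (Y w) \<partial>M) = (\<integral>\<^sup>+w. liminf (\<lambda>k. ?z k w) \<partial>M)"
    by (rule nn_integral_cong) (rule lim_imp_Liminf[symmetric, OF _ zlim], simp)
  also have "\<dots> \<le> liminf (\<lambda>k. \<integral>\<^sup>+w. ?z k w \<partial>M)" by (rule nn_integral_liminf) measurable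
  finally have lo: "(\<integral>\<^sup>+w. ennreal (Y w) \<partial>M) \<le> liminf (\<lambda>k. \<integral>\<^sup>+w. ?z k w \<partial>M)" .
  have hi: "limsup (\<lambda>k. \<integral>\<^sup>+w. ?z k w \<partial>M) \<le> (\<integral>\<^sup>+w. ennreal (Y w) \<partial>M)"
    by (intro Limsup_bounded always_eventually allI nn_integral_mono zle)
  show ?thesis
    using lo hi Liminf_le_Limsup[of sequentially "\<lambda>k. \<integral>\<^sup>+w. ?z k w \<partial>M"]
    by (intro Liminf_eq_Limsup) (auto intro: antisym)
qed

end

lemma sets_weight_measure [simp, measurable_cong]: "sets (weight_measure J V) = sets (PiM J (\<lambda>_. lborel))"
  by (simp add: weight_measure_def)

lemma space_weight_measure [simp]: "space (weight_measure J V) = space (PiM J (\<lambda>_. lborel))"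
  by (simp add: weight_measure_def)

lemma supp_fun_inner_measurable:
  assumes C: "os_convex_body m C"
  shows "(\<lambda>(x, Y). supp_fun m C (\<lambda>j. Y j \<bullet> x)) \<in> borel_measurable ((lborel :: 'a::euclidean_space measure) \<Otimes>\<^sub>M PiM {..<m} (\<lambda>_. lborel))"
  unfolding case_prod_beta
  by (intro supp_fun_measurable_coordinates[OF C] borel_measurable_inner measurable_compose[OF measurable_snd measurable_component_singleton]) auto

text \<open>For fixed \<open>x\<close> the integrand over an array with \<open>N\<close> rows and
  \<open>m\<close> columns is a product over the rows, so it integrates to an \<open>N\<close>-th
  power. In this way a power of an expectation is reached by the rearrangement inequality for
  products.\<close>

lemma inner_functional_copies:
  fixes V :: "'a::euclidean_space \<Rightarrow> ennreal" and \<phi> :: "real \<Rightarrow> ennreal"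
  assumes C: "os_convex_body m C" and V: "V \<in> borel_measurable borel" and [measurable]: "\<phi> \<in> borel_measurable borel"
  shows "inner_functional ({..<N} \<times> {..<m}) (\<lambda>y. \<Prod>i<N. \<phi> (supp_fun m C (\<lambda>j. y (i, j)))) (\<lambda>_. V)
    = (\<integral>\<^sup>+x. indicator (ball 0 1) x * (\<integral>\<^sup>+Y. \<phi> (supp_fun m C (\<lambda>j. Y j \<bullet> x)) \<partial>weight_measure {..<m} (\<lambda>_. V)) ^ N \<partial>lborel)"
  unfolding inner_functional_def
proof (rule nn_integral_cong)
  fix x :: 'a
  let ?J = "{..<N} \<times> {..<m}"
  define G where "G Y = \<phi> (supp_fun m C (\<lambda>j. Y j \<bullet> x)) * (\<Prod>j<m. V (Y j))" for Y
  have sm: "(\<lambda>Y. \<phi> (supp_fun m C (\<lambda>j. Y j \<bullet> x))) \<in> borel_measurable (PiM {..<m} (\<lambda>_. lborel))"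
    using measurable_compose[OF measurable_Pair1' supp_fun_inner_measurable[OF C], of x] by simp
  have vm: "(\<lambda>Y. \<Prod>j<m. V (Y j)) \<in> borel_measurable (PiM {..<m} (\<lambda>_. lborel))"
    using V by (intro prod_weights_measurable)
  have Gm: "G \<in> borel_measurable (PiM {..<m} (\<lambda>_. lborel))"
    unfolding G_def using sm vm by (rule borel_measurable_times_ennreal)
  have "(\<integral>\<^sup>+X. indicator (ball 0 1) x * (\<Prod>i<N. \<phi> (supp_fun m C (\<lambda>j. (\<lambda>p\<in>?J. X p \<bullet> x) (i, j)))) * (\<Prod>p\<in>?J. V (X p)) \<partial>PiM ?J (\<lambda>_. lborel))
    = (\<integral>\<^sup>+X. indicator (ball 0 1) x * (\<Prod>i<N. G (\<lambda>j\<in>{..<m}. X (i, j))) \<partial>PiM ?J (\<lambda>_. lborel))"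
  proof (rule nn_integral_cong)
    fix X :: "nat \<times> nat \<Rightarrow> 'a"
    have "(\<Prod>i<N. \<phi> (supp_fun m C (\<lambda>j. (\<lambda>p\<in>?J. X p \<bullet> x) (i, j)))) = (\<Prod>i<N. \<phi> (supp_fun m C (\<lambda>j. (\<lambda>j\<in>{..<m}. X (i, j)) j \<bullet> x)))"
      by (intro prod.cong arg_cong[where f=\<phi>] supp_fun_cong) auto
    moreover have "(\<Prod>p\<in>?J. V (X p)) = (\<Prod>i<N. \<Prod>j<m. V ((\<lambda>j\<in>{..<m}. X (i, j)) j))"
    proof -
      have "(\<Prod>p\<in>?J. V (X p)) = (\<Prod>(i, j)\<in>?J. V (X (i, j)))" by (simp add: case_prod_beta)
      also have "\<dots> = (\<Prod>i<N. \<Prod>j<m. V (X (i, j)))" by (rule prod.cartesian_product[symmetric])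
      finally show ?thesis by simp
    qed
    ultimately show "indicator (ball 0 1) x * (\<Prod>i<N. \<phi> (supp_fun m C (\<lambda>j. (\<lambda>p\<in>?J. X p \<bullet> x) (i, j)))) * (\<Prod>p\<in>?J. V (X p))
      = indicator (ball 0 1) x * (\<Prod>i<N. G (\<lambda>j\<in>{..<m}. X (i, j)))"
      unfolding G_def by (simp only: prod.distrib mult.assoc)
  qed
  also have "\<dots> = indicator (ball 0 1) x * (\<integral>\<^sup>+X. (\<Prod>i<N. G (\<lambda>j\<in>{..<m}. X (i, j))) \<partial>PiM ?J (\<lambda>_. lborel))"
  proof (rule nn_integral_cmult, rule borel_measurable_prod_ennreal)
    fix i assume "i \<in> {..<N}"
    then show "(\<lambda>X. G (\<lambda>j\<in>{..<m}. X (i, j))) \<in> borel_measurable (PiM ?J (\<lambda>_. lborel))"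
      by (intro measurable_compose[OF _ Gm] measurable_restrict measurable_component_singleton) auto
  qed
  also have "(\<integral>\<^sup>+X. (\<Prod>i<N. G (\<lambda>j\<in>{..<m}. X (i, j))) \<partial>PiM ?J (\<lambda>_. lborel)) = (\<integral>\<^sup>+Y. G Y \<partial>PiM {..<m} (\<lambda>_. lborel)) ^ card {..<N}"
    by (rule nn_integral_PiM_copies[OF finite_lessThan finite_lessThan sigma_finite_lborel Gm])
  also have "(\<integral>\<^sup>+Y. G Y \<partial>PiM {..<m} (\<lambda>_. lborel)) = (\<integral>\<^sup>+Y. \<phi> (supp_fun m C (\<lambda>j. Y j \<bullet> x)) \<partial>weight_measure {..<m} (\<lambda>_. V))"
    unfolding G_def using V sm by (intro nn_integral_weight_measure[symmetric])
  finally show "(\<integral>\<^sup>+X. indicator (ball 0 1) x * (\<Prod>i<N. \<phi> (supp_fun m C (\<lambda>j. (\<lambda>p\<in>?J. X p \<bullet> x) (i, j)))) * (\<Prod>p\<in>?J. V (X p)) \<partial>PiM ?J (\<lambda>_. lborel))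
    = indicator (ball 0 1) x * (\<integral>\<^sup>+Y. \<phi> (supp_fun m C (\<lambda>j. Y j \<bullet> x)) \<partial>weight_measure {..<m} (\<lambda>_. V)) ^ N" by simp
qed

text \<open>The expectation sits inside the exponential; it is squeezed between products over \<open>N\<close>
  independent copies, \<open>exp (-E Y) \<le> (E exp (-Y/N))^N \<le> exp (-E (N (1 - exp (-Y/N))))\<close>.\<close>
lemma exp_expectation_rearrangement:
  fixes F :: "'a::euclidean_space \<Rightarrow> real" and \<psi> :: "real \<Rightarrow> real"
  assumes C: "os_convex_body m C" and F: "finite_levels F" "(\<integral>\<^sup>+x. ennreal (F x) \<partial>lborel) = 1"
    and \<psi>m[measurable]: "\<psi> \<in> borel_measurable borel" and \<psi>0: "\<And>t. 0 \<le> t \<Longrightarrow> 0 \<le> \<psi> t" and \<psi>: "\<And>s t. 0 \<le> s \<Longrightarrow> s \<le> t \<Longrightarrow> \<psi> s \<le> \<psi> t"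
  shows "(\<integral>\<^sup>+x. indicator (ball 0 1) x * eexp (\<integral>\<^sup>+Y. ennreal (\<psi> (supp_fun m C (\<lambda>j. Y j \<bullet> x))) \<partial>weight_measure {..<m} (\<lambda>_ x. ennreal (F x))) \<partial>lborel)
    \<le> (\<integral>\<^sup>+x. indicator (ball 0 1) x * eexp (\<integral>\<^sup>+Y. ennreal (\<psi> (supp_fun m C (\<lambda>j. Y j \<bullet> x))) \<partial>weight_measure {..<m} (\<lambda>_. sym_layers F)) \<partial>lborel)"
proof -
  let ?W = "\<lambda>x. ennreal (F x)" and ?W' = "sym_layers F"
  let ?M = "\<lambda>V. weight_measure {..<m} (\<lambda>_. V)"
  let ?h = "\<lambda>(x::'a) Y. supp_fun m C (\<lambda>j. Y j \<bullet> x)"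
  have Wm: "?W \<in> borel_measurable borel" using F by (simp add: finite_levels_def)
  have Wm': "?W' \<in> borel_measurable borel" by (rule sym_layers_measurable[OF F(1)])
  have W1': "(\<integral>\<^sup>+x. ?W' x \<partial>lborel) = 1" using nn_integral_sym_layers[OF F(1)] F(2) by simp
  have prob: "emeasure (?M ?W) (space (?M ?W)) = 1" "emeasure (?M ?W') (space (?M ?W')) = 1"
    using Wm Wm' W1' F(2) by (auto intro!: emeasure_weight_measure simp del: space_weight_measure)
  interpret M': finite_measure "?M ?W'" using Wm' W1' by (intro prob_weight_measure) auto
  have hm: "(\<lambda>(x, Y). ?h x Y) \<in> borel_measurable (lborel \<Otimes>\<^sub>M ?M V)" for V :: "'a \<Rightarrow> ennreal"
    using supp_fun_inner_measurable[OF C, where 'a='a] by (simp cong: measurable_cong_sets sets_pair_measure_cong)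
  have hm1[measurable]: "?h x \<in> borel_measurable (?M V)" for V :: "'a \<Rightarrow> ennreal" and x
    using measurable_compose[OF measurable_Pair1' hm, of x V] by simp
  note hm[of "sym_layers F", measurable]
  have h0: "0 \<le> ?h x Y" for x Y by (rule supp_fun_nonneg[OF C])
  have q0: "0 \<le> \<psi> (?h x Y)" for x Y using h0 \<psi>0 by simp
  define z where "z k x = (\<integral>\<^sup>+Y. ennreal (real (Suc k) * (1 - exp (- (\<psi> (?h x Y) / real (Suc k))))) \<partial>?M ?W')" for k x
  have le: "(\<integral>\<^sup>+x. indicator (ball 0 1) x * eexp (\<integral>\<^sup>+Y. ennreal (\<psi> (?h x Y)) \<partial>?M ?W) \<partial>lborel) \<le> (\<integral>\<^sup>+x. indicator (ball 0 1) x * eexp (z k x) \<partial>lborel)" for k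
  proof -
    define N where "N = Suc k"
    have N: "0 < N" by (simp add: N_def)
    define \<phi> where "\<phi> t = ennreal (exp (- (\<psi> t / real N)))" for t
    have \<phi>m[measurable]: "\<phi> \<in> borel_measurable borel" unfolding \<phi>_def by measurable
    let ?Q = "\<lambda>y. \<Prod>i<N. \<phi> (supp_fun m C (\<lambda>j. y (i, j)))"
    have "(\<integral>\<^sup>+x. indicator (ball 0 1) x * eexp (\<integral>\<^sup>+Y. ennreal (\<psi> (?h x Y)) \<partial>?M ?W) \<partial>lborel)
      \<le> (\<integral>\<^sup>+x. indicator (ball 0 1) x * (\<integral>\<^sup>+Y. \<phi> (?h x Y) \<partial>?M ?W) ^ N \<partial>lborel)"
      unfolding \<phi>_def by (intro nn_integral_mono mult_left_mono eexp_expectation_le[OF prob(1) _ q0 N]) auto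
    also have "\<dots> = inner_functional ({..<N} \<times> {..<m}) ?Q (\<lambda>_. ?W)"
      by (rule inner_functional_copies[OF C Wm \<phi>m, symmetric])
    also have "\<dots> \<le> inner_functional ({..<N} \<times> {..<m}) ?Q (\<lambda>_. ?W')"
    proof (rule inner_functional_rearrangement)
      fix i assume i: "i \<in> {..<N}"
      show "sym_quasiconcave ({..<N} \<times> {..<m}) (\<lambda>y. \<phi> (supp_fun m C (\<lambda>j. y (i, j))))"
      proof (rule sym_quasiconcave_supp_fun[OF C _ \<phi>m])
        show "\<phi> t \<le> \<phi> s" if "0 \<le> s" "s \<le> t" for s t
          unfolding \<phi>_def using \<psi>[OF that] by (intro ennreal_leI) (simp add: divide_right_mono)
      qed (use i in auto)
    qed (use F in auto)
    also have "\<dots> = (\<integral>\<^sup>+x. indicator (ball 0 1) x * (\<integral>\<^sup>+Y. \<phi> (?h x Y) \<partial>?M ?W') ^ N \<partial>lborel)"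
      by (rule inner_functional_copies[OF C Wm' \<phi>m])
    also have "\<dots> \<le> (\<integral>\<^sup>+x. indicator (ball 0 1) x * eexp (z k x) \<partial>lborel)"
      unfolding \<phi>_def z_def N_def[symmetric]
      by (intro nn_integral_mono mult_left_mono power_expectation_le_eexp[OF prob(2) _ q0 N]) auto
    finally show ?thesis .
  qed
  have zm[measurable]: "z k \<in> borel_measurable borel" for k
  proof -
    have "(\<lambda>(x, Y). ennreal (real (Suc k) * (1 - exp (- (\<psi> (?h x Y) / real (Suc k)))))) \<in> borel_measurable (lborel \<Otimes>\<^sub>M ?M ?W')" by measurable
    then have "(\<lambda>x. \<integral>\<^sup>+Y. ennreal (real (Suc k) * (1 - exp (- (\<psi> (?h x Y) / real (Suc k))))) \<partial>?M ?W') \<in> borel_measurable lborel"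
      by (rule M'.borel_measurable_nn_integral)
    then show ?thesis by (simp add: z_def[abs_def])
  qed
  have Em: "(\<lambda>x. \<integral>\<^sup>+Y. ennreal (\<psi> (?h x Y)) \<partial>?M ?W') \<in> borel_measurable borel"
  proof -
    have "(\<lambda>(x, Y). ennreal (\<psi> (?h x Y))) \<in> borel_measurable (lborel \<Otimes>\<^sub>M ?M ?W')" by measurable
    from M'.borel_measurable_nn_integral[OF this] show ?thesis by simp
  qed
  have "(\<lambda>k. \<integral>\<^sup>+x. indicator (ball 0 1) x * eexp (z k x) \<partial>lborel) \<longlonglongrightarrow> (\<integral>\<^sup>+x. indicator (ball (0::'a) 1) x * eexp (\<integral>\<^sup>+Y. ennreal (\<psi> (?h x Y)) \<partial>?M ?W') \<partial>lborel)"
  \<comment> \<open>Since \<open>eexp\<close> is at most 1, the indicator of the unit ball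
    dominates.\<close>
  proof (rule nn_integral_dominated_convergence[where w="indicator (ball 0 1)"])
    show "AE x in lborel. indicator (ball (0::'a) 1) x * eexp (z k x) \<le> indicator (ball 0 1) x" for k
      using eexp_le_1 by (auto simp: indicator_def)
    show "(\<integral>\<^sup>+x. indicator (ball (0::'a) 1) x \<partial>lborel) < \<infinity>"
      using emeasure_lborel_ball_finite[of "0::'a" 1] by simp
    show "AE x in lborel. (\<lambda>k. indicator (ball (0::'a) 1) x * eexp (z k x)) \<longlonglongrightarrow> indicator (ball 0 1) x * eexp (\<integral>\<^sup>+Y. ennreal (\<psi> (?h x Y)) \<partial>?M ?W')"
    proof (rule AE_I2)
      fix x :: 'a
      have "(\<lambda>k. z k x) \<longlonglongrightarrow> (\<integral>\<^sup>+Y. ennreal (\<psi> (?h x Y)) \<partial>?M ?W')"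
        unfolding z_def by (rule tendsto_expectation_truncated[OF prob(2) _ q0]) measurable
      then show "(\<lambda>k. indicator (ball (0::'a) 1) x * eexp (z k x)) \<longlonglongrightarrow> indicator (ball 0 1) x * eexp (\<integral>\<^sup>+Y. ennreal (\<psi> (?h x Y)) \<partial>?M ?W')"
        by (intro ennreal_tendsto_cmult tendsto_eexp) (auto simp: indicator_def)
    qed
  qed (use Em in measurable)
  then show ?thesis by (rule tendsto_lowerbound) (use le in auto)
qed

section \<open>Volumes of non-empirical sets for positive exponents\<close>

lemma prod_integral_weight:
  fixes f :: "'a::euclidean_space \<Rightarrow> real"
  assumes "\<And>x. 0 \<le> f x" "V \<in> borel_measurable borel" "AE x in lebesgue. ennreal (f x) = V x" "g \<in> borel_measurable (PiM {..<m} (\<lambda>_. lborel))"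
  shows "prod_integral m f g = (\<integral>\<^sup>+Y. g Y \<partial>weight_measure {..<m} (\<lambda>_. V))"
  unfolding prod_integral_def using assms
  by (subst nn_integral_PiM_lebesgue_weight[where W="\<lambda>_. V"]) (auto intro!: nn_integral_weight_measure[symmetric])

text \<open>The deterministic case of the limit of expected dual volumes, taken over a one-point
  probability space.\<close>

lemma star_vol_le_of_dual_volumes:
  fixes r1 r2 :: "'a::euclidean_space \<Rightarrow> ennreal"
  assumes m: "r1 \<in> borel_measurable borel" "r2 \<in> borel_measurable borel" and hom: "inv_homogeneous r1" "inv_homogeneous r2"
    and le: "\<And>a::real. 0 < a \<Longrightarrow> (\<integral>\<^sup>+x. indicator (ball 0 1) x * epow (r1 x) a \<partial>lborel) \<le> (\<integral>\<^sup>+x. indicator (ball 0 1) x * epow (r2 x) a \<partial>lborel)"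
  shows "star_vol r1 \<le> star_vol r2"
proof -
  let ?U = "count_space (UNIV :: unit set)"
  have U: "sigma_finite_measure ?U" by (rule sigma_finite_measure_count_space_finite) simp
  have mp: "(\<lambda>(w, x). r x) \<in> borel_measurable (?U \<Otimes>\<^sub>M lborel)" if "r \<in> borel_measurable borel" for r :: "'a \<Rightarrow> ennreal"
    using that by measurable
  have "(\<integral>\<^sup>+w. emeasure lborel {x. 1 < r1 x} \<partial>?U) \<le> (\<integral>\<^sup>+w. emeasure lborel {x. 1 < r2 x} \<partial>?U)"
    by (rule dual_volume_limit[OF U U _ mp[OF m(1)] mp[OF m(2)] hom]) (use le in \<open>auto simp: nn_integral_count_space_finite\<close>)
  then show ?thesis
    by (simp add: star_vol_inv_homogeneous[OF hom(1) m(1)] star_vol_inv_homogeneous[OF hom(2) m(2)] nn_integral_count_space_finite)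
qed

lemma supp_fun_inner_scale:
  assumes "os_convex_body m C" "0 < s"
  shows "supp_fun m C (\<lambda>j. Y j \<bullet> (s *\<^sub>R x)) = s * supp_fun m C (\<lambda>j. Y j \<bullet> x)"
  using supp_fun_scale[OF assms, of "\<lambda>j. Y j \<bullet> x"] by simp

lemma nn_integral_weight_measure_measurable:
  fixes V :: "'a::euclidean_space \<Rightarrow> ennreal" and \<phi> :: "real \<Rightarrow> ennreal"
  assumes C: "os_convex_body m C" and V: "V \<in> borel_measurable borel" "(\<integral>\<^sup>+x. V x \<partial>lborel) = 1" and [measurable]: "\<phi> \<in> borel_measurable borel"
  shows "(\<lambda>x. \<integral>\<^sup>+Y. \<phi> (supp_fun m C (\<lambda>j. Y j \<bullet> x)) \<partial>weight_measure {..<m} (\<lambda>_. V)) \<in> borel_measurable borel"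
    and "(\<lambda>Y. supp_fun m C (\<lambda>j. Y j \<bullet> x)) \<in> borel_measurable (PiM {..<m} (\<lambda>_. lborel))"
proof -
  interpret finite_measure "weight_measure {..<m} (\<lambda>_. V)" using V by (intro prob_weight_measure) auto
  have hm[measurable]: "(\<lambda>(x, Y). supp_fun m C (\<lambda>j. Y j \<bullet> x)) \<in> borel_measurable ((lborel :: 'a measure) \<Otimes>\<^sub>M weight_measure {..<m} (\<lambda>_. V))"
    using supp_fun_inner_measurable[OF C, where 'a='a] by (simp cong: measurable_cong_sets sets_pair_measure_cong)
  have "(\<lambda>(x, Y). \<phi> (supp_fun m C (\<lambda>j. Y j \<bullet> x))) \<in> borel_measurable ((lborel :: 'a measure) \<Otimes>\<^sub>M weight_measure {..<m} (\<lambda>_. V))" by measurable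
  from borel_measurable_nn_integral[OF this]
  show "(\<lambda>x. \<integral>\<^sup>+Y. \<phi> (supp_fun m C (\<lambda>j. Y j \<bullet> x)) \<partial>weight_measure {..<m} (\<lambda>_. V)) \<in> borel_measurable borel" by simp
  show "(\<lambda>Y. supp_fun m C (\<lambda>j. Y j \<bullet> x)) \<in> borel_measurable (PiM {..<m} (\<lambda>_. lborel))"
    using measurable_compose[OF measurable_Pair1' supp_fun_inner_measurable[OF C], of x] by simp
qed

text \<open>The Gamma integral turns the dual volumes into superpositions of
  \<open>exp (- s * E)\<close>, where \<open>E\<close> is the expectation of the \<open>p\<close>-th
  power of the support function. The comparison of exponentials of expectations then applies for
  each \<open>s\<close>.\<close>

lemma Zvol_rearrangement_pos:
  fixes f :: "'a::euclidean_space \<Rightarrow> real"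
  assumes f: "Pn f" and C: "os_convex_body m C" and p: "0 < p"
  shows "Zvol p m C f \<le> Zvol p m C (sym_rearr f)"
proof -
  obtain F where F: "finite_levels F" "AE x in lebesgue. ennreal (f x) = ennreal (F x)" "(\<integral>\<^sup>+x. ennreal (F x) \<partial>lborel) = 1"
    "\<And>x. ennreal (sym_rearr f x) = sym_layers F x" "\<And>x. 0 \<le> sym_rearr f x"
    using Pn_weights[OF f] by blast
  let ?W = "\<lambda>x. ennreal (F x)" and ?W' = "sym_layers F"
  let ?M = "\<lambda>V. weight_measure {..<m} (\<lambda>_. V)"
  have W: "?W \<in> borel_measurable borel" "(\<integral>\<^sup>+x. ?W x \<partial>lborel) = 1" using F by (auto simp: finite_levels_def)
  have W': "?W' \<in> borel_measurable borel" "(\<integral>\<^sup>+x. ?W' x \<partial>lborel) = 1"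
    using sym_layers_measurable[OF F(1)] nn_integral_sym_layers[OF F(1)] F(3) by auto
  let ?h = "\<lambda>(x::'a) Y. supp_fun m C (\<lambda>j. Y j \<bullet> x)"
  have h0: "0 \<le> ?h x Y" for x Y by (rule supp_fun_nonneg[OF C])
  define g where "g V x = (\<integral>\<^sup>+Y. epow (ennreal (?h x Y)) p \<partial>?M V)" for V x
  define r where "r V x = epow (g V x) (- 1 / p)" for V x
  have ep: "(\<lambda>t. epow (ennreal t) p) \<in> borel_measurable borel" by measurable
  have gm: "g V \<in> borel_measurable borel" if "V \<in> borel_measurable borel" "(\<integral>\<^sup>+x. V x \<partial>lborel) = 1" for V
    unfolding g_def[abs_def] by (rule nn_integral_weight_measure_measurable(1)[OF C that ep])
  have hm[measurable]: "(\<lambda>Y. ?h x Y) \<in> borel_measurable (PiM {..<m} (\<lambda>_. lborel))" for x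
    by (rule nn_integral_weight_measure_measurable(2)[OF C W ep])
  have gs: "ennreal s * g V x = (\<integral>\<^sup>+Y. ennreal (s * ?h x Y powr p) \<partial>?M V)" if "0 < s" for s V x
    unfolding g_def using that h0 p by (subst nn_integral_cmult[symmetric]) (auto simp: epow_ennreal ennreal_mult' intro!: nn_integral_cong)
  have ghom: "g V (s *\<^sub>R x) = ennreal (s powr p) * g V x" if s: "0 < s" for s V x
  proof -
    have "g V (s *\<^sub>R x) = (\<integral>\<^sup>+Y. ennreal (s powr p * ?h x Y powr p) \<partial>?M V)"
      unfolding g_def supp_fun_inner_scale[OF C s] using s h0 p
      by (intro nn_integral_cong) (auto simp: epow_ennreal powr_mult)
    then show ?thesis using gs[of "s powr p" V x] s by simp
  qed
  have rh: "inv_homogeneous (r V)" for V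
    unfolding inv_homogeneous_def
  proof (intro allI impI)
    fix s :: real and x :: 'a assume s: "0 < s"
    show "ennreal s < r V x \<longleftrightarrow> 1 < r V (s *\<^sub>R x)"
      using epow_inverse_less_iff[OF p s, of "g V x"] epow_inverse_less_iff[OF p zero_less_one, of "ennreal (s powr p) * g V x"]
      by (simp add: r_def ghom[OF s])
  qed
  have rm: "r V \<in> borel_measurable borel" if "V \<in> borel_measurable borel" "(\<integral>\<^sup>+x. V x \<partial>lborel) = 1" for V
    unfolding r_def[abs_def] using gm[OF that] by measurable
  have Z: "Zrho p m C f = r ?W" "Zrho p m C (sym_rearr f) = r ?W'"
  proof -
    have em: "(\<lambda>Y. epow (ennreal (?h x Y)) p) \<in> borel_measurable (PiM {..<m} (\<lambda>_. lborel))" for x by measurable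
    have "\<And>x. 0 \<le> f x" using f by (simp add: Pn_def)
    from prod_integral_weight[OF this W(1) F(2) em] show "Zrho p m C f = r ?W"
      using p by (auto simp: fun_eq_iff Zrho_def r_def g_def)
    from prod_integral_weight[OF F(5) W'(1) _ em] F(4) show "Zrho p m C (sym_rearr f) = r ?W'"
      using p by (auto simp: fun_eq_iff Zrho_def r_def g_def)
  qed
  have "star_vol (r ?W) \<le> star_vol (r ?W')"
  proof (rule star_vol_le_of_dual_volumes[OF rm[OF W] rm[OF W'] rh rh])
    fix a :: real assume a: "0 < a"
    define \<alpha> where "\<alpha> = a / p"
    have \<alpha>: "0 < \<alpha>" using a p by (simp add: \<alpha>_def)
    have G0: "ennreal (Gamma \<alpha>) \<noteq> 0" "ennreal (Gamma \<alpha>) \<noteq> top" using Gamma_real_pos[OF \<alpha>] by (auto simp: ennreal_eq_0_iff)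
    \<comment> \<open>After exchanging the integrals over \<open>s\<close> and \<open>x\<close>, the
      number \<open>s\<close> moves inside the expectation, which is the form that the exponential
      comparison takes.\<close>
    have rep: "ennreal (Gamma \<alpha>) * (\<integral>\<^sup>+x. indicator (ball 0 1) x * epow (r V x) a \<partial>lborel) =
       (\<integral>\<^sup>+s. (if 0 < s then ennreal (s powr (\<alpha> - 1)) * (\<integral>\<^sup>+x. indicator (ball (0::'a) 1) x * eexp (\<integral>\<^sup>+Y. ennreal (s * ?h x Y powr p) \<partial>?M V) \<partial>lborel) else 0) \<partial>lborel)"
      if V: "V \<in> borel_measurable borel" "(\<integral>\<^sup>+x. V x \<partial>lborel) = 1" for V
    proof -
      note [measurable] = gm[OF V] rm[OF V]
      have "ennreal (Gamma \<alpha>) * (\<integral>\<^sup>+x. indicator (ball 0 1) x * epow (r V x) a \<partial>lborel)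
        = (\<integral>\<^sup>+x. ennreal (Gamma \<alpha>) * (indicator (ball 0 1) x * epow (r V x) a) \<partial>lborel)"
        by (rule nn_integral_cmult[symmetric]) measurable
      also have "\<dots> = (\<integral>\<^sup>+x. (\<integral>\<^sup>+s. indicator (ball (0::'a) 1) x * (if 0 < s then ennreal (s powr (\<alpha> - 1)) * eexp (ennreal s * g V x) else 0) \<partial>lborel) \<partial>lborel)"
      proof (rule nn_integral_cong)
        fix x :: 'a
        have "ennreal (Gamma \<alpha>) * (indicator (ball 0 1) x * epow (r V x) a) = indicator (ball 0 1) x * (ennreal (Gamma \<alpha>) * epow (g V x) (- \<alpha>))"
          unfolding r_def epow_epow[OF p a] \<alpha>_def by (simp only: mult_ac)
        also have "\<dots> = indicator (ball (0::'a) 1) x * (\<integral>\<^sup>+s. (if 0 < s then ennreal (s powr (\<alpha> - 1)) * eexp (ennreal s * g V x) else 0) \<partial>lborel)"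
          unfolding gamma_integral_ennreal[OF \<alpha>] ..
        also have "\<dots> = (\<integral>\<^sup>+s. indicator (ball (0::'a) 1) x * (if 0 < s then ennreal (s powr (\<alpha> - 1)) * eexp (ennreal s * g V x) else 0) \<partial>lborel)"
          by (rule nn_integral_cmult[symmetric]) measurable
        finally show "ennreal (Gamma \<alpha>) * (indicator (ball 0 1) x * epow (r V x) a) = (\<integral>\<^sup>+s. indicator (ball (0::'a) 1) x * (if 0 < s then ennreal (s powr (\<alpha> - 1)) * eexp (ennreal s * g V x) else 0) \<partial>lborel)" .
      qed
      also have "\<dots> = (\<integral>\<^sup>+s. (\<integral>\<^sup>+x. indicator (ball (0::'a) 1) x * (if 0 < s then ennreal (s powr (\<alpha> - 1)) * eexp (ennreal s * g V x) else 0) \<partial>lborel) \<partial>lborel)"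
        by (rule lborel_pair.Fubini') measurable
      also have "\<dots> = (\<integral>\<^sup>+s. (if 0 < s then ennreal (s powr (\<alpha> - 1)) * (\<integral>\<^sup>+x. indicator (ball (0::'a) 1) x * eexp (\<integral>\<^sup>+Y. ennreal (s * ?h x Y powr p) \<partial>?M V) \<partial>lborel) else 0) \<partial>lborel)"
      proof (rule nn_integral_cong)
        fix s :: real
        show "(\<integral>\<^sup>+x. indicator (ball (0::'a) 1) x * (if 0 < s then ennreal (s powr (\<alpha> - 1)) * eexp (ennreal s * g V x) else 0) \<partial>lborel)
          = (if 0 < s then ennreal (s powr (\<alpha> - 1)) * (\<integral>\<^sup>+x. indicator (ball (0::'a) 1) x * eexp (\<integral>\<^sup>+Y. ennreal (s * ?h x Y powr p) \<partial>?M V) \<partial>lborel) else 0)"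
        proof (cases "0 < s")
          case True
          have "(\<integral>\<^sup>+x. indicator (ball (0::'a) 1) x * (if 0 < s then ennreal (s powr (\<alpha> - 1)) * eexp (ennreal s * g V x) else 0) \<partial>lborel)
            = (\<integral>\<^sup>+x. ennreal (s powr (\<alpha> - 1)) * (indicator (ball (0::'a) 1) x * eexp (ennreal s * g V x)) \<partial>lborel)"
            using True by (intro nn_integral_cong) (simp add: mult_ac)
          also have "\<dots> = ennreal (s powr (\<alpha> - 1)) * (\<integral>\<^sup>+x. indicator (ball (0::'a) 1) x * eexp (ennreal s * g V x) \<partial>lborel)"
            by (rule nn_integral_cmult) measurable
          finally show ?thesis using True by (simp only: gs[OF True] if_True)
        qed simp
      qed
      finally show ?thesis .
    qed
    have "ennreal (Gamma \<alpha>) * (\<integral>\<^sup>+x. indicator (ball (0::'a) 1) x * epow (r ?W x) a \<partial>lborel) \<le> ennreal (Gamma \<alpha>) * (\<integral>\<^sup>+x. indicator (ball 0 1) x * epow (r ?W' x) a \<partial>lborel)"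
      unfolding rep[OF W] rep[OF W']
    proof (rule nn_integral_mono)
      fix s :: real
      show "(if 0 < s then ennreal (s powr (\<alpha> - 1)) * (\<integral>\<^sup>+x. indicator (ball (0::'a) 1) x * eexp (\<integral>\<^sup>+Y. ennreal (s * ?h x Y powr p) \<partial>?M ?W) \<partial>lborel) else 0)
        \<le> (if 0 < s then ennreal (s powr (\<alpha> - 1)) * (\<integral>\<^sup>+x. indicator (ball (0::'a) 1) x * eexp (\<integral>\<^sup>+Y. ennreal (s * ?h x Y powr p) \<partial>?M ?W') \<partial>lborel) else 0)"
      proof (cases "0 < s")
        case True
        have "(\<integral>\<^sup>+x. indicator (ball (0::'a) 1) x * eexp (\<integral>\<^sup>+Y. ennreal (s * ?h x Y powr p) \<partial>?M ?W) \<partial>lborel)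
          \<le> (\<integral>\<^sup>+x. indicator (ball (0::'a) 1) x * eexp (\<integral>\<^sup>+Y. ennreal (s * ?h x Y powr p) \<partial>?M ?W') \<partial>lborel)"
          by (rule exp_expectation_rearrangement[OF C F(1,3), where \<psi>="\<lambda>t. s * t powr p"]) (use True p in \<open>auto intro: mult_left_mono powr_mono2\<close>)
        then show ?thesis using True by (simp add: mult_left_mono)
      qed simp
    qed
    then show "(\<integral>\<^sup>+x. indicator (ball (0::'a) 1) x * epow (r ?W x) a \<partial>lborel) \<le> (\<integral>\<^sup>+x. indicator (ball 0 1) x * epow (r ?W' x) a \<partial>lborel)"
      using G0 by (subst (asm) ennreal_mult_le_mult_iff) auto
  qed
  then show ?thesis by (simp add: Zvol_def Z)
qed

section \<open>The logarithmic case\<close>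

definition log_radius :: "ennreal \<Rightarrow> ennreal \<Rightarrow> ennreal" where
  "log_radius P N = (if P = top then 0 else if N = top then top else ennreal (exp (enn2real N - enn2real P)))"

text \<open>In \<open>ereal\<close> the difference of two infinities is \<open>\<infinity>\<close>,
  so an infinite positive part gives radius 0 whatever the negative part is; for this reason
  \<open>log_radius\<close> tests \<open>P\<close> first.\<close>

lemma log_radius_ereal:
  "(let L = enn2ereal P - enn2ereal N in if L = \<infinity> then 0 else if L = - \<infinity> then \<infinity> else ennreal (exp (- real_of_ereal L))) = log_radius P N"
  by (cases P; cases N) (auto simp: log_radius_def Let_def)

lemma log_radius_measurable [measurable (raw)]:
  assumes [measurable]: "f \<in> borel_measurable M" "g \<in> borel_measurable M"
  shows "(\<lambda>x. log_radius (f x) (g x)) \<in> borel_measurable M"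
  unfolding log_radius_def by measurable

lemma log_radius_mono: "N \<le> N' \<Longrightarrow> log_radius P N \<le> log_radius P N'"
  by (cases N; cases N') (auto simp: log_radius_def top_unique intro: ennreal_leI)

text \<open>Continuity in the negative part alone, including an infinite limit; truncation will
  leave the positive part unchanged.\<close>

lemma log_radius_tendsto:
  assumes "(n \<longlongrightarrow> N) Fl"
  shows "((\<lambda>k. log_radius P (n k)) \<longlongrightarrow> log_radius P N) Fl"
proof (cases P)
  case (real p)
  show ?thesis
  proof (cases N)
    case (real \<nu>)
    have ev: "eventually (\<lambda>k. n k < top) Fl" using assms real by (intro order_tendstoD(2)) auto
    have "((\<lambda>k. enn2real (n k)) \<longlongrightarrow> \<nu>) Fl" using assms real by (intro tendsto_enn2real) auto
    then have "((\<lambda>k. ennreal (exp (enn2real (n k) - p))) \<longlongrightarrow> ennreal (exp (\<nu> - p))) Fl"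
      by (intro tendsto_ennrealI tendsto_exp tendsto_diff tendsto_const)
    moreover have "eventually (\<lambda>k. ennreal (exp (enn2real (n k) - p)) = log_radius P (n k)) Fl"
      using ev by eventually_elim (auto simp: log_radius_def \<open>P = ennreal p\<close> \<open>0 \<le> p\<close>)
    ultimately show ?thesis using real \<open>P = ennreal p\<close> \<open>0 \<le> p\<close> by (auto simp: log_radius_def intro: Lim_transform_eventually)
  next
    case top
    have "eventually (\<lambda>k. y < log_radius P (n k)) Fl" if y: "y < top" for y
    proof -
      obtain t where t: "y = ennreal t" "0 \<le> t" using y by (metis ennreal_cases less_irrefl)
      have "eventually (\<lambda>k. ennreal (ln (t + 1) + p) < n k) Fl" using assms top by (intro order_tendstoD(1)) auto
      then show ?thesis
      proof eventually_elim
        case (elim k)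
        show ?case
        proof (cases "n k")
          case (real \<nu>)
          have "0 \<le> ln (t + 1)" using t by simp
          then have "ln (t + 1) + p < \<nu>" using elim real \<open>0 \<le> p\<close> by (subst (asm) real) (subst (asm) ennreal_less_iff, auto)
          then have "exp (ln (t + 1)) < exp (\<nu> - p)" by simp
          then have "t < exp (\<nu> - p)" using t by simp
          then show ?thesis using real t \<open>P = ennreal p\<close> \<open>0 \<le> p\<close> by (simp add: log_radius_def ennreal_less_iff)
        next
          case top
          then show ?thesis using y \<open>P = ennreal p\<close> by (simp add: log_radius_def)
        qed
      qed
    qed
    then show ?thesis using top real by (intro order_tendstoI) (auto simp: log_radius_def)
  qed
next
  case top
  then show ?thesis by (simp add: log_radius_def)
qed

text \<open>For finite values the equation says \<open>N' - P' = N - P - ln s\<close>, written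
  without subtraction. The four inequalities make \<open>P\<close> and \<open>P'\<close>, and
  likewise \<open>N\<close> and \<open>N'\<close>, infinite together.\<close>

lemma log_radius_scale:
  assumes s: "0 < s"
    and eq: "P' + N + ennreal (max 0 (- ln s)) = N' + P + ennreal (max 0 (ln s))"
    and P: "P' \<le> P + ennreal (max 0 (ln s))" "P \<le> P' + ennreal (max 0 (- ln s))"
    and N: "N' \<le> N + ennreal (max 0 (- ln s))" "N \<le> N' + ennreal (max 0 (ln s))"
  shows "ennreal s < log_radius P N \<longleftrightarrow> 1 < log_radius P' N'"
proof (cases "P = top \<or> P' = top")
  case True
  then have "P = top" "P' = top" using P by (auto simp: top_unique)
  then show ?thesis by (simp add: log_radius_def)
next
  case False
  show ?thesis
  proof (cases "N = top \<or> N' = top")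
    case True
    then have "N = top" "N' = top" using N by (auto simp: top_unique)
    then show ?thesis using False by (simp add: log_radius_def)
  next
    case F2: False
    obtain p p' n n' where r: "P = ennreal p" "P' = ennreal p'" "N = ennreal n" "N' = ennreal n'" "0 \<le> p" "0 \<le> p'" "0 \<le> n" "0 \<le> n'"
      using False F2 by (metis ennreal_cases)
    have "ennreal (p' + n + max 0 (- ln s)) = ennreal (n' + p + max 0 (ln s))"
      using eq r by (simp add: ennreal_plus[symmetric] del: ennreal_plus)
    then have "p' + n + max 0 (- ln s) = n' + p + max 0 (ln s)" using r by (subst (asm) ennreal_inj) auto
    then have e: "n' - p' = (n - p) - ln s" by (auto simp: max_def split: if_splits)
    have "s < exp (n - p) \<longleftrightarrow> 0 < (n - p) - ln s" using s by (metis diff_gt_0_iff_gt exp_less_cancel_iff exp_ln)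
    also have "\<dots> \<longleftrightarrow> 1 < exp (n' - p')" unfolding e[symmetric] by simp
    finally show ?thesis using r s by (simp add: log_radius_def ennreal_less_iff flip: ennreal_1)
  qed
qed

lemma epow_mono: "0 < a \<Longrightarrow> x \<le> y \<Longrightarrow> epow x a \<le> epow y a"
  by (cases x; cases y) (auto simp: epow_def top_unique intro: ennreal_leI powr_mono2)

text \<open>Lower semicontinuity of the power, in the form in which it enters Fatou's lemma.\<close>

lemma epow_le_liminf:
  assumes a: "0 < a" and lim: "R \<longlonglongrightarrow> r"
  shows "epow r a \<le> liminf (\<lambda>k. epow (R k) a)"
proof (rule dense_le)
  fix y assume "y < epow r a"
  then obtain z where z: "y < z" "z < epow r a" using dense by blast
  have "z \<noteq> top" using z(2) by auto
  then obtain t where t: "z = ennreal t" "0 \<le> t" by (metis ennreal_cases)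
  have "0 < z" using z(1) by (rule le_less_trans[rotated]) simp
  then have t0: "0 < t" using t by simp
  then have "ennreal (t powr (1 / a)) < r" using z(2) ennreal_less_epow_iff[OF a t0, of r] unfolding t(1) by blast
  then have "eventually (\<lambda>k. ennreal (t powr (1 / a)) < R k) sequentially" by (rule order_tendstoD(1)[OF lim])
  then have "eventually (\<lambda>k. y \<le> epow (R k) a) sequentially"
    by eventually_elim (use z t ennreal_less_epow_iff[OF a t0] in \<open>auto intro: less_imp_le less_trans\<close>)
  then show "y \<le> liminf (\<lambda>k. epow (R k) a)" by (rule Liminf_bounded)
qed

lemma epow_cmult_eexp:
  assumes "0 < c" "0 < a"
  shows "epow (ennreal c * eexp T) a = ennreal (c powr a) * eexp (ennreal a * T)"
proof (cases T)
  case (real t)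
  have "epow (ennreal c * eexp T) a = ennreal ((c * exp (- t)) powr a)"
    using real assms by (simp add: epow_ennreal flip: ennreal_mult')
  also have "(c * exp (- t)) powr a = c powr a * exp (- (a * t))"
    by (subst powr_mult) (simp add: powr_def)
  also have "ennreal (c powr a * exp (- (a * t))) = ennreal (c powr a) * eexp (ennreal (a * t))"
    using real assms by (subst eexp_ennreal) (simp_all add: ennreal_mult'')
  also have "ennreal (a * t) = ennreal a * T" using real assms by (simp add: ennreal_mult')
  finally show ?thesis .
next
  case top
  have "ennreal a * top = top" using assms by (simp add: ennreal_mult_top)
  moreover have "epow 0 a = 0" using assms by (simp add: epow_def)
  moreover have "eexp top = 0" by (simp add: eexp_def)
  ultimately show ?thesis by (simp only: top mult_zero_right)
qed

text \<open>The hypothesis reads \<open>T = P - N + l\<close> in additive form, so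
  \<open>exp (l - T)\<close> is \<open>exp (N - P)\<close>; the bound on \<open>N\<close> makes the
  cancellation legitimate.\<close>

lemma log_radius_truncated:
  assumes "T + N = P + ennreal l" "N \<le> ennreal l" "0 \<le> l"
  shows "ennreal (exp l) * eexp T = log_radius P N"
proof -
  have "N \<noteq> top" using assms(2) by (auto simp: top_unique)
  then obtain n where n: "N = ennreal n" "0 \<le> n" by (metis ennreal_cases)
  show ?thesis
  proof (cases P)
    case (real p)
    have "T + N \<noteq> top" unfolding assms(1) using real by simp
    then have "T \<noteq> top" by auto
    then obtain t where t: "T = ennreal t" "0 \<le> t" by (metis ennreal_cases)
    have "ennreal (t + n) = ennreal (p + l)" using assms n t real by simp
    then have "t + n = p + l" using assms n t real by (subst (asm) ennreal_inj) auto
    then have "n - p = l + - t" by simp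
    then show ?thesis using n t real by (simp add: log_radius_def exp_diff exp_minus divide_inverse ennreal_mult')
  next
    case top
    then have "T = top" using assms(1) n ennreal_add_eq_top[of T N] by simp
    then show ?thesis using top by (simp add: log_radius_def)
  qed
qed

text \<open>The positive and negative parts of the logarithm with value \<open>- \<infinity>\<close>
  at 0; the case \<open>h = 0\<close> is separate because \<open>ln 0\<close> is 0 for
  reals.\<close>

definition lnp :: "real \<Rightarrow> ennreal" where "lnp h = (if h = 0 then 0 else ennreal (max 0 (ln h)))"
definition lnn :: "real \<Rightarrow> ennreal" where "lnn h = (if h = 0 then \<infinity> else ennreal (max 0 (- ln h)))"

lemma lnp_measurable [measurable]: "lnp \<in> borel_measurable borel" and lnn_measurable [measurable]: "lnn \<in> borel_measurable borel"
  unfolding lnp_def lnn_def by measurable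

text \<open>For positive \<open>h\<close> these are relations between positive parts of
  \<open>ln s\<close>, \<open>ln h\<close> and their sum. At \<open>h = 0\<close> both sides of the
  equation are infinite.\<close>

lemma ln_scale:
  assumes "0 < s" "0 \<le> h"
  shows "lnp (s * h) + lnn h + ennreal (max 0 (- ln s)) = lnn (s * h) + lnp h + ennreal (max 0 (ln s))"
    and "lnp (s * h) \<le> lnp h + ennreal (max 0 (ln s))" "lnp h \<le> lnp (s * h) + ennreal (max 0 (- ln s))"
    and "lnn (s * h) \<le> lnn h + ennreal (max 0 (- ln s))" "lnn h \<le> lnn (s * h) + ennreal (max 0 (ln s))"
proof -
  consider "h = 0" | "0 < h" using assms by linarith
  then have "lnp (s * h) + lnn h + ennreal (max 0 (- ln s)) = lnn (s * h) + lnp h + ennreal (max 0 (ln s)) \<and>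
    lnp (s * h) \<le> lnp h + ennreal (max 0 (ln s)) \<and> lnp h \<le> lnp (s * h) + ennreal (max 0 (- ln s)) \<and>
    lnn (s * h) \<le> lnn h + ennreal (max 0 (- ln s)) \<and> lnn h \<le> lnn (s * h) + ennreal (max 0 (ln s))"
  proof cases
    case 1
    then show ?thesis by (simp add: lnp_def lnn_def)
  next
    case 2
    then have "lnp (s * h) = ennreal (max 0 (ln s + ln h))" "lnn (s * h) = ennreal (max 0 (- ln s - ln h))"
      "lnp h = ennreal (max 0 (ln h))" "lnn h = ennreal (max 0 (- ln h))"
      using assms by (auto simp: lnp_def lnn_def ln_mult)
    note e = this
    have mx: "max 0 (a + b) + max 0 (- b) + max 0 (- a) = max 0 (- a - b) + max 0 b + max 0 a"
      "max 0 (a + b) \<le> max 0 b + max 0 a" "max 0 b \<le> max 0 (a + b) + max 0 (- a)"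
      "max 0 (- a - b) \<le> max 0 (- b) + max 0 (- a)" "max 0 (- b) \<le> max 0 (- a - b) + max 0 a" for a b :: real
      by (auto simp: max_def)
    show ?thesis
      unfolding e
      by (simp only: ennreal_plus[symmetric] max.cobounded1 add_nonneg_nonneg, intro conjI ennreal_leI arg_cong[where f=ennreal] mx)
  qed
  then show "lnp (s * h) + lnn h + ennreal (max 0 (- ln s)) = lnn (s * h) + lnp h + ennreal (max 0 (ln s))"
    "lnp (s * h) \<le> lnp h + ennreal (max 0 (ln s))" "lnp h \<le> lnp (s * h) + ennreal (max 0 (- ln s))"
    "lnn (s * h) \<le> lnn h + ennreal (max 0 (- ln s))" "lnn h \<le> lnn (s * h) + ennreal (max 0 (ln s))" by blast+
qed

text \<open>Cutting \<open>h\<close> off below at \<open>exp (- l)\<close> caps the negative part of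
  its logarithm at \<open>l\<close>, and dividing by \<open>exp (- l)\<close> adds \<open>l\<close>
  so that the result is nonnegative.\<close>

lemma ln_truncated:
  assumes "0 \<le> h" "0 \<le> l"
  shows "ennreal (ln (max h (exp (- l)) / exp (- l))) + min (lnn h) (ennreal l) = lnp h + ennreal l"
proof -
  have e: "ln (max h (exp (- l)) / exp (- l)) = ln (max h (exp (- l))) + l"
  proof -
    have "0 < max h (exp (- l))" by (simp add: less_max_iff_disj)
    then show ?thesis by (subst ln_div) auto
  qed
  consider "h = 0" | "0 < h" "h \<le> exp (- l)" | "exp (- l) < h" using assms by linarith
  then show ?thesis
  proof cases
    case 1
    then show ?thesis using assms by (simp add: lnp_def lnn_def)
  next
    case 2
    have "ln h \<le> ln (exp (- l))" using 2 by (subst ln_le_cancel_iff) auto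
    then have l: "l \<le> - ln h" "ln h \<le> 0" using assms by auto
    then have "lnp h = 0" "lnn h = ennreal (- ln h)" using 2 by (auto simp: lnp_def lnn_def max_def)
    then show ?thesis using 2 l assms unfolding e by (simp add: min_def ennreal_leI)
  next
    case 3
    then have h: "0 < h" by (meson exp_gt_zero less_trans)
    have "ln (exp (- l)) < ln h" using 3 h by (subst ln_less_cancel_iff) auto
    then have l: "- ln h < l" by simp
    have m: "max h (exp (- l)) = h" using 3 by simp
    show ?thesis
    proof (cases "0 \<le> ln h")
      case True
      then have "lnp h = ennreal (ln h)" "lnn h = 0" using h by (auto simp: lnp_def lnn_def max_def)
      then show ?thesis using True assms unfolding e unfolding m by simp
    next
      case False
      then have "lnp h = 0" "lnn h = ennreal (- ln h)" using h by (auto simp: lnp_def lnn_def max_def)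
      then show ?thesis using False l assms unfolding e unfolding m by (simp add: min_def ennreal_leI flip: ennreal_plus)
    qed
  qed
qed

text \<open>The logarithm of the support function changes sign, whereas the comparison of
  exponentials requires a nonnegative function. Cutting the support function off at
  \<open>exp (- l)\<close> and dividing by that value makes the logarithm nonnegative; the factor
  \<open>exp l\<close> is restored outside the exponential, and \<open>l\<close> tends to
  infinity.\<close>

lemma Zvol_rearrangement_zero:
  fixes f :: "'a::euclidean_space \<Rightarrow> real"
  assumes f: "Pn f" and C: "os_convex_body m C"
  shows "Zvol 0 m C f \<le> Zvol 0 m C (sym_rearr f)"
proof -
  obtain F where F: "finite_levels F" "AE x in lebesgue. ennreal (f x) = ennreal (F x)" "(\<integral>\<^sup>+x. ennreal (F x) \<partial>lborel) = 1"
    "\<And>x. ennreal (sym_rearr f x) = sym_layers F x" "\<And>x. 0 \<le> sym_rearr f x"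
    using Pn_weights[OF f] by blast
  let ?W = "\<lambda>x. ennreal (F x)" and ?W' = "sym_layers F"
  let ?M = "\<lambda>V. weight_measure {..<m} (\<lambda>_. V)"
  have W: "?W \<in> borel_measurable borel" "(\<integral>\<^sup>+x. ?W x \<partial>lborel) = 1" using F by (auto simp: finite_levels_def)
  have W': "?W' \<in> borel_measurable borel" "(\<integral>\<^sup>+x. ?W' x \<partial>lborel) = 1"
    using sym_layers_measurable[OF F(1)] nn_integral_sym_layers[OF F(1)] F(3) by auto
  let ?h = "\<lambda>(x::'a) Y. supp_fun m C (\<lambda>j. Y j \<bullet> x)"
  have h0: "0 \<le> ?h x Y" for x Y by (rule supp_fun_nonneg[OF C])
  have hm[measurable]: "(\<lambda>Y. ?h x Y) \<in> borel_measurable (PiM {..<m} (\<lambda>_. lborel))" for x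
    by (rule nn_integral_weight_measure_measurable(2)[OF C W lnp_measurable])
  have prob: "emeasure (?M V) (space (?M V)) = 1" if "V \<in> borel_measurable borel" "(\<integral>\<^sup>+x. V x \<partial>lborel) = 1" for V :: "'a \<Rightarrow> ennreal"
    using that by (intro emeasure_weight_measure) auto
  define P where "P V x = (\<integral>\<^sup>+Y. lnp (?h x Y) \<partial>?M V)" for V x
  define N where "N V x = (\<integral>\<^sup>+Y. lnn (?h x Y) \<partial>?M V)" for V x
  define r where "r V x = log_radius (P V x) (N V x)" for V x
  have PNm: "P V \<in> borel_measurable borel" "N V \<in> borel_measurable borel" if "V \<in> borel_measurable borel" "(\<integral>\<^sup>+x. V x \<partial>lborel) = 1" for V
    unfolding P_def[abs_def] N_def[abs_def] by (rule nn_integral_weight_measure_measurable(1)[OF C that], measurable)+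
  have rm: "r V \<in> borel_measurable borel" if "V \<in> borel_measurable borel" "(\<integral>\<^sup>+x. V x \<partial>lborel) = 1" for V
    unfolding r_def[abs_def] using PNm[OF that] by measurable
  have rh: "inv_homogeneous (r V)" if V: "V \<in> borel_measurable borel" "(\<integral>\<^sup>+x. V x \<partial>lborel) = 1" for V
    unfolding inv_homogeneous_def
  proof (intro allI impI)
    fix s :: real and x :: 'a assume s: "0 < s"
    have hs: "?h (s *\<^sub>R x) Y = s * ?h x Y" for Y by (rule supp_fun_inner_scale[OF C s])
    have const: "(\<integral>\<^sup>+Y. \<phi> (?h x Y) + c \<partial>?M V) = (\<integral>\<^sup>+Y. \<phi> (?h x Y) \<partial>?M V) + c" if [measurable]: "\<phi> \<in> borel_measurable borel" for \<phi> :: "real \<Rightarrow> ennreal" and c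
      using prob[OF V] by (subst nn_integral_add) auto
    show "ennreal s < r V x \<longleftrightarrow> 1 < r V (s *\<^sub>R x)"
      unfolding r_def
    proof (rule log_radius_scale[OF s])
      have "P V (s *\<^sub>R x) + N V x + ennreal (max 0 (- ln s)) = (\<integral>\<^sup>+Y. (lnp (s * ?h x Y) + lnn (?h x Y)) + ennreal (max 0 (- ln s)) \<partial>?M V)"
        unfolding P_def N_def hs by (subst const[of "\<lambda>t. lnp (s * t) + lnn t"], measurable, subst nn_integral_add) auto
      also have "\<dots> = (\<integral>\<^sup>+Y. (lnn (s * ?h x Y) + lnp (?h x Y)) + ennreal (max 0 (ln s)) \<partial>?M V)"
        using ln_scale(1)[OF s h0] by (intro nn_integral_cong) auto
      also have "\<dots> = N V (s *\<^sub>R x) + P V x + ennreal (max 0 (ln s))"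
        unfolding P_def N_def hs by (subst const[of "\<lambda>t. lnn (s * t) + lnp t"], measurable, subst nn_integral_add) auto
      finally show "P V (s *\<^sub>R x) + N V x + ennreal (max 0 (- ln s)) = N V (s *\<^sub>R x) + P V x + ennreal (max 0 (ln s))" .
      show "P V (s *\<^sub>R x) \<le> P V x + ennreal (max 0 (ln s))"
        unfolding P_def hs const[OF lnp_measurable, symmetric] by (intro nn_integral_mono ln_scale[OF s h0])
      show "N V (s *\<^sub>R x) \<le> N V x + ennreal (max 0 (- ln s))"
        unfolding N_def hs const[OF lnn_measurable, symmetric] by (intro nn_integral_mono ln_scale[OF s h0])
      have m1: "(\<lambda>t. lnp (s * t)) \<in> borel_measurable borel" "(\<lambda>t. lnn (s * t)) \<in> borel_measurable borel" by measurable
      show "P V x \<le> P V (s *\<^sub>R x) + ennreal (max 0 (- ln s))"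
        unfolding P_def hs const[OF m1(1), symmetric] by (intro nn_integral_mono ln_scale[OF s h0])
      show "N V x \<le> N V (s *\<^sub>R x) + ennreal (max 0 (ln s))"
        unfolding N_def hs const[OF m1(2), symmetric] by (intro nn_integral_mono ln_scale[OF s h0])
    qed
  qed
  have Z: "Zrho 0 m C f = r ?W" "Zrho 0 m C (sym_rearr f) = r ?W'"
  proof -
    have em: "(\<lambda>Y. lnp (?h x Y)) \<in> borel_measurable (PiM {..<m} (\<lambda>_. lborel))" "(\<lambda>Y. lnn (?h x Y)) \<in> borel_measurable (PiM {..<m} (\<lambda>_. lborel))" for x by measurable
    have Zr: "Zrho 0 m C k x = log_radius (prod_integral m k (\<lambda>Y. lnp (?h x Y))) (prod_integral m k (\<lambda>Y. lnn (?h x Y)))" for k x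
      unfolding log_radius_ereal[symmetric] Zrho_def Let_def lnp_def lnn_def by simp
    have f0: "\<And>x. 0 \<le> f x" using f by (simp add: Pn_def)
    show "Zrho 0 m C f = r ?W"
      unfolding fun_eq_iff Zr r_def P_def N_def
      using prod_integral_weight[OF f0 W(1) F(2) em(1)] prod_integral_weight[OF f0 W(1) F(2) em(2)] by simp
    have ae: "AE x in lebesgue. ennreal (sym_rearr f x) = sym_layers F x" using F(4) by simp
    show "Zrho 0 m C (sym_rearr f) = r ?W'"
      unfolding fun_eq_iff Zr r_def P_def N_def
      using prod_integral_weight[OF F(5) W'(1) ae em(1)] prod_integral_weight[OF F(5) W'(1) ae em(2)] by simp
  qed
  define l where "l k = real (Suc k)" for k
  have l0: "0 \<le> l k" for k by (simp add: l_def)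
  \<comment> \<open>Nonnegative and increasing, hence admissible in the comparison of exponentials
    of expectations.\<close>
  define y where "y k t = ln (max t (exp (- l k)) / exp (- l k))" for k t
  have ym[measurable]: "y k \<in> borel_measurable borel" for k unfolding y_def by measurable
  have y0: "0 \<le> y k t" for k t unfolding y_def by (rule ln_ge_zero) simp
  have ymono: "y k s \<le> y k t" if "s \<le> t" for k s t
    unfolding y_def using that by (subst ln_le_cancel_iff) (auto simp: less_max_iff_disj intro: divide_right_mono)
  define T where "T k V x = (\<integral>\<^sup>+Y. ennreal (y k (?h x Y)) \<partial>?M V)" for k V x
  define Nk where "Nk k V x = (\<integral>\<^sup>+Y. min (lnn (?h x Y)) (ennreal (l k)) \<partial>?M V)" for k V x
  define R where "R k V x = ennreal (exp (l k)) * eexp (T k V x)" for k V x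
  have Tm: "T k V \<in> borel_measurable borel" if "V \<in> borel_measurable borel" "(\<integral>\<^sup>+x. V x \<partial>lborel) = 1" for k V
    unfolding T_def[abs_def] by (rule nn_integral_weight_measure_measurable(1)[OF C that, where \<phi>="\<lambda>t. ennreal (y k t)"]) measurable
  \<comment> \<open>Truncation replaces only the negative part by \<open>Nk\<close> and keeps the
    positive part, so the truncated radii increase with the truncated negative part.\<close>
  have RN: "R k V x = log_radius (P V x) (Nk k V x)" if V: "V \<in> borel_measurable borel" "(\<integral>\<^sup>+x. V x \<partial>lborel) = 1" for k V x
    unfolding R_def
  proof (rule log_radius_truncated[OF _ _ l0])
    have "T k V x + Nk k V x = (\<integral>\<^sup>+Y. ennreal (y k (?h x Y)) + min (lnn (?h x Y)) (ennreal (l k)) \<partial>?M V)"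
      unfolding T_def Nk_def by (rule nn_integral_add[symmetric]) measurable
    also have "\<dots> = (\<integral>\<^sup>+Y. lnp (?h x Y) + ennreal (l k) \<partial>?M V)"
      unfolding y_def using ln_truncated[OF h0 l0] by (intro nn_integral_cong) auto
    also have "\<dots> = P V x + ennreal (l k)"
      unfolding P_def using prob[OF V] by (subst nn_integral_add) auto
    finally show "T k V x + Nk k V x = P V x + ennreal (l k)" .
    have "Nk k V x \<le> (\<integral>\<^sup>+Y. ennreal (l k) \<partial>?M V)" unfolding Nk_def by (intro nn_integral_mono) auto
    then show "Nk k V x \<le> ennreal (l k)" using prob[OF V] by simp
  qed
  have Nle: "Nk k V x \<le> N V x" for k V x unfolding Nk_def N_def by (intro nn_integral_mono) auto
  have Nlim: "(\<lambda>k. Nk k V x) \<longlonglongrightarrow> N V x" for V x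
  proof -
    have "incseq (\<lambda>k. \<integral>\<^sup>+Y. min (lnn (?h x Y)) (of_nat k) \<partial>?M V)"
      by (auto simp: incseq_def intro!: nn_integral_mono min.mono)
    then have "(\<lambda>k. \<integral>\<^sup>+Y. min (lnn (?h x Y)) (of_nat k) \<partial>?M V) \<longlonglongrightarrow> (SUP k. \<integral>\<^sup>+Y. min (lnn (?h x Y)) (of_nat k) \<partial>?M V)"
      by (rule LIMSEQ_SUP)
    also have "(SUP k. \<integral>\<^sup>+Y. min (lnn (?h x Y)) (of_nat k) \<partial>?M V) = N V x"
      unfolding N_def by (rule nn_integral_SUP_min) measurable
    finally have "(\<lambda>k. \<integral>\<^sup>+Y. min (lnn (?h x Y)) (of_nat (Suc k)) \<partial>?M V) \<longlonglongrightarrow> N V x" by (rule LIMSEQ_Suc)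
    then show ?thesis unfolding Nk_def l_def ennreal_of_nat_eq_real_of_nat .
  qed
  have "star_vol (r ?W) \<le> star_vol (r ?W')"
  proof (rule star_vol_le_of_dual_volumes[OF rm[OF W] rm[OF W'] rh[OF W] rh[OF W']])
    fix a :: real assume a: "0 < a"
    let ?b = "\<lambda>x. indicator (ball (0::'a) 1) x :: ennreal"
    have Rm: "(\<lambda>x. ?b x * epow (R k V x) a) \<in> borel_measurable borel" if "V \<in> borel_measurable borel" "(\<integral>\<^sup>+x. V x \<partial>lborel) = 1" for k V
      unfolding R_def using Tm[OF that] by measurable
    have eR: "(\<integral>\<^sup>+x. ?b x * epow (R k V x) a \<partial>lborel) = ennreal (exp (l k) powr a) * (\<integral>\<^sup>+x. ?b x * eexp (\<integral>\<^sup>+Y. ennreal (a * y k (?h x Y)) \<partial>?M V) \<partial>lborel)"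
      if V: "V \<in> borel_measurable borel" "(\<integral>\<^sup>+x. V x \<partial>lborel) = 1" for k V
    proof -
      have aT: "ennreal a * T k V x = (\<integral>\<^sup>+Y. ennreal (a * y k (?h x Y)) \<partial>?M V)" for x
        unfolding T_def using a by (subst nn_integral_cmult[symmetric]) (auto simp: ennreal_mult')
      have "?b x * epow (R k V x) a = ennreal (exp (l k) powr a) * (?b x * eexp (\<integral>\<^sup>+Y. ennreal (a * y k (?h x Y)) \<partial>?M V))" for x
        unfolding R_def epow_cmult_eexp[OF exp_gt_zero a] aT by (simp only: mult_ac)
      moreover have "(\<lambda>x. ?b x * eexp (\<integral>\<^sup>+Y. ennreal (a * y k (?h x Y)) \<partial>?M V)) \<in> borel_measurable lborel"
        unfolding aT[symmetric] using Tm[OF V] by measurable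
      ultimately show ?thesis by (simp only: nn_integral_cmult)
    qed
    have "(\<integral>\<^sup>+x. ?b x * epow (r ?W x) a \<partial>lborel) \<le> (\<integral>\<^sup>+x. liminf (\<lambda>k. ?b x * epow (R k ?W x) a) \<partial>lborel)"
    \<comment> \<open>On the side of \<open>f\<close> the truncated radii only have to approximate
      the true radius from the point of view of Fatou's lemma.\<close>
    proof (rule nn_integral_mono)
      fix x :: 'a
      have "(\<lambda>k. R k ?W x) \<longlonglongrightarrow> r ?W x" unfolding RN[OF W] r_def by (rule log_radius_tendsto[OF Nlim])
      then have "epow (r ?W x) a \<le> liminf (\<lambda>k. epow (R k ?W x) a)" by (rule epow_le_liminf[OF a])
      then show "?b x * epow (r ?W x) a \<le> liminf (\<lambda>k. ?b x * epow (R k ?W x) a)" by (auto simp: indicator_def)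
    qed
    also have "\<dots> \<le> liminf (\<lambda>k. \<integral>\<^sup>+x. ?b x * epow (R k ?W x) a \<partial>lborel)"
      by (rule nn_integral_liminf) (use Rm[OF W] in simp)
    also have "\<dots> \<le> liminf (\<lambda>k. \<integral>\<^sup>+x. ?b x * epow (r ?W' x) a \<partial>lborel)"
    proof (intro Liminf_mono always_eventually allI)
      fix k
      have "(\<integral>\<^sup>+x. ?b x * epow (R k ?W x) a \<partial>lborel) \<le> (\<integral>\<^sup>+x. ?b x * epow (R k ?W' x) a \<partial>lborel)"
        unfolding eR[OF W] eR[OF W']
        by (intro mult_left_mono exp_expectation_rearrangement[OF C F(1,3), where \<psi>="\<lambda>t. a * y k t"]) (use a y0 ymono in \<open>auto intro: mult_left_mono\<close>)
      \<comment> \<open>On the rearranged side no limit is taken: the truncated radii are at most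
        the true radius because \<open>Nk\<close> is at most \<open>N\<close>.\<close>
      also have "\<dots> \<le> (\<integral>\<^sup>+x. ?b x * epow (r ?W' x) a \<partial>lborel)"
        unfolding RN[OF W'] r_def by (intro nn_integral_mono mult_left_mono epow_mono[OF a] log_radius_mono Nle) auto
      finally show "(\<integral>\<^sup>+x. ?b x * epow (R k ?W x) a \<partial>lborel) \<le> (\<integral>\<^sup>+x. ?b x * epow (r ?W' x) a \<partial>lborel)" .
    qed
    also have "\<dots> = (\<integral>\<^sup>+x. ?b x * epow (r ?W' x) a \<partial>lborel)" by (simp add: Liminf_const)
    finally show "(\<integral>\<^sup>+x. ?b x * epow (r ?W x) a \<partial>lborel) \<le> (\<integral>\<^sup>+x. ?b x * epow (r ?W' x) a \<partial>lborel)" .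
  qed
  then show ?thesis by (simp add: Zvol_def Z)
qed

text \<open>Common to all exponents: the radial function is a negative power of a homogeneous
  function \<open>g\<close> of the inner products. The comparison is assumed for every family with
  finite levels so that it applies to the Borel versions of the densities.\<close>

lemma EZNvol_le:
  fixes F :: "nat \<Rightarrow> nat \<Rightarrow> 'a::euclidean_space \<Rightarrow> real" and g :: "(nat \<times> nat \<Rightarrow> real) \<Rightarrow> ennreal"
  defines "J N m \<equiv> SIGMA i:{..<N::nat}. {..<m i :: nat}"
  assumes F: "\<And>i j. i < N \<Longrightarrow> j < m i \<Longrightarrow> Pn (F i j)"
    and gm: "g \<in> borel_measurable (PiM (J N m) (\<lambda>_. borel))" and d: "0 < d"
    and hom: "\<And>s y. 0 < s \<Longrightarrow> g (\<lambda>j\<in>J N m. s * y j) = ennreal (s powr d) * g (\<lambda>j\<in>J N m. y j)"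
    and le: "\<And>(G :: nat \<times> nat \<Rightarrow> 'a \<Rightarrow> real) a. 0 < a \<Longrightarrow> (\<And>j. j \<in> J N m \<Longrightarrow> finite_levels (G j)) \<Longrightarrow>
       inner_functional (J N m) (\<lambda>y. epow (g y) (- (a / d))) (\<lambda>j x. ennreal (G j x)) \<le> inner_functional (J N m) (\<lambda>y. epow (g y) (- (a / d))) (\<lambda>j. sym_layers (G j))"
    and rho: "\<And>(X :: nat \<times> nat \<Rightarrow> 'a) x. ZNrho p N m C X x = epow (g (\<lambda>j\<in>J N m. X j \<bullet> x)) (- 1 / d)"
  shows "EZNvol p N m C F \<le> EZNvol p N m C (\<lambda>i j. sym_rearr (F i j))"
proof -
  let ?J = "J N m"
  have J: "finite ?J" by (simp add: J_def)
  have P: "Pn (F (fst ij) (snd ij))" if "ij \<in> ?J" for ij using that F by (auto simp: J_def)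
  then have "\<forall>ij\<in>?J. \<exists>G. finite_levels G \<and> (AE x in lebesgue. ennreal (F (fst ij) (snd ij) x) = ennreal (G x)) \<and> (\<integral>\<^sup>+x. ennreal (G x) \<partial>lborel) = 1
    \<and> (\<forall>x. ennreal (sym_rearr (F (fst ij) (snd ij)) x) = sym_layers G x) \<and> (\<forall>x. 0 \<le> sym_rearr (F (fst ij) (snd ij)) x)"
    by (intro ballI Pn_weights)
  from bchoice[OF this] obtain G where G: "\<And>ij. ij \<in> ?J \<Longrightarrow> finite_levels (G ij)"
    "\<And>ij. ij \<in> ?J \<Longrightarrow> AE x in lebesgue. ennreal (F (fst ij) (snd ij) x) = ennreal (G ij x)"
    "\<And>ij. ij \<in> ?J \<Longrightarrow> (\<integral>\<^sup>+x. ennreal (G ij x) \<partial>lborel) = 1"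
    "\<And>ij x. ij \<in> ?J \<Longrightarrow> ennreal (sym_rearr (F (fst ij) (snd ij)) x) = sym_layers (G ij) x"
    "\<And>ij x. ij \<in> ?J \<Longrightarrow> 0 \<le> sym_rearr (F (fst ij) (snd ij)) x" by blast
  have W: "(\<lambda>x. ennreal (G ij x)) \<in> borel_measurable borel" if "ij \<in> ?J" for ij using G(1)[OF that] by (simp add: finite_levels_def)
  have W': "sym_layers (G ij) \<in> borel_measurable borel" "(\<integral>\<^sup>+x. sym_layers (G ij) x \<partial>lborel) = 1" if "ij \<in> ?J" for ij
    using sym_layers_measurable[OF G(1)[OF that]] nn_integral_sym_layers[OF G(1)[OF that]] G(3)[OF that] by auto
  have r: "ZNrho p N m C X = (\<lambda>x. epow (g (\<lambda>j\<in>?J. X j \<bullet> x)) (- 1 / d))" for X :: "nat \<times> nat \<Rightarrow> 'a" by (simp add: fun_eq_iff rho)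
  have sv: "(\<lambda>X. star_vol (ZNrho p N m C X)) \<in> borel_measurable (PiM ?J (\<lambda>_. lborel :: 'a measure))"
    unfolding r by (rule expected_star_vol_le(1)[OF J W G(3) W' gm d hom le[OF _ G(1)]])
  have "EZNvol p N m C F = (\<integral>\<^sup>+X. star_vol (ZNrho p N m C X) * (\<Prod>j\<in>?J. ennreal (G j (X j))) \<partial>PiM ?J (\<lambda>_. lborel))"
    unfolding EZNvol_def J_def[symmetric]
    by (rule nn_integral_PiM_lebesgue_weight[OF J sv _ W G(2)]) (use P in \<open>auto simp: Pn_def\<close>)
  also have "\<dots> \<le> (\<integral>\<^sup>+X. star_vol (ZNrho p N m C X) * (\<Prod>j\<in>?J. sym_layers (G j) (X j)) \<partial>PiM ?J (\<lambda>_. lborel))"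
    unfolding r by (rule expected_star_vol_le(2)[OF J W G(3) W' gm d hom le[OF _ G(1)]])
  also have "\<dots> = EZNvol p N m C (\<lambda>i j. sym_rearr (F i j))"
    unfolding EZNvol_def J_def[symmetric]
    by (rule nn_integral_PiM_lebesgue_weight[OF J sv G(5) W'(1), symmetric]) (use G(4) in auto)
  finally show ?thesis .
qed

text \<open>For \<open>p = 0\<close> the product of the support functions has degree
  \<open>N\<close> and its negative powers factor over the bodies at once. For positive
  \<open>p\<close> the sum has degree \<open>p\<close> and factors only after the Gamma
  integral.\<close>

lemma EZNvol_rearrangement:
  fixes F :: "nat \<Rightarrow> nat \<Rightarrow> 'a::euclidean_space \<Rightarrow> real"
  assumes p: "0 \<le> p" and N: "0 < N" and C: "\<And>i. i < N \<Longrightarrow> os_convex_body (m i) (C i)"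
    and F: "\<And>i j. i < N \<Longrightarrow> j < m i \<Longrightarrow> Pn (F i j)"
  shows "EZNvol p N m C F \<le> EZNvol p N m C (\<lambda>i j. sym_rearr (F i j))"
proof -
  define J where "J = (SIGMA i:{..<N}. {..<m i})"
  have J: "finite J" by (simp add: J_def)
  define h where "h i y = supp_fun (m i) (C i) (\<lambda>j. y (i, j))" for i and y :: "nat \<times> nat \<Rightarrow> real"
  have h0: "0 \<le> h i y" if "i < N" for i y unfolding h_def by (rule supp_fun_nonneg[OF C[OF that]])
  have hm: "h i \<in> borel_measurable (PiM J (\<lambda>_. borel))" if "i < N" for i
    unfolding h_def using that by (intro supp_fun_measurable_coordinates[OF C[OF that]] measurable_component_singleton) (auto simp: J_def)
  have hJ: "h i (\<lambda>j\<in>J. y j) = h i y" if "i < N" for i y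
    unfolding h_def using that by (intro supp_fun_cong) (auto simp: J_def)
  have hs: "h i (\<lambda>j\<in>J. s * y j) = s * h i (\<lambda>j\<in>J. y j)" if "i < N" "0 < s" for i s y
    unfolding hJ[OF that(1)] unfolding h_def by (rule supp_fun_scale[OF C[OF that(1)] that(2)])
  have hX: "h i (\<lambda>j\<in>J. X j \<bullet> x) = supp_fun (m i) (C i) (\<lambda>j. X (i, j) \<bullet> x)" if "i < N" for i x and X :: "nat \<times> nat \<Rightarrow> 'a"
    unfolding hJ[OF that] unfolding h_def ..
  show ?thesis
  proof (cases "p = 0")
    case True
    let ?g = "\<lambda>y. ennreal (\<Prod>i<N. h i y)"
    have d: "0 < real N" using N by simp
    show ?thesis
    proof (rule EZNvol_le[of N m F ?g "real N" p C, folded J_def, OF F _ d])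
      show "?g \<in> borel_measurable (PiM J (\<lambda>_. borel))"
        using hm by (intro measurable_compose[OF _ measurable_ennreal] borel_measurable_prod) auto
      show "?g (\<lambda>j\<in>J. s * y j) = ennreal (s powr real N) * ?g (\<lambda>j\<in>J. y j)" if s: "0 < s" for s y
      proof -
        have "(\<Prod>i<N. h i (\<lambda>j\<in>J. s * y j)) = (\<Prod>i<N. s * h i (\<lambda>j\<in>J. y j))"
          using s by (intro prod.cong refl hs) auto
        also have "\<dots> = s powr real N * (\<Prod>i<N. h i (\<lambda>j\<in>J. y j))" using s by (simp add: prod.distrib powr_realpow)
        finally show ?thesis using s by (simp only: ennreal_mult' powr_ge_zero)
      qed
      show "ZNrho p N m C X x = epow (?g (\<lambda>j\<in>J. X j \<bullet> x)) (- 1 / real N)" for X :: "nat \<times> nat \<Rightarrow> 'a" and x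
      proof -
        have "(\<Prod>i<N. h i (\<lambda>j\<in>J. X j \<bullet> x)) = (\<Prod>i<N. supp_fun (m i) (C i) (\<lambda>j. X (i, j) \<bullet> x))"
          by (intro prod.cong refl hX) auto
        then show ?thesis unfolding ZNrho_def using True by simp
      qed
      fix G :: "nat \<times> nat \<Rightarrow> 'a \<Rightarrow> real" and a :: real
      assume a: "0 < a" and G: "\<And>j. j \<in> J \<Longrightarrow> finite_levels (G j)"
      define \<phi> where "\<phi> t = epow (ennreal t) (- (a / real N))" for t
      have e: "epow (?g y) (- (a / real N)) = (\<Prod>i<N. \<phi> (h i y))" for y
        unfolding \<phi>_def using h0 a N by (intro epow_neg_prod) auto
      show "inner_functional J (\<lambda>y. epow (?g y) (- (a / real N))) (\<lambda>j x. ennreal (G j x)) \<le> inner_functional J (\<lambda>y. epow (?g y) (- (a / real N))) (\<lambda>j. sym_layers (G j))"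
        unfolding e
      proof (rule inner_functional_rearrangement[OF J finite_lessThan _ G])
        fix i assume "i \<in> {..<N}"
        then have i: "i < N" by simp
        show "sym_quasiconcave J (\<lambda>y. \<phi> (h i y))"
          unfolding h_def
        proof (rule sym_quasiconcave_supp_fun[OF C[OF i]])
          show "(i, j) \<in> J" if "j < m i" for j using that i by (simp add: J_def)
          show "\<phi> \<in> borel_measurable borel" unfolding \<phi>_def by measurable
          \<comment> \<open>At 0 the negative power is infinite by convention, which is consistent
            with \<open>\<phi>\<close> being decreasing.\<close>
          show "\<phi> t \<le> \<phi> u" if u: "0 \<le> u" "u \<le> t" for t u
          proof (cases "u = 0")
            case True
            then show ?thesis using a N by (simp add: \<phi>_def epow_def)
          next
            case False
            then show ?thesis using u a N by (auto simp: \<phi>_def epow_def intro!: ennreal_leI powr_mono2')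
          qed
        qed
      qed
    qed
  next
    case False
    then have p: "0 < p" using p by simp
    let ?g = "\<lambda>y. (\<Sum>i<N. epow (ennreal (h i y)) p) / of_nat N"
    show ?thesis
    proof (rule EZNvol_le[of N m F ?g p p C, folded J_def, OF F _ p])
      show "?g \<in> borel_measurable (PiM J (\<lambda>_. borel))"
      proof (intro borel_measurable_divide_ennreal borel_measurable_sum borel_measurable_const)
        fix i assume "i \<in> {..<N}"
        then have [measurable]: "h i \<in> borel_measurable (PiM J (\<lambda>_. borel))" using hm by simp
        show "(\<lambda>y. epow (ennreal (h i y)) p) \<in> borel_measurable (PiM J (\<lambda>_. borel))" by measurable
      qed
      show "?g (\<lambda>j\<in>J. s * y j) = ennreal (s powr p) * ?g (\<lambda>j\<in>J. y j)" if s: "0 < s" for s y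
      proof -
        have "(\<Sum>i<N. epow (ennreal (h i (\<lambda>j\<in>J. s * y j))) p) = (\<Sum>i<N. ennreal (s powr p) * epow (ennreal (h i (\<lambda>j\<in>J. y j))) p)"
        proof (intro sum.cong refl)
          fix i assume "i \<in> {..<N}"
          then have i: "i < N" by simp
          show "epow (ennreal (h i (\<lambda>j\<in>J. s * y j))) p = ennreal (s powr p) * epow (ennreal (h i (\<lambda>j\<in>J. y j))) p"
            unfolding hs[OF i s] using s h0[OF i] p
            by (subst (1 2) epow_ennreal) (auto simp only: powr_mult ennreal_mult' powr_ge_zero mult_nonneg_nonneg less_imp_le)
        qed
        then show ?thesis by (simp only: sum_distrib_left[symmetric] ennreal_times_divide)
      qed
      show "ZNrho p N m C X x = epow (?g (\<lambda>j\<in>J. X j \<bullet> x)) (- 1 / p)" for X :: "nat \<times> nat \<Rightarrow> 'a" and x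
      proof -
        have "(\<Sum>i<N. epow (ennreal (h i (\<lambda>j\<in>J. X j \<bullet> x))) p) = (\<Sum>i<N. epow (ennreal (supp_fun (m i) (C i) (\<lambda>j. X (i, j) \<bullet> x))) p)"
          using hX by (intro sum.cong refl) simp
        then show ?thesis unfolding ZNrho_def using p by simp
      qed
      fix G :: "nat \<times> nat \<Rightarrow> 'a \<Rightarrow> real" and a :: real
      assume a: "0 < a" and G: "\<And>j. j \<in> J \<Longrightarrow> finite_levels (G j)"
      show "inner_functional J (\<lambda>y. epow (?g y) (- (a / p))) (\<lambda>j x. ennreal (G j x)) \<le> inner_functional J (\<lambda>y. epow (?g y) (- (a / p))) (\<lambda>j. sym_layers (G j))"
        unfolding h_def J_def by (rule inner_functional_power_mean_le[OF C _ p a N]) (use G in \<open>auto simp: J_def\<close>)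
    qed
  qed
qed

theorem theorem2p2:
  fixes p :: real
  assumes "0 \<le> p"
  shows "(\<forall>(f :: 'a::euclidean_space \<Rightarrow> real) m C.
            Pn f \<and> 1 \<le> m \<and> os_convex_body m C
            \<longrightarrow> Zvol p m C f \<le> Zvol p m C (sym_rearr f))
       \<and> (\<forall>N (m :: nat \<Rightarrow> nat) C (F :: nat \<Rightarrow> nat \<Rightarrow> 'a \<Rightarrow> real).
            DIM('a) < N
            \<and> (\<forall>i<N. 1 \<le> m i \<and> os_convex_body (m i) (C i))
            \<and> (\<forall>i<N. \<forall>j<m i. Pn (F i j))
            \<longrightarrow> EZNvol p N m C F \<le> EZNvol p N m C (\<lambda>i j. sym_rearr (F i j)))"
proof (intro conjI allI impI)
  fix f :: "'a \<Rightarrow> real" and m C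
  assume "Pn f \<and> 1 \<le> m \<and> os_convex_body m C"
  then show "Zvol p m C f \<le> Zvol p m C (sym_rearr f)"
    using Zvol_rearrangement_zero[of f m C] Zvol_rearrangement_pos[of f m C p] assms by (cases "p = 0") auto
next
  fix N m C and F :: "nat \<Rightarrow> nat \<Rightarrow> 'a \<Rightarrow> real"
  assume "DIM('a) < N \<and> (\<forall>i<N. 1 \<le> m i \<and> os_convex_body (m i) (C i)) \<and> (\<forall>i<N. \<forall>j<m i. Pn (F i j))"
  then show "EZNvol p N m C F \<le> EZNvol p N m C (\<lambda>i j. sym_rearr (F i j))"
    by (intro EZNvol_rearrangement assms) auto
qed

end
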